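(* Let $N\ge2$ and let $A,B>0$. Let $K\in C^2(\mathbb{R}^N\setminus\{0\})$ be a real-valued function such that $$|K(x)|\le\frac{A}{|x|^{N-1}}\quad\text{and}\quad|D^2K(x)|\le\frac{B}{|x|^{N+1}}\quad\text{for every }x\in\mathbb{R}^N\setminus\{0\}.$$ If $\mu$ is a finite (possibly signed) Borel measure in $\mathbb{R}^N$, then there exists a measurable function $I:\mathbb{R}^N\to[0,\infty]$ in the weak-$L^1$ Marcinkiewicz space $L^1_{\mathrm w}(\mathbb{R}^N)$ such that $$|K*\mu(x)-K*\mu(y)|\le(I(x)+I(y))\,|x-y|\quad\text{for every }x,y\in\operatorname{dom}(K*\mu)$$ and $$[I]_{L^1_{\mathrm w}(\mathbb{R}^N)}\le C\,\|\mu\|_{\mathcal M(\mathbb{R}^N)}$$ for some constant $C>0$ depending on $A$, $B$ and $N$. Hence, $K*\mu$ is approximately differentiable almost everywhere in $\mathbb{R}^N$ and $$|D_{\mathrm{ap}}(K*\mu)|\le 2I\quad\text{almost everywhere in }\mathbb{R}^N.$$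
   Context: $\operatorname{dom}(K*\mu):=\{x\in\mathbb{R}^N:\int_{\mathbb{R}^N}|K(x-y)|\,\mathrm{d}|\mu|(y)<\infty\}$, whose complement is Lebesgue-negligible; for $x$ in this set, $K*\mu(x)=\int_{\mathbb{R}^N}K(x-y)\,\mathrm{d}\mu(y)$. $\|\mu\|_{\mathcal M(\mathbb{R}^N)}:=|\mu|(\mathbb{R}^N)$ is the total variation norm. $[f]_{L^1_{\mathrm w}(\mathbb{R}^N)}:=\sup_{t>0}t\,|\{|f|>t\}|$, where $|E|$ is the Lebesgue measure of $E$; $L^1_{\mathrm w}$ is the set of measurable functions for which this is finite. Approximate limit: $\operatorname{ap\,lim}_{x\to y}v=c$ means that for every $\epsilon>0$, $\lim_{r\to0}|\{x:|v(x)-c|>\epsilon\}\cap B_r(y)|/|B_r(y)|=0$. The approximate derivative of $v$ at $y$ is the linear map $D_{\mathrm{ap}}v(y)$ such that $\operatorname{ap\,lim}_{x\to y}\frac{v(x)-v(y)-D_{\mathrm{ap}}v(y)[x-y]}{|x-y|}=0$; this makes sense for functions defined on measurable subsets of $\mathbb{R}^N$ at density points of the domain. *)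

theory Defs
  imports "HOL-Analysis.Analysis"
begin

text \<open>
  A finite signed Borel measure is a countably additive real-valued set function on the Borel sets.
  Its values on other sets are irrelevant to everything below.
\<close>

definition finite_signed_measure :: "('a::topological_space set \<Rightarrow> real) \<Rightarrow> bool" where
  "finite_signed_measure \<mu> \<longleftrightarrow> \<mu> {} = 0 \<and>
     (\<forall>A::nat \<Rightarrow> 'a set. range A \<subseteq> sets borel \<longrightarrow> disjoint_family A \<longrightarrow>
        (\<lambda>i. \<mu> (A i)) sums \<mu> (\<Union>i. A i))"

definition variation :: "('a::topological_space set \<Rightarrow> real) \<Rightarrow> 'a set \<Rightarrow> ennreal" where
  "variation \<mu> E =
     (SUP P \<in> {P. finite P \<and> P \<subseteq> sets borel \<and> partition_on E P}. \<Sum>A\<in>P. ennreal \<bar>\<mu> A\<bar>)"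

text \<open>
  For a finite signed measure, the set functions passed to \<^const>\<open>measure_of\<close> below are finite
  measures; this is shown in \<open>emeasure_variation_measure\<close>, \<open>finite_measure_variation_measure\<close>,
  \<open>emeasure_pos_part_measure\<close> and \<open>emeasure_neg_part_measure\<close>.
\<close>

definition variation_measure :: "('a::topological_space set \<Rightarrow> real) \<Rightarrow> 'a measure" where
  "variation_measure \<mu> = measure_of UNIV (sets borel) (variation \<mu>)"

lemma partition_on_disjoint_family: "partition_on E P \<Longrightarrow> disjoint_family_on (\<lambda>A. A) P"
  by (auto simp: partition_on_def disjoint_family_on_def dest: disjointD)

lemma finite_signed_measure_empty: "finite_signed_measure \<mu> \<Longrightarrow> \<mu> {} = 0"
  by (simp add: finite_signed_measure_def)

lemma finite_signed_measure_sums: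
  assumes "finite_signed_measure \<mu>" "\<And>i::nat. A i \<in> sets borel" "disjoint_family A"
  shows "(\<lambda>i. \<mu> (A i)) sums \<mu> (\<Union>i. A i)"
  using assms unfolding finite_signed_measure_def by blast

lemma finite_signed_measure_Un:
  assumes \<mu>: "finite_signed_measure \<mu>" and "A \<in> sets borel" "B \<in> sets borel" "A \<inter> B = {}"
  shows "\<mu> (A \<union> B) = \<mu> A + \<mu> B"
proof -
  define F where "F = (\<lambda>i::nat. if i = 0 then A else if i = 1 then B else {})"
  have "(\<lambda>i. \<mu> (F i)) sums \<mu> (\<Union>i. F i)"
    by (rule finite_signed_measure_sums[OF \<mu>])
       (use assms in \<open>auto simp: F_def disjoint_family_on_def\<close>)
  moreover have "(\<Union>i. F i) = A \<union> B"
    by (auto simp: F_def split: if_splits)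
  moreover have "(\<lambda>i. \<mu> (F i)) sums (\<Sum>i\<in>{0,1}. \<mu> (F i))"
    by (rule sums_finite) (auto simp: F_def finite_signed_measure_empty[OF \<mu>])
  ultimately show ?thesis
    by (auto simp: F_def dest: sums_unique2)
qed

lemma finite_signed_measure_UN:
  assumes \<mu>: "finite_signed_measure \<mu>" and "finite I"
    and "\<And>i. i \<in> I \<Longrightarrow> f i \<in> sets borel" "disjoint_family_on f I"
  shows "\<mu> (\<Union>i\<in>I. f i) = (\<Sum>i\<in>I. \<mu> (f i))"
  using assms(2-)
proof (induction I)
  case empty
  then show ?case by (simp add: finite_signed_measure_empty[OF \<mu>])
next
  case (insert i I)
  have "\<mu> (f i \<union> (\<Union>i\<in>I. f i)) = \<mu> (f i) + \<mu> (\<Union>i\<in>I. f i)"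
    by (rule finite_signed_measure_Un[OF \<mu>])
       (use insert in \<open>auto simp: disjoint_family_on_def\<close>)
  moreover have "disjoint_family_on f I"
    using insert.prems(2) by (rule disjoint_family_on_mono[rotated]) auto
  ultimately show ?case
    using insert by simp
qed

lemma sum_le_variation:
  assumes \<mu>: "finite_signed_measure \<mu>" and "finite I"
    and f: "\<And>i. i \<in> I \<Longrightarrow> f i \<in> sets borel" "disjoint_family_on f I"
    and E: "(\<Union>i\<in>I. f i) \<subseteq> E" "E \<in> sets borel"
  shows "(\<Sum>i\<in>I. ennreal \<bar>\<mu> (f i)\<bar>) \<le> variation \<mu> E"
proof -
  define P where "P = (f ` I \<union> {E - (\<Union>i\<in>I. f i)}) - {{}}"
  have "(\<Sum>i\<in>I. ennreal \<bar>\<mu> (f i)\<bar>) = (\<Sum>A\<in>f ` I. ennreal \<bar>\<mu> A\<bar>)"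
  proof (rule trans[OF _ sum.reindex_nontrivial[OF \<open>finite I\<close>, symmetric]])
    fix x y assume "x \<in> I" "y \<in> I" "x \<noteq> y" "f x = f y"
    with f(2) have "f y = {}" by (auto simp: disjoint_family_on_def)
    then show "ennreal \<bar>\<mu> (f x)\<bar> = 0"
      using \<open>f x = f y\<close> by (simp add: finite_signed_measure_empty[OF \<mu>])
  qed simp
  also have "\<dots> = (\<Sum>A\<in>f ` I - {{}}. ennreal \<bar>\<mu> A\<bar>)"
    by (rule sum.mono_neutral_right)
       (use \<open>finite I\<close> in \<open>auto simp: finite_signed_measure_empty[OF \<mu>]\<close>)
  also have "\<dots> \<le> (\<Sum>A\<in>P. ennreal \<bar>\<mu> A\<bar>)"
    by (rule sum_mono2) (use \<open>finite I\<close> in \<open>auto simp: P_def\<close>)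
  also have "\<dots> \<le> variation \<mu> E"
    unfolding variation_def
  proof (rule SUP_upper, intro CollectI conjI)
    show "finite P" using \<open>finite I\<close> by (auto simp: P_def)
    show "P \<subseteq> sets borel"
      using f(1) E sets.finite_UN[OF \<open>finite I\<close>, of f borel] by (auto simp: P_def)
    show "partition_on E P"
    proof (rule partition_onI)
      show "{} \<notin> P" by (simp add: P_def)
      have "\<Union>P = (\<Union>i\<in>I. f i) \<union> (E - (\<Union>i\<in>I. f i))" unfolding P_def by blast
      then show "\<Union>P = E" using E by blast
      fix p q assume "p \<in> P" "q \<in> P" "p \<noteq> q"
      then have "p \<in> f ` I \<and> q \<in> f ` I \<or> p \<inter> q = {}"
        unfolding P_def by auto
      then show "disjnt p q"
      proof
        assume "p \<in> f ` I \<and> q \<in> f ` I"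
        then obtain i j where ij: "i \<in> I" "j \<in> I" "p = f i" "q = f j" by auto
        with \<open>p \<noteq> q\<close> have "i \<noteq> j" by metis
        with ij f(2) show ?thesis by (simp add: disjoint_family_on_def disjnt_def)
      qed (simp add: disjnt_def)
    qed
  qed
  finally show ?thesis .
qed

lemma variation_add_le:
  assumes \<mu>: "finite_signed_measure \<mu>"
    and XY: "X \<in> sets borel" "Y \<in> sets borel" "X \<inter> Y = {}"
  shows "variation \<mu> X + variation \<mu> Y \<le> variation \<mu> (X \<union> Y)"
proof -
  let ?Q = "\<lambda>E. {P. finite P \<and> P \<subseteq> sets borel \<and> partition_on E P}"
  have ne: "?Q E \<noteq> {}" if "E \<in> sets borel" for E :: "'a set"
  proof -
    have "(if E = {} then {} else {E}) \<in> ?Q E"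
      using that by (auto simp: partition_on_def)
    then show ?thesis by blast
  qed
  have "(\<Sum>A\<in>P. ennreal \<bar>\<mu> A\<bar>) + (\<Sum>A\<in>Q. ennreal \<bar>\<mu> A\<bar>) \<le> variation \<mu> (X \<union> Y)"
    if P: "P \<in> ?Q X" and Q: "Q \<in> ?Q Y" for P Q
  proof -
    have disj: "p \<inter> q = {}" if "p \<in> P" "q \<in> Q" for p q
      using that P Q XY by (auto simp: partition_on_def)
    have "P \<inter> Q = {}"
      using disj P by (fastforce simp: partition_on_def)
    then have "(\<Sum>A\<in>P. ennreal \<bar>\<mu> A\<bar>) + (\<Sum>A\<in>Q. ennreal \<bar>\<mu> A\<bar>) = (\<Sum>A\<in>P \<union> Q. ennreal \<bar>\<mu> A\<bar>)"
      using P Q by (subst sum.union_disjoint) auto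
    also have "\<dots> \<le> variation \<mu> (X \<union> Y)"
    proof (rule sum_le_variation[OF \<mu>])
      show "disjoint_family_on (\<lambda>A. A) (P \<union> Q)"
        unfolding disjoint_family_on_def
      proof (intro ballI impI)
        fix m n assume mn: "m \<in> P \<union> Q" "n \<in> P \<union> Q" "m \<noteq> n"
        have "disjoint P" "disjoint Q" using P Q by (auto simp: partition_on_def)
        with mn disj[of m n] disj[of n m] show "m \<inter> n = {}"
          by (auto simp only: Un_iff Int_commute dest: disjointD)
      qed
    qed (use P Q XY in \<open>auto simp: partition_on_def\<close>)
    finally show ?thesis .
  qed
  then have "(SUP P\<in>?Q X. SUP Q\<in>?Q Y. (\<Sum>A\<in>P. ennreal \<bar>\<mu> A\<bar>) + (\<Sum>A\<in>Q. ennreal \<bar>\<mu> A\<bar>))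
      \<le> variation \<mu> (X \<union> Y)"
    by (intro SUP_least) auto
  also have "(SUP P\<in>?Q X. SUP Q\<in>?Q Y. (\<Sum>A\<in>P. ennreal \<bar>\<mu> A\<bar>) + (\<Sum>A\<in>Q. ennreal \<bar>\<mu> A\<bar>))
      = variation \<mu> X + variation \<mu> Y"
    unfolding variation_def using ne[OF XY(1)] ne[OF XY(2)]
    by (simp only: ennreal_SUP_add_right[symmetric] ennreal_SUP_add_left[symmetric] simp_thms)
  finally show ?thesis .
qed

lemma variation_empty: "finite_signed_measure \<mu> \<Longrightarrow> variation \<mu> {} = 0"
  by (simp add: variation_def partition_on_empty cong: conj_cong)

lemma variation_mono:
  assumes "finite_signed_measure \<mu>" "X \<in> sets borel" "Y \<in> sets borel" "X \<subseteq> Y"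
  shows "variation \<mu> X \<le> variation \<mu> Y"
proof -
  have "variation \<mu> X \<le> variation \<mu> X + variation \<mu> (Y - X)" by simp
  also have "\<dots> \<le> variation \<mu> (X \<union> (Y - X))"
    by (rule variation_add_le) (use assms in auto)
  also have "X \<union> (Y - X) = Y" using assms by auto
  finally show ?thesis .
qed

lemma countably_additive_variation:
  assumes \<mu>: "finite_signed_measure \<mu>"
  shows "countably_additive (sets borel) (variation \<mu>)"
proof (rule countably_additiveI)
  fix A :: "nat \<Rightarrow> 'a set"
  assume A: "range A \<subseteq> sets borel" "disjoint_family A"
  have Ai: "A i \<in> sets borel" for i using A by auto
  show "(\<Sum>i. variation \<mu> (A i)) = variation \<mu> (\<Union>i. A i)"
  proof (rule antisym)
    have "(\<Sum>i<n. variation \<mu> (A i)) \<le> variation \<mu> (\<Union>i<n. A i)" for n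
    proof (induction n)
      case (Suc n)
      have "(\<Sum>i<Suc n. variation \<mu> (A i)) \<le> variation \<mu> (\<Union>i<n. A i) + variation \<mu> (A n)"
        using Suc by (simp add: add_right_mono)
      also have "\<dots> \<le> variation \<mu> ((\<Union>i<n. A i) \<union> A n)"
        by (rule variation_add_le[OF \<mu>])
           (use Ai A(2) in \<open>auto simp: disjoint_family_on_def set_eq_iff, metis less_irrefl\<close>)
      also have "(\<Union>i<n. A i) \<union> A n = (\<Union>i<Suc n. A i)" by (auto simp: less_Suc_eq)
      finally show ?case .
    qed simp
    also have "variation \<mu> (\<Union>i<n. A i) \<le> variation \<mu> (\<Union>i. A i)" for n
      by (rule variation_mono[OF \<mu>]) (use Ai in auto)
    finally show "(\<Sum>i. variation \<mu> (A i)) \<le> variation \<mu> (\<Union>i. A i)"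
      by (intro suminf_le_const) auto
  next
    show "variation \<mu> (\<Union>i. A i) \<le> (\<Sum>i. variation \<mu> (A i))"
      unfolding variation_def[of \<mu> "\<Union>i. A i"]
    proof (rule SUP_least)
      fix P assume "P \<in> {P. finite P \<and> P \<subseteq> sets borel \<and> partition_on (\<Union>i. A i) P}"
      then have P: "finite P" "P \<subseteq> sets borel" "partition_on (\<Union>i. A i) P" by auto
      have "ennreal \<bar>\<mu> B\<bar> \<le> (\<Sum>i. ennreal \<bar>\<mu> (B \<inter> A i)\<bar>)" if "B \<in> P" for B
      proof -
        have B: "(\<Union>i. B \<inter> A i) = B" "B \<in> sets borel"
          using P that by (auto simp: partition_on_def)
        have s: "(\<lambda>i. \<mu> (B \<inter> A i)) sums \<mu> (\<Union>i. B \<inter> A i)"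
          by (rule finite_signed_measure_sums[OF \<mu>])
             (use B(2) Ai A(2) in \<open>auto simp: disjoint_family_on_def\<close>)
        show ?thesis
        proof (cases "summable (\<lambda>i. \<bar>\<mu> (B \<inter> A i)\<bar>)")
          case True
          have "\<bar>\<mu> B\<bar> \<le> (\<Sum>i. \<bar>\<mu> (B \<inter> A i)\<bar>)"
            using summable_rabs[OF True] s B(1) by (simp add: sums_iff)
          then show ?thesis
            using True by (subst suminf_ennreal2) (auto intro: ennreal_leI)
        next
          case False
          have "(\<Sum>i. ennreal \<bar>\<mu> (B \<inter> A i)\<bar>) = top"
          proof (rule ccontr)
            assume "(\<Sum>i. ennreal \<bar>\<mu> (B \<inter> A i)\<bar>) \<noteq> top"
            then show False
              using False summable_suminf_not_top by (metis abs_ge_zero)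
          qed
          then show ?thesis by simp
        qed
      qed
      then have "(\<Sum>B\<in>P. ennreal \<bar>\<mu> B\<bar>) \<le> (\<Sum>B\<in>P. \<Sum>i. ennreal \<bar>\<mu> (B \<inter> A i)\<bar>)"
        by (rule sum_mono)
      also have "\<dots> = (\<Sum>i. \<Sum>B\<in>P. ennreal \<bar>\<mu> (B \<inter> A i)\<bar>)"
        by (rule suminf_sum[symmetric]) simp
      also have "\<dots> \<le> (\<Sum>i. variation \<mu> (A i))"
      proof (intro suminf_le sum_le_variation[OF \<mu> P(1)])
        fix i
        show "disjoint_family_on (\<lambda>B. B \<inter> A i) P"
          using partition_on_disjoint_family[OF P(3)] unfolding disjoint_family_on_def by blast
      qed (use P(2) Ai in auto)
      finally show "(\<Sum>B\<in>P. ennreal \<bar>\<mu> B\<bar>) \<le> (\<Sum>i. variation \<mu> (A i))" .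
    qed
  qed
qed

lemma sets_variation_measure [simp, measurable_cong]: "sets (variation_measure \<mu>) = sets borel"
  unfolding variation_measure_def by (metis sets.sets_measure_of_eq space_borel)

lemma space_variation_measure [simp]: "space (variation_measure \<mu>) = UNIV"
  unfolding variation_measure_def by (simp add: space_measure_of_conv)

lemma emeasure_variation_measure:
  assumes "finite_signed_measure \<mu>" "E \<in> sets borel"
  shows "emeasure (variation_measure \<mu>) E = variation \<mu> E"
  unfolding variation_measure_def
proof (rule emeasure_measure_of_sigma)
  show "sigma_algebra UNIV (sets (borel :: 'a measure))"
    by (metis sets.sigma_algebra_axioms space_borel)
qed (use assms in \<open>auto simp: positive_def variation_empty countably_additive_variation\<close>)

lemma variation_infinite_split:
  assumes \<mu>: "finite_signed_measure \<mu>" and E: "E \<in> sets borel" "variation \<mu> E = \<infinity>"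
  obtains F where "F \<in> sets borel" "F \<subseteq> E" "\<bar>\<mu> (E - F)\<bar> \<ge> 1" "variation \<mu> F = \<infinity>"
proof -
  define t where "t = 1 + \<bar>\<mu> E\<bar>"
  have "ennreal (2 * t) < variation \<mu> E" using E by simp
  then obtain P where P: "finite P" "P \<subseteq> sets borel" "partition_on E P"
      and "ennreal (2 * t) < (\<Sum>A\<in>P. ennreal \<bar>\<mu> A\<bar>)"
    unfolding variation_def less_SUP_iff by auto
  then have big: "2 * t < (\<Sum>A\<in>P. \<bar>\<mu> A\<bar>)"
    by (simp add: ennreal_less_iff t_def del: ennreal_plus)
  define P1 where "P1 = {A\<in>P. \<mu> A \<ge> 0}"
  define P2 where "P2 = {A\<in>P. \<mu> A < 0}"
  have "P = P1 \<union> P2" "P1 \<inter> P2 = {}" by (auto simp: P1_def P2_def)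
  then have "(\<Sum>A\<in>P. \<bar>\<mu> A\<bar>) = (\<Sum>A\<in>P1. \<bar>\<mu> A\<bar>) + (\<Sum>A\<in>P2. \<bar>\<mu> A\<bar>)"
    using P(1) by (metis finite_Un sum.union_disjoint)
  also have "(\<Sum>A\<in>P1. \<bar>\<mu> A\<bar>) = \<bar>\<Sum>A\<in>P1. \<mu> A\<bar>"
    by (subst abs_of_nonneg) (auto simp: P1_def intro: sum_nonneg sum.cong)
  also have "(\<Sum>A\<in>P2. \<bar>\<mu> A\<bar>) = \<bar>\<Sum>A\<in>P2. \<mu> A\<bar>"
  proof -
    have "(\<Sum>A\<in>P2. \<bar>\<mu> A\<bar>) = - (\<Sum>A\<in>P2. \<mu> A)"
      by (subst sum_negf[symmetric]) (auto simp: P2_def intro: sum.cong)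
    moreover have "(\<Sum>A\<in>P2. \<mu> A) \<le> 0" by (auto simp: P2_def intro: sum_nonpos)
    ultimately show ?thesis by simp
  qed
  finally have "\<bar>\<Sum>A\<in>P1. \<mu> A\<bar> > t \<or> \<bar>\<Sum>A\<in>P2. \<mu> A\<bar> > t"
    using big by linarith
  then obtain Q where Q: "Q \<subseteq> P" "\<bar>\<Sum>A\<in>Q. \<mu> A\<bar> > t"
    by (metis \<open>P = P1 \<union> P2\<close> Un_upper1 Un_upper2)
  have finQ: "finite Q" using Q P(1) finite_subset by blast
  have F: "\<Union>Q \<in> sets borel" "\<Union>Q \<subseteq> E"
    using Q P finQ by (auto simp: partition_on_def)
  have "\<mu> (\<Union>A\<in>Q. A) = (\<Sum>A\<in>Q. \<mu> A)"
    by (rule finite_signed_measure_UN[OF \<mu> finQ])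
       (use Q P in \<open>auto intro: disjoint_family_on_mono[OF _ partition_on_disjoint_family]\<close>)
  with Q have m1: "\<bar>\<mu> (\<Union>Q)\<bar> > t" by simp
  have "\<mu> (\<Union>Q \<union> (E - \<Union>Q)) = \<mu> (\<Union>Q) + \<mu> (E - \<Union>Q)"
    by (rule finite_signed_measure_Un[OF \<mu>]) (use F E in auto)
  moreover have E_eq: "\<Union>Q \<union> (E - \<Union>Q) = E" using F by auto
  ultimately have m2: "\<bar>\<mu> (E - \<Union>Q)\<bar> \<ge> 1" using m1 unfolding t_def by simp
  have "emeasure (variation_measure \<mu>) (\<Union>Q \<union> (E - \<Union>Q)) =
      emeasure (variation_measure \<mu>) (\<Union>Q) + emeasure (variation_measure \<mu>) (E - \<Union>Q)"
    by (rule plus_emeasure[symmetric]) (use F E in auto)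
  then have "variation \<mu> E = variation \<mu> (\<Union>Q) + variation \<mu> (E - \<Union>Q)"
    using F E E_eq by (simp add: emeasure_variation_measure[OF \<mu>])
  then consider "variation \<mu> (\<Union>Q) = \<infinity>" | "variation \<mu> (E - \<Union>Q) = \<infinity>"
    using E(2) by (metis ennreal_add_eq_top infinity_ennreal_def)
  then show thesis
  proof cases
    case 1
    with m2 F show ?thesis by (intro that) auto
  next
    case 2
    have "E - (E - \<Union>Q) = \<Union>Q" using F by auto
    with 2 m1 F E show ?thesis by (intro that[of "E - \<Union>Q"]) (auto simp: t_def)
  qed
qed

lemma finite_measure_variation_measure:
  assumes \<mu>: "finite_signed_measure \<mu>"
  shows "finite_measure (variation_measure \<mu>)"
proof (rule finite_measureI, rule notI)
  assume "emeasure (variation_measure \<mu>) (space (variation_measure \<mu>)) = \<infinity>"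
  then have inf: "variation \<mu> UNIV = \<infinity>" by (simp add: emeasure_variation_measure[OF \<mu>])
  define R where "R = (\<lambda>E. E \<in> sets borel \<and> variation \<mu> E = \<infinity>)"
  have "\<exists>F. R F \<and> F \<subseteq> E \<and> \<bar>\<mu> (E - F)\<bar> \<ge> 1" if "R E" for E
    using variation_infinite_split[OF \<mu>, of E] that unfolding R_def by metis
  moreover have "R UNIV" using inf by (simp add: R_def)
  ultimately obtain G where G: "\<And>n::nat. R (G n)" "\<And>n. G (Suc n) \<subseteq> G n"
      "\<And>n. \<bar>\<mu> (G n - G (Suc n))\<bar> \<ge> 1"
    using dependent_nat_choice[of "\<lambda>n. R" "\<lambda>n E F. F \<subseteq> E \<and> \<bar>\<mu> (E - F)\<bar> \<ge> 1"] by metis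
  define H where "H n = G n - G (Suc n)" for n
  have dec: "G n \<subseteq> G m" if "m \<le> n" for m n
    using lift_Suc_antimono_le[of G, OF G(2) that] .
  have "H m \<inter> H n = {}" if "m < n" for m n
    using dec[of "Suc m" n] that by (auto simp: H_def)
  then have "disjoint_family H"
    unfolding disjoint_family_on_def by (metis inf_commute linorder_neqE_nat)
  then have "(\<lambda>n. \<mu> (H n)) sums \<mu> (\<Union>n. H n)"
    using G(1) by (intro finite_signed_measure_sums[OF \<mu>]) (auto simp: R_def H_def[abs_def])
  then have "(\<lambda>n. \<mu> (H n)) \<longlonglongrightarrow> 0"
    by (intro summable_LIMSEQ_zero) (simp add: sums_iff)
  then have "\<forall>\<^sub>F n in sequentially. dist (\<mu> (H n)) 0 < 1"
    by (rule tendstoD) simp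
  then show False
    using G(3) by (auto simp: H_def eventually_sequentially not_less dist_real_def)
      (meson not_less order_refl)
qed

lemma abs_le_measure_variation:
  assumes \<mu>: "finite_signed_measure \<mu>" and E: "E \<in> sets borel"
  shows "\<bar>\<mu> E\<bar> \<le> measure (variation_measure \<mu>) E"
proof -
  interpret finite_measure "variation_measure \<mu>"
    by (rule finite_measure_variation_measure[OF \<mu>])
  have "ennreal \<bar>\<mu> E\<bar> \<le> variation \<mu> E"
    using sum_le_variation[OF \<mu>, of "{()}" "\<lambda>_. E" E] E by (simp add: disjoint_family_on_def)
  also have "\<dots> = ennreal (measure (variation_measure \<mu>) E)"
    by (simp add: emeasure_variation_measure[OF \<mu> E, symmetric] emeasure_eq_measure)
  finally show ?thesis by simp
qed

definition pos_part_measure :: "('a::topological_space set \<Rightarrow> real) \<Rightarrow> 'a measure" where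
  "pos_part_measure \<mu> =
     measure_of UNIV (sets borel) (\<lambda>E. ennreal ((measure (variation_measure \<mu>) E + \<mu> E) / 2))"

definition neg_part_measure :: "('a::topological_space set \<Rightarrow> real) \<Rightarrow> 'a measure" where
  "neg_part_measure \<mu> =
     measure_of UNIV (sets borel) (\<lambda>E. ennreal ((measure (variation_measure \<mu>) E - \<mu> E) / 2))"

lemma finite_signed_measure_uminus:
  assumes "finite_signed_measure \<mu>"
  shows "finite_signed_measure (\<lambda>E. - \<mu> E)"
  using assms unfolding finite_signed_measure_def by (auto intro: sums_minus)

lemma variation_measure_uminus: "variation_measure (\<lambda>E. - \<mu> E) = variation_measure \<mu>"
  by (simp add: variation_measure_def variation_def[abs_def])

lemma neg_part_measure_eq: "neg_part_measure \<mu> = pos_part_measure (\<lambda>E. - \<mu> E)"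
  by (simp add: neg_part_measure_def pos_part_measure_def variation_measure_uminus)

lemma emeasure_pos_part_measure:
  assumes \<mu>: "finite_signed_measure \<mu>" and E: "E \<in> sets borel"
  shows "emeasure (pos_part_measure \<mu>) E =
    ennreal ((measure (variation_measure \<mu>) E + \<mu> E) / 2)"
  unfolding pos_part_measure_def
proof (rule emeasure_measure_of_sigma)
  interpret finite_measure "variation_measure \<mu>"
    by (rule finite_measure_variation_measure[OF \<mu>])
  let ?f = "\<lambda>E. (measure (variation_measure \<mu>) E + \<mu> E) / 2"
  have nonneg: "?f E \<ge> 0" if "E \<in> sets borel" for E
    using abs_le_measure_variation[OF \<mu> that] by simp
  show "sigma_algebra UNIV (sets (borel :: 'a measure))"
    by (metis sets.sigma_algebra_axioms space_borel)
  show "positive (sets borel) (\<lambda>E. ennreal (?f E))"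
    by (simp add: positive_def finite_signed_measure_empty[OF \<mu>])
  show "countably_additive (sets borel) (\<lambda>E. ennreal (?f E))"
  proof (rule countably_additiveI)
    fix A :: "nat \<Rightarrow> 'a set"
    assume A: "range A \<subseteq> sets borel" "disjoint_family A"
    have "(\<lambda>i. ?f (A i)) sums ?f (\<Union>i. A i)"
    proof (intro sums_divide sums_add finite_signed_measure_sums[OF \<mu>] A)
      show "(\<lambda>i. measure (variation_measure \<mu>) (A i)) sums
          measure (variation_measure \<mu>) (\<Union>i. A i)"
        using A by (intro finite_measure_UNION) auto
    qed (use A in auto)
    then show "(\<Sum>i. ennreal (?f (A i))) = ennreal (?f (\<Union>i. A i))"
      using A by (intro suminf_ennreal_eq nonneg) auto
  qed
qed (fact E)

lemma emeasure_neg_part_measure: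
  assumes "finite_signed_measure \<mu>" "E \<in> sets borel"
  shows "emeasure (neg_part_measure \<mu>) E =
    ennreal ((measure (variation_measure \<mu>) E - \<mu> E) / 2)"
  using emeasure_pos_part_measure[OF finite_signed_measure_uminus[OF assms(1)] assms(2)]
  by (simp add: neg_part_measure_eq variation_measure_uminus)

definition signed_integral :: "('a::topological_space set \<Rightarrow> real) \<Rightarrow> ('a \<Rightarrow> real) \<Rightarrow> real" where
  "signed_integral \<mu> f =
     integral\<^sup>L (pos_part_measure \<mu>) f - integral\<^sup>L (neg_part_measure \<mu>) f"

definition tv_norm :: "('a::topological_space set \<Rightarrow> real) \<Rightarrow> ennreal" where
  "tv_norm \<mu> = emeasure (variation_measure \<mu>) UNIV"

text \<open>
  The value \<open>K 0\<close> matters only at the (at most countably many) atoms of \<open>\<mu>\<close>.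
\<close>

definition convolution_dom ::
    "('a::euclidean_space \<Rightarrow> real) \<Rightarrow> ('a set \<Rightarrow> real) \<Rightarrow> 'a set" where
  "convolution_dom K \<mu> = {x. (\<integral>\<^sup>+ y. ennreal \<bar>K (x - y)\<bar> \<partial>variation_measure \<mu>) < \<infinity>}"

definition convolution :: "('a::euclidean_space \<Rightarrow> real) \<Rightarrow> ('a set \<Rightarrow> real) \<Rightarrow> 'a \<Rightarrow> real" where
  "convolution K \<mu> x = signed_integral \<mu> (\<lambda>y. K (x - y))"

text \<open>
  The norm of the second derivative \<open>Df (Df f) x\<close> is the operator norm, i.e. the supremum of
  \<open>\<bar>D\<^sup>2f(x)[u,v]\<bar>\<close> over unit vectors \<open>u\<close>, \<open>v\<close>.
\<close>

definition Df ::
    "('a::euclidean_space \<Rightarrow> 'b::real_normed_vector) \<Rightarrow> 'a \<Rightarrow> 'a \<Rightarrow>\<^sub>L 'b" where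
  "Df f x = Blinfun (frechet_derivative f (at x))"

text \<open>For open \<open>S\<close> only. Continuity of \<open>f\<close> and \<open>Df f\<close> follows from differentiability.\<close>

definition C2_on :: "'a::euclidean_space set \<Rightarrow> ('a \<Rightarrow> 'b::real_normed_vector) \<Rightarrow> bool" where
  "C2_on S f \<longleftrightarrow>
     (\<forall>x\<in>S. f differentiable at x) \<and> (\<forall>x\<in>S. Df f differentiable at x) \<and>
     continuous_on S (Df (Df f))"

text \<open>The functions are \<open>[0, \<infinity>]\<close>-valued, so no absolute value is needed.\<close>

definition weak_L1_seminorm :: "('a::euclidean_space \<Rightarrow> ennreal) \<Rightarrow> ennreal" where
  "weak_L1_seminorm f = (SUP t\<in>{0<..}. ennreal t * emeasure lebesgue {x. f x > ennreal t})"

definition weak_L1 :: "('a::euclidean_space \<Rightarrow> ennreal) set" where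
  "weak_L1 = {f \<in> borel_measurable lebesgue. weak_L1_seminorm f < \<infinity>}"

definition density_point :: "'a::euclidean_space set \<Rightarrow> 'a \<Rightarrow> bool" where
  "density_point S y \<longleftrightarrow> S \<in> sets lebesgue \<and>
     ((\<lambda>r. measure lebesgue (S \<inter> ball y r) / measure lebesgue (ball y r)) \<longlongrightarrow> 1) (at_right 0)"

text \<open>
  Approximate limit at \<open>y\<close> of a function with domain \<open>S\<close>. Measurability is required because
  \<^const>\<open>measure\<close> is 0 on nonmeasurable sets.
\<close>

definition has_ap_limit ::
    "'a::euclidean_space set \<Rightarrow> ('a \<Rightarrow> real) \<Rightarrow> 'a \<Rightarrow> real \<Rightarrow> bool" where
  "has_ap_limit S v y c \<longleftrightarrow>
     density_point S y \<and> v \<in> borel_measurable (lebesgue_on S) \<and>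
     (\<forall>\<epsilon>>0. ((\<lambda>r. measure lebesgue ({x\<in>S. \<bar>v x - c\<bar> > \<epsilon>} \<inter> ball y r)
                     / measure lebesgue (ball y r)) \<longlongrightarrow> 0) (at_right 0))"

text \<open>At \<open>x = y\<close> the quotient below is \<open>0 / 0 = 0\<close>; a single point does not affect the limit.\<close>

definition has_ap_derivative ::
    "'a::euclidean_space set \<Rightarrow> ('a \<Rightarrow> real) \<Rightarrow> 'a \<Rightarrow> ('a \<Rightarrow>\<^sub>L real) \<Rightarrow> bool" where
  "has_ap_derivative S v y L \<longleftrightarrow> y \<in> S \<and>
     has_ap_limit S (\<lambda>x. (v x - v y - blinfun_apply L (x - y)) / norm (x - y)) y 0"

lemma has_ap_derivative_unique:
  fixes v :: "'a::euclidean_space \<Rightarrow> real"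
  assumes D1: "has_ap_derivative S v y L1" and D2: "has_ap_derivative S v y L2"
  shows "L1 = L2"
proof (rule ccontr)
  assume "L1 \<noteq> L2"
  define M where "M = L1 - L2"
  obtain u where u: "M u \<noteq> 0"
    using \<open>L1 \<noteq> L2\<close> by (metis M_def blinfun_eqI right_minus_eq zero_blinfun.rep_eq)
  then have "u \<noteq> 0" by auto
  define \<epsilon> where "\<epsilon> = \<bar>M u\<bar> / (4 * norm u)"
  have \<epsilon>: "\<epsilon> > 0" using u \<open>u \<noteq> 0\<close> by (simp add: \<epsilon>_def)
  define W where "W = {z\<in>ball 0 1. \<bar>M z\<bar> > 2 * \<epsilon> * norm z}"
  define q where "q L x = (v x - v y - blinfun_apply L (x - y)) / norm (x - y)" for L x
  define bad where "bad L = {x\<in>S. \<bar>q L x - 0\<bar> > \<epsilon>}" for L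
  have ap: "has_ap_limit S (q L1) y 0" "has_ap_limit S (q L2) y 0"
    using D1 D2 by (simp_all add: has_ap_derivative_def q_def[abs_def])
  have S: "S \<in> sets lebesgue" using ap(1) by (simp add: has_ap_limit_def density_point_def)
  have bad_sets: "bad L \<in> sets lebesgue" if "has_ap_limit S (q L) y 0" for L
  proof -
    have m: "q L \<in> borel_measurable (lebesgue_on S)" using that by (simp add: has_ap_limit_def)
    have "{x\<in>space (lebesgue_on S). \<bar>q L x - 0\<bar> > \<epsilon>} \<in> sets (lebesgue_on S)"
      using m by measurable
    then show ?thesis using S by (simp add: bad_def sets_restrict_space_iff)
  qed
  have "open W"
  proof -
    have "W = ball 0 1 \<inter> {z. 2 * \<epsilon> * norm z < \<bar>M z\<bar>}" by (auto simp: W_def)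
    then show ?thesis
      by (simp only:) (intro open_Int open_ball open_Collect_less continuous_intros)
  qed
  have "(1 / (2 * norm u)) *\<^sub>R u \<in> W"
    using u \<open>u \<noteq> 0\<close> by (simp add: W_def \<epsilon>_def blinfun.scaleR_right field_simps)
  have W_lm: "W \<in> lmeasurable"
    using \<open>open W\<close> by (intro lmeasurable_open bounded_subset[OF bounded_ball[of 0 1]]) (auto simp: W_def)
  have W_pos: "measure lebesgue W > 0"
    using open_not_negligible[OF \<open>open W\<close>] \<open>_ \<in> W\<close> W_lm
    by (metis empty_iff negligible_iff_measure measure_nonneg order_le_less)
  define w where "w = measure lebesgue W / measure lebesgue (ball (0::'a) 1)"
  have w: "w > 0" using W_pos content_ball_pos[of 1 "0::'a"] by (simp add: w_def)
  let ?b = "\<lambda>r. measure lebesgue (ball y r)"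
  have key: "w \<le> (1 - measure lebesgue (S \<inter> ball y r) / ?b r)
      + measure lebesgue (bad L1 \<inter> ball y r) / ?b r + measure lebesgue (bad L2 \<inter> ball y r) / ?b r"
    if r: "r > 0" for r
  proof -
    let ?V = "(\<lambda>x. r *\<^sub>R x + y) ` W"
    have b: "?b r > 0" "?b r = r ^ DIM('a) * measure lebesgue (ball (0::'a) 1)"
      using r content_ball_conv_unit_ball[of r y] content_ball_pos[OF r, of y] by auto
    have V: "measure lebesgue ?V = r ^ DIM('a) * measure lebesgue W"
      using measure_lebesgue_affine[of r y W] r by (simp add: add.commute)
    have lm: "S \<inter> ball y r \<in> lmeasurable" "bad L1 \<inter> ball y r \<in> lmeasurable"
        "bad L2 \<inter> ball y r \<in> lmeasurable" "ball y r - S \<in> lmeasurable"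
      using S bad_sets ap
      by (auto intro!: bounded_set_imp_lmeasurable bounded_Int bounded_diff)
    have sub: "?V \<subseteq> (ball y r - S) \<union> (bad L1 \<inter> ball y r) \<union> (bad L2 \<inter> ball y r)"
    proof
      fix x assume "x \<in> ?V"
      then obtain z where z: "z \<in> W" "x = r *\<^sub>R z + y" by auto
      then have xb: "x \<in> ball y r" using r by (simp add: W_def dist_norm)
      have "z \<noteq> 0" using z by (auto simp: W_def)
      then have xy: "norm (x - y) > 0" using z r by simp
      have "q L2 x - q L1 x = M (x - y) / norm (x - y)"
        by (simp add: q_def M_def blinfun.diff_left diff_divide_distrib)
      moreover have "\<bar>M (x - y) / norm (x - y)\<bar> > 2 * \<epsilon>"
        using z r \<open>z \<noteq> 0\<close> by (simp add: W_def blinfun.scaleR_right abs_mult field_simps)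
      ultimately have "\<bar>q L1 x\<bar> > \<epsilon> \<or> \<bar>q L2 x\<bar> > \<epsilon>" by linarith
      with xb show "x \<in> (ball y r - S) \<union> (bad L1 \<inter> ball y r) \<union> (bad L2 \<inter> ball y r)"
        by (auto simp: bad_def)
    qed
    have "?V \<in> sets lebesgue"
      using lebesgue_sets_translation
      by (metis V W_lm W_pos b(2) measure_notin_sets mult_pos_pos order_less_irrefl r zero_less_power)
    then have "measure lebesgue ?V
        \<le> measure lebesgue ((ball y r - S) \<union> (bad L1 \<inter> ball y r) \<union> (bad L2 \<inter> ball y r))"
      by (intro measure_mono_fmeasurable[OF sub] fmeasurable.Un lm)
    also have "\<dots> \<le> measure lebesgue ((ball y r - S) \<union> (bad L1 \<inter> ball y r))
        + measure lebesgue (bad L2 \<inter> ball y r)"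
      using lm by (intro measure_Un_le) auto
    also have "measure lebesgue ((ball y r - S) \<union> (bad L1 \<inter> ball y r))
        \<le> measure lebesgue (ball y r - S) + measure lebesgue (bad L1 \<inter> ball y r)"
      using lm by (intro measure_Un_le) auto
    also have "measure lebesgue (ball y r - S) = ?b r - measure lebesgue (S \<inter> ball y r)"
    proof -
      have "measure lebesgue (ball y r - S \<inter> ball y r)
          = ?b r - measure lebesgue (S \<inter> ball y r)"
        by (rule measurable_measure_Diff) (use lm in auto)
      moreover have "ball y r - S \<inter> ball y r = ball y r - S" by auto
      ultimately show ?thesis by simp
    qed
    finally have "r ^ DIM('a) * measure lebesgue W / ?b r \<le>
        (?b r - measure lebesgue (S \<inter> ball y r) + measure lebesgue (bad L1 \<inter> ball y r)
          + measure lebesgue (bad L2 \<inter> ball y r)) / ?b r"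
      using b(1) V by (intro divide_right_mono) auto
    moreover have "r ^ DIM('a) * measure lebesgue W / ?b r = w"
      using r by (simp add: b(2) w_def)
    ultimately show ?thesis
      using b(1) by (simp add: add_divide_distrib diff_divide_distrib)
  qed
  have "((\<lambda>r. (1 - measure lebesgue (S \<inter> ball y r) / ?b r)
      + measure lebesgue (bad L1 \<inter> ball y r) / ?b r
      + measure lebesgue (bad L2 \<inter> ball y r) / ?b r) \<longlongrightarrow> (1 - 1) + 0 + 0) (at_right 0)"
    using ap \<epsilon> unfolding bad_def has_ap_limit_def density_point_def
    by (intro tendsto_intros) auto
  then have "w \<le> (1 - 1) + 0 + 0"
    by (rule tendsto_lowerbound[OF _ eventually_mono[OF eventually_at_right_less key]]) auto
  with w show False by simp
qed

definition ap_differentiable ::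
    "'a::euclidean_space set \<Rightarrow> ('a \<Rightarrow> real) \<Rightarrow> 'a \<Rightarrow> bool" where
  "ap_differentiable S v y \<longleftrightarrow> (\<exists>L. has_ap_derivative S v y L)"

text \<open>The description is proper by \<open>has_ap_derivative_unique\<close>.\<close>

definition ap_derivative ::
    "'a::euclidean_space set \<Rightarrow> ('a \<Rightarrow> real) \<Rightarrow> 'a \<Rightarrow> 'a \<Rightarrow>\<^sub>L real" where
  "ap_derivative S v y = (THE L. has_ap_derivative S v y L)"

end

theory Submission
  imports Defs
begin

text \<open>
  The heart of the matter is that, for every \<open>t > 0\<close>, the potential of a finite positive measure of
  mass \<open>m\<close> is Lipschitz with a constant of order \<open>t\<close> off a set of measure of order \<open>m / t\<close>. Split the
  measure at height \<open>t\<close> by the Calderon--Zygmund decomposition. The parts of mean zero on the dyadic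
  cubes are treated through the second differences of \<open>K\<close>, which the bound on \<open>D\<^sup>2K\<close> makes integrable
  away from the cubes. For the bounded part, the difference quotients are controlled by the maximal
  truncation of the singular integral with kernel \<open>\<nabla>K\<close>. The dyadic pieces of that kernel are
  derivatives of compactly supported functions, hence have mean zero, so that the Cotlar--Stein lemma
  gives an \<open>L\<^sup>2\<close> bound. With \<open>E\<^sub>k\<close> the exceptional set at height of order \<open>2\<^sup>k\<close>, the function
  whose value at \<open>x\<close> is the supremum of \<open>2\<^bsup>k + 2\<^esup>\<close> over all \<open>k\<close> with \<open>x \<in> E\<^sub>k\<close> can be taken as \<open>I\<close>.

  For the approximate differentiability, the measure is, up to an error of arbitrarily small mass,
  the sum of a smooth compactly supported density and a measure carried by a compact null set. The
  potentials of these two are differentiable almost everywhere, and the potential of the error is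
  Lipschitz with a small constant off a set of small measure. At a density point of the complement
  of that set this gives a linear approximation up to any given error.
\<close>

subsection \<open>Kernels and their truncations\<close>

text \<open>The gradient of \<open>K\<close> has size \<open>1 / |x|^N\<close>, integrable neither
  at 0 nor at infinity, so increments of the potential cannot be estimated by absolute values alone.
  Cancellation enters in two ways. In a cell, replacing the measure by its mean turns first
  differences of \<open>K\<close> into second differences, which gain the side of the cell over the
  distance. For the bounded part, the increment over a distance of order \<open>r\<close> is, up to
  absolutely convergent terms, given by the gradient truncated at scale \<open>r\<close>, and
  \<open>r\<close> varies with the pair of points; hence a maximal operator. It is reached from the
  L^2 bound of single truncations by averaging over dyadic cells: at a point of a cell, the
  truncation at the scale of the cell is compared with the finest truncation on the whole cell,
  whose square has a dyadic maximal function of weak type. No symmetry of \<open>K\<close> is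
  available, so mean zero of the pieces has to come from their being derivatives. The approximate
  derivative has no formula here; it is obtained as a limit of slopes that fit up to smaller and
  smaller errors, each off a set of density zero.\<close>

lemma mean_value_norm_bound:
  fixes f :: "'a::real_normed_vector \<Rightarrow> 'b::real_normed_vector"
  assumes "convex S" "a \<in> S" "b \<in> S"
    and "\<And>x. x \<in> S \<Longrightarrow> (f has_derivative f' x) (at x)"
    and "\<And>x h. x \<in> S \<Longrightarrow> norm (f' x h) \<le> B * norm h"
  shows "norm (f a - f b) \<le> B * norm (a - b)"
proof (cases "a = b")
  case False
  note ab = this
  show ?thesis
  proof (rule differentiable_bound[OF assms(1) _ _ assms(2,3)])
  show "(f has_derivative f' x) (at x within S)" if "x \<in> S" for x
    using assms(4)[OF that] by (rule has_derivative_at_withinI)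
  fix x assume x: "x \<in> S"
  show "onorm (f' x) \<le> B"
  proof (rule onorm_bound)
    \<comment> \<open>\<open>B\<close> is not assumed nonnegative; for distinct \<open>a\<close> and
      \<open>b\<close> this follows from the bound on \<open>f'\<close> in the direction
      \<open>a - b\<close>.\<close>
    have "0 \<le> B * norm (a - b)" if "a \<noteq> b"
      using assms(5)[OF x, of "a - b"] norm_ge_zero order_trans by blast
    then show "0 \<le> B" using ab by (simp add: zero_le_mult_iff)
  qed (use assms(5)[OF x] in auto)
  qed
qed simp

section \<open>A piecewise polynomial cutoff with two derivatives\<close>

definition clamp01 :: "real \<Rightarrow> real" where
  "clamp01 s = max 0 (min 1 s)"

lemma clamp01_bounds: "0 \<le> clamp01 s" "clamp01 s \<le> 1"
  by (auto simp: clamp01_def)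

text \<open>Clamping glues \<open>p\<close> to constants at 0 and 1, and the vanishing of
  \<open>p'\<close> there makes the one-sided derivatives agree. It is applied to the cutoff and
  again to its derivative.\<close>

lemma has_real_derivative_compose_clamp01:
  assumes p: "\<And>s. (p has_real_derivative p' s) (at s)" and "p' 0 = 0" "p' 1 = 0"
  shows "((\<lambda>s. p (clamp01 s)) has_real_derivative p' (clamp01 s)) (at s)"
proof -
  have const: "((\<lambda>s. p c) has_real_derivative 0) (at s)" for s c :: real
    by (rule DERIV_const)
  consider "s < 0" | "s = 0" | "0 < s" "s < 1" | "s = 1" | "1 < s" by linarith
  then show ?thesis
  proof cases
    case 1
    have "((\<lambda>s. p (clamp01 s)) has_real_derivative 0) (at s)"
      by (rule has_field_derivative_transform_within_open[OF const[of 0], of "{..<0}"])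
         (use 1 in \<open>auto simp: clamp01_def\<close>)
    then show ?thesis using 1 assms by (simp add: clamp01_def)
  next
    case 3
    have "((\<lambda>s. p (clamp01 s)) has_real_derivative p' s) (at s)"
      by (rule has_field_derivative_transform_within_open[OF p[of s], of "{0<..<1}"])
         (use 3 in \<open>auto simp: clamp01_def\<close>)
    then show ?thesis using 3 by (simp add: clamp01_def)
  next
    case 5
    have "((\<lambda>s. p (clamp01 s)) has_real_derivative 0) (at s)"
      by (rule has_field_derivative_transform_within_open[OF const[of 1], of "{1<..}"])
         (use 5 in \<open>auto simp: clamp01_def\<close>)
    then show ?thesis using 5 assms by (simp add: clamp01_def)
  next
    case 2
    have "((\<lambda>s. p (clamp01 s)) has_real_derivative 0) (at 0 within {..0})"
      by (rule has_field_derivative_transform_within[OF DERIV_subset[OF const[of 0 0], of "{..0}"], of 1])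
         (auto simp: clamp01_def)
    moreover have "((\<lambda>s. p (clamp01 s)) has_real_derivative 0) (at 0 within {0..})"
      by (rule has_field_derivative_transform_within[OF DERIV_subset[OF p[of 0], of "{0..}", unfolded assms], of 1])
         (auto simp: clamp01_def)
    ultimately have "((\<lambda>s. p (clamp01 s)) has_real_derivative 0) (at 0 within {..0} \<union> {0..})"
      unfolding has_field_derivative_iff by (auto intro!: Lim_Un)
    moreover have "{..0} \<union> {0..} = (UNIV::real set)" by auto
    ultimately show ?thesis using 2 assms by (simp add: clamp01_def)
  next
    case 4
    have "((\<lambda>s. p (clamp01 s)) has_real_derivative 0) (at 1 within {1..})"
      by (rule has_field_derivative_transform_within[OF DERIV_subset[OF const[of 1 1], of "{1..}"], of 1])
         (auto simp: clamp01_def)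
    moreover have "((\<lambda>s. p (clamp01 s)) has_real_derivative 0) (at 1 within {..1})"
      by (rule has_field_derivative_transform_within[OF DERIV_subset[OF p[of 1], of "{..1}", unfolded assms], of 1])
         (auto simp: clamp01_def dist_real_def)
    ultimately have "((\<lambda>s. p (clamp01 s)) has_real_derivative 0) (at 1 within {..1} \<union> {1..})"
      unfolding has_field_derivative_iff by (auto intro!: Lim_Un)
    moreover have "{..1} \<union> {1..} = (UNIV::real set)" by auto
    ultimately show ?thesis using 4 assms by (simp add: clamp01_def)
  qed
qed

text \<open>The antiderivative of \<open>30 c^2 (1 - c)^2\<close>, normalized to run from 0 to 1:
  first and second derivatives vanish at both ends, so that clamping preserves two
  derivatives.\<close>

definition smoothstep :: "real \<Rightarrow> real" where
  "smoothstep s = 10 * clamp01 s ^ 3 - 15 * clamp01 s ^ 4 + 6 * clamp01 s ^ 5"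

definition smoothstep' :: "real \<Rightarrow> real" where
  "smoothstep' s = 30 * clamp01 s ^ 2 - 60 * clamp01 s ^ 3 + 30 * clamp01 s ^ 4"

definition smoothstep'' :: "real \<Rightarrow> real" where
  "smoothstep'' s = 60 * clamp01 s - 180 * clamp01 s ^ 2 + 120 * clamp01 s ^ 3"

lemma DERIV_smoothstep: "(smoothstep has_real_derivative smoothstep' s) (at s)"
  unfolding smoothstep_def[abs_def] smoothstep'_def
  by (rule has_real_derivative_compose_clamp01
        [where p = "\<lambda>c. 10 * c ^ 3 - 15 * c ^ 4 + 6 * c ^ 5"
           and p' = "\<lambda>c. 30 * c ^ 2 - 60 * c ^ 3 + 30 * c ^ 4"])
     (auto intro!: derivative_eq_intros)

lemma DERIV_smoothstep': "(smoothstep' has_real_derivative smoothstep'' s) (at s)"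
  unfolding smoothstep'_def[abs_def] smoothstep''_def
  by (rule has_real_derivative_compose_clamp01
        [where p = "\<lambda>c. 30 * c ^ 2 - 60 * c ^ 3 + 30 * c ^ 4"
           and p' = "\<lambda>c. 60 * c - 180 * c ^ 2 + 120 * c ^ 3"])
     (auto intro!: derivative_eq_intros)

lemma smoothstep_eq_0: "s \<le> 0 \<Longrightarrow> smoothstep s = 0" "s \<le> 0 \<Longrightarrow> smoothstep' s = 0"
    "s \<le> 0 \<Longrightarrow> smoothstep'' s = 0"
  by (auto simp: smoothstep_def smoothstep'_def smoothstep''_def clamp01_def)

lemma smoothstep_eq_1: "s \<ge> 1 \<Longrightarrow> smoothstep s = 1" "s \<ge> 1 \<Longrightarrow> smoothstep' s = 0"
    "s \<ge> 1 \<Longrightarrow> smoothstep'' s = 0"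
  by (auto simp: smoothstep_def smoothstep'_def smoothstep''_def clamp01_def)

text \<open>The polynomial is \<open>c^3\<close> times a quadratic with minimum 5/8. The reflection
  of \<open>c\<close> to \<open>1 - c\<close> exchanges it with its complement to 1, which gives the
  upper bound.\<close>

lemma smoothstep_bounds: "0 \<le> smoothstep s" "smoothstep s \<le> 1"
proof -
  define c where "c = clamp01 s"
  have c: "0 \<le> c" "c \<le> 1" using clamp01_bounds by (auto simp: c_def)
  have q: "10 - 15 * x + 6 * x ^ 2 \<ge> 0" for x :: real
  proof -
    have "10 - 15 * x + 6 * x ^ 2 = 6 * (x - 5/4)^2 + 5/8" by (simp add: power2_eq_square algebra_simps)
    then show ?thesis by (metis add_nonneg_nonneg divide_nonneg_nonneg mult_nonneg_nonneg zero_le_numeral zero_le_power2)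
  qed
  have "smoothstep s = c ^ 3 * (10 - 15 * c + 6 * c ^ 2)"
    unfolding smoothstep_def c_def[symmetric] by algebra
  then show "0 \<le> smoothstep s" using q c by simp
  have "1 - smoothstep s = (1 - c) ^ 3 * (10 - 15 * (1 - c) + 6 * (1 - c) ^ 2)"
    unfolding smoothstep_def c_def[symmetric] by algebra
  moreover have "\<dots> \<ge> 0" using q[of "1 - c"] c by (intro mult_nonneg_nonneg) (auto simp del: right_diff_distrib)
  ultimately show "smoothstep s \<le> 1" by simp
qed

lemma smoothstep'_bound: "\<bar>smoothstep' s\<bar> \<le> 2"
proof -
  define c where "c = clamp01 s"
  have c: "0 \<le> c" "c \<le> 1" using clamp01_bounds by (auto simp: c_def)
  have "c * (1 - c) = 1/4 - (c - 1/2)^2" by (simp add: power2_eq_square algebra_simps)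
  then have 1: "c * (1 - c) \<le> 1/4" by simp
  have "(c * (1 - c))^2 \<le> (1/4)^2" using 1 c by (intro power_mono) auto
  moreover have "smoothstep' s = 30 * (c * (1 - c))^2"
    unfolding smoothstep'_def c_def[symmetric] by algebra
  ultimately have "smoothstep' s \<ge> 0" "smoothstep' s \<le> 30 * (1/4)^2" by simp_all
  then show ?thesis by (simp add: power2_eq_square)
qed

lemma smoothstep''_bound: "\<bar>smoothstep'' s\<bar> \<le> 15"
proof -
  define c where "c = clamp01 s"
  have c: "0 \<le> c" "c \<le> 1" using clamp01_bounds by (auto simp: c_def)
  have "c * (1 - c) = 1/4 - (c - 1/2)^2" by (simp add: power2_eq_square algebra_simps)
  then have 1: "c * (1 - c) \<le> 1/4" by simp
  have "smoothstep'' s = 60 * (c * (1 - c)) * (1 - 2 * c)"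
    unfolding smoothstep''_def c_def[symmetric] by algebra
  then have "\<bar>smoothstep'' s\<bar> = 60 * (c * (1 - c)) * \<bar>1 - 2 * c\<bar>"
    using c by (simp add: abs_mult)
  also have "\<dots> \<le> 60 * (1/4) * 1"
    using 1 c by (intro mult_mono) auto
  finally show ?thesis by simp
qed

text \<open>One constant for all three bounds, and the gradient as a vector field rather than a
  functional: in this form the truncations of \<open>K\<close> are again an instance, so each
  estimate below also serves for them. Nothing is said about \<open>K 0\<close>.\<close>

locale CZ_kernel =
  fixes K :: "'a::euclidean_space \<Rightarrow> real" and G :: "'a \<Rightarrow> 'a" and G' :: "'a \<Rightarrow> 'a \<Rightarrow> 'a"
    and c :: real
  assumes c_nonneg: "c \<ge> 0"
    and K_bound: "x \<noteq> 0 \<Longrightarrow> \<bar>K x\<bar> \<le> c / norm x ^ (DIM('a) - 1)"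
    and G_bound: "x \<noteq> 0 \<Longrightarrow> norm (G x) \<le> c / norm x ^ DIM('a)"
    and G'_bound: "x \<noteq> 0 \<Longrightarrow> norm (G' x h) \<le> c / norm x ^ (DIM('a) + 1) * norm h"
    and K_deriv: "x \<noteq> 0 \<Longrightarrow> (K has_derivative (\<lambda>h. G x \<bullet> h)) (at x)"
    and G_deriv: "x \<noteq> 0 \<Longrightarrow> (G has_derivative G' x) (at x)"
begin

section \<open>Increments of the kernel away from the origin\<close>

lemma power_div_mono:
  assumes "0 < (s::real)" "s \<le> t"
  shows "c / t ^ n \<le> c / s ^ n"
  using assms c_nonneg by (intro divide_left_mono power_mono mult_pos_pos) auto

lemma half_norm: "norm x \<ge> norm a / 2" if "norm (x - a) \<le> norm a / 2" for x a :: 'a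
  using norm_triangle_ineq3[of x a] that by linarith

lemma cball_half: 
  assumes "a \<noteq> (0::'a)" "x \<in> cball a (norm a / 2)"
  shows "norm x \<ge> norm a / 2" "x \<noteq> 0"
proof -
  show 1: "norm x \<ge> norm a / 2"
    using assms(2) by (intro half_norm) (simp add: dist_norm norm_minus_commute)
  show "x \<noteq> 0" using 1 assms(1) by auto
qed

lemma G_diff:
  assumes "a \<noteq> 0" "norm (a - b) \<le> norm a / 2"
  shows "norm (G a - G b) \<le> c * 2 ^ (DIM('a) + 1) / norm a ^ (DIM('a) + 1) * norm (a - b)"
proof (rule mean_value_norm_bound[of "cball a (norm a / 2)"])
  fix x assume x: "x \<in> cball a (norm a / 2)"
  note * = cball_half[OF assms(1) x]
  show "(G has_derivative G' x) (at x)" using * G_deriv by simp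
  fix h
  have "c / norm x ^ (DIM('a) + 1) \<le> c / (norm a / 2) ^ (DIM('a) + 1)"
    using * assms(1) by (intro power_div_mono) auto
  also have "\<dots> = c * 2 ^ (DIM('a) + 1) / norm a ^ (DIM('a) + 1)"
    by (simp add: power_divide)
  finally show "norm (G' x h) \<le> c * 2 ^ (DIM('a) + 1) / norm a ^ (DIM('a) + 1) * norm h"
    using G'_bound[OF *(2), of h] by (meson mult_right_mono norm_ge_zero order_trans)
qed (use assms in \<open>auto simp: dist_norm\<close>)

lemma K_diff:
  assumes "a \<noteq> 0" "norm (a - b) \<le> norm a / 2"
  shows "\<bar>K a - K b\<bar> \<le> c * 2 ^ DIM('a) / norm a ^ DIM('a) * norm (a - b)"
  unfolding real_norm_def[symmetric]
proof (rule mean_value_norm_bound[of "cball a (norm a / 2)"])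
  fix x assume x: "x \<in> cball a (norm a / 2)"
  note * = cball_half[OF assms(1) x]
  show "(K has_derivative (\<lambda>h. G x \<bullet> h)) (at x)" using * K_deriv by simp
  fix h
  have "norm (G x \<bullet> h) \<le> norm (G x) * norm h" using Cauchy_Schwarz_ineq2 by simp
  also have "norm (G x) \<le> c / norm x ^ DIM('a)" using * G_bound by simp
  also have "c / norm x ^ DIM('a) \<le> c / (norm a / 2) ^ DIM('a)"
    using * assms(1) by (intro power_div_mono) auto
  also have "\<dots> = c * 2 ^ DIM('a) / norm a ^ DIM('a)"
    by (simp add: power_divide)
  finally show "norm (G x \<bullet> h) \<le> c * 2 ^ DIM('a) / norm a ^ DIM('a) * norm h"
    by (simp add: mult_right_mono)
qed (use assms in \<open>auto simp: dist_norm\<close>)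

text \<open>The mean value theorem is used twice: along the segment from \<open>a\<close> to
  \<open>b\<close> for \<open>K (x - w) - K x\<close>, whose gradient \<open>G (x - w) - G x\<close>
  is in turn an increment of \<open>G\<close> over \<open>w\<close>. The quarters keep all points in
  the ball of radius \<open>norm a / 2\<close> about \<open>a\<close>.\<close>

lemma second_difference_near:
  assumes "a \<noteq> 0" "norm w \<le> norm a / 4" "norm (a - b) \<le> norm a / 4"
  shows "\<bar>(K (a - w) - K a) - (K (b - w) - K b)\<bar>
    \<le> c * 2 ^ (DIM('a) + 1) / norm a ^ (DIM('a) + 1) * norm w * norm (a - b)"
  unfolding real_norm_def[symmetric]
proof (rule mean_value_norm_bound[of "cball a (norm a / 4)" _ _ "\<lambda>x. K (x - w) - K x"])
  fix x assume "x \<in> cball a (norm a / 4)"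
  then have xa: "norm (x - a) \<le> norm a / 4" by (simp add: dist_norm norm_minus_commute)
  then have "norm x \<ge> 3 / 4 * norm a" using norm_triangle_ineq3[of x a] by linarith
  with assms have x: "x \<noteq> 0" by auto
  have "norm (x - w - a) \<le> norm a / 2"
    using norm_triangle_ineq4[of "x - a" w] xa assms(2) by (simp add: algebra_simps)
  then have xw: "norm (x - w) \<ge> norm a / 2" by (rule half_norm)
  with assms have x': "x - w \<noteq> 0" by auto
  show "((\<lambda>x. K (x - w) - K x) has_derivative (\<lambda>h. (G (x - w) - G x) \<bullet> h)) (at x)"
  proof -
    have "((\<lambda>x. x - w) has_derivative (\<lambda>h. h)) (at x)"
      by (auto intro!: derivative_eq_intros)
    then have "((\<lambda>x. K (x - w)) has_derivative (\<lambda>h. G (x - w) \<bullet> h)) (at x)"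
      using has_derivative_compose[of "\<lambda>x. x - w" "\<lambda>h. h" x UNIV K "\<lambda>h. G (x - w) \<bullet> h"] K_deriv[OF x']
      by simp
    from has_derivative_diff[OF this K_deriv[OF x]] show ?thesis
      by (simp add: inner_diff_left)
  qed
  fix h
  have G: "norm (G (x - w) - G x) \<le> c * 2 ^ (DIM('a) + 1) / norm a ^ (DIM('a) + 1) * norm ((x - w) - x)"
  proof (rule mean_value_norm_bound[of "cball a (norm a / 2)"])
    fix z assume z: "z \<in> cball a (norm a / 2)"
    note * = cball_half[OF assms(1) z]
    show "(G has_derivative G' z) (at z)" using * G_deriv by simp
    fix h
    have "c / norm z ^ (DIM('a) + 1) \<le> c / (norm a / 2) ^ (DIM('a) + 1)"
      using * assms(1) by (intro power_div_mono) auto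
    also have "\<dots> = c * 2 ^ (DIM('a) + 1) / norm a ^ (DIM('a) + 1)"
      by (simp add: power_divide)
    finally show "norm (G' z h) \<le> c * 2 ^ (DIM('a) + 1) / norm a ^ (DIM('a) + 1) * norm h"
      using G'_bound[OF *(2), of h] by (meson mult_right_mono norm_ge_zero order_trans)
  next
    show "x - w \<in> cball a (norm a / 2)"
      using \<open>norm (x - w - a) \<le> norm a / 2\<close> by (simp add: dist_norm norm_minus_commute)
    have "norm (x - a) \<le> norm a / 2" using xa norm_ge_zero[of a] by linarith
    then show "x \<in> cball a (norm a / 2)" by (simp add: dist_norm norm_minus_commute)
  qed simp
  have "norm ((G (x - w) - G x) \<bullet> h) \<le> norm (G (x - w) - G x) * norm h"
    using Cauchy_Schwarz_ineq2 by simp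
  also have "\<dots> \<le> c * 2 ^ (DIM('a) + 1) / norm a ^ (DIM('a) + 1) * norm w * norm h"
    using G by (intro mult_right_mono) auto
  finally show "norm ((G (x - w) - G x) \<bullet> h)
      \<le> c * 2 ^ (DIM('a) + 1) / norm a ^ (DIM('a) + 1) * norm w * norm h" .
qed (use assms in \<open>auto simp: dist_norm\<close>)

text \<open>A first difference decays one power less, but a length \<open>d\<close> of at least
  \<open>norm a / 4\<close> makes up for it and brings the bound into the shape of a second
  difference.\<close>

lemma first_difference_far:
  assumes "a \<noteq> 0" "norm w \<le> norm a / 4" "norm a / 4 \<le> d"
  shows "\<bar>K (a - w) - K a\<bar> \<le> c * 2 ^ (DIM('a) + 2) / norm a ^ (DIM('a) + 1) * norm w * d"
proof -
  have "norm w \<le> norm a / 2" using assms(2) norm_ge_zero[of a] by linarith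
  then have "\<bar>K a - K (a - w)\<bar> \<le> c * 2 ^ DIM('a) / norm a ^ DIM('a) * norm (a - (a - w))"
    using assms(1) by (intro K_diff) auto
  also have "\<dots> = c * 2 ^ (DIM('a) + 2) / norm a ^ (DIM('a) + 1) * norm w * (norm a / 4)"
    using assms(1) by (simp add: field_simps)
  also have "\<dots> \<le> c * 2 ^ (DIM('a) + 2) / norm a ^ (DIM('a) + 1) * norm w * d"
    using assms(3) c_nonneg by (intro mult_left_mono) auto
  finally show ?thesis by (simp add: abs_minus_commute)
qed

text \<open>If \<open>a\<close> and \<open>b\<close> are close relative to one of them, both
  increments are exploited; otherwise \<open>norm (a - b)\<close> is large against both, and the two
  first differences are estimated separately. The sum on the right keeps \<open>a\<close> and
  \<open>b\<close> apart, so that later each of the two points is controlled on its own.\<close>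

lemma second_difference:
  assumes "a \<noteq> 0" "b \<noteq> 0" "norm w \<le> norm a / 4" "norm w \<le> norm b / 4"
  shows "\<bar>(K (a - w) - K a) - (K (b - w) - K b)\<bar>
    \<le> c * 2 ^ (DIM('a) + 2) * norm w * norm (a - b) *
       (1 / norm a ^ (DIM('a) + 1) + 1 / norm b ^ (DIM('a) + 1))"
proof -
  let ?C = "c * 2 ^ (DIM('a) + 2) * norm w * norm (a - b)"
  have sum: "?C * (1 / norm a ^ (DIM('a) + 1) + 1 / norm b ^ (DIM('a) + 1))
      = ?C / norm a ^ (DIM('a) + 1) + ?C / norm b ^ (DIM('a) + 1)" by (simp add: distrib_left)
  have nn: "?C / norm a ^ (DIM('a) + 1) \<ge> 0" "?C / norm b ^ (DIM('a) + 1) \<ge> 0"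
    using c_nonneg by auto
  have weak: "c * 2 ^ (DIM('a) + 1) / s ^ (DIM('a) + 1) * norm w * norm (a - b) \<le> ?C / s ^ (DIM('a) + 1)"
    if "s \<ge> 0" for s
    using c_nonneg that by (simp add: divide_right_mono mult_right_mono)
  consider "norm (a - b) \<le> norm a / 4" | "norm (a - b) \<le> norm b / 4"
    | "norm a / 4 \<le> norm (a - b)" "norm b / 4 \<le> norm (a - b)" by linarith
  then show ?thesis
  proof cases
    case 1
    show ?thesis
      using second_difference_near[OF assms(1,3) 1] weak[of "norm a"] nn(2) unfolding sum by simp
  next
    case 2
    then have "norm (b - a) \<le> norm b / 4" by (simp add: norm_minus_commute)
    from second_difference_near[OF assms(2,4) this] show ?thesis
      using weak[of "norm b"] nn(1) unfolding sum by (simp add: norm_minus_commute abs_minus_commute)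
  next
    case 3
    show ?thesis
      using first_difference_far[OF assms(1,3) 3(1)] first_difference_far[OF assms(2,4) 3(2)]
      unfolding sum by (simp add: mult.commute mult.left_commute)
  qed
qed

lemma K_measurable [measurable]: "K \<in> borel_measurable borel"
proof -
  have "continuous_on (- {0}) K"
    by (intro continuous_at_imp_continuous_on ballI has_derivative_continuous[OF K_deriv]) auto
  then have "(\<lambda>x. if x \<in> - {0} then K x else K 0) \<in> borel_measurable borel"
    by (intro borel_measurable_continuous_on_if) auto
  moreover have "(\<lambda>x. if x \<in> - {0} then K x else K 0) = K" by auto
  ultimately show ?thesis by simp
qed

section \<open>Smooth truncations of the kernel at scale \<open>r\<close>\<close>

definition trunc :: "real \<Rightarrow> 'a \<Rightarrow> real" where
  "trunc r x = smoothstep ((x \<bullet> x) / r\<^sup>2 - 1) * K x"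

definition trunc' :: "real \<Rightarrow> 'a \<Rightarrow> 'a" where
  "trunc' r x = smoothstep ((x \<bullet> x) / r\<^sup>2 - 1) *\<^sub>R G x
     + (K x * smoothstep' ((x \<bullet> x) / r\<^sup>2 - 1) * (2 / r\<^sup>2)) *\<^sub>R x"

definition trunc'' :: "real \<Rightarrow> 'a \<Rightarrow> 'a \<Rightarrow> 'a" where
  "trunc'' r x h =
     (let s = (x \<bullet> x) / r\<^sup>2 - 1; ds = 2 * (x \<bullet> h) / r\<^sup>2 in
       smoothstep s *\<^sub>R G' x h + (smoothstep' s * ds) *\<^sub>R G x
       + ((G x \<bullet> h) * smoothstep' s * (2 / r\<^sup>2) + K x * (smoothstep'' s * ds) * (2 / r\<^sup>2)) *\<^sub>R x
       + (K x * smoothstep' s * (2 / r\<^sup>2)) *\<^sub>R h)"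

lemma ratio_le_0: "norm x \<le> r \<Longrightarrow> r > 0 \<Longrightarrow> (x \<bullet> x) / r\<^sup>2 - 1 \<le> 0" for x :: 'a
  by (simp add: dot_square_norm power_mono)

lemma ratio_ge_1: "2 * r \<le> norm x \<Longrightarrow> r > 0 \<Longrightarrow> (x \<bullet> x) / r\<^sup>2 - 1 \<ge> 1" for x :: 'a
proof -
  assume *: "2 * r \<le> norm x" "r > 0"
  then have "(2 * r)\<^sup>2 \<le> (norm x)\<^sup>2" by (intro power_mono) auto
  moreover have "2 * r\<^sup>2 \<le> (2 * r)\<^sup>2" by (simp add: power_mult_distrib)
  ultimately have "2 * r\<^sup>2 \<le> (norm x)\<^sup>2" by linarith
  then show ?thesis using * by (simp add: dot_square_norm field_simps)
qed

text \<open>The cutoff is a function of \<open>x \<bullet> x\<close>, hence without singularity at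
  the origin; it rises from 0 to 1 while \<open>norm x\<close> goes from \<open>r\<close> to
  \<open>sqrt 2 * r\<close>. Thus \<open>K 0\<close> never enters and the truncation is twice
  differentiable everywhere.\<close>

lemma trunc_inside: "norm x \<le> r \<Longrightarrow> r > 0 \<Longrightarrow> trunc r x = 0" "norm x \<le> r \<Longrightarrow> r > 0 \<Longrightarrow> trunc' r x = 0"
  "norm x \<le> r \<Longrightarrow> r > 0 \<Longrightarrow> trunc'' r x h = 0"
  using ratio_le_0[of x r]
  by (auto simp: trunc_def trunc'_def trunc''_def Let_def smoothstep_eq_0)

lemma trunc_outside: "2 * r \<le> norm x \<Longrightarrow> r > 0 \<Longrightarrow> trunc r x = K x"
    "2 * r \<le> norm x \<Longrightarrow> r > 0 \<Longrightarrow> trunc' r x = G x"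
  using ratio_ge_1[of r x]
  by (auto simp: trunc_def trunc'_def smoothstep_eq_1)

lemma ratio_deriv: "((\<lambda>x. (x \<bullet> x) / r\<^sup>2 - 1) has_derivative (\<lambda>h. 2 * (x \<bullet> h) / r\<^sup>2)) (at x)"
  if "r > 0" for x :: 'a
  using that by (auto intro!: derivative_eq_intros simp: inner_commute field_simps)

lemma smoothstep_ratio_deriv:
  fixes x :: 'a assumes "r > 0"
  shows "((\<lambda>x. smoothstep ((x \<bullet> x) / r\<^sup>2 - 1)) has_derivative
       (\<lambda>h. smoothstep' ((x \<bullet> x) / r\<^sup>2 - 1) * (2 * (x \<bullet> h) / r\<^sup>2))) (at x)"
    "((\<lambda>x. smoothstep' ((x \<bullet> x) / r\<^sup>2 - 1)) has_derivative
       (\<lambda>h. smoothstep'' ((x \<bullet> x) / r\<^sup>2 - 1) * (2 * (x \<bullet> h) / r\<^sup>2))) (at x)"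
  by (rule has_derivative_eq_rhs[OF DERIV_compose_FDERIV[OF DERIV_smoothstep ratio_deriv[OF assms]]],
      simp add: mult.commute)
     (rule has_derivative_eq_rhs[OF DERIV_compose_FDERIV[OF DERIV_smoothstep' ratio_deriv[OF assms]]],
      simp add: mult.commute)

lemma trunc_deriv:
  assumes "r > 0"
  shows "(trunc r has_derivative (\<lambda>h. trunc' r x \<bullet> h)) (at x)"
proof (cases "norm x < r")
  case True
  have "((\<lambda>x. 0) has_derivative (\<lambda>h. 0)) (at x)" by simp
  then have "(trunc r has_derivative (\<lambda>h. 0)) (at x)"
    by (rule has_derivative_transform_within_open[of _ _ _ _ "ball 0 r"])
       (use True assms in \<open>auto simp: trunc_inside\<close>)
  with True assms show ?thesis by (simp add: trunc_inside)
next
  case False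
  with assms have "x \<noteq> 0" by auto
  show ?thesis
    unfolding trunc_def[abs_def]
    by (rule has_derivative_eq_rhs[OF has_derivative_mult[OF smoothstep_ratio_deriv(1)[OF assms] K_deriv[OF \<open>x \<noteq> 0\<close>]]])
       (auto simp: trunc'_def inner_add_left algebra_simps)
qed

lemma trunc'_deriv:
  assumes "r > 0"
  shows "(trunc' r has_derivative trunc'' r x) (at x)"
proof (cases "norm x < r")
  case True
  have "((\<lambda>x. 0) has_derivative (\<lambda>h. 0)) (at x)" by simp
  then have "(trunc' r has_derivative (\<lambda>h. 0)) (at x)"
    by (rule has_derivative_transform_within_open[of _ _ _ _ "ball 0 r"])
       (use True assms in \<open>auto simp: trunc_inside\<close>)
  moreover have "trunc'' r x = (\<lambda>h. 0)"
    using True assms by (auto simp: trunc_inside)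
  ultimately show ?thesis by simp
next
  case False
  with assms have x: "x \<noteq> 0" by auto
  let ?s = "\<lambda>x. (x \<bullet> x) / r\<^sup>2 - 1"
  have 1: "((\<lambda>x. smoothstep (?s x) *\<^sub>R G x) has_derivative
      (\<lambda>h. smoothstep (?s x) *\<^sub>R G' x h + (smoothstep' (?s x) * (2 * (x \<bullet> h) / r\<^sup>2)) *\<^sub>R G x)) (at x)"
    by (rule has_derivative_scaleR[OF smoothstep_ratio_deriv(1)[OF assms] G_deriv[OF x]])
  have 2: "((\<lambda>x. K x * smoothstep' (?s x) * (2 / r\<^sup>2)) has_derivative
      (\<lambda>h. (K x * (smoothstep'' (?s x) * (2 * (x \<bullet> h) / r\<^sup>2)) + (G x \<bullet> h) * smoothstep' (?s x)) * (2 / r\<^sup>2))) (at x)"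
    by (rule has_derivative_mult_left[OF has_derivative_mult[OF K_deriv[OF x] smoothstep_ratio_deriv(2)[OF assms]]])
  have 3: "((\<lambda>x. (K x * smoothstep' (?s x) * (2 / r\<^sup>2)) *\<^sub>R x) has_derivative
      (\<lambda>h. (K x * smoothstep' (?s x) * (2 / r\<^sup>2)) *\<^sub>R h +
        ((K x * (smoothstep'' (?s x) * (2 * (x \<bullet> h) / r\<^sup>2)) + (G x \<bullet> h) * smoothstep' (?s x)) * (2 / r\<^sup>2)) *\<^sub>R x)) (at x)"
    by (rule has_derivative_scaleR[OF 2 has_derivative_ident])
  from has_derivative_add[OF 1 3] show ?thesis
    unfolding trunc'_def[abs_def]
    by (rule has_derivative_eq_rhs)
       (simp only: trunc''_def Let_def fun_eq_iff distrib_right add.commute add.left_commute add.assoc scaleR_add_left simp_thms)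
qed

lemma trunc_bound: "x \<noteq> 0 \<Longrightarrow> \<bar>trunc r x\<bar> \<le> c / norm x ^ (DIM('a) - 1)"
proof -
  assume x: "x \<noteq> 0"
  have "\<bar>trunc r x\<bar> \<le> 1 * \<bar>K x\<bar>"
    unfolding trunc_def abs_mult by (intro mult_right_mono) (auto simp: smoothstep_bounds)
  with K_bound[OF x] show ?thesis by linarith
qed

lemma K_bound': "x \<noteq> 0 \<Longrightarrow> \<bar>K x\<bar> \<le> c / norm x ^ DIM('a) * norm x"
proof -
  assume x: "x \<noteq> 0"
  obtain n where "DIM('a) = Suc n" using DIM_positive[where 'a='a] gr0_conv_Suc by auto
  with K_bound[OF x] x show ?thesis by simp
qed

text \<open>The derivative of the cutoff is felt only where \<open>norm x ^ 2 < 2 * r ^ 2\<close>;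
  there each factor \<open>2 / r ^ 2\<close> is at most \<open>4 / norm x ^ 2\<close>, so the terms
  with derivatives of the cutoff have the size of those of the kernel, uniformly in
  \<open>r\<close>.\<close>

lemma trunc'_bound:
  assumes "r > 0" "x \<noteq> 0"
  shows "norm (trunc' r x) \<le> 300 * c / norm x ^ DIM('a)"
proof -
  define s where "s = (x \<bullet> x) / r\<^sup>2 - 1"
  define u where "u = norm x"
  define D where "D = c / u ^ DIM('a)"
  have u: "u > 0" using assms by (simp add: u_def)
  have D: "D \<ge> 0" using c_nonneg u by (simp add: D_def)
  have K: "\<bar>K x\<bar> \<le> D * u" using K_bound'[OF assms(2)] by (simp add: D_def u_def)
  have G: "norm (G x) \<le> D" using G_bound[OF assms(2)] by (simp add: D_def u_def)
  have 1: "norm (smoothstep s *\<^sub>R G x) \<le> 1 * D"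
    unfolding norm_scaleR by (rule mult_mono) (use G in \<open>auto simp: smoothstep_bounds\<close>)
  have 2: "norm ((K x * smoothstep' s * (2 / r\<^sup>2)) *\<^sub>R x) \<le> 8 * D"
  proof (cases "s \<ge> 1")
    case True
    then show ?thesis using D by (simp add: smoothstep_eq_1)
  next
    case False
    then have "u\<^sup>2 < 2 * r\<^sup>2" using assms by (simp add: s_def dot_square_norm u_def field_simps)
    then have r: "2 / r\<^sup>2 \<le> 4 / u\<^sup>2" using u assms by (simp add: field_simps)
    have "\<bar>K x\<bar> * \<bar>smoothstep' s\<bar> * (2 / r\<^sup>2) * norm x \<le> (D * u) * 2 * (4 / u\<^sup>2) * u"
      using K r smoothstep'_bound[of s] D u by (intro mult_mono) (auto simp: u_def)
    also have "\<dots> = 8 * D" using u by (simp add: power2_eq_square)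
    finally show ?thesis by (simp add: abs_mult)
  qed
  have "norm (trunc' r x) \<le> 1 * D + 8 * D"
    unfolding trunc'_def s_def[symmetric] by (rule order_trans[OF norm_triangle_ineq add_mono[OF 1 2]])
  also have "\<dots> \<le> 300 * D" using D by simp
  finally show ?thesis by (simp add: D_def u_def)
qed

lemma trunc''_bound:
  assumes "r > 0" "x \<noteq> 0"
  shows "norm (trunc'' r x h) \<le> 300 * c / norm x ^ (DIM('a) + 1) * norm h"
proof -
  define s where "s = (x \<bullet> x) / r\<^sup>2 - 1"
  define ds where "ds = 2 * (x \<bullet> h) / r\<^sup>2"
  define u where "u = norm x"
  define k where "k = norm h"
  define D where "D = c / u ^ (DIM('a) + 1)"
  have u: "u > 0" using assms by (simp add: u_def)
  have k: "k \<ge> 0" by (simp add: k_def)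
  have D: "D \<ge> 0" using c_nonneg u by (simp add: D_def)
  have K: "\<bar>K x\<bar> \<le> D * u * u" using K_bound'[OF assms(2)] u by (simp add: D_def u_def)
  have G: "norm (G x) \<le> D * u" using G_bound[OF assms(2)] u by (simp add: D_def u_def)
  have Gh: "\<bar>G x \<bullet> h\<bar> \<le> D * u * k"
    using order_trans[OF Cauchy_Schwarz_ineq2[of "G x" h] mult_right_mono[OF G norm_ge_zero]] by (simp add: k_def)
  have G': "norm (G' x h) \<le> D * k" using G'_bound[OF assms(2)] by (simp add: D_def u_def k_def)
  have 1: "norm (smoothstep s *\<^sub>R G' x h) \<le> 1 * (D * k)"
    unfolding norm_scaleR by (rule mult_mono) (use G' in \<open>auto simp: smoothstep_bounds\<close>)
  have "norm (trunc'' r x h) \<le> 300 * (D * k)"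
  proof (cases "s \<ge> 1")
    case True
    then have "trunc'' r x h = smoothstep s *\<^sub>R G' x h"
      by (simp add: trunc''_def Let_def s_def[symmetric] smoothstep_eq_1)
    then show ?thesis using 1 D k by (smt (verit) mult_nonneg_nonneg)
  next
    case False
    then have "u\<^sup>2 < 2 * r\<^sup>2" using assms by (simp add: s_def dot_square_norm u_def field_simps)
    then have r: "2 / r\<^sup>2 \<le> 4 / u\<^sup>2" using u assms by (simp add: field_simps)
    have "\<bar>x \<bullet> h\<bar> \<le> u * k" using Cauchy_Schwarz_ineq2[of x h] by (simp add: u_def k_def)
    then have "\<bar>x \<bullet> h\<bar> * (2 / r\<^sup>2) \<le> (u * k) * (4 / u\<^sup>2)" using r u k by (intro mult_mono) auto
    also have "\<dots> = 4 * k / u" using u by (simp add: power2_eq_square)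
    finally have ds: "\<bar>ds\<bar> \<le> 4 * k / u" by (simp add: ds_def abs_mult mult.commute)
    have 2: "norm ((smoothstep' s * ds) *\<^sub>R G x) \<le> 8 * (D * k)"
    proof -
      have "\<bar>smoothstep' s\<bar> * \<bar>ds\<bar> * norm (G x) \<le> 2 * (4 * k / u) * (D * u)"
        using ds smoothstep'_bound[of s] G D u k by (intro mult_mono) auto
      also have "\<dots> = 8 * (D * k)" using u by simp
      finally show ?thesis by (simp add: abs_mult)
    qed
    have 3: "norm (((G x \<bullet> h) * smoothstep' s * (2 / r\<^sup>2)) *\<^sub>R x) \<le> 8 * (D * k)"
    proof -
      have "\<bar>G x \<bullet> h\<bar> * \<bar>smoothstep' s\<bar> * (2 / r\<^sup>2) * norm x \<le> (D * u * k) * 2 * (4 / u\<^sup>2) * u"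
        using Gh smoothstep'_bound[of s] r D u k by (intro mult_mono) (auto simp: u_def)
      also have "\<dots> = 8 * (D * k)" using u by (simp add: power2_eq_square)
      finally show ?thesis by (simp add: abs_mult)
    qed
    have 4: "norm ((K x * (smoothstep'' s * ds) * (2 / r\<^sup>2)) *\<^sub>R x) \<le> 240 * (D * k)"
    proof -
      have "\<bar>K x\<bar> * (\<bar>smoothstep'' s\<bar> * \<bar>ds\<bar>) * (2 / r\<^sup>2) * norm x
          \<le> (D * u * u) * (15 * (4 * k / u)) * (4 / u\<^sup>2) * u"
        using K smoothstep''_bound[of s] ds r D u k by (intro mult_mono) (auto simp: u_def)
      also have "\<dots> = 240 * (D * k)" using u by (simp add: power2_eq_square)
      finally show ?thesis by (simp add: abs_mult)
    qed
    have 5: "norm ((K x * smoothstep' s * (2 / r\<^sup>2)) *\<^sub>R h) \<le> 8 * (D * k)"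
    proof -
      have "\<bar>K x\<bar> * \<bar>smoothstep' s\<bar> * (2 / r\<^sup>2) * norm h \<le> (D * u * u) * 2 * (4 / u\<^sup>2) * k"
        using K smoothstep'_bound[of s] r D u k by (intro mult_mono) (auto simp: k_def)
      also have "\<dots> = 8 * (D * k)" using u by (simp add: power2_eq_square)
      finally show ?thesis by (simp add: abs_mult)
    qed
    \<comment> \<open>The five terms contribute 1, 8, 8, 240 and 8; their sum 265 is rounded up to
      300, which serves for the lower order bounds as well.\<close>
    have "norm (trunc'' r x h) \<le> ((1 * (D * k) + 8 * (D * k)) + (8 * (D * k) + 240 * (D * k))) + 8 * (D * k)"
      unfolding trunc''_def Let_def s_def[symmetric] ds_def[symmetric] scaleR_add_left
      by (intro order_trans[OF norm_triangle_ineq] add_mono 1 2 3 4 5)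
    moreover have "D * k \<ge> 0" using D k by simp
    ultimately show ?thesis by linarith
  qed
  then show ?thesis by (simp add: D_def u_def k_def)
qed

text \<open>This makes the estimates of the locale available for \<open>trunc r\<close> itself, with
  a constant independent of \<open>r\<close>.\<close>

lemma trunc_kernel: "r > 0 \<Longrightarrow> CZ_kernel (trunc r) (trunc' r) (trunc'' r) (300 * c)"
proof
  fix x :: 'a
  assume x: "x \<noteq> 0"
  have "c / norm x ^ (DIM('a) - 1) \<le> 300 * c / norm x ^ (DIM('a) - 1)"
    using c_nonneg by (intro divide_right_mono) auto
  with trunc_bound[OF x] show "\<bar>trunc r x\<bar> \<le> 300 * c / norm x ^ (DIM('a) - 1)"
    by (rule order_trans)
qed (use c_nonneg trunc'_bound trunc''_bound trunc_deriv trunc'_deriv in auto)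

lemma trunc_measurable [measurable]: "r > 0 \<Longrightarrow> trunc r \<in> borel_measurable borel"
  using CZ_kernel.K_measurable[OF trunc_kernel] .

lemma trunc'_continuous: "r > 0 \<Longrightarrow> continuous_on S (trunc' r)"
  by (intro continuous_at_imp_continuous_on ballI has_derivative_continuous[OF trunc'_deriv])

lemma trunc'_measurable [measurable]: "r > 0 \<Longrightarrow> trunc' r \<in> borel_measurable borel"
  by (rule borel_measurable_continuous_onI[OF trunc'_continuous])

lemma trunc'_Lipschitz:
  assumes "r > 0"
  shows "norm (trunc' r a - trunc' r b) \<le> 300 * c / r ^ (DIM('a) + 1) * norm (a - b)"
proof (rule mean_value_norm_bound[of UNIV])
  fix x h :: 'a
  show "norm (trunc'' r x h) \<le> 300 * c / r ^ (DIM('a) + 1) * norm h"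
  proof (cases "norm x \<le> r")
    case True
    then show ?thesis using assms c_nonneg by (simp add: trunc_inside)
  next
    case False
    then have "x \<noteq> 0" using assms by auto
    have "300 * c / norm x ^ (DIM('a) + 1) \<le> 300 * c / r ^ (DIM('a) + 1)"
      using False assms c_nonneg \<open>x \<noteq> 0\<close> by (intro divide_left_mono power_mono mult_pos_pos) auto
    with trunc''_bound[OF assms \<open>x \<noteq> 0\<close>, of h] show ?thesis
      by (meson mult_right_mono norm_ge_zero order_trans)
  qed
qed (use trunc'_deriv[OF assms] in auto)

text \<open>Far out the truncation is an ordinary kernel; up to \<open>2 * r\<close> the global
  Lipschitz bound is of the same order. The weight \<open>1 / max (norm a) r ^ (DIM('a) + 1)\<close>
  matters because its integral is of order \<open>1 / r\<close>, which exactly cancels an increment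
  of length \<open>r\<close>.\<close>

lemma trunc'_diff:
  assumes "r > 0" "norm (a - b) \<le> r"
  shows "norm (trunc' r a - trunc' r b)
    \<le> 300 * c * 2 ^ (DIM('a) + 1) / max (norm a) r ^ (DIM('a) + 1) * norm (a - b)"
proof (cases "norm a \<ge> 2 * r")
  case True
  then have "max (norm a) r = norm a" "a \<noteq> 0" using assms by auto
  moreover have "norm (a - b) \<le> norm a / 2" using True assms by simp
  ultimately show ?thesis
    using CZ_kernel.G_diff[OF trunc_kernel[OF assms(1)], of a b] by simp
next
  case False
  then have "max (norm a) r \<le> 2 * r" using assms by auto
  have "300 * c / r ^ (DIM('a) + 1) = 300 * c * 2 ^ (DIM('a) + 1) / (2 * r) ^ (DIM('a) + 1)"
    using assms by (simp add: power_mult_distrib)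
  also have "\<dots> \<le> 300 * c * 2 ^ (DIM('a) + 1) / max (norm a) r ^ (DIM('a) + 1)"
    using \<open>max (norm a) r \<le> 2 * r\<close> assms c_nonneg
    by (intro divide_left_mono power_mono mult_pos_pos) auto
  finally show ?thesis
    using trunc'_Lipschitz[OF assms(1), of a b] by (meson mult_right_mono norm_ge_zero order_trans)
qed

lemma trunc_Taylor:
  assumes "r > 0" "norm h \<le> r"
  shows "\<bar>trunc r (a + h) - trunc r a - trunc' r a \<bullet> h\<bar>
    \<le> 300 * c * 2 ^ (DIM('a) + 1) / max (norm a) r ^ (DIM('a) + 1) * (norm h)\<^sup>2"
proof -
  let ?f = "\<lambda>x. trunc r x - trunc' r a \<bullet> x"
  let ?C = "300 * c * 2 ^ (DIM('a) + 1) / max (norm a) r ^ (DIM('a) + 1) * norm h"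
  have "norm (?f (a + h) - ?f a) \<le> ?C * norm ((a + h) - a)"
  proof (rule mean_value_norm_bound[of "cball a (norm h)"])
    fix x assume x: "x \<in> cball a (norm h)"
    show "(?f has_derivative (\<lambda>h. (trunc' r x - trunc' r a) \<bullet> h)) (at x)"
      by (rule derivative_eq_intros trunc_deriv[OF assms(1)] refl)+ (simp add: inner_diff_left fun_eq_iff)
    fix k :: 'a
    have "norm (a - x) \<le> norm h" using x by (simp add: dist_norm)
    then have "norm (trunc' r a - trunc' r x) \<le> ?C"
      using assms c_nonneg
      by (intro order_trans[OF trunc'_diff[OF assms(1)]]) (auto intro!: mult_left_mono divide_right_mono)
    then have "norm (trunc' r x - trunc' r a) * norm k \<le> ?C * norm k"
      by (intro mult_right_mono) (simp_all add: norm_minus_commute)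
    then show "norm ((trunc' r x - trunc' r a) \<bullet> k) \<le> ?C * norm k"
      using order_trans[OF Cauchy_Schwarz_ineq2[of "trunc' r x - trunc' r a" k]] by simp
  qed (auto simp: dist_norm)
  then show ?thesis by (simp add: inner_add_right power2_eq_square algebra_simps)
qed

end

subsection \<open>Kernels of class \<open>C\<^sup>2\<close>\<close>

text \<open>The Riesz representative of \<open>Df f x\<close>; \<open>hessian f x h\<close> is
  likewise that of the functional \<open>Df (Df f) x h\<close>.\<close>

definition gradient :: "('a::euclidean_space \<Rightarrow> real) \<Rightarrow> 'a \<Rightarrow> 'a" where
  "gradient f x = (\<Sum>b\<in>Basis. blinfun_apply (Df f x) b *\<^sub>R b)"

definition hessian :: "('a::euclidean_space \<Rightarrow> real) \<Rightarrow> 'a \<Rightarrow> 'a \<Rightarrow> 'a" where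
  "hessian f x h = (\<Sum>b\<in>Basis. blinfun_apply (blinfun_apply (Df (Df f) x) h) b *\<^sub>R b)"

lemma inner_sum_blinfun_Basis:
  fixes L :: "'a::euclidean_space \<Rightarrow>\<^sub>L real"
  shows "(\<Sum>b\<in>Basis. blinfun_apply L b *\<^sub>R b) \<bullet> h = L h"
proof -
  have "L h = L (\<Sum>b\<in>Basis. (h \<bullet> b) *\<^sub>R b)" by (simp add: euclidean_representation)
  also have "\<dots> = (\<Sum>b\<in>Basis. blinfun_apply L b * (b \<bullet> h))"
    by (simp add: blinfun.sum_right blinfun.scaleR_right inner_commute mult.commute)
  finally show ?thesis by (simp add: inner_sum_left)
qed

lemma norm_sum_blinfun_Basis_le:
  fixes L :: "'a::euclidean_space \<Rightarrow>\<^sub>L real"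
  shows "norm (\<Sum>b\<in>Basis. blinfun_apply L b *\<^sub>R b) \<le> norm L"
proof -
  let ?v = "\<Sum>b\<in>Basis. blinfun_apply L b *\<^sub>R b"
  have "norm ?v * norm ?v = L ?v"
    using inner_sum_blinfun_Basis[of L ?v] by (simp add: norm_eq_square power2_norm_eq_inner[symmetric] power2_eq_square)
  also have "\<dots> \<le> norm L * norm ?v" using norm_blinfun[of L ?v] by simp
  finally show ?thesis by (cases "norm ?v = 0") auto
qed

lemma has_derivative_Df:
  assumes "f differentiable (at x)"
  shows "(f has_derivative blinfun_apply (Df f x)) (at x)"
  using assms by (simp add: Df_def frechet_derivative_works has_derivative_bounded_linear bounded_linear_Blinfun_apply)

text \<open>The hypotheses leave out the first derivative. Its bound is an interpolation in the
  manner of Landau's inequality: along a step proportional to \<open>norm x\<close>, the increment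
  of \<open>K\<close> is bounded through \<open>A\<close>, the deviation from linearity through
  \<open>B\<close>, and the linear term is what remains.\<close>

lemma CZ_kernel_of_C2:
  fixes K :: "'a::euclidean_space \<Rightarrow> real"
  assumes C2: "C2_on (- {0}) K" and "A \<ge> 0" "B \<ge> 0"
    and KA: "\<And>x. x \<noteq> 0 \<Longrightarrow> \<bar>K x\<bar> \<le> A / norm x ^ (DIM('a) - 1)"
    and KB: "\<And>x. x \<noteq> 0 \<Longrightarrow> norm (Df (Df K) x) \<le> B / norm x ^ (DIM('a) + 1)"
  shows "CZ_kernel K (gradient K) (hessian K) ((A + B) * 2 ^ (DIM('a) + 1))"
proof
  let ?c = "(A + B) * 2 ^ (DIM('a) + 1)"
  show "0 \<le> ?c" using assms by simp
  have AB: "A \<le> ?c" "B \<le> ?c"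
  proof -
    have "(1::real) \<le> 2 ^ (DIM('a) + 1)" by (rule one_le_power) simp
    then have "(A + B) * 1 \<le> ?c" using assms(2,3) by (intro mult_left_mono) auto
    then show "A \<le> ?c" "B \<le> ?c" using assms by auto
  qed
  fix x :: 'a
  assume x: "x \<noteq> 0"
  show "\<bar>K x\<bar> \<le> ?c / norm x ^ (DIM('a) - 1)"
    using KA[OF x] AB by (elim order_trans) (intro divide_right_mono, auto)
  have DK: "(K has_derivative (\<lambda>h. gradient K y \<bullet> h)) (at y)" if "y \<noteq> 0" for y
    using C2 that has_derivative_Df[of K y]
    by (simp add: C2_on_def gradient_def inner_sum_blinfun_Basis)
  have DG: "(gradient K has_derivative hessian K y) (at y)" if "y \<noteq> 0" for y
  proof -
    have "(Df K has_derivative blinfun_apply (Df (Df K) y)) (at y)"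
      using C2 that by (intro has_derivative_Df) (simp add: C2_on_def)
    then have "((\<lambda>y. blinfun_apply (Df K y) b *\<^sub>R b) has_derivative
        (\<lambda>h. blinfun_apply (blinfun_apply (Df (Df K) y) h) b *\<^sub>R b)) (at y)" for b
      by (intro has_derivative_scaleR_left bounded_linear.has_derivative[OF blinfun.bounded_linear_left])
    then show ?thesis
      unfolding gradient_def[abs_def] hessian_def[abs_def] by (intro has_derivative_sum) auto
  qed
  have Hb: "norm (hessian K y h) \<le> B / norm y ^ (DIM('a) + 1) * norm h" if "y \<noteq> 0" for y h
  proof -
    have "norm (hessian K y h) \<le> norm (blinfun_apply (Df (Df K) y) h)"
      unfolding hessian_def by (rule norm_sum_blinfun_Basis_le)
    also have "\<dots> \<le> norm (Df (Df K) y) * norm h" by (rule norm_blinfun)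
    also have "\<dots> \<le> B / norm y ^ (DIM('a) + 1) * norm h"
      using KB[OF that] by (rule mult_right_mono) simp
    finally show ?thesis .
  qed
  show "(K has_derivative (\<lambda>h. gradient K x \<bullet> h)) (at x)" by (rule DK[OF x])
  show "(gradient K has_derivative hessian K x) (at x)" by (rule DG[OF x])
  show "norm (hessian K x h) \<le> ?c / norm x ^ (DIM('a) + 1) * norm h" for h
    using Hb[OF x, of h]
    by (rule order_trans) (intro mult_right_mono divide_right_mono AB, auto)
  define u where "u = norm x"
  have u: "u > 0" using x by (simp add: u_def)
  obtain n where n: "DIM('a) = Suc n" using DIM_positive[where 'a='a] gr0_conv_Suc by auto
  define g where "g = norm (gradient K x)"
  have far: "norm y \<ge> u / 2" "y \<noteq> 0" if "y \<in> cball x (u / 2)" for y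
  proof -
    show 1: "norm y \<ge> u / 2"
      using that norm_triangle_ineq3[of y x] by (simp add: dist_norm norm_minus_commute u_def abs_le_iff)
    then show "y \<noteq> 0" using u by auto
  qed
  have "g \<le> ?c / u ^ DIM('a)"
  proof (cases "g = 0")
    case False
    then have g: "g > 0" by (simp add: g_def)
    \<comment> \<open>The step points along the gradient, so the linear term is
      \<open>g * (u / 2)\<close>; its length is half the distance to the origin, so that the ball it
      spans keeps away from the singularity.\<close>
    define h where "h = (u / (2 * g)) *\<^sub>R gradient K x"
    have h: "norm h = u / 2" using g u by (simp add: h_def g_def)
    let ?f = "\<lambda>y. K y - gradient K x \<bullet> y"
    define C where "C = B * 2 ^ (DIM('a) + 1) / u ^ (DIM('a) + 1)"
    have C: "C \<ge> 0" using assms u by (simp add: C_def)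
    have H': "norm (hessian K y k) \<le> C * norm k" if "y \<in> cball x (u / 2)" for y k
    proof -
      have "B / norm y ^ (DIM('a) + 1) \<le> B / (u / 2) ^ (DIM('a) + 1)"
        using far[OF that] u assms by (intro divide_left_mono power_mono mult_pos_pos) auto
      also have "\<dots> = C" by (simp add: C_def power_divide)
      finally show ?thesis
        using Hb[OF far(2)[OF that], of k] by (meson mult_right_mono norm_ge_zero order_trans)
    qed
    have "norm (?f (x + h) - ?f x) \<le> (C * (u / 2)) * norm ((x + h) - x)"
    proof (rule mean_value_norm_bound[of "cball x (u / 2)"])
      fix y assume y: "y \<in> cball x (u / 2)"
      show "(?f has_derivative (\<lambda>h. (gradient K y - gradient K x) \<bullet> h)) (at y)"
        by (rule derivative_eq_intros DK[OF far(2)[OF y]] refl)+ (simp add: inner_diff_left fun_eq_iff)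
      fix k :: 'a
      have "norm (gradient K y - gradient K x) \<le> C * norm (y - x)"
        by (rule mean_value_norm_bound[of "cball x (u / 2)"]) (use u y far DG H' in auto)
      also have "\<dots> \<le> C * (u / 2)"
        using y C by (intro mult_left_mono) (auto simp: dist_norm norm_minus_commute)
      finally have "norm (gradient K y - gradient K x) * norm k \<le> C * (u / 2) * norm k"
        by (rule mult_right_mono) simp
      then show "norm ((gradient K y - gradient K x) \<bullet> k) \<le> C * (u / 2) * norm k"
        using Cauchy_Schwarz_ineq2[of "gradient K y - gradient K x" k] by simp
    qed (use u h in \<open>auto simp: dist_norm\<close>)
    then have "\<bar>K (x + h) - K x - gradient K x \<bullet> h\<bar> \<le> C * (u / 2) * (u / 2)"
      using h by (simp add: inner_add_right algebra_simps)
    moreover have "gradient K x \<bullet> h = g * (u / 2)"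
      using g by (simp add: h_def g_def dot_square_norm power2_eq_square)
    moreover have "\<bar>K (x + h)\<bar> \<le> A * 2 ^ n / u ^ n"
    proof -
      have *: "x + h \<in> cball x (u / 2)" using h by (simp add: dist_norm)
      have "A / norm (x + h) ^ n \<le> A / (u / 2) ^ n"
        using far[OF *] u assms by (intro divide_left_mono power_mono mult_pos_pos) auto
      then show ?thesis using KA[OF far(2)[OF *]] by (simp add: n power_divide)
    qed
    moreover have "\<bar>K x\<bar> \<le> A * 2 ^ n / u ^ n"
    proof -
      have "A * 1 / u ^ n \<le> A * 2 ^ n / u ^ n"
        using assms u by (intro divide_right_mono mult_left_mono) auto
      then show ?thesis using KA[OF x] by (simp add: n u_def)
    qed
    ultimately have "g * (u / 2) \<le> 2 * (A * 2 ^ n / u ^ n) + C * (u / 2) * (u / 2)" by linarith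
    also have "C * (u / 2) * (u / 2) = B * 2 ^ n / u ^ n"
      using u by (simp add: C_def n field_simps)
    also have "2 * (A * 2 ^ n / u ^ n) + B * 2 ^ n / u ^ n = (2 * A + B) * 2 ^ n / u ^ n"
      by (simp add: add_divide_distrib algebra_simps)
    finally have "g \<le> (2 * A + B) * 2 ^ n / u ^ n * (2 / u)"
      using u by (simp add: field_simps)
    also have "\<dots> = (2 * A + B) * 2 ^ Suc n / u ^ DIM('a)" using u by (simp add: n field_simps)
    \<comment> \<open>\<open>2 * A + B\<close> is at most \<open>2 * (A + B)\<close>; this is the
      last factor 2 in the constant.\<close>
    also have "\<dots> \<le> ?c / u ^ DIM('a)"
      using assms u by (intro divide_right_mono) (auto simp: n)
    finally show ?thesis .
  qed (use assms u in simp)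
  then show "norm (gradient K x) \<le> ?c / norm x ^ DIM('a)" by (simp add: g_def u_def)
qed

subsection \<open>Integrals of powers of the norm\<close>

abbreviation ball_vol :: "'a::euclidean_space itself \<Rightarrow> real" where
  "ball_vol _ \<equiv> unit_ball_vol (real DIM('a))"

text \<open>A replacement for polar coordinates: the function is dominated by constants on dyadic
  shells, and each shell is enlarged to the full ball, at the price of a constant factor
  only.\<close>

lemma nn_integral_le_sum_balls:
  fixes f :: "'a::euclidean_space \<Rightarrow> ennreal"
  assumes f: "\<And>x. f x \<noteq> 0 \<Longrightarrow> \<exists>k. norm x < \<rho> k \<and> f x \<le> ennreal (a k)"
    and nn: "\<And>k. a k \<ge> 0" "\<And>k. \<rho> k \<ge> 0"
    and s: "(\<lambda>k. a k * \<rho> k ^ DIM('a)) sums s"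
  shows "(\<integral>\<^sup>+x. f x \<partial>lborel) \<le> ennreal (ball_vol TYPE('a) * s)"
proof -
  have "(\<integral>\<^sup>+x. f x \<partial>lborel) \<le> (\<integral>\<^sup>+x. (\<Sum>k. ennreal (a k) * indicator (ball 0 (\<rho> k)) x) \<partial>(lborel :: 'a measure))"
  proof (rule nn_integral_mono)
    fix x
    show "f x \<le> (\<Sum>k. ennreal (a k) * indicator (ball 0 (\<rho> k)) x)"
    proof (cases "f x = 0")
      case False
      then obtain k where k: "norm x < \<rho> k" "f x \<le> ennreal (a k)" using f by blast
      then have "f x \<le> ennreal (a k) * indicator (ball 0 (\<rho> k)) x" by simp
      also have "\<dots> \<le> (\<Sum>k. ennreal (a k) * indicator (ball 0 (\<rho> k)) x)"
      proof -
        define g where "g = (\<lambda>k. ennreal (a k) * indicator (ball 0 (\<rho> k)) x)"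
        have "(\<Sum>i\<in>{k}. g i) \<le> (\<Sum>i. g i)" by (rule sum_le_suminf) auto
        then have "g k \<le> (\<Sum>i. g i)" by simp
        then show ?thesis unfolding g_def .
      qed
      finally show ?thesis .
    qed simp
  qed
  also have "\<dots> = (\<Sum>k. \<integral>\<^sup>+x. ennreal (a k) * indicator (ball 0 (\<rho> k)) x \<partial>(lborel :: 'a measure))"
    by (rule nn_integral_suminf) (intro borel_measurable_times_ennreal borel_measurable_indicator, auto)
  also have "\<dots> = (\<Sum>k. ennreal (ball_vol TYPE('a) * (a k * \<rho> k ^ DIM('a))))"
    using nn by (simp add: nn_integral_cmult_indicator emeasure_ball ennreal_mult[symmetric] ac_simps)
  also have "\<dots> = ennreal (ball_vol TYPE('a) * s)"
    using nn by (intro suminf_ennreal_eq sums_mult s) auto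
  finally show ?thesis .
qed

lemma geometric_half_sums: "(\<lambda>k. C / 2 ^ k) sums (2 * C)" for C :: real
  using sums_mult[OF geometric_sums[of "1/2::real"], of C] by (simp add: power_divide mult.commute)

lemma nn_integral_inverse_norm_ball:
  assumes "R > 0"
  shows "(\<integral>\<^sup>+x. ennreal (1 / norm x ^ (DIM('a) - 1)) * indicator (ball 0 R) x \<partial>(lborel :: 'a::euclidean_space measure))
    \<le> ennreal (ball_vol TYPE('a) * (2 ^ DIM('a) * R))"
proof -
  obtain n where n: "DIM('a) = Suc n" using DIM_positive[where 'a='a] gr0_conv_Suc by auto
  \<comment> \<open>The origin lies in no shell, so it is removed beforehand as a null set.\<close>
  have "(\<integral>\<^sup>+x. ennreal (1 / norm x ^ n) * indicator (ball 0 R) x \<partial>(lborel :: 'a measure))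
      = (\<integral>\<^sup>+x. ennreal (1 / norm x ^ n) * indicator (ball 0 R - {0}) x \<partial>(lborel :: 'a measure))"
    by (rule nn_integral_cong_AE, rule AE_mp[OF AE_lborel_singleton[of 0]]) (auto split: split_indicator)
  also have "\<dots> \<le> ennreal (ball_vol TYPE('a) * (2 * (2 ^ n * R)))"
  proof (rule nn_integral_le_sum_balls[where \<rho> = "\<lambda>k. R / 2 ^ k" and a = "\<lambda>k. 1 / (R / 2 ^ Suc k) ^ n"])
    fix x :: 'a
    assume "ennreal (1 / norm x ^ n) * indicator (ball 0 R - {0}) x \<noteq> 0"
    then have x: "norm x < R" "x \<noteq> 0" by (auto split: split_indicator_asm)
    have "\<exists>m. R / 2 ^ m \<le> norm x"
    proof -
      obtain m where "(1/2::real) ^ m < norm x / R"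
        using real_arch_pow_inv[of "norm x / R" "1/2"] x assms by auto
      then show ?thesis using assms by (auto simp: power_divide field_simps intro!: exI[of _ m])
    qed
    define m where "m = (LEAST m. R / 2 ^ m \<le> norm x)"
    have m: "R / 2 ^ m \<le> norm x" unfolding m_def using \<open>\<exists>m. _\<close> by (rule LeastI_ex)
    have "m \<noteq> 0" using m x by (intro notI) simp
    then obtain k where k: "m = Suc k" by (cases m) auto
    have "\<not> R / 2 ^ k \<le> norm x" using not_less_Least[of k] k unfolding m_def by (metis lessI)
    moreover have "1 / norm x ^ n \<le> 1 / (R / 2 ^ Suc k) ^ n"
      using m assms x unfolding k by (intro divide_left_mono power_mono mult_pos_pos) auto
    ultimately show "\<exists>k. norm x < R / 2 ^ k \<and>
        ennreal (1 / norm x ^ n) * indicator (ball 0 R - {0}) x \<le> ennreal (1 / (R / 2 ^ Suc k) ^ n)"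
      using x by (intro exI[of _ k]) (auto split: split_indicator intro!: ennreal_leI)
  next
    have "(\<lambda>k. 1 / (R / 2 ^ Suc k) ^ n * (R / 2 ^ k) ^ DIM('a)) = (\<lambda>k. (2 ^ n * R) / 2 ^ k)"
      using assms by (auto simp: n field_simps power_divide power_mult_distrib fun_eq_iff)
    then show "(\<lambda>k. 1 / (R / 2 ^ Suc k) ^ n * (R / 2 ^ k) ^ DIM('a)) sums (2 * (2 ^ n * R))"
      using geometric_half_sums by metis
  qed (use assms in auto)
  finally show ?thesis by (simp add: n mult.assoc)
qed

lemma nn_integral_inverse_norm_outside_ball:
  assumes "R > 0"
  shows "(\<integral>\<^sup>+x. ennreal (1 / norm x ^ (DIM('a) + 1)) * indicator (- ball 0 R) x \<partial>(lborel :: 'a::euclidean_space measure))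
    \<le> ennreal (ball_vol TYPE('a) * (2 ^ (DIM('a) + 1) / R))"
proof -
  let ?n = "DIM('a)"
  have "(\<integral>\<^sup>+x. ennreal (1 / norm x ^ (?n + 1)) * indicator (- ball 0 R) x \<partial>(lborel :: 'a measure))
      \<le> ennreal (ball_vol TYPE('a) * (2 * (2 ^ ?n / R)))"
  proof (rule nn_integral_le_sum_balls[where \<rho> = "\<lambda>k. 2 ^ Suc k * R" and a = "\<lambda>k. 1 / (2 ^ k * R) ^ (?n + 1)"])
    fix x :: 'a
    assume "ennreal (1 / norm x ^ (?n + 1)) * indicator (- ball 0 R) x \<noteq> 0"
    then have x: "R \<le> norm x" by (auto split: split_indicator_asm)
    have "\<exists>m. norm x < 2 ^ m * R"
    proof -
      obtain m where "norm x / R < 2 ^ m" using real_arch_pow[of 2 "norm x / R"] by auto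
      then show ?thesis using assms by (auto simp: field_simps intro!: exI[of _ m])
    qed
    define m where "m = (LEAST m. norm x < 2 ^ m * R)"
    have m: "norm x < 2 ^ m * R" unfolding m_def using \<open>\<exists>m. _\<close> by (rule LeastI_ex)
    have "m \<noteq> 0" using m x by (intro notI) simp
    then obtain k where k: "m = Suc k" by (cases m) auto
    have "\<not> norm x < 2 ^ k * R" using not_less_Least[of k] k unfolding m_def by (metis lessI)
    then have "2 ^ k * R \<le> norm x" by simp
    then have "1 / norm x ^ (?n + 1) \<le> 1 / (2 ^ k * R) ^ (?n + 1)"
      using assms x by (intro divide_left_mono power_mono mult_pos_pos zero_less_power) auto
    then show "\<exists>k. norm x < 2 ^ Suc k * R \<and>
        ennreal (1 / norm x ^ (?n + 1)) * indicator (- ball 0 R) x \<le> ennreal (1 / (2 ^ k * R) ^ (?n + 1))"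
      using x m k by (intro exI[of _ k]) (auto split: split_indicator intro!: ennreal_leI)
  next
    have "(\<lambda>k. 1 / (2 ^ k * R) ^ (?n + 1) * (2 ^ Suc k * R) ^ ?n) = (\<lambda>k. (2 ^ ?n / R) / 2 ^ k)"
      using assms by (auto simp: field_simps power_mult_distrib fun_eq_iff)
    then show "(\<lambda>k. 1 / (2 ^ k * R) ^ (?n + 1) * (2 ^ Suc k * R) ^ ?n) sums (2 * (2 ^ ?n / R))"
      using geometric_half_sums by metis
  qed (use assms in auto)
  then show ?thesis by (simp add: mult.assoc)
qed

lemma nn_integral_inverse_max_norm:
  assumes "r > 0"
  shows "(\<integral>\<^sup>+x. ennreal (1 / max (norm x) r ^ (DIM('a) + 1)) \<partial>(lborel :: 'a::euclidean_space measure))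
    \<le> ennreal (ball_vol TYPE('a) * (2 ^ (DIM('a) + 2) / r))"
proof -
  let ?n = "DIM('a)"
  have "(\<integral>\<^sup>+x. ennreal (1 / max (norm x) r ^ (?n + 1)) \<partial>(lborel :: 'a measure))
      = (\<integral>\<^sup>+x. ennreal (1 / r ^ (?n + 1)) * indicator (ball 0 r) x
           + ennreal (1 / norm x ^ (?n + 1)) * indicator (- ball 0 r) x \<partial>(lborel :: 'a measure))"
    by (rule nn_integral_cong) (auto simp: max_def split: split_indicator)
  also have "\<dots> = ennreal (1 / r ^ (?n + 1)) * emeasure lborel (ball (0::'a) r)
      + (\<integral>\<^sup>+x. ennreal (1 / norm x ^ (?n + 1)) * indicator (- ball 0 r) x \<partial>(lborel :: 'a measure))"
    by (subst nn_integral_add) (measurable, auto simp: nn_integral_cmult_indicator)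
  also have "\<dots> \<le> ennreal (ball_vol TYPE('a) * (1 / r)) + ennreal (ball_vol TYPE('a) * (2 ^ (?n + 1) / r))"
    using assms nn_integral_inverse_norm_outside_ball[OF assms, where 'a='a]
    by (intro add_mono) (auto simp: emeasure_ball ennreal_mult[symmetric])
  also have "\<dots> = ennreal (ball_vol TYPE('a) * ((1 + 2 ^ (?n + 1)) / r))"
    using assms by (simp add: ennreal_plus[symmetric] add_divide_distrib distrib_left del: ennreal_plus)
  also have "\<dots> \<le> ennreal (ball_vol TYPE('a) * (2 ^ (?n + 2) / r))"
    using assms one_le_power[of "2::real" "?n + 1"]
    by (intro ennreal_leI mult_left_mono divide_right_mono) auto
  finally show ?thesis .
qed

subsection \<open>The Calderon--Zygmund decomposition\<close>

text \<open>The half-open dyadic cube of side \<open>2 powi k\<close> that contains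
  \<open>x\<close>. Naming a cube by any of its points reduces the geometry of the grid to
  identities between floors.\<close>

definition cell :: "int \<Rightarrow> 'a::euclidean_space \<Rightarrow> 'a set" where
  "cell k x = {y. \<forall>b\<in>Basis. \<lfloor>(y \<bullet> b) / 2 powi k\<rfloor> = \<lfloor>(x \<bullet> b) / 2 powi k\<rfloor>}"

lemma cell_self [simp]: "x \<in> cell k x"
  by (simp add: cell_def)

lemma cell_eq: "y \<in> cell k x \<Longrightarrow> cell k y = cell k x"
  by (auto simp: cell_def)

text \<open>The floor at a coarser dyadic scale is an integer quotient of the floor at the finer
  one; this is the nesting of the dyadic grids.\<close>

lemma cell_mono:
  assumes "j \<le> k" shows "cell j x \<subseteq> cell k x"
proof
  fix y assume y: "y \<in> cell j x"
  define n where "n = nat (k - j)"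
  have "k = j + int n" using assms by (simp add: n_def)
  then have p: "(2::real) powi k = 2 powi j * real_of_int (2 ^ n)" by (simp add: power_int_add)
  have *: "\<lfloor>s / 2 powi k\<rfloor> = \<lfloor>s / 2 powi j\<rfloor> div 2 ^ n" for s :: real
    unfolding p divide_divide_eq_left[symmetric] by (rule floor_divide_real_eq_div) simp
  show "y \<in> cell k x" using y by (simp add: cell_def *)
qed

lemma cell_nonempty_interior_bounds:
  fixes x :: "'a::euclidean_space" and k :: int
  defines "p \<equiv> (\<Sum>b\<in>Basis. (of_int \<lfloor>(x \<bullet> b) / 2 powi k\<rfloor> * 2 powi k) *\<^sub>R b) :: 'a"
  shows "box p (p + (2 powi k) *\<^sub>R One) \<subseteq> cell k x" "cell k x \<subseteq> cbox p (p + (2 powi k) *\<^sub>R One)"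
    and "cell k x = {y. \<forall>b\<in>Basis. p \<bullet> b \<le> y \<bullet> b \<and> y \<bullet> b < p \<bullet> b + 2 powi k}"
proof -
  let ?s = "2 powi k :: real"
  have p: "p \<bullet> b = of_int \<lfloor>(x \<bullet> b) / ?s\<rfloor> * ?s" if "b \<in> Basis" for b
    using that by (simp add: p_def inner_sum_left inner_Basis if_distrib[of "\<lambda>z. _ * z"] cong: if_cong)
  have *: "\<lfloor>t / ?s\<rfloor> = \<lfloor>u / ?s\<rfloor> \<longleftrightarrow> of_int \<lfloor>u / ?s\<rfloor> * ?s \<le> t \<and> t < of_int \<lfloor>u / ?s\<rfloor> * ?s + ?s" for t u
    by (simp add: floor_eq_iff field_simps)
  show eq: "cell k x = {y. \<forall>b\<in>Basis. p \<bullet> b \<le> y \<bullet> b \<and> y \<bullet> b < p \<bullet> b + ?s}"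
    unfolding cell_def using * p by auto
  show "box p (p + ?s *\<^sub>R One) \<subseteq> cell k x" "cell k x \<subseteq> cbox p (p + ?s *\<^sub>R One)"
    unfolding eq by (auto simp: mem_box inner_add_left less_imp_le)
qed

lemma cell_borel [measurable]: "cell k x \<in> sets borel"
proof -
  have "{y. \<lfloor>(y \<bullet> b) / 2 powi k\<rfloor> = \<lfloor>(x \<bullet> b) / 2 powi k\<rfloor>} \<in> sets borel" for b :: 'a
    by measurable
  moreover have "cell k x = (\<Inter>b\<in>Basis. {y. \<lfloor>(y \<bullet> b) / 2 powi k\<rfloor> = \<lfloor>(x \<bullet> b) / 2 powi k\<rfloor>})"
    by (auto simp: cell_def)
  ultimately show ?thesis by (simp only:) (intro sets.finite_INT, auto)
qed

lemma emeasure_cell: "emeasure lborel (cell k (x::'a::euclidean_space)) = ennreal ((2 powi k) ^ DIM('a))"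
proof -
  define p :: 'a where "p = (\<Sum>b\<in>Basis. (of_int \<lfloor>(x \<bullet> b) / 2 powi k\<rfloor> * 2 powi k) *\<^sub>R b)"
  note * = cell_nonempty_interior_bounds[where x = x and k = k, folded p_def]
  have "emeasure lborel (box p (p + (2 powi k) *\<^sub>R One)) \<le> emeasure lborel (cell k x)"
    by (rule emeasure_mono[OF *(1)]) simp
  moreover have "emeasure lborel (cell k x) \<le> emeasure lborel (cbox p (p + (2 powi k) *\<^sub>R One))"
    by (rule emeasure_mono[OF *(2)]) simp
  ultimately show ?thesis
    by (simp add: inner_add_left)
qed

lemma norm_diff_cell:
  fixes x :: "'a::euclidean_space"
  assumes "y \<in> cell k x" "z \<in> cell k x"
  shows "norm (y - z) \<le> DIM('a) * 2 powi k"
proof -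
  have "norm (y - z) \<le> (\<Sum>b\<in>Basis. \<bar>(y - z) \<bullet> b\<bar>)" by (rule norm_le_l1)
  also have "\<dots> \<le> (\<Sum>b\<in>(Basis::'a set). 2 powi k)"
  proof (rule sum_mono)
    fix b :: 'a assume "b \<in> Basis"
    with assms cell_nonempty_interior_bounds(3)[of k x]
    show "\<bar>(y - z) \<bullet> b\<bar> \<le> 2 powi k" by (force simp: inner_diff_left)
  qed
  finally show ?thesis by simp
qed

lemma countable_cells: "countable (range (\<lambda>(k, x::'a::euclidean_space). cell k x))"
proof -
  define D where "D = (PiE (Basis::'a set) (\<lambda>_. UNIV :: int set))"
  have D: "countable D" unfolding D_def by (intro countable_PiE) auto
  have "range (\<lambda>(k, x::'a). cell k x) \<subseteq>
      (\<lambda>(k, f). {y. \<forall>b\<in>Basis. \<lfloor>(y \<bullet> b) / 2 powi k\<rfloor> = f b}) ` (UNIV \<times> D)"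
  proof
    fix Q assume "Q \<in> range (\<lambda>(k, x::'a). cell k x)"
    then obtain k and x :: 'a where Q: "Q = cell k x" by auto
    let ?f = "\<lambda>b\<in>Basis. \<lfloor>(x \<bullet> b) / 2 powi k\<rfloor>"
    have "Q = (\<lambda>(k, f). {y. \<forall>b\<in>Basis. \<lfloor>(y \<bullet> b) / 2 powi k\<rfloor> = f b}) (k, ?f)"
      by (auto simp: Q cell_def)
    moreover have "(k, ?f) \<in> UNIV \<times> D" by (auto simp: D_def)
    ultimately show "Q \<in> (\<lambda>(k, f). {y. \<forall>b\<in>Basis. \<lfloor>(y \<bullet> b) / 2 powi k\<rfloor> = f b}) ` (UNIV \<times> D)"
      by (rule image_eqI)
  qed
  then show ?thesis
    by (rule countable_subset) (intro countable_image countable_SIGMA D, auto)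
qed

text \<open>The maximal dyadic cells with a given property, enumerated; \<open>l i = 0\<close> marks an unused index.\<close>

lemma stopping_cells:
  fixes P :: "int \<Rightarrow> 'a::euclidean_space set \<Rightarrow> bool"
  assumes bdd: "\<And>x. \<exists>n. \<forall>k\<ge>n. \<not> P k (cell k x)"
  obtains Q :: "nat \<Rightarrow> 'a set" and c :: "nat \<Rightarrow> 'a" and l :: "nat \<Rightarrow> real"
  where "disjoint_family Q" "(\<Union>i. Q i) = {x. \<exists>k. P k (cell k x)}"
    and "\<And>i. (Q i = {} \<and> l i = 0) \<or>
      (\<exists>k. Q i = cell k (c i) \<and> l i = 2 powi k \<and> P k (cell k (c i)) \<and> (\<forall>j>k. \<not> P j (cell j (c i))))"
proof -
  define M where "M k x \<longleftrightarrow> P k (cell k x) \<and> (\<forall>j>k. \<not> P j (cell j x))" for k and x :: 'a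
  define S where "S = {cell k x | k x. M k x}"
  have "countable S"
    by (rule countable_subset[OF _ countable_cells[where 'a='a]]) (auto simp: S_def)
  then obtain enc :: "'a set \<Rightarrow> nat" where enc: "inj_on enc S" by (rule countableE)
  \<comment> \<open>Indices outside the image of the encoding get the empty set, so that finitely
    and infinitely many cells are treated alike.\<close>
  define Q where "Q i = (if i \<in> enc ` S then inv_into S enc i else {})" for i
  have QS: "Q i \<in> S" if "Q i \<noteq> {}" for i
    using that by (auto simp: Q_def inv_into_into split: if_splits)
  have Qenc: "Q (enc A) = A" if "A \<in> S" for A
    using that enc by (simp add: Q_def)
  have uniq: "A = B" if AB: "A \<in> S" "B \<in> S" "z \<in> A" "z \<in> B" for A B z
  proof -
    from AB obtain j x k y where A: "A = cell j x" "M j x" and B: "B = cell k y" "M k y"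
      by (auto simp: S_def)
    have *: "\<not> j < k" if "z \<in> cell j x" "z \<in> cell k y" "M j x" "M k y" for j x k y
    proof
      assume "j < k"
      then have "z \<in> cell k x" using cell_mono[of j k x] that by auto
      then have "cell k x = cell k y" using that cell_eq by metis
      with that \<open>j < k\<close> show False by (auto simp: M_def)
    qed
    have "j = k" using *[of j x k y] *[of k y j x] A B AB by auto
    then show ?thesis using A B AB cell_eq by metis
  qed
  have disj: "disjoint_family Q"
    unfolding disjoint_family_on_def
  proof (intro ballI impI)
    fix i j :: nat assume "i \<noteq> j"
    show "Q i \<inter> Q j = {}"
    proof (rule ccontr)
      assume "Q i \<inter> Q j \<noteq> {}"
      then obtain z where z: "z \<in> Q i" "z \<in> Q j" by auto
      then have "Q i = Q j" using uniq[of "Q i" "Q j" z] QS by auto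
      moreover have "i \<in> enc ` S" "j \<in> enc ` S" using z by (auto simp: Q_def split: if_splits)
      ultimately have "i = j" by (auto simp: Q_def inv_into_f_f[OF enc])
      with \<open>i \<noteq> j\<close> show False by simp
    qed
  qed
  have Un: "(\<Union>i. Q i) = {x. \<exists>k. P k (cell k x)}"
  proof (intro subset_antisym subsetI)
    fix x assume "x \<in> (\<Union>i. Q i)"
    then obtain i where i: "x \<in> Q i" by auto
    then obtain k y where "Q i = cell k y" "M k y" using QS[of i] by (auto simp: S_def)
    then have "P k (cell k x)" using i cell_eq[of x k y] by (simp add: M_def)
    then show "x \<in> {x. \<exists>k. P k (cell k x)}" by blast
  next
    fix x assume "x \<in> {x. \<exists>k. P k (cell k x)}"
    then obtain k0 where k0: "P k0 (cell k0 x)" by auto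
    obtain n where n: "\<And>k. k \<ge> n \<Longrightarrow> \<not> P k (cell k x)" using bdd by auto
    \<comment> \<open>All admissible levels at \<open>x\<close> lie below \<open>n\<close>, so
      minimizing \<open>nat (n - k)\<close> selects the largest of them.\<close>
    obtain k where k: "P k (cell k x)" "\<And>j. P j (cell j x) \<Longrightarrow> nat (n - k) \<le> nat (n - j)"
      using ex_has_least_nat[of "\<lambda>k. P k (cell k x)" k0 "\<lambda>k. nat (n - k)"] k0 by auto
    have "M k x"
      unfolding M_def
    proof (intro conjI allI impI notI)
      fix j assume "k < j" "P j (cell j x)"
      with k(2)[of j] n[of j] n[of k] show False by (cases "j \<ge> n") auto
    qed (use k in auto)
    then have "cell k x \<in> S" by (auto simp: S_def)
    then have "Q (enc (cell k x)) = cell k x" by (rule Qenc)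
    then show "x \<in> (\<Union>i. Q i)" by (metis UN_I UNIV_I cell_self)
  qed
  have "\<exists>c l. (Q i = {} \<and> l = 0) \<or>
      (\<exists>k. Q i = cell k c \<and> l = 2 powi k \<and> P k (cell k c) \<and> (\<forall>j>k. \<not> P j (cell j c)))" for i
    using QS[of i] by (cases "Q i = {}") (auto simp: S_def M_def)
  then obtain c and l :: "nat \<Rightarrow> real" where "\<And>i. (Q i = {} \<and> l i = 0) \<or>
      (\<exists>k. Q i = cell k (c i) \<and> l i = 2 powi k \<and> P k (cell k (c i)) \<and> (\<forall>j>k. \<not> P j (cell j (c i))))"
    by metis
  with disj Un show thesis by (rule that)
qed

text \<open>The set where the dyadic maximal function of \<open>M\<close> exceeds
  \<open>t\<close>.\<close>

definition dense_cells :: "'a::euclidean_space measure \<Rightarrow> real \<Rightarrow> 'a set" where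
  "dense_cells M t = {x. \<exists>k. measure M (cell k x) > t * (2 powi k) ^ DIM('a)}"

lemma ex_two_powi_gt: "\<exists>n. \<forall>k\<ge>n. C < (2 powi k :: real) ^ Suc m"
proof -
  obtain n where n: "max C 1 < 2 ^ n" using real_arch_pow[of 2 "max C 1"] by auto
  show ?thesis
  proof (intro exI allI impI)
    fix k assume "int n \<le> k"
    then have "(2::real) powi k = 2 ^ n * 2 ^ (nat k - n)"
      by (auto simp: power_int_def power_add[symmetric])
    also have "\<dots> \<ge> 2 ^ n * 1" by (intro mult_left_mono one_le_power) auto
    finally have "max C 1 < 2 powi k" using n by linarith
    moreover have "(2 powi k :: real) ^ 1 \<le> (2 powi k) ^ Suc m"
      using calculation by (intro power_increasing) auto
    ultimately show "C < (2 powi k :: real) ^ Suc m" by (simp del: power_Suc)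
  qed
qed

text \<open>Since \<open>M\<close> is finite, large cells are not dense, so maximal dense cells
  exist. The parent of a maximal cell has average at most \<open>t\<close>, which bounds the mass of
  the cell from above at the price of the ratio \<open>2 ^ DIM('a)\<close> of the volumes.\<close>

lemma Calderon_Zygmund_decomposition:
  fixes M :: "'a::euclidean_space measure"
  assumes "finite_measure M" and sets: "sets M = sets borel" and t: "t > 0"
  obtains Q :: "nat \<Rightarrow> 'a set" and c :: "nat \<Rightarrow> 'a" and l :: "nat \<Rightarrow> real"
  where "disjoint_family Q" "\<And>i. Q i \<in> sets borel" "(\<Union>i. Q i) = dense_cells M t"
    and "\<And>i. l i \<ge> 0" "\<And>i y. y \<in> Q i \<Longrightarrow> norm (y - c i) \<le> DIM('a) * l i"
    and "\<And>i. emeasure lborel (Q i) = ennreal (l i ^ DIM('a))"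
    and "\<And>i. t * l i ^ DIM('a) \<le> measure M (Q i)"
    and "\<And>i. measure M (Q i) \<le> 2 ^ DIM('a) * t * l i ^ DIM('a)"
    and "\<And>i. Q i = {} \<longleftrightarrow> l i = 0"
proof -
  interpret finite_measure M by fact
  let ?N = "DIM('a)"
  obtain m where m: "?N = Suc m" using DIM_positive[where 'a='a] gr0_conv_Suc by auto
  define P where "P k Q \<longleftrightarrow> measure M Q > t * (2 powi k) ^ ?N" for k and Q :: "'a set"
  have bdd: "\<exists>n. \<forall>k\<ge>n. \<not> P k (cell k x)" for x
  proof -
    obtain n where n: "\<And>k. n \<le> k \<Longrightarrow> measure M (space M) / t < (2 powi k) ^ Suc m"
      using ex_two_powi_gt by blast
    have "\<not> P k (cell k x)" if "n \<le> k" for k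
    proof -
      have "measure M (cell k x) \<le> measure M (space M)"
        by (rule bounded_measure)
      also have "\<dots> \<le> t * (2 powi k) ^ ?N"
        using n[OF that] t by (simp add: m field_simps)
      finally show ?thesis by (simp add: P_def)
    qed
    then show ?thesis by blast
  qed
  obtain Q :: "nat \<Rightarrow> 'a set" and c :: "nat \<Rightarrow> 'a" and l :: "nat \<Rightarrow> real" where
    Q: "disjoint_family Q" "(\<Union>i. Q i) = {x. \<exists>k. P k (cell k x)}"
    and cases: "\<And>i. (Q i = {} \<and> l i = 0) \<or> (\<exists>k. Q i = cell k (c i) \<and> l i = 2 powi k \<and>
        P k (cell k (c i)) \<and> (\<forall>j>k. \<not> P j (cell j (c i))))"
    by (rule stopping_cells[of P, OF bdd]) (rule that)
  show thesis
  proof (rule that[OF Q(1)])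
    show "(\<Union>i. Q i) = dense_cells M t"
      unfolding Q(2) by (simp add: dense_cells_def P_def)
    fix i
    consider "Q i = {}" "l i = 0"
      | k where "Q i = cell k (c i)" "l i = 2 powi k" "P k (cell k (c i))" "\<forall>j>k. \<not> P j (cell j (c i))"
      using cases[of i] by blast
    note cs = this
    show "Q i \<in> sets borel" by (rule cs) auto
    show "l i \<ge> 0" by (rule cs) auto
    show "norm (y - c i) \<le> ?N * l i" if "y \<in> Q i" for y
      by (rule cs) (use that norm_diff_cell[OF _ cell_self, of y _ "c i"] in auto)
    show "emeasure lborel (Q i) = ennreal (l i ^ ?N)"
      by (rule cs) (auto simp: emeasure_cell)
    show "t * l i ^ ?N \<le> measure M (Q i)"
      by (rule cs) (auto simp: P_def zero_power)
    show "measure M (Q i) \<le> 2 ^ ?N * t * l i ^ ?N"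
    proof (cases rule: cs)
      case 2
      have "measure M (Q i) \<le> measure M (cell (k + 1) (c i))"
        unfolding 2 using sets by (intro finite_measure_mono cell_mono) auto
      also have "\<dots> \<le> t * (2 powi (k + 1)) ^ ?N"
        using 2(4)[rule_format, of "k + 1"] by (simp add: P_def)
      also have "\<dots> = 2 ^ ?N * t * l i ^ ?N"
        by (simp add: 2 power_int_add power_mult_distrib)
      finally show ?thesis .
    qed (simp add: zero_power)
    show "Q i = {} \<longleftrightarrow> l i = 0" by (rule cs) (auto simp: cell_def)
  qed
qed

lemma dense_cells_borel:
  fixes M :: "'a::euclidean_space measure"
  assumes "finite_measure M" "sets M = sets borel" "t > 0"
  shows "dense_cells M t \<in> sets borel"
proof -
  obtain Q :: "nat \<Rightarrow> 'a set" where "\<And>i. Q i \<in> sets borel" "(\<Union>i. Q i) = dense_cells M t"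
    using Calderon_Zygmund_decomposition[OF assms] by metis
  then show ?thesis by (metis sets.countable_UN image_subset_iff)
qed

text \<open>The weak type (1,1) bound for the dyadic maximal function. The constant is 1 because the
  selected cells are disjoint and each has average at least \<open>t\<close>.\<close>

lemma emeasure_dense_cells_le:
  fixes M :: "'a::euclidean_space measure"
  assumes M: "finite_measure M" "sets M = sets borel" and t: "t > 0"
  shows "emeasure lborel (dense_cells M t) \<le> ennreal (measure M UNIV / t)"
proof -
  interpret finite_measure M by (rule M)
  obtain Q :: "nat \<Rightarrow> 'a set" and c l where
    Q: "disjoint_family Q" "\<And>i. Q i \<in> sets borel" "(\<Union>i. Q i) = dense_cells M t"
       "\<And>i. l i \<ge> 0" "\<And>i. emeasure lborel (Q i) = ennreal (l i ^ DIM('a))"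
       "\<And>i. t * l i ^ DIM('a) \<le> measure M (Q i)"
    using Calderon_Zygmund_decomposition[OF M t] by metis
  have sp: "space M = UNIV" using sets_eq_imp_space_eq[OF M(2)] by simp
  have "emeasure lborel (dense_cells M t) = (\<Sum>i. emeasure lborel (Q i))"
    unfolding Q(3)[symmetric] by (rule suminf_emeasure[symmetric]) (use Q in auto)
  also have "\<dots> \<le> (\<Sum>i. ennreal (1 / t) * emeasure M (Q i))"
  proof (rule suminf_le)
    fix i
    have "l i ^ DIM('a) \<le> 1 / t * measure M (Q i)" using Q(6)[of i] t by (simp add: field_simps)
    then show "emeasure lborel (Q i) \<le> ennreal (1 / t) * emeasure M (Q i)"
      using t by (simp add: Q(5) emeasure_eq_measure ennreal_mult[symmetric] ennreal_leI)
  qed auto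
  also have "\<dots> = ennreal (1 / t) * emeasure M (dense_cells M t)"
    unfolding Q(3)[symmetric] ennreal_suminf_cmult
    by (subst suminf_emeasure) (use Q M in auto)
  also have "\<dots> \<le> ennreal (1 / t) * emeasure M (space M)"
    by (intro mult_left_mono emeasure_space) auto
  also have "\<dots> = ennreal (measure M UNIV / t)"
    using t by (simp add: sp emeasure_eq_measure ennreal_mult[symmetric])
  finally show ?thesis .
qed

lemma measure_cell_le:
  assumes "x \<notin> dense_cells M t"
  shows "measure M (cell k (x::'a::euclidean_space)) \<le> t * (2 powi k) ^ DIM('a)"
  using assms by (auto simp: dense_cells_def not_less)

text \<open>This replaces the differentiation theorem. \<open>E\<close> is covered by an open set of
  nearly the same volume, which is cut into dyadic cells; a cell that contains a point outside
  \<open>dense_cells M t\<close> has mass at most \<open>t\<close> times its volume, and the other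
  cells do not meet the set to be measured.\<close>

lemma emeasure_outside_dense_cells_le:
  fixes M :: "'a::euclidean_space measure"
  assumes M: "finite_measure M" "sets M = sets borel" and t: "t > 0" and E: "E \<in> sets borel"
  shows "emeasure M (E - dense_cells M t) \<le> ennreal t * emeasure lborel E"
proof (cases "emeasure lborel E = \<infinity>")
  case True
  then show ?thesis using t by (simp add: ennreal_mult_top)
next
  case False
  interpret finite_measure M by (rule M)
  note D = dense_cells_borel[OF M t]
  have "emeasure M (E - dense_cells M t) \<le> ennreal t * emeasure lborel E + ennreal e" if e: "e > 0" for e
  proof -
    obtain U where U: "open U" "E \<subseteq> U" "emeasure lborel (U - E) < ennreal (e / t)"
      using outer_regular_lborel[OF E, of "e / t"] e t by auto
    \<comment> \<open>The cap \<open>k \<le> 0\<close> ensures that maximal cells exist even if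
      \<open>U\<close> contains arbitrarily large ones.\<close>
    define P where "P k A \<longleftrightarrow> k \<le> 0 \<and> A \<subseteq> U" for k :: int and A :: "'a set"
    have bdd: "\<exists>n. \<forall>k\<ge>n. \<not> P k (cell k x)" for x
      by (rule exI[of _ 1]) (auto simp: P_def)
    obtain Q :: "nat \<Rightarrow> 'a set" and c :: "nat \<Rightarrow> 'a" and l :: "nat \<Rightarrow> real" where
      Q: "disjoint_family Q" "(\<Union>i. Q i) = {x. \<exists>k. P k (cell k x)}"
      and cases: "\<And>i. (Q i = {} \<and> l i = 0) \<or> (\<exists>k. Q i = cell k (c i) \<and> l i = 2 powi k \<and>
          P k (cell k (c i)) \<and> (\<forall>j>k. \<not> P j (cell j (c i))))"
      by (rule stopping_cells[of P, OF bdd]) (rule that)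
    have QU: "(\<Union>i. Q i) = U"
      unfolding Q(2)
    proof (intro subset_antisym subsetI)
      fix x assume "x \<in> {x. \<exists>k. P k (cell k x)}"
      then show "x \<in> U" using cell_self by (auto simp: P_def)
    next
      fix x assume "x \<in> U"
      then obtain d where d: "d > 0" "ball x d \<subseteq> U" using U(1) openE by blast
      obtain n where n: "(1/2::real) ^ n < d / DIM('a)"
        using real_arch_pow_inv[of "d / DIM('a)" "1/2"] d by auto
      have "cell (- int n) x \<subseteq> ball x d"
      proof
        fix y assume "y \<in> cell (- int n) x"
        from norm_diff_cell[OF cell_self this] have "norm (x - y) \<le> DIM('a) * (1/2) ^ n"
          by (simp add: power_int_minus power_divide field_simps)
        also have "\<dots> < d" using n by (simp add: field_simps)
        finally show "y \<in> ball x d" by (simp add: dist_norm)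
      qed
      then have "P (- int n) (cell (- int n) x)" using d by (auto simp: P_def)
      then show "x \<in> {x. \<exists>k. P k (cell k x)}" by blast
    qed
    have Qb: "Q i \<in> sets borel" for i using cases[of i] by auto
    have Qle: "emeasure M (Q i - dense_cells M t) \<le> ennreal t * emeasure lborel (Q i)" for i
    proof (cases "Q i - dense_cells M t = {}")
      case False
      then obtain x where x: "x \<in> Q i" "x \<notin> dense_cells M t" by auto
      with cases[of i] obtain k where "Q i = cell k (c i)" by auto
      with x have Qx: "Q i = cell k x" using cell_eq by metis
      have "emeasure M (Q i - dense_cells M t) \<le> emeasure M (Q i)"
        using Qb[of i] M by (intro emeasure_mono) auto
      also have "\<dots> \<le> ennreal (t * (2 powi k) ^ DIM('a))"
        unfolding Qx emeasure_eq_measure by (intro ennreal_leI measure_cell_le x)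
      also have "\<dots> = ennreal t * emeasure lborel (Q i)"
        using t by (simp add: Qx emeasure_cell ennreal_mult)
      finally show ?thesis .
    qed (simp only: emeasure_empty zero_le)
    have "emeasure M (E - dense_cells M t) \<le> emeasure M (\<Union>i. Q i - dense_cells M t)"
      using U QU Qb D M by (intro emeasure_mono) (auto intro!: sets.countable_UN)
    also have "\<dots> \<le> (\<Sum>i. emeasure M (Q i - dense_cells M t))"
      using Qb D M by (intro emeasure_subadditive_countably) auto
    also have "\<dots> \<le> (\<Sum>i. ennreal t * emeasure lborel (Q i))"
      by (intro suminf_le Qle) auto
    also have "\<dots> = ennreal t * emeasure lborel U"
      unfolding QU[symmetric] ennreal_suminf_cmult
      by (subst suminf_emeasure) (use Q Qb in auto)
    also have "emeasure lborel U = emeasure lborel E + emeasure lborel (U - E)"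
      using U E by (subst plus_emeasure) (auto intro!: arg_cong[where f="emeasure lborel"])
    also have "ennreal t * \<dots> \<le> ennreal t * (emeasure lborel E + ennreal (e / t))"
      using U(3) by (intro mult_left_mono add_left_mono) auto
    also have "\<dots> = ennreal t * emeasure lborel E + ennreal e"
      using t e by (simp add: distrib_left ennreal_mult[symmetric])
    finally show ?thesis .
  qed
  then show ?thesis by (rule ennreal_le_epsilon)
qed

subsection \<open>The Cotlar--Stein lemma\<close>

lemma lborel_distr_affine1:
  fixes y :: "'a::euclidean_space"
  assumes "\<bar>s\<bar> = (1::real)"
  shows "distr lborel borel (\<lambda>x. y + s *\<^sub>R x) = lborel"
proof -
  have "s \<noteq> 0" using assms by auto
  from lborel_affine[OF this, of y] assms show ?thesis
    by (simp add: density_1 one_ennreal_def[symmetric])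
qed

lemma nn_integral_lborel_minus:
  fixes f :: "'a::euclidean_space \<Rightarrow> ennreal"
  assumes [measurable]: "f \<in> borel_measurable borel"
  shows "(\<integral>\<^sup>+x. f (x - y) \<partial>lborel) = (\<integral>\<^sup>+x. f x \<partial>lborel)" "(\<integral>\<^sup>+x. f (y - x) \<partial>lborel) = (\<integral>\<^sup>+x. f x \<partial>lborel)"
proof -
  have "(\<integral>\<^sup>+x. f x \<partial>lborel) = (\<integral>\<^sup>+x. f x \<partial>distr lborel borel (\<lambda>x. (- y) + 1 *\<^sub>R x))"
    by (subst lborel_distr_affine1) auto
  also have "\<dots> = (\<integral>\<^sup>+x. f (x - y) \<partial>lborel)" by (subst nn_integral_distr) auto
  finally show "(\<integral>\<^sup>+x. f (x - y) \<partial>lborel) = (\<integral>\<^sup>+x. f x \<partial>lborel)" by simp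
  have "(\<integral>\<^sup>+x. f x \<partial>lborel) = (\<integral>\<^sup>+x. f x \<partial>distr lborel borel (\<lambda>x. y + (- 1) *\<^sub>R x))"
    by (subst lborel_distr_affine1) auto
  also have "\<dots> = (\<integral>\<^sup>+x. f (y - x) \<partial>lborel)" by (subst nn_integral_distr) auto
  finally show "(\<integral>\<^sup>+x. f (y - x) \<partial>lborel) = (\<integral>\<^sup>+x. f x \<partial>lborel)" by simp
qed

lemma integrable_lborel_minus:
  fixes f :: "'a::euclidean_space \<Rightarrow> 'b::{banach, second_countable_topology}"
  assumes "integrable lborel f"
  shows "integrable lborel (\<lambda>x. f (x - y))" "integrable lborel (\<lambda>x. f (y - x))"
proof -
  have [measurable]: "f \<in> borel_measurable borel" using borel_measurable_integrable[OF assms] by simp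
  have "integrable (distr lborel borel (\<lambda>x. (- y) + 1 *\<^sub>R x)) f"
    "integrable (distr lborel borel (\<lambda>x. y + (- 1) *\<^sub>R x)) f"
    using assms by (simp_all only: lborel_distr_affine1 abs_one abs_minus_cancel)
  then show "integrable lborel (\<lambda>x. f (x - y))" "integrable lborel (\<lambda>x. f (y - x))"
    by (simp_all add: integrable_distr_eq)
qed

lemma integral_lborel_minus:
  fixes f :: "'a::euclidean_space \<Rightarrow> 'b::{banach, second_countable_topology}"
  assumes [measurable]: "f \<in> borel_measurable borel"
  shows "(\<integral>x. f (x - y) \<partial>lborel) = (\<integral>x. f x \<partial>lborel)" "(\<integral>x. f (y - x) \<partial>lborel) = (\<integral>x. f x \<partial>lborel)"
proof -
  have "(\<integral>x. f x \<partial>lborel) = (\<integral>x. f x \<partial>distr lborel borel (\<lambda>x. (- y) + 1 *\<^sub>R x))"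
    by (subst lborel_distr_affine1) auto
  also have "\<dots> = (\<integral>x. f (x - y) \<partial>lborel)" by (subst integral_distr) auto
  finally show "(\<integral>x. f (x - y) \<partial>lborel) = (\<integral>x. f x \<partial>lborel)" by simp
  have "(\<integral>x. f x \<partial>lborel) = (\<integral>x. f x \<partial>distr lborel borel (\<lambda>x. y + (- 1) *\<^sub>R x))"
    by (subst lborel_distr_affine1) auto
  also have "\<dots> = (\<integral>x. f (y - x) \<partial>lborel)" by (subst integral_distr) auto
  finally show "(\<integral>x. f (y - x) \<partial>lborel) = (\<integral>x. f x \<partial>lborel)" by simp
qed

text \<open>A class closed under products and convolution and contained in L^2, on which the Hilbert
  space arguments can be carried out with functions instead of equivalence classes.\<close>

definition bdd_int :: "('a::euclidean_space \<Rightarrow> real) set" where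
  "bdd_int = {f. integrable lborel f \<and> (\<exists>B. \<forall>x. \<bar>f x\<bar> \<le> B)}"

definition conv :: "('a::euclidean_space \<Rightarrow> real) \<Rightarrow> ('a \<Rightarrow> real) \<Rightarrow> 'a \<Rightarrow> real" where
  "conv k f x = (\<integral>y. k (x - y) * f y \<partial>lborel)"

definition ip :: "('a::euclidean_space \<Rightarrow> real) \<Rightarrow> ('a \<Rightarrow> real) \<Rightarrow> real" where
  "ip f g = (\<integral>x. f x * g x \<partial>lborel)"

definition nrm :: "('a::euclidean_space \<Rightarrow> real) \<Rightarrow> real" where
  "nrm f = sqrt (ip f f)"

lemma bdd_int_measurable: "f \<in> bdd_int \<Longrightarrow> f \<in> borel_measurable borel"
  by (auto simp: bdd_int_def dest: borel_measurable_integrable)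

lemma bdd_int_integrable: "f \<in> bdd_int \<Longrightarrow> integrable lborel f"
  by (auto simp: bdd_int_def)

lemma bdd_int_bound:
  assumes "f \<in> bdd_int" obtains B where "B \<ge> 0" "\<And>x. \<bar>f x\<bar> \<le> B"
proof -
  obtain B where B: "\<And>x. \<bar>f x\<bar> \<le> B" using assms by (auto simp: bdd_int_def)
  then have "B \<ge> 0" using abs_ge_zero order_trans by blast
  with B show ?thesis by (rule that[rotated])
qed

lemma integrable_mult_bounded:
  fixes f h :: "'a::euclidean_space \<Rightarrow> real"
  assumes "integrable lborel f" "h \<in> borel_measurable borel" "\<And>x. \<bar>h x\<bar> \<le> B"
  shows "integrable lborel (\<lambda>x. f x * h x)"
proof (rule Bochner_Integration.integrable_bound)
  show "integrable lborel (\<lambda>x. B * f x)" using assms by simp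
  show "(\<lambda>x. f x * h x) \<in> borel_measurable lborel"
    using assms borel_measurable_integrable by auto
  show "AE x in lborel. norm (f x * h x) \<le> norm (B * f x)"
  proof (rule AE_I2)
    fix x
    have "B \<ge> 0" using assms(3)[of x] by (meson abs_ge_zero order_trans)
    then show "norm (f x * h x) \<le> norm (B * f x)"
      using mult_right_mono[OF assms(3)[of x], of "\<bar>f x\<bar>"] by (simp add: abs_mult mult.commute)
  qed
qed

lemma bdd_int_mult_bounded:
  assumes "f \<in> bdd_int" "h \<in> borel_measurable borel" "\<And>x. \<bar>h x\<bar> \<le> B"
  shows "(\<lambda>x. f x * h x) \<in> bdd_int"
proof -
  obtain B' where B': "B' \<ge> 0" "\<And>x. \<bar>f x\<bar> \<le> B'" using assms(1) bdd_int_bound by blast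
  have "\<bar>f x * h x\<bar> \<le> B' * B" for x
    unfolding abs_mult using B' assms(3)[of x] by (intro mult_mono) auto
  moreover have "integrable lborel (\<lambda>x. f x * h x)"
    using assms by (intro integrable_mult_bounded) (auto simp: bdd_int_integrable)
  ultimately show ?thesis by (auto simp: bdd_int_def)
qed

lemma bdd_int_mult: "f \<in> bdd_int \<Longrightarrow> g \<in> bdd_int \<Longrightarrow> (\<lambda>x. f x * g x) \<in> bdd_int"
  by (metis bdd_int_mult_bounded bdd_int_bound bdd_int_measurable)

lemma bdd_int_cmult: "f \<in> bdd_int \<Longrightarrow> (\<lambda>x. c * f x) \<in> bdd_int"
  using bdd_int_mult_bounded[of f "\<lambda>_. c" "\<bar>c\<bar>"] by (simp add: mult.commute)

lemma bdd_int_abs: "f \<in> bdd_int \<Longrightarrow> (\<lambda>x. \<bar>f x\<bar>) \<in> bdd_int"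
  by (auto simp: bdd_int_def)

lemma bdd_int_add:
  assumes "f \<in> bdd_int" "g \<in> bdd_int" shows "(\<lambda>x. f x + g x) \<in> bdd_int"
proof -
  obtain B B' where "\<And>x. \<bar>f x\<bar> \<le> B" "\<And>x. \<bar>g x\<bar> \<le> B'" using assms by (auto simp: bdd_int_def)
  then have "\<bar>f x + g x\<bar> \<le> B + B'" for x using abs_triangle_ineq[of "f x" "g x"] by (meson add_mono order_trans)
  with assms show ?thesis by (auto simp: bdd_int_def)
qed

lemma bdd_int_zero: "(\<lambda>x. 0) \<in> bdd_int"
  by (auto simp: bdd_int_def)

lemma bdd_int_sum: "(\<And>i. i \<in> J \<Longrightarrow> f i \<in> bdd_int) \<Longrightarrow> (\<lambda>x. \<Sum>i\<in>J. f i x) \<in> bdd_int"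
  by (induction J rule: infinite_finite_induct) (auto intro: bdd_int_add bdd_int_zero)

lemma bdd_int_minus: 
  assumes "f \<in> bdd_int" shows "(\<lambda>x. f (y - x)) \<in> bdd_int" "(\<lambda>x. f (x - y)) \<in> bdd_int" "(\<lambda>x. f (- x)) \<in> bdd_int"
proof -
  show *: "(\<lambda>x. f (y - x)) \<in> bdd_int" "(\<lambda>x. f (x - y)) \<in> bdd_int" for y
    using assms integrable_lborel_minus[of f] by (auto simp: bdd_int_def)
  show "(\<lambda>x. f (- x)) \<in> bdd_int" using *(1)[of 0] by simp
qed

lemma conv_integrable: "k \<in> bdd_int \<Longrightarrow> f \<in> bdd_int \<Longrightarrow> integrable lborel (\<lambda>y. k (x - y) * f y)"
  by (intro bdd_int_integrable bdd_int_mult bdd_int_minus)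

lemma conv_pair_integrable:
  fixes k f h :: "'a::euclidean_space \<Rightarrow> real"
  assumes k: "k \<in> bdd_int" and f: "f \<in> bdd_int"
    and h: "h \<in> borel_measurable borel" "\<And>x. \<bar>h x\<bar> \<le> B"
  shows "integrable (lborel \<Otimes>\<^sub>M lborel) (\<lambda>(y, x). k (x - y) * f y * h x)"
proof (rule lborel_pair.Fubini_integrable)
  note [measurable] = bdd_int_measurable[OF k] bdd_int_measurable[OF f] h(1)
  show "(\<lambda>(y, x). k (x - y) * f y * h x) \<in> borel_measurable (lborel \<Otimes>\<^sub>M lborel)" by measurable
  have B: "B \<ge> 0" using h(2) abs_ge_zero order_trans by blast
  have int: "integrable lborel (\<lambda>x. k (x - y) * f y * h x)" for y
  proof -
    have "integrable lborel (\<lambda>x. k (x - y) * h x)"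
      using k h by (intro integrable_mult_bounded integrable_lborel_minus bdd_int_integrable) auto
    from integrable_mult_right[OF this, of "f y"] show ?thesis by (simp add: ac_simps)
  qed
  then show "AE y in lborel. integrable lborel (\<lambda>x. case (y, x) of (y, x) \<Rightarrow> k (x - y) * f y * h x)" by simp
  show "integrable lborel (\<lambda>y. \<integral>x. norm (case (y, x) of (y, x) \<Rightarrow> k (x - y) * f y * h x) \<partial>lborel)"
  proof (rule Bochner_Integration.integrable_bound)
    show "integrable lborel (\<lambda>y. (B * (\<integral>x. \<bar>k x\<bar> \<partial>lborel)) * f y)"
      using f by (auto intro: bdd_int_integrable)
    show "(\<lambda>y. \<integral>x. norm (case (y, x) of (y, x) \<Rightarrow> k (x - y) * f y * h x) \<partial>lborel) \<in> borel_measurable lborel"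
      by (intro lborel.borel_measurable_lebesgue_integral) measurable
    show "AE y in lborel. norm (\<integral>x. norm (case (y, x) of (y, x) \<Rightarrow> k (x - y) * f y * h x) \<partial>lborel)
        \<le> norm ((B * (\<integral>x. \<bar>k x\<bar> \<partial>lborel)) * f y)"
    proof (rule AE_I2)
      fix y
      have ki: "integrable lborel (\<lambda>x. \<bar>k (x - y)\<bar>)"
        using k by (intro integrable_abs integrable_lborel_minus bdd_int_integrable)
      have "(\<integral>x. \<bar>k (x - y) * f y * h x\<bar> \<partial>lborel) \<le> (\<integral>x. (B * \<bar>f y\<bar>) * \<bar>k (x - y)\<bar> \<partial>lborel)"
      proof (rule integral_mono)
        show "integrable lborel (\<lambda>x. \<bar>k (x - y) * f y * h x\<bar>)" using int by (rule integrable_abs)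
        show "integrable lborel (\<lambda>x. (B * \<bar>f y\<bar>) * \<bar>k (x - y)\<bar>)" using ki by simp
        fix x
        have "\<bar>k (x - y)\<bar> * \<bar>f y\<bar> * \<bar>h x\<bar> \<le> \<bar>k (x - y)\<bar> * \<bar>f y\<bar> * B"
          by (intro mult_left_mono h) auto
        then show "\<bar>k (x - y) * f y * h x\<bar> \<le> (B * \<bar>f y\<bar>) * \<bar>k (x - y)\<bar>" by (simp add: abs_mult ac_simps)
      qed
      also have "\<dots> = (B * \<bar>f y\<bar>) * (\<integral>x. \<bar>k x\<bar> \<partial>lborel)"
        by (simp add: integral_lborel_minus(1)[of "\<lambda>x. \<bar>k x\<bar>"])
      finally show "norm (\<integral>x. norm (case (y, x) of (y, x) \<Rightarrow> k (x - y) * f y * h x) \<partial>lborel)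
          \<le> norm ((B * (\<integral>x. \<bar>k x\<bar> \<partial>lborel)) * f y)"
        using B by (simp add: abs_mult ac_simps integral_nonneg_AE)
    qed
  qed
qed

lemma conv_Fubini:
  fixes k f h :: "'a::euclidean_space \<Rightarrow> real"
  assumes k: "k \<in> bdd_int" and f: "f \<in> bdd_int"
    and h: "h \<in> borel_measurable borel" "\<And>x. \<bar>h x\<bar> \<le> B"
  shows "(\<integral>x. conv k f x * h x \<partial>lborel) = (\<integral>y. f y * (\<integral>x. k (x - y) * h x \<partial>lborel) \<partial>lborel)"
    and "integrable lborel (\<lambda>x. conv k f x * h x)"
proof -
  note I = conv_pair_integrable[OF assms]
  have 1: "(\<integral>y. k (x - y) * f y * h x \<partial>lborel) = conv k f x * h x" for x
    by (simp add: conv_def)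
  have 2: "(\<integral>x. k (x - y) * f y * h x \<partial>lborel) = f y * (\<integral>x. k (x - y) * h x \<partial>lborel)" for y
    by (simp add: mult.assoc mult.left_commute[of _ "f y"])
  from lborel_pair.Fubini_integral[OF I] show "(\<integral>x. conv k f x * h x \<partial>lborel) = (\<integral>y. f y * (\<integral>x. k (x - y) * h x \<partial>lborel) \<partial>lborel)"
    unfolding 1 2 .
  from lborel_pair.integrable_snd[OF I] show "integrable lborel (\<lambda>x. conv k f x * h x)"
    unfolding 1 .
qed

lemma conv_bdd_int: 
  assumes k: "k \<in> bdd_int" and f: "f \<in> bdd_int" shows "conv k f \<in> bdd_int"
proof -
  have "integrable lborel (conv k f)"
    using conv_Fubini(2)[OF k f, of "\<lambda>_. 1" 1] by simp
  moreover obtain B where B: "B \<ge> 0" "\<And>x. \<bar>k x\<bar> \<le> B" using k bdd_int_bound by blast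
  have "\<bar>conv k f x\<bar> \<le> B * (\<integral>y. \<bar>f y\<bar> \<partial>lborel)" for x
  proof -
    have "\<bar>conv k f x\<bar> \<le> (\<integral>y. \<bar>k (x - y) * f y\<bar> \<partial>lborel)"
      unfolding conv_def by (rule integral_abs_bound)
    also have "\<dots> \<le> (\<integral>y. B * \<bar>f y\<bar> \<partial>lborel)"
      using B f integrable_abs[OF conv_integrable[OF k f, of x]]
      by (intro integral_mono) (auto simp: abs_mult bdd_int_integrable intro!: mult_right_mono)
    finally show ?thesis by simp
  qed
  ultimately show ?thesis by (auto simp: bdd_int_def)
qed

lemma conv_commute: 
  assumes "k \<in> bdd_int" "f \<in> bdd_int" shows "conv k f = conv f k"
proof
  fix x
  note [measurable] = assms[THEN bdd_int_measurable]
  have "conv k f x = (\<integral>y. (\<lambda>z. k (x - z) * f z) (x - y) \<partial>lborel)"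
    unfolding conv_def by (rule integral_lborel_minus(2)[symmetric]) measurable
  then show "conv k f x = conv f k x" by (simp add: conv_def mult.commute)
qed

lemma conv_assoc:
  assumes k: "k \<in> bdd_int" and l: "l \<in> bdd_int" and f: "f \<in> bdd_int"
  shows "conv k (conv l f) x = conv (conv k l) f x"
proof -
  note [measurable] = assms[THEN bdd_int_measurable]
  obtain B where B: "\<And>x. \<bar>k x\<bar> \<le> B" using k bdd_int_bound by blast
  have *: "(\<integral>y. l (y - z) * k (x - y) \<partial>lborel) = conv k l (x - z)" for z
  proof -
    have "(\<integral>y. l (y - z) * k (x - y) \<partial>lborel) = (\<integral>y. (\<lambda>w. k (x - z - w) * l w) (y - z) \<partial>lborel)"
      by (simp add: algebra_simps)
    also have "\<dots> = conv k l (x - z)"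
      unfolding conv_def by (rule integral_lborel_minus) measurable
    finally show ?thesis .
  qed
  have "conv k (conv l f) x = (\<integral>y. conv l f y * k (x - y) \<partial>lborel)"
    by (simp add: conv_def mult.commute)
  also have "\<dots> = (\<integral>z. f z * conv k l (x - z) \<partial>lborel)"
    by (subst conv_Fubini(1)[OF l f _ B]) (simp_all add: *)
  also have "\<dots> = conv (conv k l) f x" by (simp add: conv_def mult.commute)
  finally show ?thesis .
qed

lemma conv_add_right: "k \<in> bdd_int \<Longrightarrow> f \<in> bdd_int \<Longrightarrow> g \<in> bdd_int \<Longrightarrow>
    conv k (\<lambda>x. f x + g x) x = conv k f x + conv k g x"
  unfolding conv_def distrib_left by (rule Bochner_Integration.integral_add) (auto intro: conv_integrable)

lemma conv_add_left: "k \<in> bdd_int \<Longrightarrow> l \<in> bdd_int \<Longrightarrow> f \<in> bdd_int \<Longrightarrow>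
    conv (\<lambda>x. k x + l x) f x = conv k f x + conv l f x"
  unfolding conv_def distrib_right by (rule Bochner_Integration.integral_add) (auto intro: conv_integrable)

lemma conv_zero_right: "conv k (\<lambda>x. 0) x = 0"
  by (simp add: conv_def)

lemma conv_sum_right:
  assumes "k \<in> bdd_int" "\<And>i. i \<in> J \<Longrightarrow> f i \<in> bdd_int"
  shows "conv k (\<lambda>x. \<Sum>i\<in>J. f i x) x = (\<Sum>i\<in>J. conv k (f i) x)"
  using assms
  by (induction J rule: infinite_finite_induct) (auto simp: conv_zero_right conv_add_right bdd_int_sum)

lemma ip_adjoint:
  assumes k: "k \<in> bdd_int" and f: "f \<in> bdd_int" and h: "h \<in> bdd_int"
  shows "ip (conv k f) h = ip f (conv (\<lambda>x. k (- x)) h)"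
proof -
  obtain B where B: "\<And>x. \<bar>h x\<bar> \<le> B" using h bdd_int_bound by blast
  show ?thesis
    unfolding ip_def by (subst conv_Fubini(1)[OF k f bdd_int_measurable[OF h] B]) (simp add: conv_def)
qed

lemma ip_nonneg: "ip f f \<ge> 0"
  by (simp add: ip_def)

lemma nrm_nonneg [simp]: "nrm f \<ge> 0"
  by (simp add: nrm_def ip_nonneg)

lemma nrm_power2: "(nrm f)\<^sup>2 = ip f f"
  by (simp add: nrm_def ip_nonneg)

lemma ip_integrable: "f \<in> bdd_int \<Longrightarrow> g \<in> bdd_int \<Longrightarrow> integrable lborel (\<lambda>x. f x * g x)"
  by (intro bdd_int_integrable bdd_int_mult)

lemma ip_add_left: "f \<in> bdd_int \<Longrightarrow> g \<in> bdd_int \<Longrightarrow> h \<in> bdd_int \<Longrightarrow>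
    ip (\<lambda>x. f x + g x) h = ip f h + ip g h"
  unfolding ip_def distrib_right by (rule Bochner_Integration.integral_add) (auto intro: ip_integrable)

lemma ip_commute: "ip f g = ip g f"
  by (simp add: ip_def mult.commute)

lemma ip_cmult_left: "ip (\<lambda>x. c * f x) g = c * ip f g"
  by (simp add: ip_def mult.assoc)

lemma Cauchy_Schwarz_ip:
  assumes f: "f \<in> bdd_int" and g: "g \<in> bdd_int"
  shows "\<bar>ip f g\<bar> \<le> nrm f * nrm g"
proof -
  define a b c where "a = ip f f" and "b = ip f g" and "c = ip g g"
  have quad: "0 \<le> a + 2 * t * b + t\<^sup>2 * c" for t
  proof -
    let ?h = "\<lambda>x. f x + t * g x"
    note bi = f bdd_int_cmult[OF g, of t] bdd_int_add[OF f bdd_int_cmult[OF g, of t]]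
    have "ip ?h ?h = a + 2 * t * b + t\<^sup>2 * c"
    proof -
      have 1: "ip k ?h = ip f k + t * ip g k" if "k \<in> bdd_int" for k
        using ip_add_left[OF f bdd_int_cmult[OF g, of t] that] by (simp only: ip_commute[of k] ip_cmult_left)
      have "ip ?h ?h = ip f ?h + t * ip g ?h"
        using ip_add_left[OF f bdd_int_cmult[OF g, of t] bi(3)] by (simp only: ip_cmult_left)
      also have "\<dots> = a + t * ip g f + t * (b + t * c)"
        unfolding 1[OF f] 1[OF g] a_def b_def c_def ..
      also have "\<dots> = a + 2 * t * b + t\<^sup>2 * c"
        by (simp add: b_def ip_commute[of g f] power2_eq_square algebra_simps)
      finally show ?thesis .
    qed
    with ip_nonneg[of ?h] show ?thesis by simp
  qed
  have ac: "a \<ge> 0" "c \<ge> 0" by (simp_all add: a_def c_def ip_nonneg)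
  have "b\<^sup>2 \<le> a * c"
  proof (cases "c = 0")
    case True
    have "b = 0"
    proof (rule ccontr)
      assume "b \<noteq> 0"
      \<comment> \<open>With \<open>c = 0\<close> the quadratic is linear in \<open>t\<close>, and
        this value of \<open>t\<close> makes it equal to -1.\<close>
      then show False using quad[of "- (a + 1) / (2 * b)"] True by (simp add: field_simps)
    qed
    with ac show ?thesis by simp
  next
    case False
    with ac have "c > 0" by simp
    then show ?thesis using quad[of "- b / c"] by (simp add: field_simps power2_eq_square)
  qed
  then have "\<bar>b\<bar> \<le> sqrt (a * c)" using real_sqrt_le_mono[of "b\<^sup>2"] by simp
  then show ?thesis by (simp add: nrm_def real_sqrt_mult a_def b_def c_def)
qed

lemma nrm_triangle:
  assumes f: "f \<in> bdd_int" and g: "g \<in> bdd_int"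
  shows "nrm (\<lambda>x. f x + g x) \<le> nrm f + nrm g"
proof (rule power2_le_imp_le)
  have "(nrm (\<lambda>x. f x + g x))\<^sup>2 = ip f f + 2 * ip f g + ip g g"
  proof -
    have 1: "ip k (\<lambda>x. f x + g x) = ip f k + ip g k" if "k \<in> bdd_int" for k
      using ip_add_left[OF f g that] by (simp only: ip_commute[of k])
    show ?thesis
      unfolding nrm_power2 ip_add_left[OF f g bdd_int_add[OF f g]] 1[OF f] 1[OF g] ip_commute[of g f] by simp
  qed
  also have "\<dots> \<le> (nrm f)\<^sup>2 + 2 * (nrm f * nrm g) + (nrm g)\<^sup>2"
    using Cauchy_Schwarz_ip[OF f g] by (simp add: nrm_power2)
  finally show "(nrm (\<lambda>x. f x + g x))\<^sup>2 \<le> (nrm f + nrm g)\<^sup>2" by (simp add: power2_sum)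
qed auto

lemma nrm_zero: "nrm (\<lambda>x. 0) = 0"
  by (simp add: nrm_def ip_def)

lemma nrm_sum:
  assumes "\<And>i. i \<in> J \<Longrightarrow> f i \<in> bdd_int"
  shows "nrm (\<lambda>x. \<Sum>i\<in>J. f i x) \<le> (\<Sum>i\<in>J. nrm (f i))"
  using assms
proof (induction J rule: infinite_finite_induct)
  case (insert i J)
  have "nrm (\<lambda>x. \<Sum>i\<in>insert i J. f i x) \<le> nrm (f i) + nrm (\<lambda>x. \<Sum>i\<in>J. f i x)"
    using insert nrm_triangle[of "f i" "\<lambda>x. \<Sum>i\<in>J. f i x"] by (simp add: bdd_int_sum)
  with insert show ?case by (auto intro: order_trans)
qed (auto simp: nrm_zero)

text \<open>Pointwise Cauchy--Schwarz with the weight \<open>\<bar>k (x - y)\<bar>\<close> reduces this to Fubini's theorem.\<close>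

lemma nrm_conv_le:
  assumes k: "k \<in> bdd_int" and f: "f \<in> bdd_int" and a: "(\<integral>x. \<bar>k x\<bar> \<partial>lborel) \<le> a" "a > 0"
  shows "nrm (conv k f) \<le> a * nrm f"
proof (rule power2_le_imp_le)
  define f2 where "f2 x = f x * f x" for x
  have f2: "f2 \<in> bdd_int" unfolding f2_def[abs_def] by (intro bdd_int_mult f)
  note ka = bdd_int_abs[OF k]
  have pt: "(conv k f x)\<^sup>2 \<le> a * conv (\<lambda>x. \<bar>k x\<bar>) f2 x" for x
  proof -
    define h where "h = conv k f x"
    note [measurable] = bdd_int_measurable[OF k]
    have ki: "integrable lborel (\<lambda>y. \<bar>k (x - y)\<bar>)"
      using k by (intro integrable_abs integrable_lborel_minus bdd_int_integrable)
    have kf: "integrable lborel (\<lambda>y. \<bar>k (x - y)\<bar> * f2 y)"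
      using conv_integrable[OF ka f2] .
    have "h * h = (\<integral>y. k (x - y) * f y * h \<partial>lborel)" by (simp add: h_def conv_def)
    also have "\<dots> \<le> (\<integral>y. a / 2 * (\<bar>k (x - y)\<bar> * f2 y) + (h * h / (2 * a)) * \<bar>k (x - y)\<bar> \<partial>lborel)"
    proof (rule integral_mono)
      show "integrable lborel (\<lambda>y. k (x - y) * f y * h)"
        using conv_integrable[OF k f, of x] by simp
      show "integrable lborel (\<lambda>y. a / 2 * (\<bar>k (x - y)\<bar> * f2 y) + (h * h / (2 * a)) * \<bar>k (x - y)\<bar>)"
        using ki kf by (intro Bochner_Integration.integrable_add integrable_mult_right)
      fix y
      have "f y * h \<le> a / 2 * (f y * f y) + h * h / (2 * a)" "- (f y * h) \<le> a / 2 * (f y * f y) + h * h / (2 * a)"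
        using a(2) zero_le_power2[of "a * f y - h"] zero_le_power2[of "a * f y + h"]
        by (simp_all add: field_simps power2_eq_square)
      then have "\<bar>f y * h\<bar> \<le> a / 2 * (f y * f y) + h * h / (2 * a)" by linarith
      then have "\<bar>k (x - y)\<bar> * \<bar>f y * h\<bar> \<le> \<bar>k (x - y)\<bar> * (a / 2 * (f y * f y) + h * h / (2 * a))"
        by (intro mult_left_mono) auto
      moreover have "k (x - y) * f y * h \<le> \<bar>k (x - y)\<bar> * \<bar>f y * h\<bar>"
        by (metis abs_ge_self abs_mult mult.assoc)
      ultimately show "k (x - y) * f y * h \<le> a / 2 * (\<bar>k (x - y)\<bar> * f2 y) + (h * h / (2 * a)) * \<bar>k (x - y)\<bar>"
        by (simp add: f2_def algebra_simps)
    qed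
    also have "\<dots> = a / 2 * conv (\<lambda>x. \<bar>k x\<bar>) f2 x + h * h / (2 * a) * (\<integral>y. \<bar>k (x - y)\<bar> \<partial>lborel)"
      using ki kf by (subst Bochner_Integration.integral_add) (auto simp: conv_def)
    also have "(\<integral>y. \<bar>k (x - y)\<bar> \<partial>lborel) = (\<integral>y. \<bar>k y\<bar> \<partial>lborel)"
      by (rule integral_lborel_minus(2)[of "\<lambda>z. \<bar>k z\<bar>"]) measurable
    also have "a / 2 * conv (\<lambda>x. \<bar>k x\<bar>) f2 x + h * h / (2 * a) * (\<integral>y. \<bar>k y\<bar> \<partial>lborel)
        \<le> a / 2 * conv (\<lambda>x. \<bar>k x\<bar>) f2 x + h * h / (2 * a) * a"
      using a by (intro add_left_mono mult_left_mono) auto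
    finally have "h * h \<le> a / 2 * conv (\<lambda>x. \<bar>k x\<bar>) f2 x + h * h / 2" using a(2) by simp
    then show ?thesis by (simp add: h_def power2_eq_square)
  qed
  have cb: "conv k f \<in> bdd_int" "conv (\<lambda>x. \<bar>k x\<bar>) f2 \<in> bdd_int" by (intro conv_bdd_int k f ka f2)+
  have "(nrm (conv k f))\<^sup>2 \<le> (\<integral>x. a * conv (\<lambda>x. \<bar>k x\<bar>) f2 x \<partial>lborel)"
    unfolding nrm_power2 ip_def
    by (rule integral_mono) (use cb pt in \<open>auto simp: power2_eq_square intro: ip_integrable bdd_int_integrable\<close>)
  also have "\<dots> = a * (\<integral>x. conv (\<lambda>x. \<bar>k x\<bar>) f2 x * 1 \<partial>lborel)" by simp
  also have "(\<integral>x. conv (\<lambda>x. \<bar>k x\<bar>) f2 x * 1 \<partial>lborel) = (\<integral>y. f2 y * (\<integral>x. \<bar>k (x - y)\<bar> * 1 \<partial>lborel) \<partial>lborel)"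
    by (rule conv_Fubini(1)[OF ka f2, of "\<lambda>_. 1" 1]) auto
  also have "\<dots> = ip f f * (\<integral>x. \<bar>k x\<bar> \<partial>lborel)"
    using integral_lborel_minus(1)[of "\<lambda>x. \<bar>k x\<bar>"] bdd_int_measurable[OF k]
    by (simp add: ip_def f2_def)
  also have "a * \<dots> \<le> a * (ip f f * a)"
    using a ip_nonneg[of f] by (intro mult_left_mono) auto
  also have "a * (ip f f * a) = (a * nrm f)\<^sup>2"
    unfolding power_mult_distrib nrm_power2 by (simp add: power2_eq_square)
  finally show "(nrm (conv k f))\<^sup>2 \<le> (a * nrm f)\<^sup>2" .
qed (use a in auto)

text \<open>Because \<open>p\<close> has mean zero, \<open>q x\<close> may be subtracted from
  \<open>q (x - z)\<close> under the integral; the L^1 modulus of continuity of \<open>q\<close> is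
  then tested against the first moment of \<open>p\<close>. If \<open>p\<close> lives at a smaller
  scale than \<open>q\<close>, the product of the two constants is small like the ratio of the
  scales.\<close>

lemma almost_orthogonal_L1:
  assumes p: "p \<in> bdd_int" and q: "q \<in> bdd_int" and p0: "(\<integral>x. p x \<partial>lborel) = 0"
    and pz: "integrable lborel (\<lambda>z. \<bar>p z\<bar> * norm z)" "(\<integral>z. \<bar>p z\<bar> * norm z \<partial>lborel) \<le> \<alpha>"
    and qz: "\<And>z. (\<integral>x. \<bar>q (x - z) - q x\<bar> \<partial>lborel) \<le> \<beta> * norm z" and "\<beta> \<ge> 0"
  shows "(\<integral>x. \<bar>conv p q x\<bar> \<partial>lborel) \<le> \<alpha> * \<beta>"
proof -
  note [measurable] = p[THEN bdd_int_measurable] q[THEN bdd_int_measurable]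
  \<comment> \<open>Multiplication by the sign replaces the absolute value, so that Fubini's theorem
    applies to a bilinear expression tested against a bounded function.\<close>
  define s where "s x = (if conv p q x \<ge> 0 then 1 else - 1 :: real)" for x
  have cm[measurable]: "conv p q \<in> borel_measurable borel"
    by (intro bdd_int_measurable conv_bdd_int p q)
  have sm[measurable]: "s \<in> borel_measurable borel" unfolding s_def[abs_def] by measurable
  have s1: "\<bar>s x\<bar> \<le> 1" for x by (simp add: s_def)
  have int: "integrable lborel (\<lambda>x. q (x - z) * s x)" for z
    using q s1 by (intro integrable_mult_bounded[where B=1] integrable_lborel_minus bdd_int_integrable) auto
  have "(\<integral>x. \<bar>conv p q x\<bar> \<partial>lborel) = (\<integral>x. conv q p x * s x \<partial>lborel)"
    unfolding conv_commute[OF q p] by (intro Bochner_Integration.integral_cong) (auto simp: s_def)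
  also have "\<dots> = (\<integral>z. p z * (\<integral>x. q (x - z) * s x \<partial>lborel) \<partial>lborel)"
    by (rule conv_Fubini(1)[OF q p sm s1])
  also have "\<dots> = (\<integral>z. p z * (\<integral>x. q (x - z) * s x \<partial>lborel) - (\<integral>x. q x * s x \<partial>lborel) * p z \<partial>lborel)"
  proof (subst Bochner_Integration.integral_diff)
    show "integrable lborel (\<lambda>z. p z * (\<integral>x. q (x - z) * s x \<partial>lborel))"
      using lborel_pair.integrable_fst[OF conv_pair_integrable[OF q p sm s1]]
      by (simp add: mult.assoc mult.left_commute[of _ "p _"])
  qed (use p p0 in \<open>auto intro: bdd_int_integrable\<close>)
  also have "\<dots> = (\<integral>z. p z * (\<integral>x. (q (x - z) - q x) * s x \<partial>lborel) \<partial>lborel)"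
    using int[of 0] int by (simp add: left_diff_distrib right_diff_distrib mult.commute)
  also have "\<dots> \<le> (\<integral>z. \<beta> * (\<bar>p z\<bar> * norm z) \<partial>lborel)"
  proof (rule integral_mono')
    show "integrable lborel (\<lambda>z. \<beta> * (\<bar>p z\<bar> * norm z))" using pz by simp
    fix z
    have "\<bar>\<integral>x. (q (x - z) - q x) * s x \<partial>lborel\<bar> \<le> (\<integral>x. \<bar>(q (x - z) - q x) * s x\<bar> \<partial>lborel)"
      by (rule integral_abs_bound)
    also have "\<dots> = (\<integral>x. \<bar>q (x - z) - q x\<bar> \<partial>lborel)"
      by (intro Bochner_Integration.integral_cong) (auto simp: s_def)
    also have "\<dots> \<le> \<beta> * norm z" by (rule qz)
    finally have "\<bar>p z\<bar> * \<bar>\<integral>x. (q (x - z) - q x) * s x \<partial>lborel\<bar> \<le> \<bar>p z\<bar> * (\<beta> * norm z)"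
      by (rule mult_left_mono) simp
    moreover have "p z * (\<integral>x. (q (x - z) - q x) * s x \<partial>lborel)
        \<le> \<bar>p z\<bar> * \<bar>\<integral>x. (q (x - z) - q x) * s x \<partial>lborel\<bar>"
      by (metis abs_ge_self abs_mult)
    ultimately show "p z * (\<integral>x. (q (x - z) - q x) * s x \<partial>lborel) \<le> \<beta> * (\<bar>p z\<bar> * norm z)"
      by (simp add: mult.left_commute)
  qed (use \<open>\<beta> \<ge> 0\<close> in auto)
  also have "\<dots> = \<beta> * (\<integral>z. \<bar>p z\<bar> * norm z \<partial>lborel)" by simp
  also have "\<dots> \<le> \<beta> * \<alpha>" using pz \<open>\<beta> \<ge> 0\<close> by (intro mult_left_mono)
  finally show ?thesis by (simp add: mult.commute)
qed

section \<open>Powers of a finite sum of convolution operators\<close>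

primrec word_op :: "('i \<Rightarrow> 'a::euclidean_space \<Rightarrow> real) \<Rightarrow> 'i list \<Rightarrow> ('a \<Rightarrow> real) \<Rightarrow> 'a \<Rightarrow> real" where
  "word_op k [] f = f"
| "word_op k (i # w) f = conv (k i) (word_op k w f)"

fun chain_weight :: "('i \<Rightarrow> 'i \<Rightarrow> real) \<Rightarrow> 'i list \<Rightarrow> real" where
  "chain_weight \<gamma> (i # j # w) = \<gamma> i j * chain_weight \<gamma> (j # w)"
| "chain_weight \<gamma> _ = 1"

text \<open>Letters are paired from the left; a letter left over at the end costs the trivial
  operator bound \<open>c\<close>.\<close>

fun pair_weight :: "real \<Rightarrow> ('i \<Rightarrow> 'i \<Rightarrow> real) \<Rightarrow> 'i list \<Rightarrow> real" where
  "pair_weight c \<gamma> (i # j # w) = (\<gamma> i j)\<^sup>2 * pair_weight c \<gamma> w"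
| "pair_weight c \<gamma> [i] = c"
| "pair_weight c \<gamma> [] = 1"

text \<open>The two ways of pairing neighbours in a word multiply to the square of the chain weight.\<close>

lemma pair_weight_mult:
  "pair_weight c \<gamma> (i # w) * pair_weight c \<gamma> w = c * (chain_weight \<gamma> (i # w))\<^sup>2"
proof (induction w arbitrary: i)
  case (Cons j w)
  have "pair_weight c \<gamma> (i # j # w) * pair_weight c \<gamma> (j # w)
      = (\<gamma> i j)\<^sup>2 * (pair_weight c \<gamma> (j # w) * pair_weight c \<gamma> w)" by simp
  also have "\<dots> = c * (chain_weight \<gamma> (i # j # w))\<^sup>2"
    unfolding Cons.IH by (simp add: power_mult_distrib)
  finally show ?case .
qed simp

definition words :: "'i set \<Rightarrow> nat \<Rightarrow> 'i list set" where
  "words J n = {w. set w \<subseteq> J \<and> length w = n}"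

lemma sum_words_Suc: "(\<Sum>w\<in>words J (Suc n). g w) = (\<Sum>i\<in>J. \<Sum>w\<in>words J n. g (i # w))"
proof -
  have "words J (Suc n) = (\<lambda>(i, w). i # w) ` (J \<times> words J n)"
    by (auto simp: words_def length_Suc_conv image_iff)
  moreover have "inj_on (\<lambda>(i, w). i # w) (J \<times> words J n)" by (auto simp: inj_on_def)
  ultimately have "(\<Sum>w\<in>words J (Suc n). g w) = (\<Sum>(i, w)\<in>J \<times> words J n. g (i # w))"
    by (simp add: sum.reindex case_prod_unfold)
  then show ?thesis by (simp add: sum.cartesian_product)
qed

lemma words_0: "words J 0 = {[]}"
  by (auto simp: words_def)

text \<open>All kernels are assumed to be even, or all odd, so that the sum is symmetric or
  antisymmetric for the pairing. Powers of the sum then play the part that powers of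
  \<open>T* T\<close> play in general, and almost orthogonality is required only of the products
  \<open>k i\<close> with \<open>k j\<close>, without reflected kernels.\<close>

locale Cotlar_Stein =
  fixes k :: "'i \<Rightarrow> 'a::euclidean_space \<Rightarrow> real" and J :: "'i set" and \<sigma> c A :: real
    and \<gamma> :: "'i \<Rightarrow> 'i \<Rightarrow> real"
  assumes J: "finite J" and k: "\<And>i. i \<in> J \<Longrightarrow> k i \<in> bdd_int"
    and \<sigma>: "\<bar>\<sigma>\<bar> = 1" "\<And>i x. i \<in> J \<Longrightarrow> k i (- x) = \<sigma> * k i x"
    and c: "c > 0" "\<And>i. i \<in> J \<Longrightarrow> (\<integral>x. \<bar>k i x\<bar> \<partial>lborel) \<le> c"
    and \<gamma>: "\<And>i j. \<gamma> i j > 0"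
      "\<And>i j. i \<in> J \<Longrightarrow> j \<in> J \<Longrightarrow> (\<integral>x. \<bar>conv (k i) (k j) x\<bar> \<partial>lborel) \<le> (\<gamma> i j)\<^sup>2"
    and A: "A > 0" "\<And>i. i \<in> J \<Longrightarrow> (\<Sum>j\<in>J. \<gamma> i j) \<le> A"
begin

lemma word_op_bdd_int: "f \<in> bdd_int \<Longrightarrow> set w \<subseteq> J \<Longrightarrow> word_op k w f \<in> bdd_int"
  by (induction w) (auto intro: conv_bdd_int k)

lemma pair_weight_nonneg: "pair_weight c \<gamma> w \<ge> 0"
  by (induction w rule: induct_list012) (use c \<gamma> in \<open>auto intro!: mult_nonneg_nonneg\<close>)

lemma chain_weight_nonneg: "chain_weight \<gamma> w \<ge> 0"
  by (induction w rule: induct_list012) (auto intro!: mult_nonneg_nonneg \<gamma>(1)[THEN less_imp_le])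

lemma nrm_word_op_pair:
  assumes f: "f \<in> bdd_int"
  shows "set w \<subseteq> J \<Longrightarrow> nrm (word_op k w f) \<le> pair_weight c \<gamma> w * nrm f"
proof (induction w rule: induct_list012)
  case (2 i)
  then show ?case using nrm_conv_le[OF k f c(2) c(1), of i] by simp
next
  case (3 i j w)
  then have ij: "i \<in> J" "j \<in> J" "set w \<subseteq> J" by auto
  note w = word_op_bdd_int[OF f ij(3)]
  have "word_op k (i # j # w) f = conv (conv (k i) (k j)) (word_op k w f)"
    using conv_assoc[OF k[OF ij(1)] k[OF ij(2)] w] by (simp add: fun_eq_iff)
  then have "nrm (word_op k (i # j # w) f) \<le> (\<gamma> i j)\<^sup>2 * nrm (word_op k w f)"
    using nrm_conv_le[OF conv_bdd_int[OF k k] w \<gamma>(2), OF ij(1,2) ij(1,2)] \<gamma>(1)[of i j] by simp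
  also have "\<dots> \<le> (\<gamma> i j)\<^sup>2 * (pair_weight c \<gamma> w * nrm f)"
    by (intro mult_left_mono 3 ij) auto
  finally show ?case by simp
qed simp

text \<open>The letters of a word can be paired starting with the first or with the second letter.
  The geometric mean of the two resulting bounds contains each neighbouring pair exactly once, so it
  can be summed letter by letter.\<close>

lemma nrm_word_op_chain:
  assumes f: "f \<in> bdd_int" and w: "set (i # w) \<subseteq> J"
  shows "nrm (word_op k (i # w) f) \<le> c * chain_weight \<gamma> (i # w) * nrm f"
proof (rule power2_le_imp_le)
  have 1: "nrm (word_op k (i # w) f) \<le> pair_weight c \<gamma> (i # w) * nrm f"
    by (rule nrm_word_op_pair[OF f w])
  have "nrm (word_op k (i # w) f) \<le> c * nrm (word_op k w f)"
    using w nrm_conv_le[OF k word_op_bdd_int[OF f] c(2) c(1), of i w] by simp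
  also have "\<dots> \<le> c * (pair_weight c \<gamma> w * nrm f)"
    using w c by (intro mult_left_mono nrm_word_op_pair f) auto
  finally have 2: "nrm (word_op k (i # w) f) \<le> c * (pair_weight c \<gamma> w * nrm f)" .
  have "(nrm (word_op k (i # w) f))\<^sup>2 \<le> (pair_weight c \<gamma> (i # w) * nrm f) * (c * (pair_weight c \<gamma> w * nrm f))"
    unfolding power2_eq_square
    by (intro mult_mono 1 2 mult_nonneg_nonneg pair_weight_nonneg nrm_nonneg)
  also have "\<dots> = (pair_weight c \<gamma> (i # w) * pair_weight c \<gamma> w) * (c * nrm f * nrm f)"
    by (simp only: ac_simps)
  also have "\<dots> = (c * chain_weight \<gamma> (i # w) * nrm f)\<^sup>2"
    unfolding pair_weight_mult by (simp add: power2_eq_square ac_simps)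
  finally show "(nrm (word_op k (i # w) f))\<^sup>2 \<le> (c * chain_weight \<gamma> (i # w) * nrm f)\<^sup>2" .
qed (use c chain_weight_nonneg in \<open>auto intro!: mult_nonneg_nonneg\<close>)

lemma sum_chain_weight_le: "i \<in> J \<Longrightarrow> (\<Sum>w\<in>words J n. chain_weight \<gamma> (i # w)) \<le> A ^ n"
proof (induction n arbitrary: i)
  case (Suc n)
  have "(\<Sum>w\<in>words J (Suc n). chain_weight \<gamma> (i # w)) = (\<Sum>j\<in>J. \<gamma> i j * (\<Sum>w\<in>words J n. chain_weight \<gamma> (j # w)))"
    by (simp add: sum_words_Suc sum_distrib_left)
  also have "\<dots> \<le> (\<Sum>j\<in>J. \<gamma> i j * A ^ n)"
    by (intro sum_mono mult_left_mono Suc.IH \<gamma>(1)[THEN less_imp_le])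
  also have "\<dots> \<le> A * A ^ n"
    unfolding sum_distrib_right[symmetric] using A Suc.prems by (intro mult_right_mono) auto
  finally show ?case by simp
qed (simp add: words_0)

definition T :: "('a \<Rightarrow> real) \<Rightarrow> 'a \<Rightarrow> real" where
  "T f x = (\<Sum>i\<in>J. conv (k i) f x)"

lemma T_bdd_int: "f \<in> bdd_int \<Longrightarrow> T f \<in> bdd_int"
  unfolding T_def[abs_def] by (intro bdd_int_sum conv_bdd_int k)

lemma funpow_T_bdd_int: "f \<in> bdd_int \<Longrightarrow> (T ^^ n) f \<in> bdd_int"
  by (induction n) (auto intro: T_bdd_int)

lemma funpow_T_eq: "f \<in> bdd_int \<Longrightarrow> (T ^^ n) f x = (\<Sum>w\<in>words J n. word_op k w f x)"
proof (induction n arbitrary: x)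
  case (Suc n)
  have "(T ^^ n) f = (\<lambda>x. \<Sum>w\<in>words J n. word_op k w f x)" using Suc by auto
  then have "(T ^^ Suc n) f x = (\<Sum>i\<in>J. conv (k i) (\<lambda>x. \<Sum>w\<in>words J n. word_op k w f x) x)"
    by (simp add: T_def)
  also have "\<dots> = (\<Sum>i\<in>J. \<Sum>w\<in>words J n. conv (k i) (word_op k w f) x)"
    using Suc.prems by (intro sum.cong refl conv_sum_right k word_op_bdd_int) (auto simp: words_def)
  finally show ?case by (simp add: sum_words_Suc)
qed (simp add: words_0)

lemma nrm_funpow_T_le:
  assumes f: "f \<in> bdd_int"
  shows "nrm ((T ^^ Suc n) f) \<le> card J * (c * A ^ n * nrm f)"
proof -
  have "nrm ((T ^^ Suc n) f) \<le> (\<Sum>w\<in>words J (Suc n). nrm (word_op k w f))"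
    unfolding funpow_T_eq[OF f, abs_def] funpow_T_eq[OF f, THEN ext]
    by (intro nrm_sum word_op_bdd_int f) (auto simp: words_def)
  also have "\<dots> = (\<Sum>i\<in>J. \<Sum>w\<in>words J n. nrm (word_op k (i # w) f))" by (rule sum_words_Suc)
  also have "\<dots> \<le> (\<Sum>i\<in>J. \<Sum>w\<in>words J n. c * chain_weight \<gamma> (i # w) * nrm f)"
    by (intro sum_mono nrm_word_op_chain f) (auto simp: words_def)
  also have "\<dots> = (\<Sum>i\<in>J. c * (\<Sum>w\<in>words J n. chain_weight \<gamma> (i # w)) * nrm f)"
    by (simp add: sum_distrib_left sum_distrib_right)
  also have "\<dots> \<le> (\<Sum>i\<in>J. c * A ^ n * nrm f)"
    using c by (intro sum_mono mult_right_mono mult_left_mono sum_chain_weight_le) auto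
  finally show ?thesis by simp
qed

lemma ip_T: 
  assumes f: "f \<in> bdd_int" and h: "h \<in> bdd_int"
  shows "ip (T f) h = \<sigma> * ip f (T h)"
proof -
  have 1: "ip (\<lambda>x. \<Sum>i\<in>J. g i x) h = (\<Sum>i\<in>J. ip (g i) h)"
    if "\<And>i. i \<in> J \<Longrightarrow> g i \<in> bdd_int" "h \<in> bdd_int" for g and h :: "'a \<Rightarrow> real"
    using J that
    by (induction J rule: finite_induct) (auto simp: ip_add_left bdd_int_sum ip_def[of "\<lambda>x. 0"])
  have "ip (T f) h = (\<Sum>i\<in>J. ip (conv (k i) f) h)"
    unfolding T_def[abs_def] by (rule 1) (auto intro: conv_bdd_int k f h)
  also have "\<dots> = (\<Sum>i\<in>J. \<sigma> * ip (conv (k i) h) f)"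
  proof (rule sum.cong)
    fix i assume i: "i \<in> J"
    have "(\<lambda>x. k i (- x)) = (\<lambda>x. \<sigma> * k i x)" using \<sigma>(2)[OF i] by auto
    then have "conv (\<lambda>x. k i (- x)) h = (\<lambda>x. \<sigma> * conv (k i) h x)"
      by (simp add: conv_def[abs_def] mult.assoc)
    then show "ip (conv (k i) f) h = \<sigma> * ip (conv (k i) h) f"
      using ip_adjoint[OF k[OF i] f h] by (simp add: ip_commute[of f] ip_cmult_left)
  qed simp
  also have "\<dots> = \<sigma> * ip (T h) f"
    unfolding T_def[abs_def] sum_distrib_left[symmetric]
    by (subst 1) (auto intro: conv_bdd_int k f h)
  finally show ?thesis by (simp add: ip_commute)
qed

lemma ip_funpow_T:
  assumes f: "f \<in> bdd_int" and h: "h \<in> bdd_int"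
  shows "\<bar>ip ((T ^^ n) f) h\<bar> = \<bar>ip f ((T ^^ n) h)\<bar>"
  using h
proof (induction n arbitrary: h)
  case (Suc n)
  have "\<bar>ip ((T ^^ Suc n) f) h\<bar> = \<bar>ip ((T ^^ n) f) (T h)\<bar>"
    using ip_T[OF funpow_T_bdd_int[OF f] Suc.prems] \<sigma>(1) by (simp add: abs_mult)
  also have "\<dots> = \<bar>ip f ((T ^^ n) (T h))\<bar>" by (rule Suc.IH[OF T_bdd_int[OF Suc.prems]])
  finally show ?case by (simp add: funpow_swap1)
qed simp

lemma nrm_funpow_T_square:
  assumes f: "f \<in> bdd_int"
  shows "(nrm ((T ^^ n) f))\<^sup>2 \<le> nrm ((T ^^ (2 * n)) f) * nrm f"
proof -
  have "(nrm ((T ^^ n) f))\<^sup>2 = \<bar>ip ((T ^^ n) f) ((T ^^ n) f)\<bar>"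
    by (simp add: nrm_power2 ip_nonneg)
  also have "\<dots> = \<bar>ip f ((T ^^ (2 * n)) f)\<bar>"
    unfolding ip_funpow_T[OF f funpow_T_bdd_int[OF f]] by (simp add: mult_2 funpow_add)
  also have "\<dots> \<le> nrm f * nrm ((T ^^ (2 * n)) f)"
    by (rule Cauchy_Schwarz_ip[OF f funpow_T_bdd_int[OF f]])
  finally show ?thesis by (simp add: mult.commute)
qed

text \<open>The trivial expansion of a high power carries a factor \<open>card J * c\<close>, which
  has to disappear. By symmetry, the ratio \<open>\<rho> 1\<close> satisfies
  \<open>\<rho> 1 ^ (2 ^ m) \<le> \<rho> (2 ^ m)\<close>; if it exceeded \<open>A\<close>, its
  powers would outgrow any fixed factor.\<close>

lemma nrm_T_le:
  assumes f: "f \<in> bdd_int"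
  shows "nrm (T f) \<le> A * nrm f"
proof (cases "nrm f = 0")
  case True
  then show ?thesis using nrm_funpow_T_le[OF f, of 0] by simp
next
  case False
  define b where "b = nrm f"
  have b: "b > 0" using False nrm_nonneg[of f] by (simp add: b_def order_less_le del: nrm_nonneg)
  define \<rho> where "\<rho> n = nrm ((T ^^ n) f) / b" for n
  have \<rho>0: "\<rho> n \<ge> 0" for n using b by (simp add: \<rho>_def)
  have sq: "(\<rho> n)\<^sup>2 \<le> \<rho> (2 * n)" for n
    using nrm_funpow_T_square[OF f, of n] b
    by (simp add: \<rho>_def power_divide b_def[symmetric] field_simps power2_eq_square)
  have pow: "(\<rho> 1) ^ (2 ^ m) \<le> \<rho> (2 ^ m)" for m
  proof (induction m)
    case (Suc m)
    have "(\<rho> 1) ^ (2 ^ Suc m) = ((\<rho> 1) ^ (2 ^ m))\<^sup>2" by (simp add: power_mult[symmetric] mult.commute)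
    also have "\<dots> \<le> (\<rho> (2 ^ m))\<^sup>2" using Suc \<rho>0 by (intro power_mono) auto
    also have "\<dots> \<le> \<rho> (2 * 2 ^ m)" by (rule sq)
    finally show ?case by simp
  qed simp
  have up: "\<rho> (Suc n) \<le> card J * c * A ^ n" for n
    using nrm_funpow_T_le[OF f, of n] b by (simp add: \<rho>_def b_def[symmetric] field_simps)
  define x where "x = \<rho> 1 / A"
  have bound: "x ^ (2 ^ m) \<le> card J * c / A" for m
  proof -
    obtain n where n: "2 ^ m = Suc n" by (metis Suc_pred pos2 zero_less_power)
    have "x ^ (2 ^ m) \<le> \<rho> (2 ^ m) / A ^ (2 ^ m)"
      unfolding x_def power_divide using pow A by (intro divide_right_mono) auto
    also have "\<dots> \<le> (card J * c * A ^ n) / A ^ (2 ^ m)"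
      using up[of n] A n by (intro divide_right_mono) auto
    also have "\<dots> = card J * c / A" using A by (simp add: n)
    finally show ?thesis .
  qed
  have "x \<le> 1"
  proof (rule ccontr)
    assume "\<not> x \<le> 1"
    then have x: "1 < x" by simp
    then obtain n where "card J * c / A < x ^ n" using real_arch_pow by blast
    also have "x ^ n \<le> x ^ (2 ^ n)"
      using x less_exp[of n] by (intro power_increasing) auto
    also have "\<dots> \<le> card J * c / A" by (rule bound)
    finally show False by simp
  qed
  then have "\<rho> 1 \<le> A" using A by (simp add: x_def)
  then show ?thesis using b by (simp add: \<rho>_def b_def[symmetric] field_simps)
qed

end

lemma sum_power_dist_le:
  fixes J :: "int set" and q :: real
  assumes "finite J" "0 < q" "q < 1"
  shows "(\<Sum>j\<in>J. q ^ nat \<bar>i - j\<bar>) \<le> 2 / (1 - q)"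
proof -
  have geo: "(\<Sum>m\<in>M. q ^ m) \<le> 1 / (1 - q)" if "finite M" for M
    using sum_le_suminf[of "\<lambda>m. q ^ m" M] that assms suminf_geometric[of q] by (simp add: summable_geometric)
  let ?J1 = "{j\<in>J. i \<le> j}" and ?J2 = "{j\<in>J. j < i}"
  have "(\<Sum>j\<in>J. q ^ nat \<bar>i - j\<bar>) = (\<Sum>j\<in>?J1. q ^ nat \<bar>i - j\<bar>) + (\<Sum>j\<in>?J2. q ^ nat \<bar>i - j\<bar>)"
    using assms(1) by (subst sum.union_disjoint[symmetric]) (auto intro!: sum.cong)
  also have "(\<Sum>j\<in>?J1. q ^ nat \<bar>i - j\<bar>) = (\<Sum>m\<in>(\<lambda>j. nat (j - i)) ` ?J1. q ^ m)"
    by (subst sum.reindex) (auto simp: inj_on_def intro!: sum.cong)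
  also have "(\<Sum>j\<in>?J2. q ^ nat \<bar>i - j\<bar>) = (\<Sum>m\<in>(\<lambda>j. nat (i - j)) ` ?J2. q ^ m)"
    by (subst sum.reindex) (auto simp: inj_on_def intro!: sum.cong)
  also have "(\<Sum>m\<in>(\<lambda>j. nat (j - i)) ` ?J1. q ^ m) + (\<Sum>m\<in>(\<lambda>j. nat (i - j)) ` ?J2. q ^ m) \<le> 1 / (1 - q) + 1 / (1 - q)"
    using assms(1) by (intro add_mono geo) auto
  finally show ?thesis by simp
qed

text \<open>Dyadic kernels at the scales \<open>2\<^sup>i r\<close>: \<open>C\<close> bounds the size, the first moment and the
  \<open>L\<^sup>1\<close> modulus of continuity.\<close>

lemma dyadic_sum_symmetric:
  fixes k :: "int \<Rightarrow> 'a::euclidean_space \<Rightarrow> real"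
  assumes J: "finite J" and k: "\<And>i. k i \<in> bdd_int" and C: "C > 0" and r: "r > 0"
    and \<sigma>: "\<bar>\<sigma>\<bar> = 1" "\<And>i x. k i (- x) = \<sigma> * k i x"
    and k0: "\<And>i. (\<integral>x. k i x \<partial>lborel) = 0" and k1: "\<And>i. (\<integral>x. \<bar>k i x\<bar> \<partial>lborel) \<le> C"
    and kz: "\<And>i. integrable lborel (\<lambda>z. \<bar>k i z\<bar> * norm z)"
      "\<And>i. (\<integral>z. \<bar>k i z\<bar> * norm z \<partial>lborel) \<le> C * (r * 2 powi i)"
    and km: "\<And>i z. (\<integral>x. \<bar>k i (x - z) - k i x\<bar> \<partial>lborel) \<le> C / (r * 2 powi i) * norm z"
    and f: "f \<in> bdd_int"
  shows "nrm (\<lambda>x. \<Sum>i\<in>J. conv (k i) f x) \<le> 8 * C * nrm f"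
proof -
  \<comment> \<open>The L^1 norm of the product of the kernels at scales \<open>i\<close> and
    \<open>j\<close> decays like \<open>2 ^ - |i - j|\<close>, and the Cotlar--Stein sum involves
    its square root. From \<open>q \<le> 3/4\<close> the geometric sum \<open>2 / (1 - q)\<close> is
    at most 8.\<close>
  define q where "q = sqrt (1/2)"
  have q: "0 < q" "q < 1" by (auto simp: q_def real_sqrt_lt_1_iff)
  have q2: "q\<^sup>2 = 1/2" by (simp add: q_def)
  have q34: "q \<le> 3/4" unfolding q_def by (rule real_le_lsqrt) (auto simp: power2_eq_square)
  define \<gamma> where "\<gamma> i j = C * q ^ nat \<bar>i - j\<bar>" for i j :: int
  have \<gamma>2: "(\<gamma> i j)\<^sup>2 = C * C * (1/2) ^ nat \<bar>i - j\<bar>" for i j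
  proof -
    have "(q ^ n)\<^sup>2 = (1/2) ^ n" for n by (metis power_mult mult.commute q2)
    then show ?thesis unfolding \<gamma>_def power_mult_distrib by (simp add: power2_eq_square)
  qed
  have le: "(\<integral>x. \<bar>conv (k i) (k j) x\<bar> \<partial>lborel) \<le> (\<gamma> i j)\<^sup>2" if "i \<le> j" for i j
  proof -
    have "(\<integral>x. \<bar>conv (k i) (k j) x\<bar> \<partial>lborel) \<le> (C * (r * 2 powi i)) * (C / (r * 2 powi j))"
      by (rule almost_orthogonal_L1[OF k k k0 kz km]) (use C r in auto)
    also have "\<dots> = C * C * (2 powi i / 2 powi j)" using r by simp
    also have "(2 powi i / 2 powi j :: real) = (1/2) ^ nat \<bar>i - j\<bar>"
    proof -
      have "(2::real) powi j = 2 powi i * 2 ^ nat \<bar>i - j\<bar>"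
        using that power_int_add[of "2::real" i "int (nat \<bar>i - j\<bar>)"] by (simp add: power_int_def)
      then show ?thesis by (simp add: power_divide)
    qed
    finally show ?thesis unfolding \<gamma>2 .
  qed
  interpret Cotlar_Stein k J \<sigma> C "8 * C" \<gamma>
  proof
    show "(\<integral>x. \<bar>conv (k i) (k j) x\<bar> \<partial>lborel) \<le> (\<gamma> i j)\<^sup>2" for i j
    proof (cases "i \<le> j")
      case False
      have "\<gamma> i j = \<gamma> j i" by (simp add: \<gamma>_def abs_minus_commute)
      then show ?thesis using False le[of j i] conv_commute[OF k k, of i j] by simp
    qed (rule le)
    show "\<gamma> i j > 0" for i j using C q by (simp add: \<gamma>_def)
    show "(\<Sum>j\<in>J. \<gamma> i j) \<le> 8 * C" for i
    proof -
      have "(\<Sum>j\<in>J. \<gamma> i j) \<le> C * (2 / (1 - q))"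
        unfolding \<gamma>_def sum_distrib_left[symmetric]
        using C q J by (intro mult_left_mono sum_power_dist_le) auto
      also have "\<dots> \<le> C * 8" using q34 C by (intro mult_left_mono) (auto simp: field_simps)
      finally show ?thesis by simp
    qed
  qed (use assms in auto)
  show ?thesis using nrm_T_le[OF f] unfolding T_def[abs_def] .
qed

text \<open>Every kernel is split into its even and its odd part. Both parts inherit size, moment,
  modulus and mean zero with the same constants, and the triangle inequality doubles the
  bound.\<close>

lemma dyadic_sum:
  fixes k :: "int \<Rightarrow> 'a::euclidean_space \<Rightarrow> real"
  assumes J: "finite J" and k: "\<And>i. k i \<in> bdd_int" and C: "C > 0" and r: "r > 0"
    and k0: "\<And>i. (\<integral>x. k i x \<partial>lborel) = 0" and k1: "\<And>i. (\<integral>x. \<bar>k i x\<bar> \<partial>lborel) \<le> C"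
    and kz: "\<And>i. integrable lborel (\<lambda>z. \<bar>k i z\<bar> * norm z)"
      "\<And>i. (\<integral>z. \<bar>k i z\<bar> * norm z \<partial>lborel) \<le> C * (r * 2 powi i)"
    and km: "\<And>i z. (\<integral>x. \<bar>k i (x - z) - k i x\<bar> \<partial>lborel) \<le> C / (r * 2 powi i) * norm z"
    and f: "f \<in> bdd_int"
  shows "nrm (\<lambda>x. \<Sum>i\<in>J. conv (k i) f x) \<le> 16 * C * nrm f"
proof -
  define p where "p \<sigma> i x = (k i x + \<sigma> * k i (- x)) / 2" for \<sigma> :: real and i x
  note [measurable] = k[THEN bdd_int_measurable]
  have kr: "(\<lambda>x. k i (- x)) \<in> bdd_int" for i by (rule bdd_int_minus(3)[OF k])
  have refl: "(\<integral>x. g (- x) \<partial>lborel) = (\<integral>x. g x \<partial>lborel)" if "g \<in> borel_measurable borel" for g :: "'a \<Rightarrow> real"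
    using integral_lborel_minus(2)[OF that, of 0] by simp
  have p: "p \<sigma> i \<in> bdd_int" for \<sigma> i
    using bdd_int_cmult[OF bdd_int_add[OF k bdd_int_cmult[OF kr, of \<sigma>]], of "1/2"] by (simp add: p_def[abs_def])
  have bound: "nrm (\<lambda>x. \<Sum>i\<in>J. conv (p \<sigma> i) f x) \<le> 8 * C * nrm f" if \<sigma>: "\<bar>\<sigma>\<bar> = 1" for \<sigma>
  proof (rule dyadic_sum_symmetric[OF J p C r \<sigma> _ _ _ _ _ _ f])
    fix i :: int and x :: 'a
    have ss: "\<sigma> * \<sigma> = 1" using \<sigma> by (metis abs_mult_self_eq mult_1)
    show "p \<sigma> i (- x) = \<sigma> * p \<sigma> i x"
      using ss by (simp add: p_def field_simps mult.assoc[symmetric])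
    note ki = bdd_int_integrable[OF k, of i] bdd_int_integrable[OF kr, of i]
    show "(\<integral>x. p \<sigma> i x \<partial>lborel) = 0"
      using ki refl[of "k i"] k0 by (simp add: p_def)
    have ab: "\<bar>p \<sigma> i x\<bar> \<le> (\<bar>k i x\<bar> + \<bar>k i (- x)\<bar>) / 2" for x
      using abs_triangle_ineq[of "k i x" "\<sigma> * k i (- x)"] \<sigma> by (simp add: p_def abs_mult)
    have "(\<integral>x. \<bar>p \<sigma> i x\<bar> \<partial>lborel) \<le> (\<integral>x. (\<bar>k i x\<bar> + \<bar>k i (- x)\<bar>) / 2 \<partial>lborel)"
      using ki p ab by (intro integral_mono) (auto intro: bdd_int_integrable)
    also have "\<dots> = (\<integral>x. \<bar>k i x\<bar> \<partial>lborel)"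
      using ki refl[of "\<lambda>x. \<bar>k i x\<bar>"] by simp
    finally show "(\<integral>x. \<bar>p \<sigma> i x\<bar> \<partial>lborel) \<le> C" using k1[of i] by simp
    have kzr: "integrable lborel (\<lambda>z. \<bar>k i (- z)\<bar> * norm z)"
      using integrable_lborel_minus(2)[OF kz(1)[of i], of 0] by simp
    have abz: "\<bar>p \<sigma> i z\<bar> * norm z \<le> (\<bar>k i z\<bar> * norm z + \<bar>k i (- z)\<bar> * norm z) / 2" for z
      using mult_right_mono[OF ab[of z] norm_ge_zero[of z]] by (simp add: field_simps)
    show pz: "integrable lborel (\<lambda>z. \<bar>p \<sigma> i z\<bar> * norm z)"
    proof (rule Bochner_Integration.integrable_bound)
      show "integrable lborel (\<lambda>z. (\<bar>k i z\<bar> * norm z + \<bar>k i (- z)\<bar> * norm z) / 2)" using kz(1) kzr by simp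
      show "(\<lambda>z. \<bar>p \<sigma> i z\<bar> * norm z) \<in> borel_measurable lborel"
        using bdd_int_measurable[OF p] by measurable
      show "AE z in lborel. norm (\<bar>p \<sigma> i z\<bar> * norm z) \<le> norm ((\<bar>k i z\<bar> * norm z + \<bar>k i (- z)\<bar> * norm z) / 2)"
        using abz by (intro AE_I2) (simp add: abs_mult)
    qed
    have "(\<integral>z. \<bar>p \<sigma> i z\<bar> * norm z \<partial>lborel) \<le> (\<integral>z. (\<bar>k i z\<bar> * norm z + \<bar>k i (- z)\<bar> * norm z) / 2 \<partial>lborel)"
      using kz(1) kzr pz abz by (intro integral_mono) auto
    also have "\<dots> = (\<integral>z. \<bar>k i z\<bar> * norm z \<partial>lborel)"
      using kz(1) kzr refl[of "\<lambda>z. \<bar>k i z\<bar> * norm z"] by simp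
    finally show "(\<integral>z. \<bar>p \<sigma> i z\<bar> * norm z \<partial>lborel) \<le> C * (r * 2 powi i)" using kz(2)[of i] by simp
    fix z :: 'a
    have i1: "integrable lborel (\<lambda>x. \<bar>k i (x - z) - k i x\<bar>)" for z
      using integrable_lborel_minus(1)[OF ki(1), of z] ki by simp
    have i2: "integrable lborel (\<lambda>x. \<bar>k i (- x + z) - k i (- x)\<bar>)"
      using integrable_lborel_minus(2)[OF i1[of "- z"], of 0] by simp
    have "(\<integral>x. \<bar>p \<sigma> i (x - z) - p \<sigma> i x\<bar> \<partial>lborel)
        \<le> (\<integral>x. (\<bar>k i (x - z) - k i x\<bar> + \<bar>k i (- x + z) - k i (- x)\<bar>) / 2 \<partial>lborel)"
    proof (rule integral_mono)
      show "integrable lborel (\<lambda>x. \<bar>p \<sigma> i (x - z) - p \<sigma> i x\<bar>)"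
        using integrable_lborel_minus(1)[OF bdd_int_integrable[OF p]] bdd_int_integrable[OF p] by simp
      show "integrable lborel (\<lambda>x. (\<bar>k i (x - z) - k i x\<bar> + \<bar>k i (- x + z) - k i (- x)\<bar>) / 2)"
        using i1 i2 by simp
      fix x
      have eq: "p \<sigma> i (x - z) - p \<sigma> i x = ((k i (x - z) - k i x) + \<sigma> * (k i (- x + z) - k i (- x))) / 2"
        by (simp add: p_def field_simps)
      show "\<bar>p \<sigma> i (x - z) - p \<sigma> i x\<bar> \<le> (\<bar>k i (x - z) - k i x\<bar> + \<bar>k i (- x + z) - k i (- x)\<bar>) / 2"
        unfolding eq abs_divide using abs_triangle_ineq[of "k i (x - z) - k i x" "\<sigma> * (k i (- x + z) - k i (- x))"] \<sigma>
        by (simp add: abs_mult)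
    qed
    also have "\<dots> = ((\<integral>x. \<bar>k i (x - z) - k i x\<bar> \<partial>lborel) + (\<integral>x. \<bar>k i (x - (- z)) - k i x\<bar> \<partial>lborel)) / 2"
      using i1 i2 refl[of "\<lambda>x. \<bar>k i (x + z) - k i x\<bar>"] by simp
    also have "\<dots> \<le> (C / (r * 2 powi i) * norm z + C / (r * 2 powi i) * norm (- z)) / 2"
      using km[of i z] km[of i "- z"] by (intro divide_right_mono add_mono) auto
    finally show "(\<integral>x. \<bar>p \<sigma> i (x - z) - p \<sigma> i x\<bar> \<partial>lborel) \<le> C / (r * 2 powi i) * norm z" by simp
  qed
  have "conv (k i) f x = conv (p 1 i) f x + conv (p (- 1) i) f x" for i x
  proof -
    have "(\<lambda>x. p 1 i x + p (- 1) i x) = k i" by (simp add: p_def fun_eq_iff field_simps)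
    then show ?thesis using conv_add_left[OF p p f, of 1 i "- 1" i x] by simp
  qed
  then have "nrm (\<lambda>x. \<Sum>i\<in>J. conv (k i) f x)
      = nrm (\<lambda>x. (\<Sum>i\<in>J. conv (p 1 i) f x) + (\<Sum>i\<in>J. conv (p (- 1) i) f x))"
    by (simp add: sum.distrib)
  also have "\<dots> \<le> 8 * C * nrm f + 8 * C * nrm f"
    using bound[of 1] bound[of "- 1"]
    by (intro order_trans[OF nrm_triangle add_mono] bdd_int_sum conv_bdd_int p f) auto
  finally show ?thesis by simp
qed

subsection \<open>Truncated singular integrals\<close>

lemma integrable_indicator_ball: "integrable lborel (\<lambda>x. indicator (ball (a::'a::euclidean_space) R) x * C :: real)"
  using emeasure_bounded_finite[OF bounded_ball[of a R]]
  by (intro integrable_mult_left integrable_real_indicator) auto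

lemma integral_indicator_ball:
  "R \<ge> 0 \<Longrightarrow> (\<integral>x. indicator (ball (a::'a::euclidean_space) R) x * C \<partial>lborel) = C * (ball_vol TYPE('a) * R ^ DIM('a))" for C :: real
  using content_ball[of R a] by simp

lemma integral_bounded_support:
  fixes f :: "'a::euclidean_space \<Rightarrow> real"
  assumes f: "f \<in> borel_measurable borel" "\<And>x. \<bar>f x\<bar> \<le> C" "\<And>x. R \<le> norm (x - a) \<Longrightarrow> f x = 0" and "R \<ge> 0"
  shows "integrable lborel f" "(\<integral>x. \<bar>f x\<bar> \<partial>lborel) \<le> C * (ball_vol TYPE('a) * R ^ DIM('a))" "f \<in> bdd_int"
proof -
  have le: "\<bar>f x\<bar> \<le> indicator (ball a R) x * C" for x
    using f(2)[of x] f(3)[of x] by (auto simp: dist_norm norm_minus_commute split: split_indicator)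
  show 1: "integrable lborel f"
    by (rule Bochner_Integration.integrable_bound[OF integrable_indicator_ball[of a R C]])
       (use f(1) le in \<open>auto intro!: AE_I2 order_trans[OF le]\<close>)
  show "(\<integral>x. \<bar>f x\<bar> \<partial>lborel) \<le> C * (ball_vol TYPE('a) * R ^ DIM('a))"
    unfolding integral_indicator_ball[OF \<open>R \<ge> 0\<close>, of a C, symmetric]
    by (rule integral_mono) (use 1 le integrable_indicator_ball in auto)
  show "f \<in> bdd_int" using 1 f(2) by (auto simp: bdd_int_def)
qed

context CZ_kernel
begin

text \<open>The difference of consecutive truncations of the gradient, that is, the derivative in
  direction \<open>e\<close> of \<open>trunc r - trunc (2 * r)\<close>, a function that vanishes for
  \<open>norm x \<le> r\<close> and for \<open>norm x \<ge> 4 * r\<close>.\<close>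

definition piece :: "'a \<Rightarrow> real \<Rightarrow> 'a \<Rightarrow> real" where
  "piece e r x = e \<bullet> (trunc' r x - trunc' (2 * r) x)"

text \<open>The pointwise bound \<open>600 * c / r ^ DIM('a)\<close> times the radius
  \<open>4 * r\<close> of the support for the first moment, times the volume of a ball of radius
  \<open>6 * r\<close>, which also contains the support after a translation by at most
  \<open>r\<close>. The summand 1 keeps the constant positive when \<open>c = 0\<close>.\<close>

definition piece_const :: real where
  "piece_const = 2400 * c * (ball_vol TYPE('a) * 6 ^ DIM('a)) + 1"

lemma piece_const_pos: "piece_const > 0"
  using c_nonneg by (simp add: piece_const_def add_nonneg_pos)

lemma trunc'_bound_uniform:
  assumes "r > 0" shows "norm (trunc' r x) \<le> 300 * c / r ^ DIM('a)"
proof (cases "norm x \<le> r")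
  case True
  then show ?thesis using assms c_nonneg by (simp add: trunc_inside)
next
  case False
  then have "x \<noteq> 0" using assms by auto
  have "300 * c / norm x ^ DIM('a) \<le> 300 * c / r ^ DIM('a)"
    using False assms c_nonneg \<open>x \<noteq> 0\<close> by (intro divide_left_mono power_mono mult_pos_pos) auto
  with trunc'_bound[OF assms \<open>x \<noteq> 0\<close>] show ?thesis by linarith
qed

lemma inner_le: "norm e \<le> 1 \<Longrightarrow> \<bar>e \<bullet> v\<bar> \<le> norm v" for e v :: 'a
  using Cauchy_Schwarz_ineq2[of e v] mult_right_mono[of "norm e" 1 "norm v"] by simp

context
  fixes e :: 'a and r :: real
  assumes e: "norm e \<le> 1" and r: "r > 0"
begin

lemma piece_measurable [measurable]: "piece e r \<in> borel_measurable borel"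
proof -
  have [measurable]: "trunc' r \<in> borel_measurable borel" "trunc' (2 * r) \<in> borel_measurable borel"
    using r by (auto intro: trunc'_measurable)
  show ?thesis unfolding piece_def[abs_def] by measurable
qed

lemma trunc'_scale_le: "norm (trunc' (2 * r) x) \<le> 300 * c / r ^ DIM('a)"
proof -
  have "300 * c / (2 * r) ^ DIM('a) \<le> 300 * c / r ^ DIM('a)"
    using r c_nonneg by (intro divide_left_mono power_mono mult_pos_pos) auto
  then show ?thesis using trunc'_bound_uniform[of "2 * r" x] r by linarith
qed

lemma piece_bound: "\<bar>piece e r x\<bar> \<le> 600 * c / r ^ DIM('a)"
proof -
  have "\<bar>piece e r x\<bar> \<le> norm (trunc' r x - trunc' (2 * r) x)"
    unfolding piece_def by (rule inner_le[OF e])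
  also have "\<dots> \<le> norm (trunc' r x) + norm (trunc' (2 * r) x)" by (rule norm_triangle_ineq4)
  also have "\<dots> \<le> 300 * c / r ^ DIM('a) + 300 * c / r ^ DIM('a)"
    by (intro add_mono trunc'_bound_uniform trunc'_scale_le r)
  finally show ?thesis by simp
qed

lemma piece_support: "4 * r \<le> norm x \<Longrightarrow> piece e r x = 0"
  using r by (simp add: piece_def trunc_outside)

lemma piece_Lipschitz: "\<bar>piece e r x - piece e r y\<bar> \<le> 600 * c / r ^ (DIM('a) + 1) * norm (x - y)"
proof -
  have "300 * c / (2 * r) ^ (DIM('a) + 1) \<le> 300 * c / r ^ (DIM('a) + 1)"
    using r c_nonneg by (intro divide_left_mono power_mono mult_pos_pos) auto
  then have "norm (trunc' (2 * r) x - trunc' (2 * r) y) \<le> 300 * c / r ^ (DIM('a) + 1) * norm (x - y)"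
    using trunc'_Lipschitz[of "2 * r" x y] r by (smt (verit) mult_right_mono norm_ge_zero)
  moreover have "norm (trunc' r x - trunc' r y) \<le> 300 * c / r ^ (DIM('a) + 1) * norm (x - y)"
    using trunc'_Lipschitz[OF r] .
  moreover have "\<bar>piece e r x - piece e r y\<bar> \<le> norm ((trunc' r x - trunc' r y) - (trunc' (2 * r) x - trunc' (2 * r) y))"
    unfolding piece_def inner_diff_right[symmetric]
    using inner_le[OF e, of "(trunc' r x - trunc' r y) - (trunc' (2 * r) x - trunc' (2 * r) y)"]
    by (simp add: algebra_simps)
  moreover have "\<dots> \<le> norm (trunc' r x - trunc' r y) + norm (trunc' (2 * r) x - trunc' (2 * r) y)"
    by (rule norm_triangle_ineq4)
  moreover have "600 * c / r ^ (DIM('a) + 1) * norm (x - y)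
      = 300 * c / r ^ (DIM('a) + 1) * norm (x - y) + 300 * c / r ^ (DIM('a) + 1) * norm (x - y)" by simp
  ultimately show ?thesis by linarith
qed

lemma piece_bdd_int: "piece e r \<in> bdd_int"
  by (rule integral_bounded_support(3)[of _ "600 * c / r ^ DIM('a)" "5 * r" 0])
     (use r piece_bound piece_support in auto)

lemma piece_L1: "(\<integral>x. \<bar>piece e r x\<bar> \<partial>lborel) \<le> 600 * c * (ball_vol TYPE('a) * 6 ^ DIM('a))"
proof -
  have "(\<integral>x. \<bar>piece e r x\<bar> \<partial>lborel) \<le> 600 * c / r ^ DIM('a) * (ball_vol TYPE('a) * (6 * r) ^ DIM('a))"
    by (rule integral_bounded_support(2)[of _ _ _ 0]) (use r piece_bound piece_support in auto)
  then show ?thesis using r by (simp add: power_mult_distrib)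
qed

lemma piece_moment:
  "integrable lborel (\<lambda>z. \<bar>piece e r z\<bar> * norm z)" "(\<integral>z. \<bar>piece e r z\<bar> * norm z \<partial>lborel) \<le> piece_const * r"
proof -
  have b: "\<bar>\<bar>piece e r z\<bar> * norm z\<bar> \<le> 600 * c / r ^ DIM('a) * (4 * r)" for z
  proof (cases "4 * r \<le> norm z")
    case False
    then show ?thesis unfolding abs_mult using piece_bound r c_nonneg by (intro mult_mono) auto
  qed (use r c_nonneg piece_support in auto)
  have m: "(\<lambda>z. \<bar>piece e r z\<bar> * norm z) \<in> borel_measurable borel" by measurable
  show "integrable lborel (\<lambda>z. \<bar>piece e r z\<bar> * norm z)"
    by (rule integral_bounded_support(1)[OF m b, of "6 * r" 0]) (use r piece_support in auto)
  have "(\<integral>z. \<bar>\<bar>piece e r z\<bar> * norm z\<bar> \<partial>lborel) \<le> 600 * c / r ^ DIM('a) * (4 * r) * (ball_vol TYPE('a) * (6 * r) ^ DIM('a))"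
    by (rule integral_bounded_support(2)[OF m b, of "6 * r" 0]) (use r piece_support in auto)
  also have "\<dots> = (piece_const - 1) * r"
    using r by (simp add: power_mult_distrib piece_const_def)
  also have "\<dots> \<le> piece_const * r" using r by (intro mult_right_mono) auto
  finally show "(\<integral>z. \<bar>piece e r z\<bar> * norm z \<partial>lborel) \<le> piece_const * r" by (simp add: abs_mult)
qed

text \<open>Translations by at most \<open>r\<close> are handled by the Lipschitz bound on a common
  support, longer ones by the triangle inequality, where \<open>norm z / r\<close> exceeds 1
  anyway.\<close>

lemma piece_modulus: "(\<integral>x. \<bar>piece e r (x - z) - piece e r x\<bar> \<partial>lborel) \<le> piece_const / r * norm z"
proof (cases "norm z \<le> r")
  case True
  let ?f = "\<lambda>x. piece e r (x - z) - piece e r x"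
  have "(\<integral>x. \<bar>?f x\<bar> \<partial>lborel) \<le> (600 * c / r ^ (DIM('a) + 1) * norm z) * (ball_vol TYPE('a) * (6 * r) ^ DIM('a))"
  proof (rule integral_bounded_support(2)[of _ _ "6 * r" 0])
    show "?f \<in> borel_measurable borel" by measurable
    show "\<bar>?f x\<bar> \<le> 600 * c / r ^ (DIM('a) + 1) * norm z" for x using piece_Lipschitz[of "x - z" x] by simp
    show "?f x = 0" if "6 * r \<le> norm (x - 0)" for x
      using that True r norm_triangle_ineq2[of x z] by (subst (1 2) piece_support) auto
  qed (use r in auto)
  also have "\<dots> = 600 * c * (ball_vol TYPE('a) * 6 ^ DIM('a)) / r * norm z"
    using r by (simp add: power_mult_distrib)
  also have "\<dots> \<le> piece_const / r * norm z"
    using r c_nonneg by (intro mult_right_mono divide_right_mono) (auto simp: piece_const_def)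
  finally show ?thesis .
next
  case False
  note i = integrable_lborel_minus(1)[OF bdd_int_integrable[OF piece_bdd_int], of z] bdd_int_integrable[OF piece_bdd_int]
  have "(\<integral>x. \<bar>piece e r (x - z) - piece e r x\<bar> \<partial>lborel) \<le> (\<integral>x. \<bar>piece e r (x - z)\<bar> + \<bar>piece e r x\<bar> \<partial>lborel)"
    using i by (intro integral_mono) auto
  also have "\<dots> = 2 * (\<integral>x. \<bar>piece e r x\<bar> \<partial>lborel)"
    using i integral_lborel_minus(1)[of "\<lambda>x. \<bar>piece e r x\<bar>" z] by simp
  also have "\<dots> \<le> piece_const * 1"
  proof -
    define X where "X = c * (ball_vol TYPE('a) * 6 ^ DIM('a))"
    have "(\<integral>x. \<bar>piece e r x\<bar> \<partial>lborel) \<le> 600 * X" using piece_L1 by (simp add: X_def mult.assoc)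
    moreover have "piece_const = 2400 * X + 1" by (simp add: X_def piece_const_def mult.assoc)
    moreover have "X \<ge> 0" using c_nonneg by (simp add: X_def)
    ultimately show ?thesis by linarith
  qed
  also have "\<dots> \<le> piece_const * (norm z / r)"
    using False r piece_const_pos by (intro mult_left_mono) auto
  finally show ?thesis by simp
qed

text \<open>The integral of a directional derivative is the limit of the integrals of its difference
  quotients, and these vanish by translation invariance. Compact support and the global Lipschitz
  bound provide the dominating function. This is the only source of cancellation in the singular
  integral.\<close>

lemma piece_mean_zero: "(\<integral>x. piece e r x \<partial>lborel) = 0"
proof -
  define P where "P x = trunc r x - trunc (2 * r) x" for x
  define F where "F x = trunc' r x - trunc' (2 * r) x" for x
  have Pm[measurable]: "P \<in> borel_measurable borel" proof -
    have [measurable]: "trunc r \<in> borel_measurable borel" "trunc (2 * r) \<in> borel_measurable borel"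
      using r by (auto intro: trunc_measurable)
    show ?thesis unfolding P_def[abs_def] by measurable
  qed
  have DP: "(P has_derivative (\<lambda>h. F x \<bullet> h)) (at x)" for x
    unfolding P_def[abs_def] F_def
    using has_derivative_diff[OF trunc_deriv[OF r, of x] trunc_deriv[of "2 * r" x]] r
    by (simp add: inner_diff_left)
  define B where "B = 600 * c / r ^ DIM('a)"
  have FB: "norm (F x) \<le> B" for x
  proof -
    have "norm (F x) \<le> norm (trunc' r x) + norm (trunc' (2 * r) x)" unfolding F_def by (rule norm_triangle_ineq4)
    also have "\<dots> \<le> 300 * c / r ^ DIM('a) + 300 * c / r ^ DIM('a)"
      by (intro add_mono trunc'_bound_uniform trunc'_scale_le r)
    finally show ?thesis by (simp add: B_def)
  qed
  have PL: "\<bar>P a - P b\<bar> \<le> B * norm (a - b)" for a b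
    unfolding real_norm_def[symmetric]
  proof (rule mean_value_norm_bound[of UNIV])
    show "norm (F x \<bullet> h) \<le> B * norm h" for x h
      using order_trans[OF Cauchy_Schwarz_ineq2[of "F x" h] mult_right_mono[OF FB norm_ge_zero]] by simp
  qed (use DP in auto)
  have P0: "P x = 0" if "4 * r \<le> norm x" for x
    using that r by (simp add: P_def trunc_outside)
  have Pint: "integrable lborel P"
  proof (rule integral_bounded_support(1)[OF Pm, where R = "4 * r" and a = 0])
    have "\<bar>P x\<bar> \<le> B * (4 * r)" for x
    proof (cases "4 * r \<le> norm x")
      case True
      have "B \<ge> 0" using r c_nonneg by (simp add: B_def)
      with True P0[of x] r show ?thesis by simp
    next
      case False
      have "P 0 = 0" using r by (simp add: P_def trunc_inside)
      then have "\<bar>P x\<bar> \<le> B * norm x" using PL[of x 0] by simp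
      also have "\<dots> \<le> B * (4 * r)" using False r c_nonneg by (intro mult_left_mono) (auto simp: B_def)
      finally show ?thesis .
    qed
    then show "\<And>x. \<bar>P x\<bar> \<le> B * (4 * r)" .
  qed (use r P0 in auto)
  define h where "h n = inverse (real (Suc n))" for n
  have h: "h n > 0" "h n \<le> 1" for n by (auto simp: h_def inverse_le_1_iff)
  define Q where "Q n x = (P (x - (- h n *\<^sub>R e)) - P x) / h n" for n x
  have "(\<lambda>n. \<integral>x. Q n x \<partial>lborel) \<longlonglongrightarrow> (\<integral>x. piece e r x \<partial>lborel)"
  proof (rule integral_dominated_convergence[where w = "\<lambda>x. indicator (ball 0 (4 * r + 1)) x * B"])
    show "piece e r \<in> borel_measurable lborel" by simp
    show "Q n \<in> borel_measurable lborel" for n unfolding Q_def[abs_def] by measurable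
    show "integrable lborel (\<lambda>x. indicator (ball (0::'a) (4 * r + 1)) x * B)" by (rule integrable_indicator_ball)
    show "AE x in lborel. (\<lambda>n. Q n x) \<longlonglongrightarrow> piece e r x"
    proof (rule AE_I2)
      fix x :: 'a
      have "((\<lambda>s. x + s *\<^sub>R e) has_derivative (\<lambda>s. s *\<^sub>R e)) (at 0)"
        by (auto intro!: derivative_eq_intros)
      from has_derivative_compose[OF this, of P "\<lambda>h. F x \<bullet> h"] DP[of x]
      have "((\<lambda>s. P (x + s *\<^sub>R e)) has_derivative (\<lambda>s. F x \<bullet> (s *\<^sub>R e))) (at 0)" by simp
      moreover have "(\<lambda>s. F x \<bullet> (s *\<^sub>R e)) = (*) (piece e r x)"
        by (auto simp: piece_def F_def inner_commute)
      ultimately have "DERIV (\<lambda>s. P (x + s *\<^sub>R e)) 0 :> piece e r x"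
        by (simp add: has_field_derivative_def)
      then have lim: "((\<lambda>s. (P (x + s *\<^sub>R e) - P x) / s) \<longlongrightarrow> piece e r x) (at 0)"
        by (simp add: DERIV_def)
      have hl: "filterlim h (at 0) sequentially"
        unfolding filterlim_at using LIMSEQ_inverse_real_of_nat h
        by (auto simp: h_def[abs_def] intro!: always_eventually)
      from filterlim_compose[OF lim hl] show "(\<lambda>n. Q n x) \<longlonglongrightarrow> piece e r x" by (simp add: Q_def)
    qed
    show "AE x in lborel. norm (Q n x) \<le> indicator (ball 0 (4 * r + 1)) x * B" for n
    proof (rule AE_I2)
      fix x :: 'a
      have "\<bar>P (x - (- h n *\<^sub>R e)) - P x\<bar> \<le> B * (h n * norm e)"
        using PL[of "x - (- h n *\<^sub>R e)" x] h[of n] by simp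
      also have "\<dots> \<le> B * (h n * 1)"
        using h[of n] e r c_nonneg by (intro mult_left_mono) (auto simp: B_def)
      finally have 1: "\<bar>Q n x\<bar> \<le> B" using h[of n] by (simp add: Q_def field_simps)
      show "norm (Q n x) \<le> indicator (ball 0 (4 * r + 1)) x * B"
      proof (cases "norm x < 4 * r + 1")
        case False
        have "norm (h n *\<^sub>R e) \<le> 1" using h[of n] e mult_mono[of "h n" 1 "norm e" 1] by simp
        then have "4 * r \<le> norm (x - (- h n *\<^sub>R e))"
          using False norm_triangle_ineq2[of x "- h n *\<^sub>R e"] by simp
        then have "Q n x = 0" using False P0 by (simp add: Q_def)
        with False show ?thesis by simp
      qed (use 1 in simp)
    qed
  qed
  moreover have "(\<integral>x. Q n x \<partial>lborel) = 0" for n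
    using Pint integrable_lborel_minus(1)[OF Pint, of "- h n *\<^sub>R e"] integral_lborel_minus(1)[OF Pm, of "- h n *\<^sub>R e"]
    by (simp add: Q_def)
  ultimately show ?thesis by (simp add: LIMSEQ_const_iff)
qed

end

text \<open>The component in direction \<open>e\<close> of the singular integral with kernel
  \<open>G\<close>, smoothly truncated at scale \<open>r\<close>.\<close>

definition tau :: "'a \<Rightarrow> real \<Rightarrow> ('a \<Rightarrow> real) \<Rightarrow> 'a \<Rightarrow> real" where
  "tau e r g x = (\<integral>y. (e \<bullet> trunc' r (x - y)) * g y \<partial>lborel)"

context
  fixes e :: 'a and r :: real
  assumes e: "norm e \<le> 1" and r: "r > 0"
begin

lemma tau_integrable:
  assumes "g \<in> bdd_int"
  shows "integrable lborel (\<lambda>y. (e \<bullet> trunc' r (x - y)) * g y)"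
proof -
  have "integrable lborel (\<lambda>y. g y * (e \<bullet> trunc' r (x - y)))"
  proof (rule integrable_mult_bounded[OF bdd_int_integrable[OF assms]])
    show "(\<lambda>y. e \<bullet> trunc' r (x - y)) \<in> borel_measurable borel" using r by measurable
    show "\<bar>e \<bullet> trunc' r (x - y)\<bar> \<le> 300 * c / r ^ DIM('a)" for y
      using inner_le[OF e] trunc'_bound_uniform[OF r] order_trans by blast
  qed
  then show ?thesis by (simp add: mult.commute)
qed

lemma tau_measurable [measurable]:
  assumes [measurable]: "g \<in> borel_measurable borel"
  shows "tau e r g \<in> borel_measurable borel"
proof -
  have [measurable]: "trunc' r \<in> borel_measurable borel" using r by simp
  have "(\<lambda>x. \<integral>y. (e \<bullet> trunc' r (x - y)) * g y \<partial>lborel) \<in> borel_measurable lborel"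
    by (rule lborel.borel_measurable_lebesgue_integral) measurable
  then show ?thesis by (simp add: tau_def[abs_def])
qed

lemma abs_tau_le:
  assumes "g \<in> bdd_int"
  shows "\<bar>tau e r g x\<bar> \<le> 300 * c / r ^ DIM('a) * (\<integral>y. \<bar>g y\<bar> \<partial>lborel)"
proof -
  have "\<bar>tau e r g x\<bar> \<le> (\<integral>y. \<bar>(e \<bullet> trunc' r (x - y)) * g y\<bar> \<partial>lborel)"
    unfolding tau_def by (rule integral_abs_bound)
  also have "\<dots> \<le> (\<integral>y. 300 * c / r ^ DIM('a) * \<bar>g y\<bar> \<partial>lborel)"
  proof (rule integral_mono)
    fix y
    have "\<bar>e \<bullet> trunc' r (x - y)\<bar> \<le> 300 * c / r ^ DIM('a)"
      using inner_le[OF e] trunc'_bound_uniform[OF r] order_trans by blast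
    then show "\<bar>(e \<bullet> trunc' r (x - y)) * g y\<bar> \<le> 300 * c / r ^ DIM('a) * \<bar>g y\<bar>"
      unfolding abs_mult by (rule mult_right_mono) simp
  qed (intro integrable_abs integrable_mult_right tau_integrable bdd_int_integrable assms)+
  finally show ?thesis by simp
qed

end

lemma tau_diff_eq_sum:
  assumes e: "norm e \<le> 1" and r: "r > 0" and g: "g \<in> bdd_int"
  shows "tau e r g x - tau e (r * 2 ^ n) g x = (\<Sum>j\<in>{0..<int n}. conv (piece e (r * 2 powi j)) g x)"
proof (induction n)
  case (Suc n)
  have rn: "r * 2 ^ n > 0" using r by simp
  have "{0..<int (Suc n)} = insert (int n) {0..<int n}" by auto
  then have "(\<Sum>j\<in>{0..<int (Suc n)}. conv (piece e (r * 2 powi j)) g x)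
      = conv (piece e (r * 2 ^ n)) g x + (tau e r g x - tau e (r * 2 ^ n) g x)"
    unfolding Suc.IH by simp
  also have "conv (piece e (r * 2 ^ n)) g x = tau e (r * 2 ^ n) g x - tau e (2 * (r * 2 ^ n)) g x"
    unfolding conv_def piece_def inner_diff_right left_diff_distrib tau_def
    using tau_integrable[OF e _ g] rn by (intro Bochner_Integration.integral_diff) auto
  finally show ?case by (simp add: mult.left_commute)
qed simp

lemma tau_diff_bdd_int:
  assumes e: "norm e \<le> 1" and r: "r > 0" and g: "g \<in> bdd_int"
  shows "(\<lambda>x. tau e r g x - tau e (r * 2 ^ n) g x) \<in> bdd_int"
  unfolding tau_diff_eq_sum[OF assms]
  by (intro bdd_int_sum conv_bdd_int g piece_bdd_int e) (use r in auto)

lemma nrm_tau_diff_le: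
  assumes e: "norm e \<le> 1" and r: "r > 0" and g: "g \<in> bdd_int"
  shows "nrm (\<lambda>x. tau e r g x - tau e (r * 2 ^ n) g x) \<le> 16 * piece_const * nrm g"
  unfolding tau_diff_eq_sum[OF assms]
proof (rule dyadic_sum[where r = r])
  fix i :: int and z :: 'a
  have ri: "r * 2 powi i > 0" using r by simp
  note P = e ri
  show "piece e (r * 2 powi i) \<in> bdd_int" by (rule piece_bdd_int[OF P])
  show "(\<integral>x. piece e (r * 2 powi i) x \<partial>lborel) = 0" by (rule piece_mean_zero[OF P])
  have "600 * c * (ball_vol TYPE('a) * 6 ^ DIM('a)) \<le> piece_const"
    unfolding piece_const_def using c_nonneg
    by (intro add_increasing2 mult_right_mono) auto
  then show "(\<integral>x. \<bar>piece e (r * 2 powi i) x\<bar> \<partial>lborel) \<le> piece_const"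
    using piece_L1[OF P] by linarith
  show "integrable lborel (\<lambda>z. \<bar>piece e (r * 2 powi i) z\<bar> * norm z)" by (rule piece_moment[OF P])
  show "(\<integral>z. \<bar>piece e (r * 2 powi i) z\<bar> * norm z \<partial>lborel) \<le> piece_const * (r * 2 powi i)"
    by (rule piece_moment[OF P])
  show "(\<integral>x. \<bar>piece e (r * 2 powi i) (x - z) - piece e (r * 2 powi i) x\<bar> \<partial>lborel)
      \<le> piece_const / (r * 2 powi i) * norm z" by (rule piece_modulus[OF P])
qed (use r g piece_const_pos in auto)

text \<open>The Cotlar--Stein bound concerns finitely many scales, from \<open>r\<close> up to
  \<open>r * 2 ^ n\<close>, and is uniform in \<open>n\<close>. The truncation at the upper end
  tends to 0 pointwise by the decay of the kernel, so Fatou's lemma yields the bound for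
  \<open>tau e r g\<close>.\<close>

lemma nn_integral_tau_square_le:
  assumes e: "norm e \<le> 1" and r: "r > 0" and g: "g \<in> bdd_int"
  shows "(\<integral>\<^sup>+x. ennreal ((tau e r g x)\<^sup>2) \<partial>lborel) \<le> ennreal ((16 * piece_const)\<^sup>2 * ip g g)"
proof -
  note [measurable] = bdd_int_measurable[OF g] tau_measurable[OF e r bdd_int_measurable[OF g]]
  define D where "D n x = tau e r g x - tau e (r * 2 ^ n) g x" for n x
  have Db: "D n \<in> bdd_int" for n unfolding D_def[abs_def] by (rule tau_diff_bdd_int[OF assms])
  note [measurable] = bdd_int_measurable[OF Db]
  have lim: "(\<lambda>n. D n x) \<longlonglongrightarrow> tau e r g x" for x
  proof -
    have "(\<lambda>n. tau e (r * 2 ^ n) g x) \<longlonglongrightarrow> 0"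
    proof (rule Lim_null_comparison)
      let ?C = "300 * c / r ^ DIM('a) * (\<integral>y. \<bar>g y\<bar> \<partial>lborel)"
      show "\<forall>\<^sub>F n in sequentially. norm (tau e (r * 2 ^ n) g x) \<le> ?C * (1/2) ^ n"
      proof (rule always_eventually, rule allI)
        fix n
        have "(2::real) ^ n \<le> (2 ^ n) ^ DIM('a)"
          using power_increasing[of 1 "DIM('a)" "2 ^ n :: real"] by simp
        then have "300 * c / (r * 2 ^ n) ^ DIM('a) \<le> 300 * c / (r ^ DIM('a) * 2 ^ n)"
          unfolding power_mult_distrib using r c_nonneg
          by (intro divide_left_mono mult_left_mono mult_pos_pos) auto
        then have "300 * c / (r * 2 ^ n) ^ DIM('a) * (\<integral>y. \<bar>g y\<bar> \<partial>lborel)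
            \<le> 300 * c / (r ^ DIM('a) * 2 ^ n) * (\<integral>y. \<bar>g y\<bar> \<partial>lborel)"
          by (intro mult_right_mono) auto
        also have "\<dots> = ?C * (1/2) ^ n" by (simp add: power_divide)
        finally show "norm (tau e (r * 2 ^ n) g x) \<le> ?C * (1/2) ^ n"
          using abs_tau_le[OF e _ g, of "r * 2 ^ n" x] r by simp
      qed
      show "(\<lambda>n. ?C * (1/2) ^ n) \<longlonglongrightarrow> 0" by (intro tendsto_mult_right_zero LIMSEQ_power_zero) simp
    qed
    from tendsto_diff[OF tendsto_const this] show ?thesis by (simp add: D_def)
  qed
  have "(\<integral>\<^sup>+x. ennreal ((tau e r g x)\<^sup>2) \<partial>lborel) = (\<integral>\<^sup>+x. liminf (\<lambda>n. ennreal ((D n x)\<^sup>2)) \<partial>lborel)"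
  proof (rule nn_integral_cong)
    fix x
    have "(\<lambda>n. ennreal ((D n x)\<^sup>2)) \<longlonglongrightarrow> ennreal ((tau e r g x)\<^sup>2)"
      by (intro tendsto_ennrealI tendsto_power lim)
    from lim_imp_Liminf[OF _ this] show "ennreal ((tau e r g x)\<^sup>2) = liminf (\<lambda>n. ennreal ((D n x)\<^sup>2))" by simp
  qed
  also have "\<dots> \<le> liminf (\<lambda>n. \<integral>\<^sup>+x. ennreal ((D n x)\<^sup>2) \<partial>lborel)"
    by (rule nn_integral_liminf) measurable
  also have "\<dots> \<le> ennreal ((16 * piece_const)\<^sup>2 * ip g g)"
  proof (rule Liminf_le)
    have "(\<integral>\<^sup>+x. ennreal ((D n x)\<^sup>2) \<partial>lborel) \<le> ennreal ((16 * piece_const)\<^sup>2 * ip g g)" for n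
    proof -
      have "(\<integral>\<^sup>+x. ennreal ((D n x)\<^sup>2) \<partial>lborel) = ennreal (ip (D n) (D n))"
        unfolding ip_def power2_eq_square
        by (rule nn_integral_eq_integral) (use ip_integrable[OF Db Db] in auto)
      also have "ip (D n) (D n) = (nrm (D n))\<^sup>2" by (simp add: nrm_power2)
      also have "(nrm (D n))\<^sup>2 \<le> (16 * piece_const * nrm g)\<^sup>2"
        using nrm_tau_diff_le[OF assms, of n] by (intro power_mono) (auto simp: D_def[abs_def])
      also have "\<dots> = (16 * piece_const)\<^sup>2 * ip g g" by (simp add: power_mult_distrib nrm_power2)
      finally show ?thesis by (simp add: ennreal_leI)
    qed
    then show "\<forall>\<^sub>F n in sequentially. (\<integral>\<^sup>+x. ennreal ((D n x)\<^sup>2) \<partial>lborel) \<le> ennreal ((16 * piece_const)\<^sup>2 * ip g g)"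
      by simp
  qed simp
  finally show ?thesis .
qed

end

lemma integrable_of_nn_integral_le:
  fixes f :: "'a \<Rightarrow> real"
  assumes "f \<in> borel_measurable M" "(\<integral>\<^sup>+x. ennreal \<bar>f x\<bar> \<partial>M) \<le> ennreal C" "C \<ge> 0"
  shows "integrable M f" "(\<integral>x. \<bar>f x\<bar> \<partial>M) \<le> C"
proof -
  show 1: "integrable M f"
    unfolding integrable_iff_bounded using assms by (auto intro: le_less_trans)
  have "ennreal (\<integral>x. \<bar>f x\<bar> \<partial>M) = (\<integral>\<^sup>+x. ennreal \<bar>f x\<bar> \<partial>M)"
    using 1 by (intro nn_integral_eq_integral[symmetric]) auto
  with assms(2,3) show "(\<integral>x. \<bar>f x\<bar> \<partial>M) \<le> C" by (metis ennreal_le_iff)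
qed

lemma integral_inverse_max_norm:
  assumes "r > 0"
  shows "integrable lborel (\<lambda>x::'a::euclidean_space. 1 / max (norm x) r ^ (DIM('a) + 1))"
    "(\<integral>x. 1 / max (norm (x::'a::euclidean_space)) r ^ (DIM('a) + 1) \<partial>lborel) \<le> ball_vol TYPE('a) * (2 ^ (DIM('a) + 2) / r)"
proof -
  have *: "\<bar>1 / max (norm x) r ^ (DIM('a) + 1)\<bar> = 1 / max (norm x) r ^ (DIM('a) + 1)" for x :: 'a
    using assms by (intro abs_of_nonneg) auto
  have 1: "(\<lambda>x::'a. 1 / max (norm x) r ^ (DIM('a) + 1)) \<in> borel_measurable lborel" by measurable
  have 2: "(\<integral>\<^sup>+x. ennreal \<bar>1 / max (norm x) r ^ (DIM('a) + 1)\<bar> \<partial>(lborel::'a measure)) \<le> ennreal (ball_vol TYPE('a) * (2 ^ (DIM('a) + 2) / r))"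
    unfolding * by (rule nn_integral_inverse_max_norm[OF assms])
  show "integrable lborel (\<lambda>x::'a. 1 / max (norm x) r ^ (DIM('a) + 1))"
    "(\<integral>x. 1 / max (norm (x::'a)) r ^ (DIM('a) + 1) \<partial>lborel) \<le> ball_vol TYPE('a) * (2 ^ (DIM('a) + 2) / r)"
    using integrable_of_nn_integral_le[OF 1 2] assms unfolding * by auto
qed

lemma ex_dyadic_scale:
  fixes d :: real
  assumes "d > 0"
  obtains k :: int where "d \<le> 2 powi k" "2 powi k \<le> 2 * d"
proof
  let ?k = "\<lceil>log 2 d\<rceil>"
  have eq: "(2::real) powi ?k = 2 powr real_of_int ?k" by (rule powr_real_of_int'[symmetric]) auto
  have "d = 2 powr (log 2 d)" using assms by simp
  also have "\<dots> \<le> 2 powr real_of_int ?k" by (intro powr_mono) auto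
  finally show "d \<le> 2 powi ?k" by (simp add: eq)
  have "2 powr real_of_int ?k \<le> 2 powr (log 2 d + 1)" by (intro powr_mono) auto
  also have "\<dots> = 2 * d" using assms by (simp add: powr_add)
  finally show "2 powi ?k \<le> 2 * d" by (simp add: eq)
qed

section \<open>The maximal truncation\<close>

context CZ_kernel
begin

text \<open>At its own scale a truncation of a function bounded by \<open>t\<close> varies by
  \<open>O(t)\<close>: the increment of the kernel is at most a constant times \<open>r\<close>
  times the weight of \<open>trunc'_diff\<close>, whose integral is of order
  \<open>1 / r\<close>.\<close>

lemma tau_oscillation:
  assumes e: "norm e \<le> 1" and r: "r > 0" and g: "g \<in> bdd_int" "\<And>x. \<bar>g x\<bar> \<le> t" and xz: "norm (x - z) \<le> r"
  shows "\<bar>tau e r g x - tau e r g z\<bar> \<le> 300 * c * 2 ^ (2 * DIM('a) + 3) * ball_vol TYPE('a) * t"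
proof -
  let ?n = "DIM('a)"
  let ?W = "\<lambda>y. 1 / max (norm (x - y)) r ^ (?n + 1)"
  have t: "t \<ge> 0" using g(2) abs_ge_zero order_trans by blast
  have W: "integrable lborel ?W" "(\<integral>y. ?W y \<partial>lborel) \<le> ball_vol TYPE('a) * (2 ^ (?n + 2) / r)"
    using integrable_lborel_minus(2)[OF integral_inverse_max_norm(1)[OF r, where 'a='a], of x]
      integral_lborel_minus(2)[of "\<lambda>y::'a. 1 / max (norm y) r ^ (?n + 1)" x] integral_inverse_max_norm(2)[OF r, where 'a='a]
    by auto
  note int = tau_integrable[OF e r g(1)]
  have "tau e r g x - tau e r g z = (\<integral>y. (e \<bullet> trunc' r (x - y)) * g y - (e \<bullet> trunc' r (z - y)) * g y \<partial>lborel)"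
    unfolding tau_def by (rule Bochner_Integration.integral_diff[symmetric]) (rule int)+
  then have "\<bar>tau e r g x - tau e r g z\<bar> \<le> (\<integral>y. \<bar>(e \<bullet> trunc' r (x - y)) * g y - (e \<bullet> trunc' r (z - y)) * g y\<bar> \<partial>lborel)"
    by (simp only:) (rule integral_abs_bound)
  also have "\<dots> \<le> (\<integral>y. (300 * c * 2 ^ (?n + 1) * r * t) * ?W y \<partial>lborel)"
  proof (rule integral_mono)
    show "integrable lborel (\<lambda>y. \<bar>(e \<bullet> trunc' r (x - y)) * g y - (e \<bullet> trunc' r (z - y)) * g y\<bar>)"
      by (intro integrable_abs Bochner_Integration.integrable_diff int)
    show "integrable lborel (\<lambda>y. (300 * c * 2 ^ (?n + 1) * r * t) * ?W y)"
      by (rule integrable_mult_right[OF W(1)])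
    fix y
    have "\<bar>(e \<bullet> trunc' r (x - y)) * g y - (e \<bullet> trunc' r (z - y)) * g y\<bar> = \<bar>e \<bullet> (trunc' r (x - y) - trunc' r (z - y))\<bar> * \<bar>g y\<bar>"
      by (simp add: inner_diff_right left_diff_distrib[symmetric] abs_mult)
    also have "\<dots> \<le> (300 * c * 2 ^ (?n + 1) * ?W y * r) * t"
    proof (rule mult_mono)
      have "\<bar>e \<bullet> (trunc' r (x - y) - trunc' r (z - y))\<bar> \<le> norm (trunc' r (x - y) - trunc' r (z - y))" by (rule inner_le[OF e])
      also have "\<dots> \<le> 300 * c * 2 ^ (?n + 1) / max (norm (x - y)) r ^ (?n + 1) * norm ((x - y) - (z - y))"
        by (rule trunc'_diff[OF r]) (use xz in simp)
      also have "\<dots> \<le> 300 * c * 2 ^ (?n + 1) / max (norm (x - y)) r ^ (?n + 1) * r"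
        using xz r c_nonneg by (intro mult_left_mono) (auto intro!: divide_nonneg_nonneg)
      finally show "\<bar>e \<bullet> (trunc' r (x - y) - trunc' r (z - y))\<bar> \<le> 300 * c * 2 ^ (?n + 1) * ?W y * r" by simp
      show "0 \<le> 300 * c * 2 ^ (?n + 1) * ?W y * r" using r c_nonneg by (intro mult_nonneg_nonneg divide_nonneg_nonneg) auto
    qed (use g in auto)
    finally show "\<bar>(e \<bullet> trunc' r (x - y)) * g y - (e \<bullet> trunc' r (z - y)) * g y\<bar> \<le> (300 * c * 2 ^ (?n + 1) * r * t) * ?W y"
      by (simp add: ac_simps)
  qed
  also have "\<dots> = (300 * c * 2 ^ (?n + 1) * r * t) * (\<integral>y. ?W y \<partial>lborel)" by (rule integral_mult_right_zero)
  also have "\<dots> \<le> (300 * c * 2 ^ (?n + 1) * r * t) * (ball_vol TYPE('a) * (2 ^ (?n + 2) / r))"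
    using r c_nonneg t by (intro mult_left_mono W) auto
  also have "\<dots> = 300 * c * (2 ^ (?n + 1) * 2 ^ (?n + 2)) * ball_vol TYPE('a) * t" using r by (simp add: field_simps)
  also have "(2::real) ^ (?n + 1) * 2 ^ (?n + 2) = 2 ^ (2 * ?n + 3)" by (simp add: power_add power_even_eq power2_eq_square)
  finally show ?thesis .
qed

text \<open>The first summand bounds the oscillation and the last one the local L^2 norm. The 3
  collects one \<open>t\<close> from the mean of the square on a cell that is not dense and one from
  each of the two uses of \<open>abs_le_square_div\<close>.\<close>

definition max_const :: real where
  "max_const = 300 * c * 2 ^ (2 * DIM('a) + 3) * ball_vol TYPE('a) + 3
     + (16 * piece_const)\<^sup>2 * (ball_vol TYPE('a) * (6 * real DIM('a)) ^ DIM('a))"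

text \<open>An upper bound for the diameter of the cells of level \<open>k\<close>, in the form
  given by \<open>norm_diff_cell\<close>.\<close>

definition scale :: "int \<Rightarrow> real" where
  "scale k = real DIM('a) * 2 powi k"

lemma scale_pos: "scale k > 0"
  by (simp add: scale_def)

definition square_measure :: "'a \<Rightarrow> real \<Rightarrow> ('a \<Rightarrow> real) \<Rightarrow> 'a measure" where
  "square_measure e r g = density lborel (\<lambda>x. ennreal ((tau e r g x)\<^sup>2))"

lemma square_measure:
  assumes e: "norm e \<le> 1" and r: "r > 0" and g: "g \<in> bdd_int"
  shows "finite_measure (square_measure e r g)" "sets (square_measure e r g) = sets borel"
    "measure (square_measure e r g) UNIV \<le> (16 * piece_const)\<^sup>2 * ip g g"
    "integrable lborel (\<lambda>x. (tau e r g x)\<^sup>2)"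
    "A \<in> sets borel \<Longrightarrow> measure (square_measure e r g) A = (\<integral>x. indicator A x * (tau e r g x)\<^sup>2 \<partial>lborel)"
proof -
  note [measurable] = bdd_int_measurable[OF g] tau_measurable[OF e r bdd_int_measurable[OF g]]
  note le = nn_integral_tau_square_le[OF assms]
  show int: "integrable lborel (\<lambda>x. (tau e r g x)\<^sup>2)"
    by (rule integrable_of_nn_integral_le(1)[of _ _ "(16 * piece_const)\<^sup>2 * ip g g"]) (use le ip_nonneg[of g] in auto)
  have em: "emeasure (square_measure e r g) A = ennreal (\<integral>x. indicator A x * (tau e r g x)\<^sup>2 \<partial>lborel)"
    if A: "A \<in> sets borel" for A
  proof -
    have "emeasure (square_measure e r g) A = (\<integral>\<^sup>+x. ennreal ((tau e r g x)\<^sup>2) * indicator A x \<partial>lborel)"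
      unfolding square_measure_def using A by (intro emeasure_density) auto
    also have "\<dots> = (\<integral>\<^sup>+x. ennreal (indicator A x * (tau e r g x)\<^sup>2) \<partial>lborel)"
      by (intro nn_integral_cong) (auto split: split_indicator)
    also have "\<dots> = ennreal (\<integral>x. indicator A x * (tau e r g x)\<^sup>2 \<partial>lborel)"
      using A integrable_real_mult_indicator[OF _ int, of A] by (intro nn_integral_eq_integral) (auto simp: mult.commute)
    finally show ?thesis .
  qed
  show "sets (square_measure e r g) = sets borel" by (simp add: square_measure_def)
  show fin: "finite_measure (square_measure e r g)"
    using em[of UNIV] by (intro finite_measureI) (auto simp: square_measure_def)
  show eq: "measure (square_measure e r g) A = (\<integral>x. indicator A x * (tau e r g x)\<^sup>2 \<partial>lborel)"
    if "A \<in> sets borel" for A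
    unfolding measure_def em[OF that] by (intro enn2real_ennreal integral_nonneg_AE) auto
  have "ennreal (\<integral>x. (tau e r g x)\<^sup>2 \<partial>lborel) \<le> ennreal ((16 * piece_const)\<^sup>2 * ip g g)"
    using le int by (subst nn_integral_eq_integral[symmetric]) auto
  then show "measure (square_measure e r g) UNIV \<le> (16 * piece_const)\<^sup>2 * ip g g"
    using eq[of UNIV] ip_nonneg[of g] by (simp add: ennreal_le_iff)
qed

lemma abs_le_square_div: "t > 0 \<Longrightarrow> \<bar>a\<bar> \<le> a\<^sup>2 / t + t" for a t :: real
proof -
  assume t: "t > 0"
  have "2 * (\<bar>a\<bar> * t) \<le> a\<^sup>2 + t\<^sup>2" using sum_squares_bound[of "\<bar>a\<bar>" t] by simp
  moreover have "0 \<le> \<bar>a\<bar> * t" using t by simp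
  ultimately have "\<bar>a\<bar> * t \<le> a\<^sup>2 + t * t" unfolding power2_eq_square[of t] by linarith
  then have "\<bar>a\<bar> \<le> (a\<^sup>2 + t * t) / t" using t by (simp add: pos_le_divide_eq)
  then show ?thesis using t by (simp add: add_divide_distrib)
qed

text \<open>A dyadic form of Cotlar's inequality. For \<open>z\<close> in the cell of
  \<open>x\<close>, the value at \<open>x\<close> equals
  \<open>tau e \<rho> g x - tau e \<rho> g z\<close> plus \<open>tau e (scale m) g z\<close> minus
  \<open>D z\<close>; the absolute values are averaged over the cell. The first term is an
  oscillation at the right scale, the second has a small mean square because the cell is not dense,
  and the third depends only on \<open>g\<close> near the cell, where the L^2 bound costs
  \<open>t ^ 2\<close> times the volume.\<close>

lemma tau_le_off_dense_cells:
  assumes e: "norm e \<le> 1" and t: "t > 0" and g: "g \<in> bdd_int" "\<And>x. \<bar>g x\<bar> \<le> t" and mk: "m \<le> k"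
    and x: "x \<notin> dense_cells (square_measure e (scale m) g) (t\<^sup>2)"
  shows "\<bar>tau e (scale k) g x\<bar> \<le> max_const * t"
proof -
  let ?n = "DIM('a)"
  define Q where "Q = cell k x"
  define q where "q = (2 powi k :: real) ^ ?n"
  define \<rho> where "\<rho> = scale k"
  define n where "n = nat (k - m)"
  have q: "q > 0" by (simp add: q_def)
  have \<rho>: "\<rho> > 0" by (simp add: \<rho>_def scale_pos)
  have \<rho>n: "\<rho> = scale m * 2 ^ n"
    using power_int_add[of "2::real" m "int n"] mk by (simp add: \<rho>_def n_def scale_def power_int_def)
  have Qm[measurable]: "Q \<in> sets borel" by (simp add: Q_def)
  have Qi: "integrable lborel (\<lambda>z. indicator Q z * C)" "(\<integral>z. indicator Q z * C \<partial>lborel) = C * q" for C :: real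
    using emeasure_cell[of k x] q by (auto simp: Q_def q_def measure_def)
  \<comment> \<open>For \<open>z\<close> in the cell and \<open>y\<close> outside this ball,
    \<open>norm (z - y)\<close> is at least \<open>5 * \<rho>\<close>, beyond
    \<open>2 * \<rho>\<close>, from where both truncated kernels equal \<open>G\<close>. Their
    difference therefore sees only the restriction of \<open>g\<close> to the ball.\<close>
  define B where "B = ball x (6 * \<rho>)"
  define gB where "gB y = g y * indicator B y" for y
  have gB: "gB \<in> bdd_int"
    unfolding gB_def[abs_def] by (rule bdd_int_mult_bounded[OF g(1), of _ 1]) (auto simp: B_def intro!: borel_measurable_indicator split: split_indicator)
  define D where "D z = tau e (scale m) gB z - tau e (scale m * 2 ^ n) gB z" for z
  have D: "D \<in> bdd_int" unfolding D_def[abs_def] by (rule tau_diff_bdd_int[OF e scale_pos gB])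
  define C1 where "C1 = 300 * c * 2 ^ (2 * ?n + 3) * ball_vol TYPE('a)"
  define C2 where "C2 = (16 * piece_const)\<^sup>2 * (ball_vol TYPE('a) * (6 * real ?n) ^ ?n)"
  have local: "tau e (scale m) g z - tau e \<rho> g z = D z" if z: "z \<in> Q" for z
  proof -
    have zx: "norm (x - z) \<le> \<rho>"
      using norm_diff_cell[OF cell_self, of z k x] z by (simp add: Q_def \<rho>_def scale_def)
    have "tau e (scale m) g z - tau e \<rho> g z = (\<integral>y. (e \<bullet> (trunc' (scale m) (z - y) - trunc' \<rho> (z - y))) * g y \<partial>lborel)"
      unfolding inner_diff_right left_diff_distrib tau_def
      by (intro Bochner_Integration.integral_diff[symmetric] tau_integrable e \<rho> scale_pos g)
    also have "\<dots> = (\<integral>y. (e \<bullet> (trunc' (scale m) (z - y) - trunc' \<rho> (z - y))) * gB y \<partial>lborel)"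
    proof (rule Bochner_Integration.integral_cong[OF refl])
      fix y
      show "(e \<bullet> (trunc' (scale m) (z - y) - trunc' \<rho> (z - y))) * g y = (e \<bullet> (trunc' (scale m) (z - y) - trunc' \<rho> (z - y))) * gB y"
      proof (cases "y \<in> B")
        case False
        then have "6 * \<rho> \<le> norm (x - y)" by (simp add: B_def dist_norm)
        then have far: "2 * \<rho> \<le> norm (z - y)"
          using zx \<rho> norm_triangle_ineq[of "x - z" "z - y"] by simp
        have "scale m \<le> \<rho>" unfolding \<rho>n using scale_pos[of m] by simp
        then have "2 * scale m \<le> norm (z - y)" using far by simp
        with far show ?thesis using \<rho> scale_pos[of m] by (simp add: trunc_outside)
      qed (simp add: gB_def)
    qed
    also have "\<dots> = D z"
      unfolding inner_diff_right left_diff_distrib D_def \<rho>n[symmetric] tau_def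
      by (intro Bochner_Integration.integral_diff tau_integrable e \<rho> scale_pos gB)
    finally show ?thesis .
  qed
  have pt: "indicator Q z * \<bar>tau e \<rho> g x\<bar>
      \<le> indicator Q z * ((C1 + 2) * t) + (1 / t * (indicator Q z * (tau e (scale m) g z)\<^sup>2) + 1 / t * (D z * D z))" for z
  proof (cases "z \<in> Q")
    case True
    then have zx: "norm (x - z) \<le> \<rho>"
      using norm_diff_cell[OF cell_self, of z k x] by (simp add: Q_def \<rho>_def scale_def)
    have 1: "\<bar>tau e \<rho> g x - tau e \<rho> g z\<bar> \<le> C1 * t"
      unfolding C1_def by (rule tau_oscillation[OF e \<rho> g zx])
    have "\<bar>tau e \<rho> g x\<bar> \<le> \<bar>tau e \<rho> g x - tau e \<rho> g z\<bar> + \<bar>tau e (scale m) g z\<bar> + \<bar>D z\<bar>"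
      using local[OF True] by linarith
    also have "\<dots> \<le> C1 * t + ((tau e (scale m) g z)\<^sup>2 / t + t) + ((D z)\<^sup>2 / t + t)"
      by (intro add_mono 1 abs_le_square_div t)
    finally show ?thesis using True by (simp add: power2_eq_square algebra_simps)
  next
    case False
    then show ?thesis using t by simp
  qed
  note sm = square_measure[OF e scale_pos[of m] g(1)]
  have Qt: "integrable lborel (\<lambda>z. indicator Q z * (tau e (scale m) g z)\<^sup>2)"
    using integrable_real_mult_indicator[OF _ sm(4), of Q] by (simp add: mult.commute)
  have ipgB: "ip gB gB \<le> t\<^sup>2 * (ball_vol TYPE('a) * (6 * \<rho>) ^ ?n)"
  proof -
    have "ip gB gB \<le> (\<integral>y. indicator B y * t\<^sup>2 \<partial>lborel)"
      unfolding ip_def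
    proof (rule integral_mono)
      fix y
      have "\<bar>g y\<bar> * \<bar>g y\<bar> \<le> t * t" using g(2)[of y] t by (intro mult_mono) auto
      then show "gB y * gB y \<le> indicator B y * t\<^sup>2"
        by (auto simp: gB_def power2_eq_square split: split_indicator)
    qed (use ip_integrable[OF gB gB] integrable_indicator_ball[of x "6 * \<rho>"] in \<open>auto simp: B_def\<close>)
    also have "\<dots> = t\<^sup>2 * (ball_vol TYPE('a) * (6 * \<rho>) ^ ?n)"
      unfolding B_def using \<rho> by (intro integral_indicator_ball) auto
    finally show ?thesis .
  qed
  have ipD: "ip D D \<le> C2 * t\<^sup>2 * q"
  proof -
    have "ip D D = (nrm D)\<^sup>2" by (simp add: nrm_power2)
    also have "\<dots> \<le> (16 * piece_const * nrm gB)\<^sup>2"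
      using nrm_tau_diff_le[OF e scale_pos gB, of m n] by (intro power_mono) (auto simp: D_def[abs_def])
    also have "\<dots> = (16 * piece_const)\<^sup>2 * ip gB gB" by (simp add: power_mult_distrib nrm_power2)
    also have "\<dots> \<le> (16 * piece_const)\<^sup>2 * (t\<^sup>2 * (ball_vol TYPE('a) * (6 * \<rho>) ^ ?n))"
      by (intro mult_left_mono ipgB) auto
    also have "(6 * \<rho>) ^ ?n = (6 * real ?n) ^ ?n * q"
      by (simp add: \<rho>_def scale_def q_def power_mult_distrib)
    finally show ?thesis by (simp add: C2_def ac_simps)
  qed
  have "\<bar>tau e \<rho> g x\<bar> * q = (\<integral>z. indicator Q z * \<bar>tau e \<rho> g x\<bar> \<partial>lborel)" by (simp only: Qi)
  also have "\<dots> \<le> (\<integral>z. indicator Q z * ((C1 + 2) * t) + (1 / t * (indicator Q z * (tau e (scale m) g z)\<^sup>2) + 1 / t * (D z * D z)) \<partial>lborel)"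
    by (rule integral_mono[OF Qi(1) _ pt])
       (intro Bochner_Integration.integrable_add Qi integrable_mult_right Qt ip_integrable D)
  also have "\<dots> = (\<integral>z. indicator Q z * ((C1 + 2) * t) \<partial>lborel)
      + ((\<integral>z. 1 / t * (indicator Q z * (tau e (scale m) g z)\<^sup>2) \<partial>lborel) + (\<integral>z. 1 / t * (D z * D z) \<partial>lborel))"
    by (subst Bochner_Integration.integral_add Bochner_Integration.integral_add;
        intro Bochner_Integration.integrable_add Qi integrable_mult_right Qt ip_integrable D arg_cong2[of _ _ _ _ "(+)"] refl Bochner_Integration.integral_add)
  also have "\<dots> = (C1 + 2) * t * q + (1 / t * measure (square_measure e (scale m) g) Q + 1 / t * ip D D)"
    by (simp only: Qi integral_mult_right_zero sm(5)[OF Qm] ip_def)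
  also have "\<dots> \<le> (C1 + 2) * t * q + (1 / t * (t\<^sup>2 * q) + 1 / t * (C2 * t\<^sup>2 * q))"
    using measure_cell_le[OF x, of k] ipD t unfolding Q_def[symmetric] q_def[symmetric]
    by (intro add_mono mult_left_mono order_refl) auto
  also have "\<dots> = (max_const * t) * q"
  proof -
    have "max_const = C1 + 3 + C2" by (simp add: max_const_def C1_def C2_def)
    then show ?thesis using t by (simp only:) (simp add: power2_eq_square algebra_simps)
  qed
  finally show ?thesis using q by (simp add: \<rho>_def)
qed

text \<open>The comparison needs a finest scale, so only the scales from \<open>- int n\<close>
  upwards are treated at a time; the bound does not depend on \<open>n\<close> and the sets
  increase. Since \<open>g\<close> is bounded by \<open>t\<close>, its squared L^2 norm is at most
  \<open>t\<close> times its L^1 norm, which turns the quadratic weak type bound at height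
  \<open>t ^ 2\<close> into a linear one.\<close>

lemma maximal_tau:
  assumes e: "norm e \<le> 1" and t: "t > 0" and g: "g \<in> bdd_int" "\<And>x. \<bar>g x\<bar> \<le> t"
  obtains E where "E \<in> sets borel" "emeasure lborel E \<le> ennreal ((16 * piece_const)\<^sup>2 * (\<integral>x. \<bar>g x\<bar> \<partial>lborel) / t)"
    "\<And>x k. x \<notin> E \<Longrightarrow> \<bar>tau e (scale k) g x\<bar> \<le> max_const * t"
proof -
  note [measurable] = bdd_int_measurable[OF g(1)] tau_measurable[OF e scale_pos bdd_int_measurable[OF g(1)]]
  define F where "F n = {x. \<exists>k\<ge>- int n. \<bar>tau e (scale k) g x\<bar> > max_const * t}" for n
  let ?C = "(16 * piece_const)\<^sup>2 * (\<integral>x. \<bar>g x\<bar> \<partial>lborel) / t"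
  have Fm: "F n \<in> sets borel" for n
    unfolding F_def by measurable
  have ipg: "ip g g \<le> t * (\<integral>x. \<bar>g x\<bar> \<partial>lborel)"
    unfolding ip_def integral_mult_right_zero[symmetric]
  proof (rule integral_mono)
    show "g x * g x \<le> t * \<bar>g x\<bar>" for x
      using mult_right_mono[OF g(2)[of x], of "\<bar>g x\<bar>"] by simp
  qed (use ip_integrable[OF g(1) g(1)] bdd_int_integrable[OF g(1)] in auto)
  have Fle: "emeasure lborel (F n) \<le> ennreal ?C" for n
  proof -
    note sm = square_measure[OF e scale_pos[of "- int n"] g(1)]
    have "F n \<subseteq> dense_cells (square_measure e (scale (- int n)) g) (t\<^sup>2)"
      using tau_le_off_dense_cells[OF e t g, of "- int n"] by (force simp: F_def)
    then have "emeasure lborel (F n) \<le> emeasure lborel (dense_cells (square_measure e (scale (- int n)) g) (t\<^sup>2))"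
      using t dense_cells_borel[OF sm(1,2)] by (intro emeasure_mono) auto
    also have "\<dots> \<le> ennreal (measure (square_measure e (scale (- int n)) g) UNIV / t\<^sup>2)"
      using t by (intro emeasure_dense_cells_le sm) auto
    also have "\<dots> \<le> ennreal ?C"
    proof (rule ennreal_leI)
      have "measure (square_measure e (scale (- int n)) g) UNIV \<le> (16 * piece_const)\<^sup>2 * (t * (\<integral>x. \<bar>g x\<bar> \<partial>lborel))"
        by (rule order_trans[OF sm(3)]) (intro mult_left_mono ipg, auto)
      then have "measure (square_measure e (scale (- int n)) g) UNIV / t\<^sup>2 \<le> (16 * piece_const)\<^sup>2 * (t * (\<integral>x. \<bar>g x\<bar> \<partial>lborel)) / t\<^sup>2"
        by (rule divide_right_mono) simp
      also have "\<dots> = ?C" using t by (simp add: power2_eq_square)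
      finally show "measure (square_measure e (scale (- int n)) g) UNIV / t\<^sup>2 \<le> ?C" .
    qed
    finally show ?thesis .
  qed
  show thesis
  proof (rule that[of "\<Union>n. F n"])
    show "(\<Union>n. F n) \<in> sets borel" using Fm by auto
    have "incseq F"
    proof (rule monoI, rule subsetI)
      fix i j :: nat and x assume "i \<le> j" "x \<in> F i"
      then obtain k where "k \<ge> - int i" "\<bar>tau e (scale k) g x\<bar> > max_const * t" by (auto simp: F_def)
      with \<open>i \<le> j\<close> show "x \<in> F j" by (auto simp: F_def intro!: exI[of _ k])
    qed
    then have "emeasure lborel (\<Union>n. F n) = (SUP n. emeasure lborel (F n))"
      using Fm by (intro SUP_emeasure_incseq[symmetric]) auto
    also have "\<dots> \<le> ennreal ?C" by (intro SUP_least Fle)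
    finally show "emeasure lborel (\<Union>n. F n) \<le> ennreal ?C" .
    fix x k assume "x \<notin> (\<Union>n. F n)"
    then have "x \<notin> F (nat (- k))" by blast
    then show "\<bar>tau e (scale k) g x\<bar> \<le> max_const * t"
      by (auto simp: F_def not_less)
  qed
qed

subsection \<open>Potentials of bounded functions\<close>

definition pot :: "('a \<Rightarrow> real) \<Rightarrow> 'a \<Rightarrow> real" where
  "pot g x = (\<integral>y. K (x - y) * g y \<partial>lborel)"

lemma near_part:
  assumes r: "r > 0"
  shows "integrable lborel (\<lambda>x. K x - trunc r x)"
    "(\<integral>x. \<bar>K x - trunc r x\<bar> \<partial>lborel) \<le> c * (ball_vol TYPE('a) * (2 ^ DIM('a) * (2 * r)))"
proof -
  have [measurable]: "trunc r \<in> borel_measurable borel" using r by (rule trunc_measurable)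
  have m: "(\<lambda>x. K x - trunc r x) \<in> borel_measurable lborel" by measurable
  have pt: "ennreal \<bar>K x - trunc r x\<bar> \<le> ennreal c * (ennreal (1 / norm x ^ (DIM('a) - 1)) * indicator (ball 0 (2 * r)) x)"
    if x: "x \<noteq> 0" for x
  proof (cases "2 * r \<le> norm x")
    case True
    then show ?thesis using r by (simp add: trunc_outside)
  next
    case False
    define s where "s = smoothstep (x \<bullet> x / r\<^sup>2 - 1)"
    have s: "0 \<le> s" "s \<le> 1" by (auto simp: s_def smoothstep_bounds)
    have "K x - trunc r x = (1 - s) * K x" by (simp add: trunc_def s_def algebra_simps)
    then have "\<bar>K x - trunc r x\<bar> = (1 - s) * \<bar>K x\<bar>" using s by (simp add: abs_mult)
    also have "\<dots> \<le> 1 * (c / norm x ^ (DIM('a) - 1))" using s K_bound[OF x] by (intro mult_mono) auto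
    finally have "\<bar>K x - trunc r x\<bar> \<le> c * (1 / norm x ^ (DIM('a) - 1))" by simp
    then have "ennreal \<bar>K x - trunc r x\<bar> \<le> ennreal c * ennreal (1 / norm x ^ (DIM('a) - 1))"
      using c_nonneg by (subst ennreal_mult[symmetric]) (auto intro!: ennreal_leI)
    then show ?thesis using False by simp
  qed
  have "(\<integral>\<^sup>+x. ennreal \<bar>K x - trunc r x\<bar> \<partial>lborel)
      \<le> (\<integral>\<^sup>+x. ennreal c * (ennreal (1 / norm x ^ (DIM('a) - 1)) * indicator (ball 0 (2 * r)) x) \<partial>(lborel :: 'a measure))"
  proof (rule nn_integral_mono_AE)
    show "AE x in lborel. ennreal \<bar>K x - trunc r x\<bar>
        \<le> ennreal c * (ennreal (1 / norm x ^ (DIM('a) - 1)) * indicator (ball 0 (2 * r)) x)"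
      using AE_lborel_singleton[of "0::'a"] by eventually_elim (rule pt)
  qed
  also have "\<dots> = ennreal c * (\<integral>\<^sup>+x. ennreal (1 / norm x ^ (DIM('a) - 1)) * indicator (ball 0 (2 * r)) x \<partial>(lborel::'a measure))"
    by (rule nn_integral_cmult) (intro borel_measurable_times_ennreal borel_measurable_indicator, auto)
  also have "\<dots> \<le> ennreal c * ennreal (ball_vol TYPE('a) * (2 ^ DIM('a) * (2 * r)))"
    using r by (intro mult_left_mono nn_integral_inverse_norm_ball) auto
  also have "\<dots> = ennreal (c * (ball_vol TYPE('a) * (2 ^ DIM('a) * (2 * r))))"
    using r c_nonneg by (subst ennreal_mult) auto
  finally have *: "(\<integral>\<^sup>+x. ennreal \<bar>K x - trunc r x\<bar> \<partial>lborel) \<le> ennreal (c * (ball_vol TYPE('a) * (2 ^ DIM('a) * (2 * r))))" .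
  show "integrable lborel (\<lambda>x. K x - trunc r x)"
    "(\<integral>x. \<bar>K x - trunc r x\<bar> \<partial>lborel) \<le> c * (ball_vol TYPE('a) * (2 ^ DIM('a) * (2 * r)))"
    using integrable_of_nn_integral_le[OF m *] r c_nonneg by auto
qed

lemma trunc_bound_uniform:
  assumes r: "r > 0" shows "\<bar>trunc r x\<bar> \<le> c / r ^ (DIM('a) - 1)"
proof (cases "norm x \<le> r")
  case True
  then show ?thesis using r c_nonneg by (simp add: trunc_inside)
next
  case False
  then have x: "x \<noteq> 0" using r by auto
  have "c / norm x ^ (DIM('a) - 1) \<le> c / r ^ (DIM('a) - 1)"
    using False r c_nonneg x by (intro divide_left_mono power_mono mult_pos_pos) auto
  with trunc_bound[OF x, of r] show ?thesis by linarith
qed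

lemma near_integrable:
  assumes r: "r > 0" and g: "g \<in> bdd_int" "\<And>x. \<bar>g x\<bar> \<le> t"
  shows "integrable lborel (\<lambda>y. (K (x - y) - trunc r (x - y)) * g y)"
    "\<bar>\<integral>y. (K (x - y) - trunc r (x - y)) * g y \<partial>lborel\<bar> \<le> c * (ball_vol TYPE('a) * (2 ^ DIM('a) * (2 * r))) * t"
proof -
  have [measurable]: "trunc r \<in> borel_measurable borel" using r by (rule trunc_measurable)
  note i = integrable_lborel_minus(2)[OF near_part(1)[OF r], of x]
  show 1: "integrable lborel (\<lambda>y. (K (x - y) - trunc r (x - y)) * g y)"
    by (rule integrable_mult_bounded[OF i bdd_int_measurable[OF g(1)] g(2)])
  have "\<bar>\<integral>y. (K (x - y) - trunc r (x - y)) * g y \<partial>lborel\<bar> \<le> (\<integral>y. \<bar>(K (x - y) - trunc r (x - y)) * g y\<bar> \<partial>lborel)"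
    by (rule integral_abs_bound)
  also have "\<dots> \<le> (\<integral>y. \<bar>K (x - y) - trunc r (x - y)\<bar> * t \<partial>lborel)"
    by (rule integral_mono[OF integrable_abs[OF 1] integrable_mult_left[OF integrable_abs[OF i]]])
       (unfold abs_mult, intro mult_left_mono g, simp)
  also have "\<dots> = (\<integral>y. \<bar>K y - trunc r y\<bar> \<partial>lborel) * t"
    using integral_lborel_minus(2)[of "\<lambda>y. \<bar>K y - trunc r y\<bar>" x] by simp
  also have "\<dots> \<le> c * (ball_vol TYPE('a) * (2 ^ DIM('a) * (2 * r))) * t"
    using g(2)[of 0] by (intro mult_right_mono near_part r) auto
  finally show "\<bar>\<integral>y. (K (x - y) - trunc r (x - y)) * g y \<partial>lborel\<bar> \<le> c * (ball_vol TYPE('a) * (2 ^ DIM('a) * (2 * r))) * t" .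
qed

lemma trunc_mult_integrable:
  assumes r: "r > 0" and g: "integrable lborel g"
  shows "integrable lborel (\<lambda>y. trunc r (x - y) * g y)"
proof -
  have [measurable]: "trunc r \<in> borel_measurable borel" using r by (rule trunc_measurable)
  have "integrable lborel (\<lambda>y. g y * trunc r (x - y))"
    by (rule integrable_mult_bounded[OF g _ trunc_bound_uniform[OF r]]) measurable
  then show ?thesis by (simp add: mult.commute)
qed

lemma pot_integrable:
  assumes g: "g \<in> bdd_int" shows "integrable lborel (\<lambda>y. K (x - y) * g y)"
proof -
  obtain t where t: "\<And>x. \<bar>g x\<bar> \<le> t" using bdd_int_bound[OF g] by blast
  from Bochner_Integration.integrable_add[OF near_integrable(1)[OF zero_less_one g t] trunc_mult_integrable[OF zero_less_one bdd_int_integrable[OF g]], of x x]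
  show ?thesis by (simp add: algebra_simps)
qed

lemma pot_split:
  assumes r: "r > 0" and g: "g \<in> bdd_int"
  shows "pot g x = (\<integral>y. (K (x - y) - trunc r (x - y)) * g y \<partial>lborel) + (\<integral>y. trunc r (x - y) * g y \<partial>lborel)"
proof -
  obtain t where t: "\<And>x. \<bar>g x\<bar> \<le> t" using bdd_int_bound[OF g] by blast
  show ?thesis
    unfolding pot_def
    by (subst Bochner_Integration.integral_add[OF near_integrable(1)[OF r g t] trunc_mult_integrable[OF r bdd_int_integrable[OF g]], symmetric])
       (simp add: algebra_simps)
qed

text \<open>Two contributions of the near part, one of the Taylor remainder, and one from each
  component of the linear term.\<close>

definition good_const :: real where
  "good_const = 8 * c * ball_vol TYPE('a) * 2 ^ DIM('a) + 300 * c * 2 ^ (2 * DIM('a) + 3) * ball_vol TYPE('a)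
     + real DIM('a) * max_const"

text \<open>The kernel is cut at a scale \<open>r\<close> comparable to \<open>norm (x - y)\<close>.
  What is removed has L^1 norm of order \<open>r\<close>. For the rest, Taylor's formula about
  \<open>y\<close> leaves a remainder with an integrable weight and a linear term, whose
  coefficients are the truncations at \<open>y\<close>. These are bounded for every scale by
  assumption, and only at \<open>y\<close>, so \<open>x\<close> is arbitrary.\<close>

lemma pot_diff_le:
  assumes t: "t > 0" and g: "g \<in> bdd_int" "\<And>x. \<bar>g x\<bar> \<le> t"
    and y: "\<And>b k. b \<in> Basis \<Longrightarrow> \<bar>tau b (scale k) g y\<bar> \<le> max_const * t"
  shows "\<bar>pot g x - pot g y\<bar> \<le> good_const * t * norm (x - y)"
proof (cases "x = y")
  case False
  let ?n = "DIM('a)"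
  define h where "h = x - y"
  define \<omega> where "\<omega> = ball_vol TYPE('a)"
  have \<omega>: "\<omega> > 0" by (simp add: \<omega>_def)
  have h: "norm h > 0" using False by (simp add: h_def)
  \<comment> \<open>Division by the dimension compensates the factor in \<open>scale\<close>, so
    that \<open>r\<close> lies between \<open>norm h\<close> and \<open>2 * norm h\<close>.\<close>
  obtain k where k: "norm h / ?n \<le> 2 powi k" "2 powi k \<le> 2 * (norm h / ?n)"
    using ex_dyadic_scale[of "norm h / ?n"] h by auto
  define r where "r = scale k"
  have r: "r > 0" "norm h \<le> r" "r \<le> 2 * norm h"
    using k by (auto simp: r_def scale_pos scale_def field_simps)
  let ?N = "\<lambda>x. \<integral>z. (K (x - z) - trunc r (x - z)) * g z \<partial>lborel"
  have N: "\<bar>?N x\<bar> \<le> 4 * c * \<omega> * 2 ^ ?n * t * norm h" for x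
  proof -
    have "\<bar>?N x\<bar> \<le> c * (\<omega> * (2 ^ ?n * (2 * r))) * t" unfolding \<omega>_def by (rule near_integrable(2)[OF r(1) g])
    also have "\<dots> \<le> c * (\<omega> * (2 ^ ?n * (2 * (2 * norm h)))) * t"
      using r(3) c_nonneg \<omega> t by (intro mult_right_mono mult_left_mono) auto
    finally show ?thesis by (simp add: ac_simps)
  qed
  let ?W = "\<lambda>z. 1 / max (norm (y - z)) r ^ (?n + 1)"
  have W: "integrable lborel ?W" "(\<integral>z. ?W z \<partial>lborel) \<le> \<omega> * (2 ^ (?n + 2) / r)"
    using integrable_lborel_minus(2)[OF integral_inverse_max_norm(1)[OF r(1), where 'a='a], of y]
      integral_lborel_minus(2)[of "\<lambda>z::'a. 1 / max (norm z) r ^ (?n + 1)" y] integral_inverse_max_norm(2)[OF r(1), where 'a='a]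
    by (auto simp: \<omega>_def)
  note gi = bdd_int_integrable[OF g(1)]
  note ti = trunc_mult_integrable[OF r(1) gi]
  let ?D = "\<lambda>z. (trunc' r (y - z) \<bullet> h) * g z"
  have Deq: "?D = (\<lambda>z. \<Sum>b\<in>Basis. (h \<bullet> b) * ((b \<bullet> trunc' r (y - z)) * g z))"
  proof
    fix z
    have "trunc' r (y - z) \<bullet> h = (\<Sum>b\<in>Basis. (trunc' r (y - z) \<bullet> b) * (h \<bullet> b))" by (rule euclidean_inner)
    then show "?D z = (\<Sum>b\<in>Basis. (h \<bullet> b) * ((b \<bullet> trunc' r (y - z)) * g z))"
      by (simp add: sum_distrib_right sum_distrib_left inner_commute ac_simps)
  qed
  have bi: "integrable lborel (\<lambda>z. (b \<bullet> trunc' r (y - z)) * g z)" if "b \<in> Basis" for b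
    using that by (intro tau_integrable r g) auto
  have Di: "integrable lborel ?D"
    unfolding Deq by (intro Bochner_Integration.integrable_sum integrable_mult_right bi)
  have "(\<integral>z. ?D z \<partial>lborel) = (\<Sum>b\<in>Basis. (h \<bullet> b) * tau b r g y)"
    unfolding Deq tau_def
    by (subst Bochner_Integration.integral_sum) (auto intro!: integrable_mult_right bi)
  then have "\<bar>\<integral>z. ?D z \<partial>lborel\<bar> \<le> (\<Sum>b\<in>Basis. \<bar>(h \<bullet> b) * tau b r g y\<bar>)" by (simp only: sum_abs)
  also have "\<dots> \<le> (\<Sum>b\<in>(Basis::'a set). norm h * (max_const * t))"
    unfolding abs_mult using y by (intro sum_mono mult_mono Basis_le_norm) (auto simp: r_def)
  finally have DD: "\<bar>\<integral>z. ?D z \<partial>lborel\<bar> \<le> real ?n * max_const * t * norm h" by (simp add: ac_simps)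
  let ?R = "\<lambda>z. (trunc r (x - z) - trunc r (y - z) - trunc' r (y - z) \<bullet> h) * g z"
  have Req: "?R z = trunc r (x - z) * g z - trunc r (y - z) * g z - ?D z" for z by (simp add: algebra_simps)
  have Ri: "integrable lborel ?R" unfolding Req by (intro Bochner_Integration.integrable_diff ti Di)
  have "\<bar>\<integral>z. ?R z \<partial>lborel\<bar> \<le> (\<integral>z. \<bar>?R z\<bar> \<partial>lborel)" by (rule integral_abs_bound)
  also have "\<dots> \<le> (\<integral>z. (300 * c * 2 ^ (?n + 1) * (norm h)\<^sup>2 * t) * ?W z \<partial>lborel)"
  proof (rule integral_mono[OF integrable_abs[OF Ri] integrable_mult_right[OF W(1)]])
    fix z
    have "\<bar>trunc r ((y - z) + h) - trunc r (y - z) - trunc' r (y - z) \<bullet> h\<bar>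
        \<le> 300 * c * 2 ^ (?n + 1) / max (norm (y - z)) r ^ (?n + 1) * (norm h)\<^sup>2"
      by (rule trunc_Taylor[OF r(1,2)])
    moreover have "(y - z) + h = x - z" by (simp add: h_def)
    ultimately have "\<bar>trunc r (x - z) - trunc r (y - z) - trunc' r (y - z) \<bullet> h\<bar>
        \<le> 300 * c * 2 ^ (?n + 1) * ?W z * (norm h)\<^sup>2" by simp
    then have "\<bar>?R z\<bar> \<le> (300 * c * 2 ^ (?n + 1) * ?W z * (norm h)\<^sup>2) * t"
      unfolding abs_mult using g(2)[of z] r c_nonneg by (intro mult_mono mult_nonneg_nonneg divide_nonneg_nonneg) auto
    then show "\<bar>?R z\<bar> \<le> (300 * c * 2 ^ (?n + 1) * (norm h)\<^sup>2 * t) * ?W z" by (simp add: ac_simps)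
  qed
  also have "\<dots> = (300 * c * 2 ^ (?n + 1) * (norm h)\<^sup>2 * t) * (\<integral>z. ?W z \<partial>lborel)" by (rule integral_mult_right_zero)
  also have "\<dots> \<le> (300 * c * 2 ^ (?n + 1) * (norm h)\<^sup>2 * t) * (\<omega> * (2 ^ (?n + 2) / r))"
    using c_nonneg t by (intro mult_left_mono W) auto
  also have "\<dots> = 300 * c * (2 ^ (?n + 1) * 2 ^ (?n + 2)) * \<omega> * t * norm h * (norm h / r)"
    by (simp add: power2_eq_square)
  also have "\<dots> \<le> 300 * c * (2 ^ (?n + 1) * 2 ^ (?n + 2)) * \<omega> * t * norm h * 1"
    using c_nonneg t \<omega> r by (intro mult_left_mono) auto
  also have "(2::real) ^ (?n + 1) * 2 ^ (?n + 2) = 2 ^ (2 * ?n + 3)"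
    by (simp add: power_add power_even_eq power2_eq_square)
  finally have RR: "\<bar>\<integral>z. ?R z \<partial>lborel\<bar> \<le> 300 * c * 2 ^ (2 * ?n + 3) * \<omega> * t * norm h" by simp
  have "(\<integral>z. ?R z \<partial>lborel) = (\<integral>z. trunc r (x - z) * g z \<partial>lborel) - (\<integral>z. trunc r (y - z) * g z \<partial>lborel) - (\<integral>z. ?D z \<partial>lborel)"
    unfolding Req
    by (subst Bochner_Integration.integral_diff Bochner_Integration.integral_diff[OF ti ti];
        (intro Bochner_Integration.integrable_diff ti Di)?)+ simp
  then have "pot g x - pot g y = ?N x - ?N y + (\<integral>z. ?R z \<partial>lborel) + (\<integral>z. ?D z \<partial>lborel)"
    unfolding pot_split[OF r(1) g(1)] by simp
  then have "\<bar>pot g x - pot g y\<bar> \<le> 4 * c * \<omega> * 2 ^ ?n * t * norm h + 4 * c * \<omega> * 2 ^ ?n * t * norm h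
      + 300 * c * 2 ^ (2 * ?n + 3) * \<omega> * t * norm h + real ?n * max_const * t * norm h"
    using N[of x] N[of y] RR DD by linarith
  also have "\<dots> = good_const * t * norm (x - y)"
    by (simp add: good_const_def \<omega>_def h_def distrib_right)
  finally show ?thesis .
qed simp

lemma pot_Lipschitz_off_small_set:
  assumes t: "t > 0" and g: "g \<in> bdd_int" "\<And>x. \<bar>g x\<bar> \<le> t"
  obtains E where "E \<in> sets borel"
    "emeasure lborel E \<le> ennreal (real DIM('a) * (16 * piece_const)\<^sup>2 * (\<integral>x. \<bar>g x\<bar> \<partial>lborel) / t)"
    "\<And>x y. y \<notin> E \<Longrightarrow> \<bar>pot g x - pot g y\<bar> \<le> good_const * t * norm (x - y)"
proof -
  let ?C = "(16 * piece_const)\<^sup>2 * (\<integral>x. \<bar>g x\<bar> \<partial>lborel) / t"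
  have "\<exists>E. E \<in> sets borel \<and> emeasure lborel E \<le> ennreal ?C \<and> (\<forall>x k. x \<notin> E \<longrightarrow> \<bar>tau b (scale k) g x\<bar> \<le> max_const * t)"
    if "b \<in> Basis" for b
    using maximal_tau[OF _ t g, of b] that by (metis norm_Basis order_refl)
  then obtain E where E: "\<And>b. b \<in> Basis \<Longrightarrow> E b \<in> sets borel" "\<And>b. b \<in> Basis \<Longrightarrow> emeasure lborel (E b) \<le> ennreal ?C"
    "\<And>b x k. b \<in> Basis \<Longrightarrow> x \<notin> E b \<Longrightarrow> \<bar>tau b (scale k) g x\<bar> \<le> max_const * t"
    by metis
  show thesis
  proof (rule that[of "\<Union>b\<in>Basis. E b"])
    show "(\<Union>b\<in>Basis. E b) \<in> sets borel" using E by auto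
    have "emeasure lborel (\<Union>b\<in>Basis. E b) \<le> (\<Sum>b\<in>Basis. emeasure lborel (E b))"
      using E by (intro emeasure_subadditive_finite) auto
    also have "\<dots> \<le> (\<Sum>b\<in>(Basis::'a set). ennreal ?C)" by (intro sum_mono E)
    also have "\<dots> = ennreal (real DIM('a) * ?C)"
      using t by (simp add: ennreal_of_nat_eq_real_of_nat ennreal_mult[symmetric])
    finally show "emeasure lborel (\<Union>b\<in>Basis. E b) \<le> ennreal (real DIM('a) * (16 * piece_const)\<^sup>2 * (\<integral>x. \<bar>g x\<bar> \<partial>lborel) / t)"
      by (simp add: mult.assoc)
    show "\<bar>pot g x - pot g y\<bar> \<le> good_const * t * norm (x - y)" if "y \<notin> (\<Union>b\<in>Basis. E b)" for x y
      by (rule pot_diff_le[OF t g]) (use that E in auto)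
  qed
qed

end

subsection \<open>Potentials of measures\<close>

lemma integral_partition_sums:
  fixes f :: "'a \<Rightarrow> real" and R :: "nat \<Rightarrow> 'a set"
  assumes f: "integrable M f" and R: "\<And>i. R i \<in> sets M" "disjoint_family R" "(\<Union>i. R i) = space M"
  shows "(\<lambda>i. \<integral>x. indicator (R i) x * f x \<partial>M) sums (\<integral>x. f x \<partial>M)"
proof -
  have int: "integrable M (\<lambda>x. indicator (R i) x * f x)" for i
    using integrable_real_mult_indicator[OF R(1) f, of i] by (simp add: mult.commute)
  have part: "(\<Sum>i<n. indicator (R i) x * f x) = indicator (\<Union>i<n. R i) x * f x" for n x
  proof -
    have "disjoint_family_on R {..<n}" using R(2) by (rule disjoint_family_on_mono[rotated]) auto
    then have "indicator (\<Union>i<n. R i) x = (\<Sum>i<n. indicator (R i) x :: real)"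
      by (intro indicator_UN_disjoint) auto
    then show ?thesis by (simp add: sum_distrib_right)
  qed
  have "(\<lambda>n. \<integral>x. indicator (\<Union>i<n. R i) x * f x \<partial>M) \<longlonglongrightarrow> (\<integral>x. f x \<partial>M)"
  proof (rule integral_dominated_convergence[where w = "\<lambda>x. \<bar>f x\<bar>"])
    show "f \<in> borel_measurable M" using f by simp
    then show "(\<lambda>x. indicator (\<Union>i<n. R i) x * f x) \<in> borel_measurable M" for n
      using R(1) by (intro borel_measurable_times borel_measurable_indicator sets.finite_UN) auto
    show "integrable M (\<lambda>x. \<bar>f x\<bar>)" using f by simp
    show "AE x in M. (\<lambda>n. indicator (\<Union>i<n. R i) x * f x) \<longlonglongrightarrow> f x"
    proof (rule AE_I2)
      fix x assume "x \<in> space M"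
      then obtain i where i: "x \<in> R i" using R(3) by auto
      have "eventually (\<lambda>n. indicator (\<Union>i<n. R i) x * f x = f x) sequentially"
        using eventually_gt_at_top[of i] by eventually_elim (use i in \<open>auto split: split_indicator\<close>)
      then show "(\<lambda>n. indicator (\<Union>i<n. R i) x * f x) \<longlonglongrightarrow> f x" by (rule tendsto_eventually)
    qed
    show "AE x in M. norm (indicator (\<Union>i<n. R i) x * f x) \<le> \<bar>f x\<bar>" for n
      by (rule AE_I2) (simp split: split_indicator)
  qed
  moreover have "(\<integral>x. indicator (\<Union>i<n. R i) x * f x \<partial>M) = (\<Sum>i<n. \<integral>x. indicator (R i) x * f x \<partial>M)" for n
    unfolding part[symmetric] by (rule Bochner_Integration.integral_sum) (rule int)
  ultimately show ?thesis by (simp add: sums_def)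
qed

lemma bounded_density:
  fixes M :: "'a::euclidean_space measure"
  assumes M: "finite_measure M" "sets M = sets borel" and t: "t \<ge> 0"
    and le: "\<And>A. A \<in> sets borel \<Longrightarrow> emeasure M A \<le> ennreal t * emeasure lborel A"
  obtains f where "f \<in> borel_measurable borel" "\<And>x. 0 \<le> f x" "\<And>x. f x \<le> t"
    "M = density lborel (\<lambda>x. ennreal (f x))"
proof -
  interpret finite_measure M by (rule M)
  have "absolutely_continuous lborel M"
    unfolding absolutely_continuous_def
  proof
    fix A :: "'a set" assume "A \<in> null_sets lborel"
    then show "A \<in> null_sets M" using le[of A] M(2) by (auto simp: null_sets_def)
  qed
  then obtain h where h: "h \<in> borel_measurable lborel" "density lborel h = M"
    using sigma_finite_measure.Radon_Nikodym[OF sigma_finite_lborel, of M] M(2) by auto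
  note [measurable] = h(1)
  \<comment> \<open>The slack \<open>e\<close> makes the comparison strict: on \<open>S\<close> the
    measure is at least \<open>t + e\<close> and at most \<open>t\<close> times the volume, which
    forces volume 0 once the volume is known to be finite.\<close>
  have small: "AE x in lborel. h x \<le> ennreal (t + e)" if e: "e > 0" for e :: real
  proof -
    define S where "S = {x. h x > ennreal (t + e)}"
    have S[measurable]: "S \<in> sets borel" unfolding S_def by measurable
    have eS: "emeasure M S = (\<integral>\<^sup>+x. h x * indicator S x \<partial>lborel)"
      unfolding h(2)[symmetric] by (rule emeasure_density) auto
    have "ennreal (t + e) * emeasure lborel S = (\<integral>\<^sup>+x. ennreal (t + e) * indicator S x \<partial>lborel)"
      by (rule nn_integral_cmult_indicator[symmetric]) simp
    also have "\<dots> \<le> emeasure M S"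
      unfolding eS by (rule nn_integral_mono) (auto simp: S_def split: split_indicator)
    finally have 1: "ennreal (t + e) * emeasure lborel S \<le> emeasure M S" .
    have "emeasure M S < top" by (simp add: emeasure_eq_measure)
    then have "ennreal (t + e) * emeasure lborel S < top" using 1 by (rule le_less_trans[rotated])
    then have fin: "emeasure lborel S \<noteq> top" using t e by (auto simp: ennreal_mult_top)
    then obtain s where s: "emeasure lborel S = ennreal s" "s \<ge> 0" by (cases "emeasure lborel S") auto
    have "ennreal ((t + e) * s) \<le> ennreal (t * s)"
      using order_trans[OF 1 le[OF S]] t e s by (simp add: ennreal_mult[symmetric] del: ennreal_plus)
    then have "(t + e) * s \<le> t * s" using t s by (subst (asm) ennreal_le_iff) auto
    then have "s = 0" using e s by (simp add: distrib_right mult_le_0_iff)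
    then have "S \<in> null_sets lborel" using s by (auto simp: null_sets_def)
    from AE_not_in[OF this] show ?thesis by eventually_elim (auto simp: S_def not_less)
  qed
  have "AE x in lborel. \<forall>n. h x \<le> ennreal (t + inverse (Suc n))"
    unfolding AE_all_countable by (intro allI small) simp
  then have ht: "AE x in lborel. h x \<le> ennreal t"
  proof eventually_elim
    fix x assume *: "\<forall>n. h x \<le> ennreal (t + inverse (Suc n))"
    have "(\<lambda>n. ennreal (t + inverse (Suc n))) \<longlonglongrightarrow> ennreal (t + 0)"
      by (intro tendsto_ennrealI tendsto_add tendsto_const LIMSEQ_inverse_real_of_nat)
    then show "h x \<le> ennreal t" using * by (intro tendsto_lowerbound[of _ "ennreal t"]) auto
  qed
  show thesis
  \<comment> \<open>Cutting the density at \<open>t\<close> turns an almost everywhere bound into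
    one at every point, without changing the measure.\<close>
  proof (rule that[of "\<lambda>x. enn2real (min (h x) (ennreal t))"])
    show "enn2real (min (h x) (ennreal t)) \<le> t" for x
      using t by (intro enn2real_leI) auto
    have "M = density lborel (\<lambda>x. min (h x) (ennreal t))"
      unfolding h(2)[symmetric] by (rule density_cong) (use ht in \<open>auto simp: min_absorb1\<close>)
    also have "(\<lambda>x. min (h x) (ennreal t)) = (\<lambda>x. ennreal (enn2real (min (h x) (ennreal t))))"
      by (rule ext, rule ennreal_enn2real[symmetric]) (auto simp: min_less_iff_disj)
    finally show "M = density lborel (\<lambda>x. ennreal (enn2real (min (h x) (ennreal t))))" .
  qed auto
qed

lemma density_indicator:
  fixes M :: "'a::euclidean_space measure"
  assumes M: "finite_measure M" "sets M = sets borel" and F: "F \<in> sets borel"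
  defines "MF \<equiv> density M (\<lambda>x. ennreal (indicator F x))"
  shows "finite_measure MF" "sets MF = sets borel"
    "\<And>A. A \<in> sets borel \<Longrightarrow> emeasure MF A = emeasure M (A \<inter> F)"
proof -
  interpret finite_measure M by (rule M)
  have [measurable_cong]: "sets M = sets borel" by fact
  note [measurable] = F
  show s: "sets MF = sets borel" by (simp add: MF_def M)
  show e: "emeasure MF A = emeasure M (A \<inter> F)" if "A \<in> sets borel" for A
  proof -
    have "emeasure MF A = (\<integral>\<^sup>+x. ennreal (indicator F x) * indicator A x \<partial>M)"
      unfolding MF_def using that by (intro emeasure_density) auto
    also have "\<dots> = (\<integral>\<^sup>+x. indicator (A \<inter> F) x \<partial>M)"
      by (intro nn_integral_cong) (auto split: split_indicator)
    also have "\<dots> = emeasure M (A \<inter> F)" using that by (intro nn_integral_indicator) auto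
    finally show ?thesis .
  qed
  show "finite_measure MF"
    using e[of UNIV] sets_eq_imp_space_eq[OF s] by (intro finite_measureI) (auto simp: emeasure_eq_measure)
qed

lemma density_outside_dense_cells:
  fixes M :: "'a::euclidean_space measure"
  assumes M: "finite_measure M" "sets M = sets borel" and t: "t > 0"
  obtains f where "f \<in> borel_measurable borel" "\<And>x. 0 \<le> f x" "\<And>x. f x \<le> t"
    "density M (\<lambda>x. ennreal (indicator (- dense_cells M t) x)) = density lborel (\<lambda>x. ennreal (f x))"
proof -
  have F: "- dense_cells M t \<in> sets borel" using dense_cells_borel[OF M t] by simp
  note MF = density_indicator[OF M F]
  show thesis
  proof (rule bounded_density[OF MF(1,2), of t])
    fix A :: "'a set" assume A: "A \<in> sets borel"
    have "A \<inter> - dense_cells M t = A - dense_cells M t" by auto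
    then show "emeasure (density M (\<lambda>x. ennreal (indicator (- dense_cells M t) x))) A \<le> ennreal t * emeasure lborel A"
      using MF(3)[OF A] emeasure_outside_dense_cells_le[OF M t A] by simp
  qed (use t that in auto)
qed

lemma suminf_disjoint_indicator:
  fixes a :: "nat \<Rightarrow> real"
  assumes "disjoint_family Q" "x \<in> Q i"
  shows "(\<Sum>j. a j * indicator (Q j) x) = a i"
proof -
  have "(\<lambda>j. a j * indicator (Q j) x) = (\<lambda>j. if j = i then a j else 0)"
    using assms by (auto simp: fun_eq_iff disjoint_family_on_def split: split_indicator)
  then show ?thesis using sums_single[of i a] by (simp add: sums_iff)
qed

section \<open>The weak type estimate for potentials of measures\<close>

context CZ_kernel
begin

definition upot :: "'a measure \<Rightarrow> 'a \<Rightarrow> real" where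
  "upot M x = (\<integral>y. K (x - y) \<partial>M)"

definition udom :: "'a measure \<Rightarrow> 'a set" where
  "udom M = {x. (\<integral>\<^sup>+y. ennreal \<bar>K (x - y)\<bar> \<partial>M) < \<infinity>}"

lemma udom_integrable:
  assumes "sets M = sets borel" "x \<in> udom M"
  shows "integrable M (\<lambda>y. K (x - y))"
proof -
  have [measurable_cong]: "sets M = sets borel" by fact
  have "(\<lambda>y. K (x - y)) \<in> borel_measurable M" by measurable
  with assms show ?thesis by (simp add: udom_def integrable_iff_bounded)
qed

lemma udom_borel:
  assumes "finite_measure M" "sets M = sets borel"
  shows "udom M \<in> sets borel"
proof -
  interpret finite_measure M by fact
  have [measurable_cong]: "sets M = sets borel" by fact
  have "(\<lambda>x. \<integral>\<^sup>+y. ennreal \<bar>K (x - y)\<bar> \<partial>M) \<in> borel_measurable borel"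
    by (rule borel_measurable_nn_integral) measurable
  then show ?thesis unfolding udom_def by measurable
qed

text \<open>\<open>K\<close> is the sum of an integrable function and a bounded one. The first is
  handled by Tonelli's theorem and translation invariance, the second by the finiteness of
  \<open>M\<close>.\<close>

lemma AE_udom:
  assumes M: "finite_measure M" "sets M = sets borel"
  shows "AE x in lborel. x \<in> udom M"
proof -
  interpret finite_measure M by fact
  interpret P: pair_sigma_finite lborel M ..
  have [measurable_cong]: "sets M = sets borel" by fact
  have [measurable]: "trunc 1 \<in> borel_measurable borel" by (rule trunc_measurable) simp
  let ?n = "\<lambda>z. ennreal \<bar>K z - trunc 1 z\<bar>"
  obtain C where C: "(\<integral>\<^sup>+x. ?n x \<partial>lborel) = ennreal C"
    using near_part(1)[of 1] by (simp add: nn_integral_eq_integral integrable_abs)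
  have "(\<integral>\<^sup>+x. (\<integral>\<^sup>+y. ?n (x - y) \<partial>M) \<partial>lborel) = (\<integral>\<^sup>+y. (\<integral>\<^sup>+x. ?n (x - y) \<partial>lborel) \<partial>M)"
    by (rule P.Fubini'[symmetric]) measurable
  also have "\<dots> = (\<integral>\<^sup>+y. ennreal C \<partial>M)"
    using C nn_integral_lborel_minus(1)[of ?n] by simp
  also have "\<dots> < \<infinity>"
    by (simp add: emeasure_eq_measure ennreal_mult_less_top)
  finally have fin: "(\<integral>\<^sup>+x. (\<integral>\<^sup>+y. ?n (x - y) \<partial>M) \<partial>lborel) \<noteq> \<infinity>" by simp
  have "(\<lambda>x. \<integral>\<^sup>+y. ?n (x - y) \<partial>M) \<in> borel_measurable lborel"
    by (rule borel_measurable_nn_integral) measurable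
  from nn_integral_PInf_AE[OF this fin] show ?thesis
  proof eventually_elim
    fix x assume fin: "(\<integral>\<^sup>+y. ?n (x - y) \<partial>M) \<noteq> \<infinity>"
    have "(\<integral>\<^sup>+y. ennreal \<bar>K (x - y)\<bar> \<partial>M) \<le> (\<integral>\<^sup>+y. ?n (x - y) + ennreal c \<partial>M)"
    proof (rule nn_integral_mono)
      fix y
      have "\<bar>K (x - y)\<bar> \<le> \<bar>K (x - y) - trunc 1 (x - y)\<bar> + c"
        using trunc_bound_uniform[of 1 "x - y"] by simp
      then show "ennreal \<bar>K (x - y)\<bar> \<le> ?n (x - y) + ennreal c"
        using c_nonneg by (subst ennreal_plus[symmetric]) (auto intro!: ennreal_leI simp del: ennreal_plus)
    qed
    also have "\<dots> = (\<integral>\<^sup>+y. ?n (x - y) \<partial>M) + ennreal c * emeasure M (space M)"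
      by (subst nn_integral_add) auto
    also have "\<dots> < \<infinity>"
      using fin by (simp add: emeasure_eq_measure ennreal_mult_less_top less_top)
    finally show "x \<in> udom M" by (simp add: udom_def)
  qed
qed

text \<open>On \<open>Q\<close> the measure and its mean density have the same mass, so the value of
  \<open>z \<mapsto> K (x - z) - K (y - z)\<close> at \<open>p\<close> may be subtracted from both
  integrals. What remains is a second difference with increment \<open>z - p\<close>. The excluded
  ball of radius \<open>4 * DIM('a) * l\<close> is exactly what \<open>second_difference\<close>
  asks of the quarters.\<close>

lemma bad_part_term:
  fixes M :: "'a measure" and l :: real
  assumes M: "finite_measure M" "sets M = sets borel" and Q: "Q \<in> sets borel"
    and l: "emeasure lborel Q = ennreal (l ^ DIM('a))" "l \<ge> 0" "Q = {} \<longleftrightarrow> l = 0"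
    and Qc: "\<And>z. z \<in> Q \<Longrightarrow> norm (z - p) \<le> DIM('a) * l"
    and xy: "x \<notin> ball p (4 * DIM('a) * l)" "y \<notin> ball p (4 * DIM('a) * l)"
    and int: "integrable M (\<lambda>z. K (x - z) - K (y - z))"
      "integrable lborel (\<lambda>z. indicator Q z * (K (x - z) - K (y - z)))"
  shows "\<bar>(\<integral>z. indicator Q z * (K (x - z) - K (y - z)) \<partial>M)
      - measure M Q / l ^ DIM('a) * (\<integral>z. indicator Q z * (K (x - z) - K (y - z)) \<partial>lborel)\<bar>
    \<le> c * 2 ^ (DIM('a) + 3) * DIM('a) * norm (x - y) *
       (measure M Q * l / norm (x - p) ^ (DIM('a) + 1) + measure M Q * l / norm (y - p) ^ (DIM('a) + 1))"
proof (cases "l = 0")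
  case True
  then show ?thesis using l by simp
next
  case False
  interpret finite_measure M by (rule M)
  let ?n = "DIM('a)"
  have [measurable_cong]: "sets M = sets borel" by fact
  note [measurable] = Q
  have l0: "l > 0" using False l by simp
  define \<phi> where "\<phi> z = K (x - z) - K (y - z)" for z
  define S where "S = c * 2 ^ (?n + 2) * (?n * l) * norm (x - y) *
       (1 / norm (x - p) ^ (?n + 1) + 1 / norm (y - p) ^ (?n + 1))"
  have far: "4 * (?n * l) \<le> norm (x - p)" "4 * (?n * l) \<le> norm (y - p)"
    using xy by (auto simp: dist_norm norm_minus_commute)
  then have ne: "x - p \<noteq> 0" "y - p \<noteq> 0" using l0 by (auto simp: mult_le_0_iff)
  have S: "\<bar>\<phi> z - \<phi> p\<bar> \<le> S" if z: "z \<in> Q" for z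
  proof -
    define w where "w = z - p"
    have w: "norm w \<le> ?n * l" using Qc[OF z] by (simp add: w_def)
    have e: "x - z = (x - p) - w" "y - z = (y - p) - w" by (simp_all add: w_def)
    have "\<bar>\<phi> z - \<phi> p\<bar> = \<bar>(K ((x - p) - w) - K (x - p)) - (K ((y - p) - w) - K (y - p))\<bar>"
      unfolding \<phi>_def e by (simp add: algebra_simps)
    also have "\<dots> \<le> c * 2 ^ (?n + 2) * norm w * norm ((x - p) - (y - p)) *
       (1 / norm (x - p) ^ (?n + 1) + 1 / norm (y - p) ^ (?n + 1))"
      by (rule second_difference[OF ne]) (use w far in linarith)+
    also have "\<dots> \<le> S"
      unfolding S_def using w c_nonneg l0
      by (intro mult_right_mono mult_mono) (auto intro!: add_nonneg_nonneg divide_nonneg_nonneg)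
    finally show ?thesis .
  qed
  have S0: "S \<ge> 0" unfolding S_def using c_nonneg l0 by simp
  \<comment> \<open>Used for \<open>M\<close> and for \<open>lborel\<close>; after rescaling the
    second, the terms with \<open>\<phi> p\<close> cancel.\<close>
  have near: "\<bar>(\<integral>z. indicator Q z * \<phi> z \<partial>N) - \<phi> p * measure N Q\<bar> \<le> S * measure N Q"
    if N: "sets N = sets borel" "integrable N (\<lambda>z. indicator Q z * \<phi> z)" "emeasure N Q < \<infinity>" for N
  proof -
    have [measurable_cong]: "sets N = sets borel" by fact
    have iQ: "integrable N (\<lambda>z. indicator Q z * C)" "(\<integral>z. indicator Q z * C \<partial>N) = C * measure N Q" for C :: real
      using N(3) sets_eq_imp_space_eq[OF N(1)] by auto
    have "(\<integral>z. indicator Q z * \<phi> z \<partial>N) - \<phi> p * measure N Q = (\<integral>z. indicator Q z * \<phi> z - indicator Q z * \<phi> p \<partial>N)"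
      unfolding iQ(2)[of "\<phi> p", symmetric] by (rule Bochner_Integration.integral_diff[symmetric]) (rule N iQ)+
    then have "\<bar>(\<integral>z. indicator Q z * \<phi> z \<partial>N) - \<phi> p * measure N Q\<bar> \<le> (\<integral>z. \<bar>indicator Q z * \<phi> z - indicator Q z * \<phi> p\<bar> \<partial>N)"
      by (simp only:) (rule integral_abs_bound)
    also have "\<dots> \<le> (\<integral>z. indicator Q z * S \<partial>N)"
      by (rule integral_mono) (use S N(2) iQ in \<open>auto split: split_indicator\<close>)
    finally show ?thesis unfolding iQ .
  qed
  have 1: "\<bar>(\<integral>z. indicator Q z * \<phi> z \<partial>M) - \<phi> p * measure M Q\<bar> \<le> S * measure M Q"
    using integrable_real_mult_indicator[OF _ int(1), of Q] M
    by (intro near) (auto simp: \<phi>_def mult.commute emeasure_eq_measure)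
  have mQ: "measure lborel Q = l ^ ?n" using l by (simp add: measure_def)
  have "\<bar>(\<integral>z. indicator Q z * \<phi> z \<partial>lborel) - \<phi> p * l ^ ?n\<bar> \<le> S * l ^ ?n"
    using near[of lborel] int(2) l by (simp add: \<phi>_def mQ)
  then have "measure M Q / l ^ ?n * \<bar>(\<integral>z. indicator Q z * \<phi> z \<partial>lborel) - \<phi> p * l ^ ?n\<bar> \<le> measure M Q / l ^ ?n * (S * l ^ ?n)"
    using l0 by (intro mult_left_mono) auto
  moreover have "measure M Q / l ^ ?n * \<bar>(\<integral>z. indicator Q z * \<phi> z \<partial>lborel) - \<phi> p * l ^ ?n\<bar>
      = \<bar>measure M Q / l ^ ?n * ((\<integral>z. indicator Q z * \<phi> z \<partial>lborel) - \<phi> p * l ^ ?n)\<bar>"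
    using l0 by (simp add: abs_mult)
  moreover have "measure M Q / l ^ ?n * ((\<integral>z. indicator Q z * \<phi> z \<partial>lborel) - \<phi> p * l ^ ?n)
      = measure M Q / l ^ ?n * (\<integral>z. indicator Q z * \<phi> z \<partial>lborel) - \<phi> p * measure M Q"
    using l0 by (simp add: right_diff_distrib)
  moreover have "measure M Q / l ^ ?n * (S * l ^ ?n) = S * measure M Q" using l0 by simp
  ultimately have 2: "\<bar>measure M Q / l ^ ?n * (\<integral>z. indicator Q z * \<phi> z \<partial>lborel) - \<phi> p * measure M Q\<bar> \<le> S * measure M Q"
    by metis
  have "\<bar>(\<integral>z. indicator Q z * \<phi> z \<partial>M) - measure M Q / l ^ ?n * (\<integral>z. indicator Q z * \<phi> z \<partial>lborel)\<bar> \<le> 2 * (S * measure M Q)"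
    using 1 2 by linarith
  also have "2 * (S * measure M Q) = c * 2 ^ (?n + 3) * ?n * norm (x - y) *
       (measure M Q * l / norm (x - p) ^ (?n + 1) + measure M Q * l / norm (y - p) ^ (?n + 1))"
  proof -
    have "2 * (c * 2 ^ (?n + 2) * (?n * l) * d * (X + Y) * m) = c * 2 ^ (?n + 3) * ?n * d * (m * l * X + m * l * Y)"
      for d X Y m :: real by (simp add: algebra_simps power_add)
    from this[of "norm (x - y)" "1 / norm (x - p) ^ (?n + 1)" "1 / norm (y - p) ^ (?n + 1)" "measure M Q"]
    show ?thesis by (simp add: S_def)
  qed
  finally show ?thesis unfolding \<phi>_def .
qed

text \<open>The constant of \<open>bad_part_term\<close>, doubled because the sum over the cells is
  bounded by \<open>t\<close> at each of the two points.\<close>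

definition bad_const :: real where
  "bad_const = c * 2 ^ (DIM('a) + 4) * DIM('a)"

definition lip_const :: real where
  "lip_const = bad_const + good_const * 2 ^ DIM('a)"

text \<open>The three summands measure the exceptional sets: that of the maximal truncations in each
  coordinate direction, that where the sum over the cells is large, and the union of the enlarged
  cells.\<close>

definition small_const :: real where
  "small_const = real DIM('a) * (16 * piece_const)\<^sup>2 + ball_vol TYPE('a) * 2 ^ (DIM('a) + 1)
     + ball_vol TYPE('a) * (4 * real DIM('a)) ^ DIM('a)"

text \<open>The density \<open>g\<close> of the good part is bounded by
  \<open>2 ^ DIM('a) * t\<close>, and its L^1 norm is at most the mass of \<open>M\<close>. The
  difference of \<open>upot M\<close> and \<open>pot g\<close> is a sum over the cells, controlled
  pointwise by a function of Marcinkiewicz type. Both endpoints must avoid the exceptional set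
  because each cell has to be far from both.\<close>

lemma upot_Lipschitz_off_small_set:
  fixes M :: "'a measure"
  assumes M: "finite_measure M" "sets M = sets borel" and t: "t > 0"
  obtains E where "E \<in> sets borel" "emeasure lborel E \<le> ennreal (small_const * measure M UNIV / t)"
    "\<And>x y. x \<in> udom M - E \<Longrightarrow> y \<in> udom M - E \<Longrightarrow> \<bar>upot M x - upot M y\<bar> \<le> lip_const * t * norm (x - y)"
proof -
  interpret finite_measure M by (rule M)
  have [measurable_cong]: "sets M = sets borel" by fact
  have spM: "space M = UNIV" using sets_eq_imp_space_eq[OF M(2)] by simp
  let ?n = "DIM('a)"
  define \<omega> where "\<omega> = ball_vol TYPE('a)"
  have \<omega>: "\<omega> > 0" by (simp add: \<omega>_def)
  define m where "m = measure M UNIV"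
  have m: "m \<ge> 0" by (simp add: m_def)
  obtain Q :: "nat \<Rightarrow> 'a set" and p :: "nat \<Rightarrow> 'a" and l :: "nat \<Rightarrow> real" where
    Q: "disjoint_family Q" "\<And>i. Q i \<in> sets borel" "(\<Union>i. Q i) = dense_cells M t"
    and l: "\<And>i. l i \<ge> 0" "\<And>i z. z \<in> Q i \<Longrightarrow> norm (z - p i) \<le> ?n * l i"
      "\<And>i. emeasure lborel (Q i) = ennreal (l i ^ ?n)" "\<And>i. t * l i ^ ?n \<le> measure M (Q i)"
      "\<And>i. measure M (Q i) \<le> 2 ^ ?n * t * l i ^ ?n" "\<And>i. Q i = {} \<longleftrightarrow> l i = 0"
    by (rule Calderon_Zygmund_decomposition[OF M t]) (rule that)
  note [measurable] = Q(2)
  define F where "F = - dense_cells M t"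
  have F[measurable]: "F \<in> sets borel" using dense_cells_borel[OF M t] by (simp add: F_def)
  \<comment> \<open>The complement of the cells is piece 0 and cell \<open>j\<close> is piece
    \<open>Suc j\<close>; the integrals against \<open>M\<close> and against \<open>g\<close> are
    compared piece by piece.\<close>
  define R where "R i = (case i of 0 \<Rightarrow> F | Suc j \<Rightarrow> Q j)" for i
  have R: "\<And>i. R i \<in> sets borel" "disjoint_family R" "(\<Union>i. R i) = UNIV"
  proof -
    show "R i \<in> sets borel" for i by (simp add: R_def split: nat.split)
    have "F \<inter> Q j = {}" for j using Q(3) by (auto simp: F_def)
    then show "disjoint_family R"
      using Q(1) unfolding disjoint_family_on_def R_def by (auto split: nat.split)
    have "x \<in> F \<or> (\<exists>j. x \<in> Q j)" for x using Q(3) by (auto simp: F_def)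
    then show "(\<Union>i. R i) = UNIV" by (auto simp: R_def) (metis (no_types) nat.case(1) nat.case(2))
  qed
  have sumQ: "(\<Sum>i. ennreal (measure M (Q i))) = emeasure M (dense_cells M t)"
    unfolding Q(3)[symmetric] emeasure_eq_measure[symmetric]
    by (rule suminf_emeasure) (use Q M in auto)
  then have sumQm: "(\<Sum>i. ennreal (measure M (Q i))) \<le> ennreal m"
    using bounded_measure[of "dense_cells M t"] by (simp add: emeasure_eq_measure m_def spM ennreal_leI)
  define MF where "MF = density M (\<lambda>x. ennreal (indicator F x))"
  note MF = density_indicator[OF M F, folded MF_def]
  obtain f where f: "f \<in> borel_measurable borel" "\<And>x. 0 \<le> f x" "\<And>x. f x \<le> t"
    "MF = density lborel (\<lambda>x. ennreal (f x))"
    unfolding MF_def F_def by (rule density_outside_dense_cells[OF M t]) (rule that[unfolded MF_def F_def])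
  note [measurable] = f(1)
  define a where "a i = measure M (Q i) / l i ^ ?n" for i
  have a0: "a i \<ge> 0" for i using l(1)[of i] by (simp add: a_def)
  have al: "a i * l i ^ ?n = measure M (Q i)" for i
    using l(6)[of i] by (cases "l i = 0") (auto simp: a_def)
  \<comment> \<open>The good part: the density of \<open>M\<close> off the cells, and its mean on
    each cell.\<close>
  define g where "g x = indicator F x * f x + (\<Sum>i. a i * indicator (Q i) x)" for x
  have gF: "g x = f x" if "x \<in> F" for x
  proof -
    have "x \<notin> Q j" for j using that Q(3) by (auto simp: F_def)
    then show ?thesis using that by (simp add: g_def)
  qed
  have gQ: "g x = a i" if "x \<in> Q i" for x i
  proof -
    have "x \<notin> F" using that Q(3) by (auto simp: F_def)
    then show ?thesis using suminf_disjoint_indicator[OF Q(1) that, of a] by (simp add: g_def)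
  qed
  have FQ: "x \<in> F \<or> (\<exists>i. x \<in> Q i)" for x using Q(3) by (auto simp: F_def)
  have gm[measurable]: "g \<in> borel_measurable borel" unfolding g_def[abs_def] by measurable
  have t2: "t \<le> 2 ^ ?n * t" using t one_le_power[of "2::real" ?n] by simp
  have gb: "0 \<le> g x" "g x \<le> 2 ^ ?n * t" for x
  proof -
    consider "x \<in> F" | i where "x \<in> Q i" using FQ by blast
    then have "0 \<le> g x \<and> g x \<le> 2 ^ ?n * t"
    proof cases
      case 1
      then show ?thesis using gF[OF 1] f(2)[of x] f(3)[of x] t2 by simp
    next
      case (2 i)
      then have "l i > 0" using l(1)[of i] l(6)[of i] by (auto simp: order_less_le)
      then have "a i \<le> 2 ^ ?n * t" using l(5)[of i] by (simp add: a_def field_simps)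
      then show ?thesis using gQ[OF 2] a0 by simp
    qed
    then show "0 \<le> g x" "g x \<le> 2 ^ ?n * t" by auto
  qed
  have "(\<integral>\<^sup>+x. ennreal \<bar>g x\<bar> \<partial>lborel) \<le> (\<integral>\<^sup>+x. ennreal (f x) * indicator F x + (\<Sum>i. ennreal (a i) * indicator (Q i) x) \<partial>lborel)"
  proof (rule nn_integral_mono)
    fix x
    consider "x \<in> F" | i where "x \<in> Q i" using FQ by blast
    then show "ennreal \<bar>g x\<bar> \<le> ennreal (f x) * indicator F x + (\<Sum>i. ennreal (a i) * indicator (Q i) x)"
    proof cases
      case 1
      then show ?thesis using f(2)[of x] by (simp add: gF)
    next
      case (2 i)
      define b where "b = (\<lambda>i. ennreal (a i) * indicator (Q i) x)"
      have "ennreal \<bar>g x\<bar> = b i" using 2 a0 by (simp add: gQ b_def)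
      also have "\<dots> = (\<Sum>i\<in>{i}. b i)" by simp
      also have "\<dots> \<le> (\<Sum>i. b i)" by (rule sum_le_suminf) auto
      finally show ?thesis unfolding b_def by (simp add: add_increasing)
    qed
  qed
  also have "\<dots> = (\<integral>\<^sup>+x. ennreal (f x) * indicator F x \<partial>lborel) + (\<integral>\<^sup>+x. (\<Sum>i. ennreal (a i) * indicator (Q i) x) \<partial>lborel)"
    by (rule nn_integral_add) measurable
  also have "(\<integral>\<^sup>+x. ennreal (f x) * indicator F x \<partial>lborel) = emeasure MF F"
    unfolding f(4) by (rule emeasure_density[symmetric]) auto
  also have "\<dots> = emeasure M F" using MF(3)[OF F] by simp
  also have "(\<integral>\<^sup>+x. (\<Sum>i. ennreal (a i) * indicator (Q i) x) \<partial>lborel) = (\<Sum>i. \<integral>\<^sup>+x. ennreal (a i) * indicator (Q i) x \<partial>lborel)"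
    by (rule nn_integral_suminf) measurable
  also have "\<dots> = (\<Sum>i. ennreal (measure M (Q i)))"
    using l(1) a0 by (intro suminf_cong) (simp add: nn_integral_cmult_indicator l(3) ennreal_mult[symmetric] al)
  also have "emeasure M F + \<dots> = emeasure M (F \<union> dense_cells M t)"
    unfolding sumQ by (rule plus_emeasure) (use dense_cells_borel[OF M t] F M in \<open>auto simp: F_def\<close>)
  also have "F \<union> dense_cells M t = UNIV" by (auto simp: F_def)
  also have "emeasure M UNIV = ennreal m" by (simp add: emeasure_eq_measure m_def)
  finally have gn: "(\<integral>\<^sup>+x. ennreal \<bar>g x\<bar> \<partial>lborel) \<le> ennreal m" .
  have gint: "integrable lborel g" "(\<integral>x. \<bar>g x\<bar> \<partial>lborel) \<le> m"
    using integrable_of_nn_integral_le[OF _ gn m] by auto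
  have gB: "g \<in> bdd_int" "\<And>x. \<bar>g x\<bar> \<le> 2 ^ ?n * t"
    using gint(1) gb by (auto simp: bdd_int_def)
  have t2': "2 ^ ?n * t > 0" using t by simp
  obtain E1 where E1: "E1 \<in> sets borel"
    "emeasure lborel E1 \<le> ennreal (real ?n * (16 * piece_const)\<^sup>2 * (\<integral>x. \<bar>g x\<bar> \<partial>lborel) / (2 ^ ?n * t))"
    "\<And>x y. y \<notin> E1 \<Longrightarrow> \<bar>pot g x - pot g y\<bar> \<le> good_const * (2 ^ ?n * t) * norm (x - y)"
    using pot_Lipschitz_off_small_set[OF t2' gB] by metis
  have E1m: "emeasure lborel E1 \<le> ennreal (real ?n * (16 * piece_const)\<^sup>2 * m / t)"
  proof (rule order_trans[OF E1(2)], rule ennreal_leI)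
    have "real ?n * (16 * piece_const)\<^sup>2 * (\<integral>x. \<bar>g x\<bar> \<partial>lborel) / (2 ^ ?n * t) \<le> real ?n * (16 * piece_const)\<^sup>2 * m / (2 ^ ?n * t)"
      using t gint(2) by (intro divide_right_mono mult_left_mono) auto
    also have "\<dots> \<le> real ?n * (16 * piece_const)\<^sup>2 * m / t"
      using t t2 m by (intro divide_left_mono) auto
    finally show "real ?n * (16 * piece_const)\<^sup>2 * (\<integral>x. \<bar>g x\<bar> \<partial>lborel) / (2 ^ ?n * t) \<le> real ?n * (16 * piece_const)\<^sup>2 * m / t" .
  qed
  define E3 where "E3 = (\<Union>i. ball (p i) (4 * ?n * l i))"
  have E3: "E3 \<in> sets borel" unfolding E3_def by (intro sets.countable_UN) auto
  have E3m: "emeasure lborel E3 \<le> ennreal (\<omega> * (4 * real ?n) ^ ?n * m / t)"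
  proof -
    have "emeasure lborel E3 \<le> (\<Sum>i. emeasure lborel (ball (p i) (4 * ?n * l i)))"
      unfolding E3_def by (rule emeasure_subadditive_countably) auto
    also have "\<dots> \<le> (\<Sum>i. ennreal (\<omega> * (4 * real ?n) ^ ?n / t) * ennreal (measure M (Q i)))"
    proof (rule suminf_le)
      fix i
      have "l i ^ ?n \<le> measure M (Q i) / t" using l(4)[of i] t by (simp add: field_simps)
      then have "\<omega> * (4 * real ?n * l i) ^ ?n \<le> \<omega> * ((4 * real ?n) ^ ?n * (measure M (Q i) / t))"
        unfolding power_mult_distrib[of "4 * real ?n" "l i"] using \<omega> by (intro mult_left_mono) auto
      then show "emeasure lborel (ball (p i) (4 * ?n * l i)) \<le> ennreal (\<omega> * (4 * real ?n) ^ ?n / t) * ennreal (measure M (Q i))"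
        using l(1)[of i] \<omega> t unfolding \<omega>_def
        by (subst ennreal_mult[symmetric]) (auto simp: emeasure_ball intro!: ennreal_leI)
    qed auto
    also have "\<dots> \<le> ennreal (\<omega> * (4 * real ?n) ^ ?n / t) * ennreal m"
      unfolding ennreal_suminf_cmult by (intro mult_left_mono sumQm) auto
    also have "\<dots> = ennreal (\<omega> * (4 * real ?n) ^ ?n * m / t)"
      using \<omega> t m by (subst ennreal_mult[symmetric]) auto
    finally show ?thesis .
  qed
  \<comment> \<open>The contribution of cell \<open>i\<close> to the bound of
    \<open>bad_part_term\<close>. Off the enlarged cell, of radius proportional to
    \<open>l i\<close>, its integral is a multiple of the mass alone: the integral of the weight is
    of order \<open>1 / l i\<close> and cancels the factor \<open>l i\<close>. Hence the sum
    \<open>J\<close> has an integral controlled by the total mass, and Chebyshev's inequality gives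
    \<open>E2\<close>.\<close>
  define j where "j i x = measure M (Q i) * l i / norm (x - p i) ^ (?n + 1)" for i x
  have j0: "j i x \<ge> 0" for i x using l(1)[of i] by (simp add: j_def)
  define J where "J x = (\<Sum>i. ennreal (j i x) * indicator (- ball (p i) (4 * ?n * l i)) x)" for x
  have jm[measurable]: "j i \<in> borel_measurable borel" for i unfolding j_def[abs_def] by measurable
  have bm[measurable]: "ball (p i) (4 * ?n * l i) \<in> sets borel" for i by simp
  have Jm[measurable]: "J \<in> borel_measurable borel" unfolding J_def[abs_def] by measurable
  have "(\<integral>\<^sup>+x. J x \<partial>lborel) = (\<Sum>i. \<integral>\<^sup>+x. ennreal (j i x) * indicator (- ball (p i) (4 * ?n * l i)) x \<partial>lborel)"
    unfolding J_def by (rule nn_integral_suminf) measurable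
  also have "\<dots> \<le> (\<Sum>i. ennreal (\<omega> * 2 ^ (?n + 1)) * ennreal (measure M (Q i)))"
  proof (rule suminf_le)
    fix i
    show "(\<integral>\<^sup>+x. ennreal (j i x) * indicator (- ball (p i) (4 * ?n * l i)) x \<partial>lborel) \<le> ennreal (\<omega> * 2 ^ (?n + 1)) * ennreal (measure M (Q i))"
    proof (cases "l i = 0")
      case False
      then have li: "4 * ?n * l i > 0" using l(1)[of i] by (simp add: order_less_le)
      let ?h = "\<lambda>x::'a. ennreal (1 / norm x ^ (?n + 1)) * indicator (- ball 0 (4 * ?n * l i)) x"
      have hm: "?h \<in> borel_measurable borel"
        by (intro borel_measurable_times_ennreal borel_measurable_indicator) auto
      have "(\<integral>\<^sup>+x. ennreal (j i x) * indicator (- ball (p i) (4 * ?n * l i)) x \<partial>lborel)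
          = (\<integral>\<^sup>+x. ennreal (measure M (Q i) * l i) * ?h (x - p i) \<partial>lborel)"
      proof (rule nn_integral_cong)
        fix x
        have "ennreal (j i x) = ennreal (measure M (Q i) * l i) * ennreal (1 / norm (x - p i) ^ (?n + 1))"
          using l(1)[of i] by (subst ennreal_mult[symmetric]) (auto simp: j_def)
        moreover have "(indicator (- ball (p i) (4 * ?n * l i)) x :: ennreal) = indicator (- ball 0 (4 * ?n * l i)) (x - p i)"
          by (auto simp: dist_norm norm_minus_commute split: split_indicator)
        ultimately show "ennreal (j i x) * indicator (- ball (p i) (4 * ?n * l i)) x = ennreal (measure M (Q i) * l i) * ?h (x - p i)"
          by (simp add: mult.assoc)
      qed
      also have "\<dots> = ennreal (measure M (Q i) * l i) * (\<integral>\<^sup>+x. ?h (x - p i) \<partial>lborel)"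
        by (rule nn_integral_cmult) (use hm in measurable)
      also have "(\<integral>\<^sup>+x. ?h (x - p i) \<partial>lborel) = (\<integral>\<^sup>+x. ?h x \<partial>lborel)"
        by (rule nn_integral_lborel_minus(1)[OF hm])
      also have "\<dots> \<le> ennreal (\<omega> * (2 ^ (?n + 1) / (4 * ?n * l i)))"
        unfolding \<omega>_def by (rule nn_integral_inverse_norm_outside_ball[OF li])
      also have "ennreal (measure M (Q i) * l i) * ennreal (\<omega> * (2 ^ (?n + 1) / (4 * ?n * l i)))
          = ennreal (measure M (Q i) * l i * (\<omega> * (2 ^ (?n + 1) / (4 * ?n * l i))))"
        using li l(1)[of i] \<omega> by (intro ennreal_mult[symmetric]) auto
      also have "measure M (Q i) * l i * (\<omega> * (2 ^ (?n + 1) / (4 * ?n * l i))) = (\<omega> * 2 ^ (?n + 1)) * measure M (Q i) * (1 / (4 * ?n))"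
        using False by (simp add: field_simps)
      also have "ennreal \<dots> \<le> ennreal ((\<omega> * 2 ^ (?n + 1)) * measure M (Q i) * 1)"
      proof (intro ennreal_leI mult_left_mono)
        have "1 \<le> real ?n" using DIM_positive[where 'a='a] by linarith
        then have "1 \<le> 4 * real ?n" by linarith
        then show "1 / real (4 * ?n) \<le> 1" by (simp add: divide_le_eq)
      qed (use \<omega> in auto)
      also have "\<dots> = ennreal (\<omega> * 2 ^ (?n + 1)) * ennreal (measure M (Q i))"
        using \<omega> by (simp add: ennreal_mult[symmetric])
      finally show ?thesis by (simp add: mult_left_mono)
    qed (simp add: j_def)
  qed auto
  also have "\<dots> \<le> ennreal (\<omega> * 2 ^ (?n + 1)) * ennreal m"
    unfolding ennreal_suminf_cmult by (intro mult_left_mono sumQm) auto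
  finally have Jint: "(\<integral>\<^sup>+x. J x \<partial>lborel) \<le> ennreal (\<omega> * 2 ^ (?n + 1)) * ennreal m" .
  define E2 where "E2 = {x. J x > ennreal t}"
  have E2[measurable]: "E2 \<in> sets borel" unfolding E2_def by measurable
  have E2m: "emeasure lborel E2 \<le> ennreal (\<omega> * 2 ^ (?n + 1) * m / t)"
  proof -
    have "ennreal t * emeasure lborel E2 = (\<integral>\<^sup>+x. ennreal t * indicator E2 x \<partial>lborel)"
      by (rule nn_integral_cmult_indicator[symmetric]) simp
    also have "\<dots> \<le> (\<integral>\<^sup>+x. J x \<partial>lborel)"
      by (rule nn_integral_mono) (auto simp: E2_def split: split_indicator)
    finally have "ennreal (1 / t) * (ennreal t * emeasure lborel E2) \<le> ennreal (1 / t) * (ennreal (\<omega> * 2 ^ (?n + 1)) * ennreal m)"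
      using Jint by (intro mult_left_mono) auto
    moreover have "ennreal (1 / t) * (ennreal t * emeasure lborel E2) = emeasure lborel E2"
      using t by (simp add: mult.assoc[symmetric] ennreal_mult[symmetric])
    ultimately show ?thesis using t \<omega> m by (simp add: ennreal_mult[symmetric] mult.commute)
  qed
  show thesis
  proof (rule that[of "E1 \<union> E2 \<union> E3"])
    show "E1 \<union> E2 \<union> E3 \<in> sets borel" using E1(1) E2 E3 by auto
    have "emeasure lborel (E1 \<union> E2 \<union> E3) \<le> emeasure lborel (E1 \<union> E2) + emeasure lborel E3"
      using E1(1) E2 E3 by (intro emeasure_subadditive) auto
    also have "\<dots> \<le> (emeasure lborel E1 + emeasure lborel E2) + emeasure lborel E3"
      using E1(1) E2 by (intro add_right_mono emeasure_subadditive) auto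
    also have "\<dots> \<le> (ennreal (real ?n * (16 * piece_const)\<^sup>2 * m / t) + ennreal (\<omega> * 2 ^ (?n + 1) * m / t)) + ennreal (\<omega> * (4 * real ?n) ^ ?n * m / t)"
      by (intro add_mono E1m E2m E3m)
    also have "\<dots> = ennreal (real ?n * (16 * piece_const)\<^sup>2 * m / t + \<omega> * 2 ^ (?n + 1) * m / t + \<omega> * (4 * real ?n) ^ ?n * m / t)"
      using m t \<omega> by (subst ennreal_plus[symmetric] | simp del: ennreal_plus)+
    also have "real ?n * (16 * piece_const)\<^sup>2 * m / t + \<omega> * 2 ^ (?n + 1) * m / t + \<omega> * (4 * real ?n) ^ ?n * m / t = small_const * m / t"
      unfolding small_const_def \<omega>_def by (simp only: distrib_right add_divide_distrib)
    finally show "emeasure lborel (E1 \<union> E2 \<union> E3) \<le> ennreal (small_const * measure M UNIV / t)" by (simp add: m_def)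
    fix x y assume x: "x \<in> udom M - (E1 \<union> E2 \<union> E3)" and y: "y \<in> udom M - (E1 \<union> E2 \<union> E3)"
    note ix = udom_integrable[OF M(2), of x] udom_integrable[OF M(2), of y]
    define h where "h z = K (x - z) - K (y - z)" for z
    have hM: "integrable M h" unfolding h_def[abs_def] using x y ix by auto
    have hg: "integrable lborel (\<lambda>z. h z * g z)"
      using Bochner_Integration.integrable_diff[OF pot_integrable[OF gB(1)] pot_integrable[OF gB(1)], of x y]
      by (simp add: h_def left_diff_distrib)
    have hQ: "integrable lborel (\<lambda>z. indicator (Q i) z * (K (x - z) - K (y - z)))" for i
    proof -
      have "indicator (Q i) \<in> bdd_int"
        using l(3)[of i] by (auto simp: bdd_int_def intro!: exI[of _ 1] split: split_indicator)
      from Bochner_Integration.integrable_diff[OF pot_integrable[OF this] pot_integrable[OF this], of x y]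
      show ?thesis by (simp add: algebra_simps)
    qed
    have hm[measurable]: "h \<in> borel_measurable borel" unfolding h_def[abs_def] by measurable
    define A where "A i = (\<integral>z. indicator (R i) z * h z \<partial>M)" for i
    define B where "B i = (\<integral>z. indicator (R i) z * (h z * g z) \<partial>lborel)" for i
    have "A sums (\<integral>z. h z \<partial>M)"
      unfolding A_def[abs_def] by (rule integral_partition_sums[OF hM]) (use R M spM in auto)
    moreover have "(\<integral>z. h z \<partial>M) = upot M x - upot M y"
      unfolding h_def upot_def using x y ix by (intro Bochner_Integration.integral_diff) auto
    moreover have "B sums (\<integral>z. h z * g z \<partial>lborel)"
      unfolding B_def[abs_def] by (rule integral_partition_sums[OF hg]) (use R in auto)
    moreover have "(\<integral>z. h z * g z \<partial>lborel) = pot g x - pot g y"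
      unfolding h_def left_diff_distrib pot_def by (intro Bochner_Integration.integral_diff pot_integrable gB)
    ultimately have AB: "(\<lambda>i. A i - B i) sums ((upot M x - upot M y) - (pot g x - pot g y))"
      by (auto intro: sums_diff)
    \<comment> \<open>Off the cells \<open>M\<close> has density \<open>g\<close>, so this piece of
      the bad part vanishes.\<close>
    have AB0: "A 0 = B 0"
    proof -
      have "A 0 = (\<integral>z. indicator F z * (indicator F z * h z) \<partial>M)"
        unfolding A_def R_def by (intro Bochner_Integration.integral_cong) (auto split: split_indicator)
      also have "\<dots> = (\<integral>z. indicator F z * h z \<partial>MF)"
        unfolding MF_def by (rule integral_real_density[symmetric]) auto
      also have "\<dots> = (\<integral>z. f z * (indicator F z * h z) \<partial>lborel)"
        unfolding f(4) using f(2) by (intro integral_real_density) auto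
      also have "\<dots> = B 0"
        unfolding B_def R_def by (intro Bochner_Integration.integral_cong) (auto simp: gF split: split_indicator)
      finally show ?thesis .
    qed
    have Jx: "summable (\<lambda>i. j i v)" "(\<Sum>i. j i v) \<le> t" if v: "v \<notin> E1 \<union> E2 \<union> E3" for v
    proof -
      have "J v = (\<Sum>i. ennreal (j i v))"
        unfolding J_def using v by (intro suminf_cong) (auto simp: E3_def split: split_indicator)
      then have le: "(\<Sum>i. ennreal (j i v)) \<le> ennreal t" using v by (auto simp: E2_def not_less)
      then have "(\<Sum>i. ennreal (j i v)) \<noteq> top" by (metis ennreal_less_top le_less_trans order_less_irrefl)
      then show s: "summable (\<lambda>i. j i v)" by (rule summable_suminf_not_top[OF j0])
      show "(\<Sum>i. j i v) \<le> t"
        using le suminf_ennreal2[OF j0 s] t by (metis ennreal_le_iff less_imp_le)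
    qed
    define D where "D = c * 2 ^ (?n + 3) * ?n * norm (x - y)"
    have D0: "D \<ge> 0" using c_nonneg by (simp add: D_def)
    have ABi: "\<bar>A (Suc i) - B (Suc i)\<bar> \<le> D * (j i x + j i y)" for i
    proof -
      have "B (Suc i) = (\<integral>z. a i * (indicator (Q i) z * (K (x - z) - K (y - z))) \<partial>lborel)"
        unfolding B_def R_def by (intro Bochner_Integration.integral_cong) (auto simp: gQ h_def split: split_indicator)
      also have "\<dots> = measure M (Q i) / l i ^ ?n * (\<integral>z. indicator (Q i) z * (K (x - z) - K (y - z)) \<partial>lborel)"
        unfolding a_def[symmetric] by (rule integral_mult_right_zero)
      finally have B: "B (Suc i) = \<dots>" .
      have A: "A (Suc i) = (\<integral>z. indicator (Q i) z * (K (x - z) - K (y - z)) \<partial>M)"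
        by (simp add: A_def R_def h_def)
      show ?thesis
        unfolding A B D_def j_def
        by (rule bad_part_term[OF M Q(2) l(3,1,6,2)]) (use x y hM hQ in \<open>auto simp: E3_def h_def[abs_def]\<close>)
    qed
    note Jx' = Jx[of x] Jx[of y]
    have xy: "x \<notin> E1 \<union> E2 \<union> E3" "y \<notin> E1 \<union> E2 \<union> E3" using x y by auto
    have sj: "summable (\<lambda>i. D * (j i x + j i y))"
      using xy by (intro summable_mult summable_add Jx')
    \<comment> \<open>Dropping piece 0 does not change the sum, and the remaining index runs over
      the cells.\<close>
    have "(\<lambda>i. A (Suc i) - B (Suc i)) sums ((upot M x - upot M y) - (pot g x - pot g y))"
      using AB AB0 by (subst sums_Suc_iff) simp
    then have "(upot M x - upot M y) - (pot g x - pot g y) = (\<Sum>i. A (Suc i) - B (Suc i))" by (simp add: sums_iff)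
    moreover have sab: "summable (\<lambda>i. \<bar>A (Suc i) - B (Suc i)\<bar>)"
      by (rule summable_comparison_test'[OF sj, of 0]) (use ABi in auto)
    ultimately have "\<bar>(upot M x - upot M y) - (pot g x - pot g y)\<bar> \<le> (\<Sum>i. \<bar>A (Suc i) - B (Suc i)\<bar>)"
      using summable_rabs by metis
    also have "\<dots> \<le> (\<Sum>i. D * (j i x + j i y))" by (rule suminf_le[OF ABi sab sj])
    also have "\<dots> = D * ((\<Sum>i. j i x) + (\<Sum>i. j i y))"
      using xy by (simp add: suminf_mult suminf_add[symmetric] summable_add Jx')
    also have "\<dots> \<le> D * (t + t)" using xy by (intro mult_left_mono add_mono Jx' D0)
    also have "\<dots> = bad_const * t * norm (x - y)" by (simp add: D_def bad_const_def power_add)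
    finally have bad: "\<bar>(upot M x - upot M y) - (pot g x - pot g y)\<bar> \<le> bad_const * t * norm (x - y)" .
    have "\<bar>upot M x - upot M y\<bar> \<le> bad_const * t * norm (x - y) + good_const * (2 ^ ?n * t) * norm (x - y)"
      using bad E1(3)[of y x] y by auto
    also have "\<dots> = lip_const * t * norm (x - y)" by (simp add: lip_const_def algebra_simps)
    finally show "\<bar>upot M x - upot M y\<bar> \<le> lip_const * t * norm (x - y)" .
  qed
qed

end

subsection \<open>Lebesgue density and approximate derivatives\<close>

text \<open>Lebesgue density 0 at \<open>y\<close>. Measurability is part of the notion because
  \<open>measure\<close> is 0 on nonmeasurable sets.\<close>

definition thin_at :: "'a::euclidean_space set \<Rightarrow> 'a \<Rightarrow> bool" where
  "thin_at A y \<longleftrightarrow> A \<in> sets lebesgue \<and>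
     ((\<lambda>r. measure lebesgue (A \<inter> ball y r) / measure lebesgue (ball y r)) \<longlongrightarrow> 0) (at_right 0)"

lemma lmeasurable_Int_ball: "A \<in> sets lebesgue \<Longrightarrow> A \<inter> ball (y::'a::euclidean_space) r \<in> lmeasurable"
  by (intro bounded_set_imp_lmeasurable bounded_Int) auto

lemma thin_at_subset:
  assumes "thin_at B y" "A \<in> sets lebesgue" "r0 > 0" "A \<inter> ball y r0 \<subseteq> B"
  shows "thin_at A y"
  unfolding thin_at_def
proof (intro conjI)
  have B: "B \<in> sets lebesgue" using assms(1) by (simp add: thin_at_def)
  show "((\<lambda>r. measure lebesgue (A \<inter> ball y r) / measure lebesgue (ball y r)) \<longlongrightarrow> 0) (at_right 0)"
  proof (rule tendsto_sandwich[OF _ _ tendsto_const])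
    show "((\<lambda>r. measure lebesgue (B \<inter> ball y r) / measure lebesgue (ball y r)) \<longlongrightarrow> 0) (at_right 0)"
      using assms(1) by (simp add: thin_at_def)
    show "\<forall>\<^sub>F r in at_right 0. measure lebesgue (A \<inter> ball y r) / measure lebesgue (ball y r)
        \<le> measure lebesgue (B \<inter> ball y r) / measure lebesgue (ball y r)"
      unfolding eventually_at_right_field
    proof (intro exI[of _ r0] conjI allI impI)
      fix r assume r: "0 < r" "r < r0"
      have "A \<inter> ball y r \<subseteq> B \<inter> ball y r" using assms(4) r by auto
      then show "measure lebesgue (A \<inter> ball y r) / measure lebesgue (ball y r)
          \<le> measure lebesgue (B \<inter> ball y r) / measure lebesgue (ball y r)"
        by (intro divide_right_mono measure_mono_fmeasurable lmeasurable_Int_ball B)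
           (use assms(2) in \<open>auto intro: sets.Int\<close>)
    qed (rule assms(3))
  qed auto
qed (rule assms(2))

lemma thin_at_Un:
  assumes "thin_at A y" "thin_at B y" shows "thin_at (A \<union> B) y"
  unfolding thin_at_def
proof (intro conjI)
  have AB: "A \<in> sets lebesgue" "B \<in> sets lebesgue" using assms by (auto simp: thin_at_def)
  then show "A \<union> B \<in> sets lebesgue" by auto
  show "((\<lambda>r. measure lebesgue ((A \<union> B) \<inter> ball y r) / measure lebesgue (ball y r)) \<longlongrightarrow> 0) (at_right 0)"
  proof (rule tendsto_sandwich[OF _ _ tendsto_const])
    show "((\<lambda>r. measure lebesgue (A \<inter> ball y r) / measure lebesgue (ball y r)
        + measure lebesgue (B \<inter> ball y r) / measure lebesgue (ball y r)) \<longlongrightarrow> 0) (at_right 0)"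
      using tendsto_add[of _ 0 _ _ 0] assms by (force simp: thin_at_def)
    have "measure lebesgue ((A \<union> B) \<inter> ball y r) \<le> measure lebesgue (A \<inter> ball y r) + measure lebesgue (B \<inter> ball y r)" for r
      unfolding Int_Un_distrib2 using AB by (intro measure_Un_le) (auto intro: sets.Int)
    then show "\<forall>\<^sub>F r in at_right 0. measure lebesgue ((A \<union> B) \<inter> ball y r) / measure lebesgue (ball y r)
        \<le> measure lebesgue (A \<inter> ball y r) / measure lebesgue (ball y r)
        + measure lebesgue (B \<inter> ball y r) / measure lebesgue (ball y r)"
      by (intro always_eventually allI) (simp add: add_divide_distrib[symmetric] divide_right_mono)
  qed auto
qed

lemma thin_at_null: 
  assumes "A \<in> null_sets lebesgue" shows "thin_at A y"
proof -
  have "measure lebesgue (A \<inter> ball y r) = 0" for r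
  proof -
    have "A \<inter> ball y r \<in> null_sets lebesgue" using assms by (intro null_set_Int2) auto
    then show ?thesis by (auto simp: null_sets_def measure_def)
  qed
  then show ?thesis using assms by (auto simp: thin_at_def)
qed

text \<open>Vitali's covering theorem, applied to balls inside an open set that almost misses \<open>A\<close>.\<close>

lemma Lebesgue_density:
  fixes A :: "'a::euclidean_space set"
  assumes A: "A \<in> sets borel"
  shows "AE y in lebesgue. y \<notin> A \<longrightarrow> thin_at A y"
proof -
  \<comment> \<open>The points outside \<open>A\<close>, in a bounded region, with arbitrarily small
    balls in which \<open>A\<close> takes more than the fraction \<open>1 / Suc n\<close>.
    Boundedness keeps the covering balls inside a bounded set.\<close>
  define D where "D n R = {y \<in> ball 0 (real R) - A. \<forall>d>0. \<exists>r. 0 < r \<and> r < d \<and>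
      ennreal (1 / Suc n) * emeasure lborel (ball y r) < emeasure lborel (A \<inter> ball y r)}" for n R :: nat
  have neg: "negligible (D n R)" for n R
    unfolding negligible_outer_le
  proof (intro allI impI)
    fix e :: real assume e: "e > 0"
    define a where "a = 1 / real (Suc n)"
    have a: "a > 0" by (simp add: a_def)
    define B where "B = ball (0::'a) (real R) - A"
    have B: "B \<in> sets borel" using A by (auto simp: B_def)
    obtain U0 where U0: "open U0" "B \<subseteq> U0" "emeasure lborel (U0 - B) < ennreal (a * e)"
      using outer_regular_lborel[OF B, of "a * e"] a e by auto
    define U where "U = U0 \<inter> ball 0 (real R)"
    have U: "open U" "B \<subseteq> U" "A \<inter> U \<subseteq> U0 - B" using U0 by (auto simp: U_def B_def)
    have AU: "emeasure lborel (A \<inter> U) \<le> ennreal (a * e)"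
      using emeasure_mono[OF U(3), of lborel] U0 B by (auto intro: order_trans less_imp_le)
    define K where "K = {(y, r). y \<in> D n R \<and> 0 < r \<and> ball y r \<subseteq> U \<and>
      ennreal a * emeasure lborel (ball y r) < emeasure lborel (A \<inter> ball y r)}"
    obtain C where C: "countable C" "C \<subseteq> K"
      "pairwise (\<lambda>i j. disjnt (ball (fst i) (snd i)) (ball (fst j) (snd j))) C"
      "negligible (D n R - (\<Union>i\<in>C. ball (fst i) (snd i)))"
    proof (rule Vitali_covering_theorem_balls[of "D n R" K fst snd])
      fix x and d :: real assume x: "x \<in> D n R" and d: "0 < d"
      then have "x \<in> U" using U by (auto simp: D_def B_def)
      then obtain s where s: "s > 0" "ball x s \<subseteq> U" using U(1) openE by blast
      have "\<forall>d>0. \<exists>r. 0 < r \<and> r < d \<and> ennreal a * emeasure lborel (ball x r) < emeasure lborel (A \<inter> ball x r)"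
        using x by (simp add: D_def a_def)
      moreover have "min d s > 0" using d s by simp
      ultimately obtain r where r: "0 < r" "r < min d s" "ennreal a * emeasure lborel (ball x r) < emeasure lborel (A \<inter> ball x r)"
        by blast
      then have "(x, r) \<in> K" using x s by (auto simp: K_def)
      then show "\<exists>i. i \<in> K \<and> x \<in> ball (fst i) (snd i) \<and> snd i < d" using r by (intro exI[of _ "(x, r)"]) auto
    qed (rule that)
    define V where "V = (\<Union>i\<in>C. ball (fst i) (snd i))"
    have V: "V \<in> sets borel" unfolding V_def by (intro borel_open open_UN) auto
    have dis: "disjoint_family_on (\<lambda>i. ball (fst i) (snd i)) C"
      using C(3) by (auto simp: disjoint_family_on_def pairwise_def disjnt_def)
    \<comment> \<open>Each ball is filled by \<open>A\<close> to more than the fraction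
      \<open>a\<close>, and the balls are disjoint and lie in \<open>U\<close>; so the volume of
      their union is at most that of \<open>A \<inter> U\<close> divided by
      \<open>a\<close>.\<close>
    have "ennreal a * emeasure lborel V = ennreal a * (\<integral>\<^sup>+i. emeasure lborel (ball (fst i) (snd i)) \<partial>count_space C)"
      unfolding V_def using C(1) dis by (subst emeasure_UN_countable) auto
    also have "\<dots> = (\<integral>\<^sup>+i. ennreal a * emeasure lborel (ball (fst i) (snd i)) \<partial>count_space C)"
      by (rule nn_integral_cmult[symmetric]) auto
    also have "\<dots> \<le> (\<integral>\<^sup>+i. emeasure lborel (A \<inter> ball (fst i) (snd i)) \<partial>count_space C)"
      using C(2) by (intro nn_integral_mono) (auto simp: K_def intro: less_imp_le)
    also have "\<dots> = emeasure lborel (\<Union>i\<in>C. A \<inter> ball (fst i) (snd i))"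
    proof (rule emeasure_UN_countable[symmetric])
      show "disjoint_family_on (\<lambda>i. A \<inter> ball (fst i) (snd i)) C"
        using dis unfolding disjoint_family_on_def by blast
    qed (use C(1) A in auto)
    also have "\<dots> \<le> emeasure lborel (A \<inter> U)"
    proof (rule emeasure_mono)
      have "ball (fst i) (snd i) \<subseteq> U" if "i \<in> C" for i
        using C(2) that by (cases i) (auto simp: K_def)
      then show "(\<Union>i\<in>C. A \<inter> ball (fst i) (snd i)) \<subseteq> A \<inter> U" by blast
    qed (use A U(1) in auto)
    finally have "ennreal a * emeasure lborel V \<le> ennreal (a * e)" using AU by (rule order_trans)
    then have "ennreal (1 / a) * (ennreal a * emeasure lborel V) \<le> ennreal (1 / a) * ennreal (a * e)"
      by (rule mult_left_mono) simp
    then have Ve: "emeasure lborel V \<le> ennreal e"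
      using a e by (simp add: mult.assoc[symmetric] ennreal_mult[symmetric])
    let ?T = "V \<union> (D n R - V)"
    have Dn: "D n R - V \<in> null_sets lebesgue" using C(4) by (simp add: V_def negligible_iff_null_sets)
    have "emeasure lebesgue ?T = emeasure lebesgue V"
      using Dn V by (intro emeasure_Un_null_set) auto
    then have "emeasure lebesgue ?T \<le> ennreal e" using Ve V by simp
    moreover have "?T \<in> sets lebesgue"
      by (rule sets.Un) (use V Dn in \<open>simp_all add: null_setsD2\<close>)
    ultimately show "\<exists>T. D n R \<subseteq> T \<and> T \<in> lmeasurable \<and> measure lebesgue T \<le> e"
      using e by (intro exI[of _ ?T]) (auto simp: fmeasurable_def measure_def intro!: enn2real_leI intro: le_less_trans)
  qed
  have "AE y in lebesgue. \<forall>n R. y \<notin> D n R"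
    unfolding AE_all_countable using neg AE_not_in by (auto simp: negligible_iff_null_sets)
  then show ?thesis
  proof eventually_elim
    fix y assume y: "\<forall>n R. y \<notin> D n R"
    show "y \<notin> A \<longrightarrow> thin_at A y"
    proof
      assume yA: "y \<notin> A"
      have "((\<lambda>r. measure lebesgue (A \<inter> ball y r) / measure lebesgue (ball y r)) \<longlongrightarrow> 0) (at_right 0)"
      proof (rule tendstoI)
        fix e :: real assume e: "e > 0"
        obtain n where n: "1 / real (Suc n) < e" using e nat_approx_posE by metis
        obtain R :: nat where R: "norm y < real R" using reals_Archimedean2 by blast
        have "y \<notin> D n R" using y by blast
        then obtain d where d: "d > 0" "\<And>r. 0 < r \<Longrightarrow> r < d \<Longrightarrow>
            \<not> ennreal (1 / Suc n) * emeasure lborel (ball y r) < emeasure lborel (A \<inter> ball y r)"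
          using yA R by (auto simp: D_def)
        show "\<forall>\<^sub>F r in at_right 0. dist (measure lebesgue (A \<inter> ball y r) / measure lebesgue (ball y r)) 0 < e"
          unfolding eventually_at_right_field
        proof (intro exI[of _ d] conjI allI impI)
          fix r assume r: "0 < r" "r < d"
          have "emeasure lborel (A \<inter> ball y r) \<le> ennreal (1 / Suc n) * emeasure lborel (ball y r)"
            using d(2)[OF r] by (simp add: not_less)
          moreover have "emeasure lborel (A \<inter> ball y r) = ennreal (measure lebesgue (A \<inter> ball y r))"
          proof -
            have "A \<inter> ball y r \<in> sets borel" using A by auto
            then show ?thesis
              using emeasure_eq_measure2[OF lmeasurable_Int_ball[of A y r]] A by simp
          qed
          moreover have "emeasure lborel (ball y r) = ennreal (measure lebesgue (ball y r))"
            using emeasure_eq_measure2[of "ball y r" lebesgue] lmeasurable_ball[of y r] by simp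
          ultimately have "ennreal (measure lebesgue (A \<inter> ball y r)) \<le> ennreal (1 / Suc n * measure lebesgue (ball y r))"
            by (simp add: ennreal_mult[symmetric])
          then have "measure lebesgue (A \<inter> ball y r) \<le> 1 / Suc n * measure lebesgue (ball y r)"
            by (subst (asm) ennreal_le_iff) auto
          then have "measure lebesgue (A \<inter> ball y r) / measure lebesgue (ball y r) \<le> 1 / Suc n"
            using content_ball_pos[OF r(1), of y] by (simp add: pos_divide_le_eq)
          then show "dist (measure lebesgue (A \<inter> ball y r) / measure lebesgue (ball y r)) 0 < e"
            using n by (simp add: dist_real_def)
        qed (rule d(1))
      qed
      then show "thin_at A y" using A by (simp add: thin_at_def)
    qed
  qed
qed

text \<open>If the norm were larger, the directions in which the bound fails would form a nonempty
  open cone. A cone with vertex \<open>y\<close> fills a fixed positive fraction of every ball about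
  \<open>y\<close>, yet near \<open>y\<close> it would have to be contained in a set of density
  0.\<close>

lemma norm_blinfun_le_off_thin:
  fixes L :: "'a::euclidean_space \<Rightarrow>\<^sub>L real"
  assumes thin: "thin_at A y" and r0: "r0 > 0" and "\<epsilon> \<ge> 0"
    and L: "\<And>x. x \<in> ball y r0 - A \<Longrightarrow> \<bar>L (x - y)\<bar> \<le> \<epsilon> * norm (x - y)"
  shows "norm L \<le> \<epsilon>"
proof (rule ccontr)
  assume "\<not> norm L \<le> \<epsilon>"
  then obtain u where u: "\<bar>L u\<bar> > \<epsilon> * norm u"
    using norm_blinfun_bound[OF \<open>\<epsilon> \<ge> 0\<close>, of L] by (metis not_le real_norm_def)
  then have "u \<noteq> 0" by auto
  define W where "W = {z\<in>ball 0 1. \<bar>L z\<bar> > \<epsilon> * norm z}"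
  have "open W"
  proof -
    have "W = ball 0 1 \<inter> {z. \<epsilon> * norm z < \<bar>L z\<bar>}" by (auto simp: W_def)
    then show ?thesis
      by (simp only:) (intro open_Int open_ball open_Collect_less continuous_intros)
  qed
  have uW: "(1 / (2 * norm u)) *\<^sub>R u \<in> W"
    using u \<open>u \<noteq> 0\<close> by (simp add: W_def blinfun.scaleR_right abs_mult pos_less_divide_eq)
  have W_lm: "W \<in> lmeasurable"
    using \<open>open W\<close> by (intro lmeasurable_open bounded_subset[OF bounded_ball[of 0 1]]) (auto simp: W_def)
  have W_pos: "measure lebesgue W > 0"
    using open_not_negligible[OF \<open>open W\<close>] uW W_lm
    by (metis empty_iff negligible_iff_measure measure_nonneg order_le_less)
  define w where "w = measure lebesgue W / measure lebesgue (ball (0::'a) 1)"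
  have w: "w > 0" using W_pos content_ball_pos[of 1 "0::'a"] by (simp add: w_def)
  have A: "A \<in> sets lebesgue" using thin by (simp add: thin_at_def)
  have key: "w \<le> measure lebesgue (A \<inter> ball y r) / measure lebesgue (ball y r)" if r: "0 < r" "r < r0" for r
  proof -
    let ?V = "(\<lambda>x. r *\<^sub>R x + y) ` W"
    have b: "measure lebesgue (ball y r) > 0" "measure lebesgue (ball y r) = r ^ DIM('a) * measure lebesgue (ball (0::'a) 1)"
      using r content_ball_conv_unit_ball[of r y] content_ball_pos[OF r(1), of y] by auto
    have V: "measure lebesgue ?V = r ^ DIM('a) * measure lebesgue W"
      using measure_lebesgue_affine[of r y W] r by (simp add: add.commute)
    have sub: "?V \<subseteq> A \<inter> ball y r"
    proof
      fix x assume "x \<in> ?V"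
      then obtain z where z: "z \<in> W" "x = r *\<^sub>R z + y" by auto
      then have xb: "x \<in> ball y r" using r by (simp add: W_def dist_norm)
      have "\<bar>L (x - y)\<bar> > \<epsilon> * norm (x - y)"
        using z r by (simp add: W_def blinfun.scaleR_right abs_mult)
      then have "x \<in> A" using L[of x] xb r by (auto simp: not_le[symmetric])
      with xb show "x \<in> A \<inter> ball y r" by simp
    qed
    \<comment> \<open>As \<open>measure\<close> is 0 on nonmeasurable sets, the positive value found
      in \<open>V\<close> gives measurability.\<close>
    have "?V \<in> sets lebesgue"
      by (metis V W_pos b(2) measure_notin_sets mult_pos_pos order_less_irrefl r(1) zero_less_power)
    then have "measure lebesgue ?V \<le> measure lebesgue (A \<inter> ball y r)"
      by (intro measure_mono_fmeasurable[OF sub] lmeasurable_Int_ball A)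
    then have "measure lebesgue ?V / measure lebesgue (ball y r) \<le> measure lebesgue (A \<inter> ball y r) / measure lebesgue (ball y r)"
      using b(1) by (intro divide_right_mono) auto
    moreover have "measure lebesgue ?V / measure lebesgue (ball y r) = w"
      using r unfolding V b(2) by (simp add: w_def)
    ultimately show ?thesis by simp
  qed
  have "\<forall>\<^sub>F r in at_right 0. w \<le> measure lebesgue (A \<inter> ball y r) / measure lebesgue (ball y r)"
    unfolding eventually_at_right_field using key r0 by (intro exI[of _ r0]) auto
  then have "w \<le> 0"
    using thin by (intro tendsto_lowerbound[of _ 0]) (auto simp: thin_at_def)
  with w show False by simp
qed

text \<open>Approximate differentiability with slope \<open>L\<close> up to a fixed relative error.
  The complement of the domain \<open>S\<close> is absorbed in the thin set \<open>A\<close>, so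
  that domains can be changed by null sets.\<close>

definition near_linear :: "'a::euclidean_space set \<Rightarrow> ('a \<Rightarrow> real) \<Rightarrow> 'a \<Rightarrow> ('a \<Rightarrow>\<^sub>L real) \<Rightarrow> real \<Rightarrow> bool" where
  "near_linear S v y L \<epsilon> \<longleftrightarrow> (\<exists>A r. thin_at A y \<and> r > 0 \<and>
     (\<forall>x\<in>ball y r - A. x \<in> S \<and> \<bar>v x - v y - L (x - y)\<bar> \<le> \<epsilon> * norm (x - y)))"

lemma near_linear_diff_le:
  assumes L1: "near_linear S v y L1 a" and L2: "near_linear S v y L2 b" and ab: "a \<ge> 0" "b \<ge> 0"
  shows "norm (L1 - L2) \<le> a + b"
proof -
  obtain A r where A: "thin_at A y" "r > 0"
    "\<And>x. x \<in> ball y r - A \<Longrightarrow> \<bar>v x - v y - L1 (x - y)\<bar> \<le> a * norm (x - y)"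
    using L1 unfolding near_linear_def by blast
  obtain B s where B: "thin_at B y" "s > 0"
    "\<And>x. x \<in> ball y s - B \<Longrightarrow> \<bar>v x - v y - L2 (x - y)\<bar> \<le> b * norm (x - y)"
    using L2 unfolding near_linear_def by blast
  show ?thesis
  proof (rule norm_blinfun_le_off_thin[OF thin_at_Un[OF A(1) B(1)], of "min r s"])
    fix x assume "x \<in> ball y (min r s) - (A \<union> B)"
    then have "\<bar>v x - v y - L1 (x - y)\<bar> \<le> a * norm (x - y)" "\<bar>v x - v y - L2 (x - y)\<bar> \<le> b * norm (x - y)"
      using A(3)[of x] B(3)[of x] by auto
    then show "\<bar>(L1 - L2) (x - y)\<bar> \<le> (a + b) * norm (x - y)"
      by (simp add: blinfun.diff_left distrib_right)
  qed (use A B ab in auto)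
qed

text \<open>The slope found for a given error depends on the decomposition used for that error. Two
  slopes differ by at most the sum of their errors, so slopes for errors tending to 0 form a Cauchy
  sequence, and its limit serves for every error.\<close>

lemma near_linear_limit:
  assumes "\<And>\<epsilon>. \<epsilon> > 0 \<Longrightarrow> \<exists>L. near_linear S v y L \<epsilon>"
  obtains L where "\<And>\<epsilon>. \<epsilon> > 0 \<Longrightarrow> near_linear S v y L \<epsilon>"
proof -
  define e where "e n = inverse (real (Suc n))" for n
  have e: "e n > 0" for n by (simp add: e_def)
  have e0: "e \<longlonglongrightarrow> 0" unfolding e_def[abs_def] by (rule LIMSEQ_inverse_real_of_nat)
  have "\<forall>n. \<exists>L. near_linear S v y L (e n)" using assms e by blast
  then obtain L where L: "\<And>n. near_linear S v y (L n) (e n)" by metis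
  have LL: "norm (L n - L m) \<le> e n + e m" for n m
    by (rule near_linear_diff_le[OF L L]) (use e in \<open>auto intro: less_imp_le\<close>)
  have mono: "e m \<le> e n" if "n \<le> m" for n m using that by (simp add: e_def le_imp_inverse_le)
  have "Cauchy L"
  proof (rule CauchyI)
    fix d :: real assume "d > 0"
    then have "eventually (\<lambda>n. e n < d / 2) sequentially" using order_tendstoD(2)[OF e0, of "d / 2"] by simp
    then obtain N where N: "e N < d / 2" by (auto simp: eventually_sequentially)
    show "\<exists>M. \<forall>m\<ge>M. \<forall>n\<ge>M. norm (L m - L n) < d"
    proof (intro exI[of _ N] allI impI)
      fix m n assume "N \<le> m" "N \<le> n"
      then show "norm (L m - L n) < d" using LL[of m n] mono[of N m] mono[of N n] N by linarith
    qed
  qed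
  then obtain L0 where L0: "L \<longlonglongrightarrow> L0" using Cauchy_convergent convergent_def by blast
  have L0n: "norm (L n - L0) \<le> e n" for n
  proof (rule tendsto_upperbound)
    show "(\<lambda>m. norm (L n - L m) - e m) \<longlonglongrightarrow> norm (L n - L0)"
      using tendsto_diff[OF tendsto_norm[OF tendsto_diff[OF tendsto_const L0]] e0] by simp
    have "norm (L n - L m) - e m \<le> e n" for m using LL[of n m] by simp
    then show "\<forall>\<^sub>F m in sequentially. norm (L n - L m) - e m \<le> e n" by simp
  qed simp
  show thesis
  proof (rule that[of L0])
    fix \<epsilon> :: real assume "\<epsilon> > 0"
    then have "eventually (\<lambda>n. e n < \<epsilon> / 2) sequentially" using order_tendstoD(2)[OF e0, of "\<epsilon> / 2"] by simp
    then obtain n where n: "e n < \<epsilon> / 2" by (auto simp: eventually_sequentially)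
    obtain A r where A: "thin_at A y" "r > 0"
      "\<And>x. x \<in> ball y r - A \<Longrightarrow> x \<in> S \<and> \<bar>v x - v y - L n (x - y)\<bar> \<le> e n * norm (x - y)"
      using L[of n] unfolding near_linear_def by blast
    show "near_linear S v y L0 \<epsilon>"
      unfolding near_linear_def
    proof (intro exI[of _ A] exI[of _ r] conjI ballI)
      fix x assume x: "x \<in> ball y r - A"
      have "\<bar>(L n - L0) (x - y)\<bar> \<le> norm (L n - L0) * norm (x - y)" using norm_blinfun[of "L n - L0" "x - y"] by simp
      also have "\<dots> \<le> e n * norm (x - y)" by (intro mult_right_mono L0n) auto
      finally have "\<bar>v x - v y - L0 (x - y)\<bar> \<le> e n * norm (x - y) + e n * norm (x - y)"
        using A(3)[OF x] unfolding blinfun.diff_left by linarith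
      also have "\<dots> \<le> \<epsilon> * norm (x - y)"
        unfolding distrib_right[symmetric] using n by (intro mult_right_mono) auto
      finally show "\<bar>v x - v y - L0 (x - y)\<bar> \<le> \<epsilon> * norm (x - y)" .
      show "x \<in> S" using A(3)[OF x] by simp
    qed (use A in auto)
  qed
qed

lemma has_ap_derivative_of_near_linear:
  fixes v :: "'a::euclidean_space \<Rightarrow> real"
  assumes S: "- S \<in> null_sets lebesgue" and v: "v \<in> borel_measurable (lebesgue_on S)" and y: "y \<in> S"
    and L: "\<And>\<epsilon>. \<epsilon> > 0 \<Longrightarrow> near_linear S v y L \<epsilon>"
  shows "has_ap_derivative S v y L"
proof -
  have Sm: "S \<in> sets lebesgue"
    using null_setsD2[OF S] by (metis Compl_in_sets_lebesgue double_complement)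
  have full: "measure lebesgue (S \<inter> ball y r) = measure lebesgue (ball y r)" for r
  proof -
    have "ball y r - S \<in> null_sets lebesgue"
      by (rule null_sets_subset[OF S]) (use Sm in auto)
    then have "emeasure lebesgue (ball y r - (ball y r - S)) = emeasure lebesgue (ball y r)"
      by (intro emeasure_Diff_null_set) auto
    moreover have "ball y r - (ball y r - S) = S \<inter> ball y r" by auto
    ultimately show ?thesis by (simp add: measure_def)
  qed
  have "density_point S y"
    unfolding density_point_def full
  proof (intro conjI Sm)
    have "\<forall>\<^sub>F r in at_right 0. measure lebesgue (ball y r) / measure lebesgue (ball y r) = 1"
      unfolding eventually_at_right_field
      by (intro exI[of _ 1]) (use content_ball_pos[of _ y] in \<open>auto simp: less_le\<close>)
    then show "((\<lambda>r. measure lebesgue (ball y r) / measure lebesgue (ball y r)) \<longlongrightarrow> 1) (at_right 0)"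
      by (rule tendsto_eventually)
  qed
  moreover
  have id: "(\<lambda>x. x) \<in> borel_measurable (lebesgue_on S)"
    using measurable_restrict_space1[OF measurable_completion[of id lborel borel]] by (simp add: id_def)
  define q where "q x = (v x - v y - L (x - y)) / norm (x - y)" for x
  have q: "q \<in> borel_measurable (lebesgue_on S)"
  proof -
    have "(\<lambda>x. L (x - y)) \<in> borel_measurable borel" by (intro borel_measurable_continuous_onI continuous_intros)
    from measurable_compose[OF id this] have [measurable]: "(\<lambda>x. L (x - y)) \<in> borel_measurable (lebesgue_on S)" .
    have "(\<lambda>x. norm (x - y)) \<in> borel_measurable borel" by (intro borel_measurable_continuous_onI continuous_intros)
    from measurable_compose[OF id this] have [measurable]: "(\<lambda>x. norm (x - y)) \<in> borel_measurable (lebesgue_on S)" .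
    note [measurable] = v
    show ?thesis unfolding q_def[abs_def] by measurable
  qed
  moreover have "((\<lambda>r. measure lebesgue ({x\<in>S. \<bar>q x - 0\<bar> > \<epsilon>} \<inter> ball y r) / measure lebesgue (ball y r)) \<longlongrightarrow> 0) (at_right 0)"
    if \<epsilon>: "\<epsilon> > 0" for \<epsilon>
  proof -
    obtain A r where A: "thin_at A y" "r > 0"
      "\<And>x. x \<in> ball y r - A \<Longrightarrow> x \<in> S \<and> \<bar>v x - v y - L (x - y)\<bar> \<le> \<epsilon> * norm (x - y)"
      using L[OF \<epsilon>] unfolding near_linear_def by blast
    have "{x\<in>space (lebesgue_on S). \<bar>q x - 0\<bar> > \<epsilon>} \<in> sets (lebesgue_on S)" using q by measurable
    then have m: "{x\<in>S. \<bar>q x - 0\<bar> > \<epsilon>} \<in> sets lebesgue" using Sm by (simp add: sets_restrict_space_iff)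
    have "{x\<in>S. \<bar>q x - 0\<bar> > \<epsilon>} \<inter> ball y r \<subseteq> A"
    proof
      fix x assume x: "x \<in> {x\<in>S. \<bar>q x - 0\<bar> > \<epsilon>} \<inter> ball y r"
      show "x \<in> A"
      proof (rule ccontr)
        assume "x \<notin> A"
        with x A(3)[of x] have le: "\<bar>v x - v y - L (x - y)\<bar> \<le> \<epsilon> * norm (x - y)" by auto
        have "\<bar>q x\<bar> \<le> \<epsilon>"
          using le \<epsilon> by (cases "x = y") (auto simp: q_def divide_le_eq)
        with x show False by auto
      qed
    qed
    from thin_at_subset[OF A(1) m A(2) this] show ?thesis by (simp add: thin_at_def)
  qed
  ultimately show ?thesis
    using y unfolding has_ap_derivative_def has_ap_limit_def q_def[abs_def] by blast
qed

lemma near_linear_norm_le: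
  assumes L: "\<And>\<epsilon>. \<epsilon> > 0 \<Longrightarrow> near_linear S v y L \<epsilon>" and B: "thin_at B y" and C: "C \<ge> 0"
    and v: "\<And>x. x \<in> S - B \<Longrightarrow> \<bar>v x - v y\<bar> \<le> C * norm (x - y)"
  shows "norm L \<le> C"
proof (rule field_le_epsilon)
  fix \<epsilon> :: real assume \<epsilon>: "\<epsilon> > 0"
  obtain A r where A: "thin_at A y" "r > 0"
    "\<And>x. x \<in> ball y r - A \<Longrightarrow> x \<in> S \<and> \<bar>v x - v y - L (x - y)\<bar> \<le> \<epsilon> * norm (x - y)"
    using L[OF \<epsilon>] unfolding near_linear_def by blast
  show "norm L \<le> C + \<epsilon>"
  proof (rule norm_blinfun_le_off_thin[OF thin_at_Un[OF A(1) B] A(2)])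
    fix x assume "x \<in> ball y r - (A \<union> B)"
    then have "\<bar>v x - v y - L (x - y)\<bar> \<le> \<epsilon> * norm (x - y)" "\<bar>v x - v y\<bar> \<le> C * norm (x - y)"
      using A(3)[of x] v[of x] by auto
    then show "\<bar>L (x - y)\<bar> \<le> (C + \<epsilon>) * norm (x - y)" by (simp add: distrib_right)
  qed (use C \<epsilon> in auto)
qed

subsection \<open>Density of smooth functions in \<open>L\<^sup>1\<close>\<close>

text \<open>Differentiability in the classical sense, with the linear approximation spelled out so
  that it combines directly with \<open>near_linear\<close>.\<close>

definition diffable :: "('a::euclidean_space \<Rightarrow> real) \<Rightarrow> 'a \<Rightarrow> bool" where
  "diffable v y \<longleftrightarrow> (\<exists>L :: 'a \<Rightarrow>\<^sub>L real. \<forall>\<epsilon>>0. \<exists>r>0. \<forall>x\<in>ball y r.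
     \<bar>v x - v y - L (x - y)\<bar> \<le> \<epsilon> * norm (x - y))"

lemma diffable_of_quadratic_remainder:
  assumes "d > 0" "C \<ge> 0" and rem: "\<And>h. norm h < d \<Longrightarrow> \<bar>v (y + h) - v y - w \<bullet> h\<bar> \<le> C * (norm h)\<^sup>2"
  shows "diffable v (y::'a::euclidean_space)"
  unfolding diffable_def
proof (intro exI[of _ "blinfun_inner_right w"] allI impI)
  fix \<epsilon> :: real assume \<epsilon>: "\<epsilon> > 0"
  show "\<exists>r>0. \<forall>x\<in>ball y r. \<bar>v x - v y - blinfun_inner_right w (x - y)\<bar> \<le> \<epsilon> * norm (x - y)"
  proof (intro exI[of _ "min d (\<epsilon> / (C + 1))"] conjI ballI)
    show "0 < min d (\<epsilon> / (C + 1))" using assms \<epsilon> by simp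
    fix x assume x: "x \<in> ball y (min d (\<epsilon> / (C + 1)))"
    define h where "h = x - y"
    have h: "norm h < d" "norm h \<le> \<epsilon> / (C + 1)" using x by (auto simp: h_def dist_norm norm_minus_commute)
    have "\<bar>v x - v y - w \<bullet> h\<bar> \<le> C * (norm h)\<^sup>2" using rem[OF h(1)] by (simp add: h_def)
    also have "\<dots> = (C * norm h) * norm h" by (simp add: power2_eq_square)
    also have "\<dots> \<le> \<epsilon> * norm h"
    proof (rule mult_right_mono)
      have "C * norm h \<le> C * (\<epsilon> / (C + 1))" using h(2) assms(2) by (rule mult_left_mono)
      also have "\<dots> \<le> \<epsilon>" using assms(2) \<epsilon> by (simp add: field_simps)
      finally show "C * norm h \<le> \<epsilon>" .
    qed simp
    finally show "\<bar>v x - v y - blinfun_inner_right w (x - y)\<bar> \<le> \<epsilon> * norm (x - y)" by (simp add: h_def)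
  qed
qed

lemma diffable_add:
  assumes "diffable v y" "diffable u y" shows "diffable (\<lambda>x. v x + u x) y"
proof -
  obtain L1 where L1: "\<And>\<epsilon>. \<epsilon> > 0 \<Longrightarrow> \<exists>r>0. \<forall>x\<in>ball y r. \<bar>v x - v y - blinfun_apply L1 (x - y)\<bar> \<le> \<epsilon> * norm (x - y)"
    using assms(1) by (auto simp: diffable_def)
  obtain L2 where L2: "\<And>\<epsilon>. \<epsilon> > 0 \<Longrightarrow> \<exists>r>0. \<forall>x\<in>ball y r. \<bar>u x - u y - blinfun_apply L2 (x - y)\<bar> \<le> \<epsilon> * norm (x - y)"
    using assms(2) by (auto simp: diffable_def)
  show ?thesis
    unfolding diffable_def
  proof (intro exI[of _ "L1 + L2"] allI impI)
    fix \<epsilon> :: real assume "\<epsilon> > 0"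
    then have e2: "\<epsilon> / 2 > 0" by simp
    obtain r where r: "r > 0" "\<And>x. x \<in> ball y r \<Longrightarrow> \<bar>v x - v y - blinfun_apply L1 (x - y)\<bar> \<le> \<epsilon> / 2 * norm (x - y)"
      using L1[OF e2] by blast
    obtain s where s: "s > 0" "\<And>x. x \<in> ball y s \<Longrightarrow> \<bar>u x - u y - blinfun_apply L2 (x - y)\<bar> \<le> \<epsilon> / 2 * norm (x - y)"
      using L2[OF e2] by blast
    show "\<exists>r>0. \<forall>x\<in>ball y r. \<bar>v x + u x - (v y + u y) - blinfun_apply (L1 + L2) (x - y)\<bar> \<le> \<epsilon> * norm (x - y)"
    proof (intro exI[of _ "min r s"] conjI ballI)
      fix x assume "x \<in> ball y (min r s)"
      then have "\<bar>v x - v y - blinfun_apply L1 (x - y)\<bar> \<le> \<epsilon> / 2 * norm (x - y)"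
        "\<bar>u x - u y - blinfun_apply L2 (x - y)\<bar> \<le> \<epsilon> / 2 * norm (x - y)" using r(2)[of x] s(2)[of x] by auto
      moreover have "\<epsilon> * norm (x - y) = \<epsilon> / 2 * norm (x - y) + \<epsilon> / 2 * norm (x - y)" by simp
      ultimately show "\<bar>v x + u x - (v y + u y) - blinfun_apply (L1 + L2) (x - y)\<bar> \<le> \<epsilon> * norm (x - y)"
        unfolding blinfun.add_left by linarith
    qed (use r s in auto)
  qed
qed

text \<open>Bounded functions with a bounded continuous gradient and a quadratic Taylor remainder,
  uniform in the base point. This regularity survives sums and finite products, holds for the
  cutoffs above, and is all that differentiation under the integral sign requires.\<close>

definition C11 :: "('a::euclidean_space \<Rightarrow> real) set" where
  "C11 = {\<phi>. \<exists>g M. continuous_on UNIV g \<and> (\<forall>x. \<bar>\<phi> x\<bar> \<le> M \<and> norm (g x) \<le> M) \<and>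
     (\<forall>x h. \<bar>\<phi> (x + h) - \<phi> x - g x \<bullet> h\<bar> \<le> M * (norm h)\<^sup>2)}"

lemma C11_obtain:
  assumes "\<phi> \<in> C11"
  obtains g M where "continuous_on UNIV g" "M \<ge> 1" "\<And>x. \<bar>\<phi> x\<bar> \<le> M" "\<And>x. norm (g x) \<le> M"
    "\<And>x h. \<bar>\<phi> (x + h) - \<phi> x - g x \<bullet> h\<bar> \<le> M * (norm h)\<^sup>2" "\<And>x h. \<bar>\<phi> (x + h) - \<phi> x\<bar> \<le> 2 * M * norm h"
proof -
  obtain g M0 where g: "continuous_on UNIV g" "\<And>x. \<bar>\<phi> x\<bar> \<le> M0" "\<And>x. norm (g x) \<le> M0"
    "\<And>x h. \<bar>\<phi> (x + h) - \<phi> x - g x \<bullet> h\<bar> \<le> M0 * (norm h)\<^sup>2" using assms by (auto simp: C11_def)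
  define M where "M = max M0 1"
  have M: "M0 \<le> M" "1 \<le> M" by (auto simp: M_def)
  have b: "\<bar>\<phi> x\<bar> \<le> M" "norm (g x) \<le> M" for x using g(2,3)[of x] M by auto
  have r: "\<bar>\<phi> (x + h) - \<phi> x - g x \<bullet> h\<bar> \<le> M * (norm h)\<^sup>2" for x h
    using g(4)[of x h] mult_right_mono[OF M(1), of "(norm h)\<^sup>2"] by simp
  have "\<bar>\<phi> (x + h) - \<phi> x\<bar> \<le> 2 * M * norm h" for x h
  proof (cases "norm h \<le> 1")
    case True
    have "\<bar>g x \<bullet> h\<bar> \<le> M * norm h"
      using order_trans[OF Cauchy_Schwarz_ineq2 mult_right_mono[OF b(2) norm_ge_zero]] .
    moreover have "(norm h)\<^sup>2 \<le> norm h" using True by (simp add: power2_eq_square mult_left_le)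
    then have "M * (norm h)\<^sup>2 \<le> M * norm h" using M by (intro mult_left_mono) auto
    ultimately show ?thesis using r[of x h] by linarith
  next
    case False
    have "\<bar>\<phi> (x + h) - \<phi> x\<bar> \<le> 2 * M * 1" using b(1)[of "x + h"] b(1)[of x] by linarith
    also have "\<dots> \<le> 2 * M * norm h" using False M by (intro mult_left_mono) auto
    finally show ?thesis .
  qed
  with g(1) M(2) b r show ?thesis by (rule that)
qed

lemma C11_I:
  assumes "continuous_on UNIV g" "\<And>x. \<bar>\<phi> x\<bar> \<le> M1" "\<And>x. norm (g x) \<le> M2"
    "\<And>x h. \<bar>\<phi> (x + h) - \<phi> x - g x \<bullet> h\<bar> \<le> M3 * (norm h)\<^sup>2"
  shows "\<phi> \<in> C11"
proof -
  let ?M = "max M1 (max M2 M3)"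
  have "\<bar>\<phi> (x + h) - \<phi> x - g x \<bullet> h\<bar> \<le> ?M * (norm h)\<^sup>2" for x h
    by (rule order_trans[OF assms(4) mult_right_mono]) auto
  moreover have "\<bar>\<phi> x\<bar> \<le> ?M" "norm (g x) \<le> ?M" for x using assms(2,3)[of x] by auto
  ultimately show ?thesis using assms(1) unfolding C11_def by blast
qed

lemma C11_const: "(\<lambda>x. a) \<in> C11"
  by (rule C11_I[of "\<lambda>_. 0" _ "\<bar>a\<bar>" 0 0]) auto

lemma C11_mult:
  assumes "\<phi> \<in> C11" "\<psi> \<in> C11" shows "(\<lambda>x. \<phi> x * \<psi> x) \<in> C11"
proof -
  obtain g M where g: "continuous_on UNIV g" "M \<ge> 1" "\<And>x. \<bar>\<phi> x\<bar> \<le> M" "\<And>x. norm (g x) \<le> M"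
    "\<And>x h. \<bar>\<phi> (x + h) - \<phi> x - g x \<bullet> h\<bar> \<le> M * (norm h)\<^sup>2" "\<And>x h. \<bar>\<phi> (x + h) - \<phi> x\<bar> \<le> 2 * M * norm h"
    using C11_obtain[OF assms(1)] by metis
  obtain g' M' where g': "continuous_on UNIV g'" "M' \<ge> 1" "\<And>x. \<bar>\<psi> x\<bar> \<le> M'" "\<And>x. norm (g' x) \<le> M'"
    "\<And>x h. \<bar>\<psi> (x + h) - \<psi> x - g' x \<bullet> h\<bar> \<le> M' * (norm h)\<^sup>2" "\<And>x h. \<bar>\<psi> (x + h) - \<psi> x\<bar> \<le> 2 * M' * norm h"
    using C11_obtain[OF assms(2)] by metis
  have cont: "continuous_on UNIV \<phi>" "continuous_on UNIV \<psi>"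
  proof -
    have "continuous_on UNIV \<phi>" if "\<And>x h. \<bar>\<phi> (x + h) - \<phi> x\<bar> \<le> 2 * M * norm h" "M \<ge> 1" for \<phi> :: "'a \<Rightarrow> real" and M
    proof (rule lipschitz_on_continuous_on[of "2 * M"], rule lipschitz_onI)
      show "dist (\<phi> x) (\<phi> y) \<le> 2 * M * dist x y" for x y using that(1)[of y "x - y"] by (simp add: dist_norm)
    qed (use that in simp)
    then show "continuous_on UNIV \<phi>" "continuous_on UNIV \<psi>" using g g' by blast+
  qed
  show ?thesis
  proof (rule C11_I[of "\<lambda>x. \<psi> x *\<^sub>R g x + \<phi> x *\<^sub>R g' x"])
    show "continuous_on UNIV (\<lambda>x. \<psi> x *\<^sub>R g x + \<phi> x *\<^sub>R g' x)"
      by (intro continuous_intros cont g g')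
    show "\<bar>\<phi> x * \<psi> x\<bar> \<le> M * M'" for x unfolding abs_mult using g g' by (intro mult_mono) auto
    show "norm (\<psi> x *\<^sub>R g x + \<phi> x *\<^sub>R g' x) \<le> M' * M + M * M'" for x
    proof (rule order_trans[OF norm_triangle_ineq add_mono])
      show "norm (\<psi> x *\<^sub>R g x) \<le> M' * M" "norm (\<phi> x *\<^sub>R g' x) \<le> M * M'"
        unfolding norm_scaleR using g(2-4) g'(2-4) by (intro mult_mono; force)+
    qed
    fix x h
    define a b c where "a = (\<phi> (x + h) - \<phi> x - g x \<bullet> h) * \<psi> (x + h)"
      and "b = (g x \<bullet> h) * (\<psi> (x + h) - \<psi> x)" and "c = \<phi> x * (\<psi> (x + h) - \<psi> x - g' x \<bullet> h)"
    have eq: "\<phi> (x + h) * \<psi> (x + h) - \<phi> x * \<psi> x - (\<psi> x *\<^sub>R g x + \<phi> x *\<^sub>R g' x) \<bullet> h = a + b + c"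
      unfolding a_def b_def c_def by (simp add: inner_add_left algebra_simps)
    have "\<bar>a\<bar> \<le> (M * (norm h)\<^sup>2) * M'"
      unfolding a_def abs_mult by (intro mult_mono g(5) g'(3)) (use g(2) in auto)
    moreover have "\<bar>b\<bar> \<le> (M * norm h) * (2 * M' * norm h)"
      unfolding b_def abs_mult
      by (intro mult_mono g'(6) order_trans[OF Cauchy_Schwarz_ineq2 mult_right_mono[OF g(4) norm_ge_zero]]) (use g(2) in auto)
    moreover have "\<bar>c\<bar> \<le> M * (M' * (norm h)\<^sup>2)"
      unfolding c_def abs_mult by (intro mult_mono g(3) g'(5)) (use g(2) in auto)
    ultimately have "\<bar>a + b + c\<bar> \<le> (M * (norm h)\<^sup>2) * M' + (M * norm h) * (2 * M' * norm h) + M * (M' * (norm h)\<^sup>2)"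
      by linarith
    also have "\<dots> = (4 * M * M') * (norm h)\<^sup>2" by (simp add: power2_eq_square algebra_simps)
    finally show "\<bar>\<phi> (x + h) * \<psi> (x + h) - \<phi> x * \<psi> x - (\<psi> x *\<^sub>R g x + \<phi> x *\<^sub>R g' x) \<bullet> h\<bar> \<le> (4 * M * M') * (norm h)\<^sup>2"
      unfolding eq .
  qed
qed

lemma C11_add:
  assumes "\<phi> \<in> C11" "\<psi> \<in> C11" shows "(\<lambda>x. \<phi> x + \<psi> x) \<in> C11"
proof -
  obtain g M where g: "continuous_on UNIV g" "\<And>x. \<bar>\<phi> x\<bar> \<le> M" "\<And>x. norm (g x) \<le> M"
    "\<And>x h. \<bar>\<phi> (x + h) - \<phi> x - g x \<bullet> h\<bar> \<le> M * (norm h)\<^sup>2"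
    using C11_obtain[OF assms(1)] by metis
  obtain g' M' where g': "continuous_on UNIV g'" "\<And>x. \<bar>\<psi> x\<bar> \<le> M'" "\<And>x. norm (g' x) \<le> M'"
    "\<And>x h. \<bar>\<psi> (x + h) - \<psi> x - g' x \<bullet> h\<bar> \<le> M' * (norm h)\<^sup>2"
    using C11_obtain[OF assms(2)] by metis
  show ?thesis
  proof (rule C11_I[of "\<lambda>x. g x + g' x" _ "M + M'" "M + M'" "M + M'"])
    show "\<bar>\<phi> x + \<psi> x\<bar> \<le> M + M'" for x using g(2)[of x] g'(2)[of x] by linarith
    show "norm (g x + g' x) \<le> M + M'" for x using g g' by (intro order_trans[OF norm_triangle_ineq] add_mono)
    show "\<bar>\<phi> (x + h) + \<psi> (x + h) - (\<phi> x + \<psi> x) - (g x + g' x) \<bullet> h\<bar> \<le> (M + M') * (norm h)\<^sup>2" for x h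
      using g(4)[of x h] g'(4)[of x h] unfolding inner_add_left distrib_right by linarith
  qed (intro continuous_intros g g')
qed

lemma C11_cmult: "\<phi> \<in> C11 \<Longrightarrow> (\<lambda>x. a * \<phi> x) \<in> C11"
  by (rule C11_mult[OF C11_const])

lemma C11_prod: "(\<And>i. i \<in> I \<Longrightarrow> \<phi> i \<in> C11) \<Longrightarrow> (\<lambda>x. \<Prod>i\<in>I. \<phi> i x) \<in> C11"
  by (induction I rule: infinite_finite_induct) (auto intro: C11_const C11_mult)

lemma C11_measurable: "\<phi> \<in> C11 \<Longrightarrow> \<phi> \<in> borel_measurable borel"
proof -
  assume "\<phi> \<in> C11"
  then obtain M where M: "M \<ge> 1" "\<And>x h. \<bar>\<phi> (x + h) - \<phi> x\<bar> \<le> 2 * M * norm h" using C11_obtain by metis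
  have "continuous_on UNIV \<phi>"
  proof (rule lipschitz_on_continuous_on[of "2 * M"], rule lipschitz_onI)
    show "dist (\<phi> x) (\<phi> y) \<le> 2 * M * dist x y" for x y using M(2)[of y "x - y"] by (simp add: dist_norm)
  qed (use M in simp)
  then show ?thesis by (rule borel_measurable_continuous_onI)
qed

lemma smoothstep_Taylor: "\<bar>smoothstep (s + t) - smoothstep s - smoothstep' s * t\<bar> \<le> 15 * t\<^sup>2"
proof -
  let ?f = "\<lambda>x. smoothstep x - smoothstep' s * x"
  have "norm (?f (s + t) - ?f s) \<le> (15 * \<bar>t\<bar>) * norm ((s + t) - s)"
  proof (rule mean_value_norm_bound[of "cball s \<bar>t\<bar>"])
    fix x assume x: "x \<in> cball s \<bar>t\<bar>"
    show "(?f has_derivative (\<lambda>h. (smoothstep' x - smoothstep' s) * h)) (at x)"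
      using DERIV_diff[OF DERIV_smoothstep[of x] DERIV_cmult[OF DERIV_ident, of "smoothstep' s" x UNIV]]
      by (simp add: has_field_derivative_def mult.commute[of _ "smoothstep' x - smoothstep' s"])
    have "norm (smoothstep' x - smoothstep' s) \<le> 15 * norm (x - s)"
    proof (rule mean_value_norm_bound[of UNIV])
      show "(smoothstep' has_derivative (*) (smoothstep'' z)) (at z)" for z
        using DERIV_smoothstep' by (simp add: has_field_derivative_def)
      show "norm (smoothstep'' z * h) \<le> 15 * norm h" for z h :: real
        using smoothstep''_bound by (simp add: abs_mult mult_right_mono)
    qed auto
    also have "\<dots> \<le> 15 * \<bar>t\<bar>" using x by (simp add: dist_real_def abs_minus_commute)
    finally show "norm ((smoothstep' x - smoothstep' s) * h) \<le> 15 * \<bar>t\<bar> * norm h" for h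
      by (simp add: abs_mult mult_right_mono)
  qed (auto simp: dist_real_def)
  then have "\<bar>smoothstep (s + t) - smoothstep s - smoothstep' s * t\<bar> \<le> 15 * (\<bar>t\<bar> * \<bar>t\<bar>)"
    by (simp add: algebra_simps)
  then show ?thesis by (simp add: power2_eq_square)
qed

lemma C11_smoothstep: "(\<lambda>x. smoothstep (a + x \<bullet> w)) \<in> C11"
proof (rule C11_I[of "\<lambda>x. smoothstep' (a + x \<bullet> w) *\<^sub>R w"])
  have "continuous_on UNIV smoothstep'"
    by (intro continuous_at_imp_continuous_on ballI DERIV_isCont[OF DERIV_smoothstep'])
  moreover have "continuous_on UNIV (\<lambda>x. a + x \<bullet> w)" by (intro continuous_intros)
  ultimately have "continuous_on UNIV (\<lambda>x. smoothstep' (a + x \<bullet> w))"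
    by (rule continuous_on_compose2) simp
  then show "continuous_on UNIV (\<lambda>x. smoothstep' (a + x \<bullet> w) *\<^sub>R w)"
    by (rule continuous_on_scaleR[OF _ continuous_on_const])
  show "\<bar>smoothstep (a + x \<bullet> w)\<bar> \<le> 1" for x using smoothstep_bounds[of "a + x \<bullet> w"] by simp
  show "norm (smoothstep' (a + x \<bullet> w) *\<^sub>R w) \<le> 2 * norm w" for x
    using smoothstep'_bound by (simp add: mult_right_mono)
  fix x h
  define t where "t = h \<bullet> w"
  have 1: "\<bar>smoothstep ((a + x \<bullet> w) + t) - smoothstep (a + x \<bullet> w) - smoothstep' (a + x \<bullet> w) * t\<bar> \<le> 15 * t\<^sup>2"
    by (rule smoothstep_Taylor)
  have "\<bar>t\<bar>\<^sup>2 \<le> (norm h * norm w)\<^sup>2"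
    unfolding t_def by (intro power_mono Cauchy_Schwarz_ineq2) simp
  then have 2: "15 * t\<^sup>2 \<le> (15 * (norm w)\<^sup>2) * (norm h)\<^sup>2" by (simp add: power_mult_distrib mult.commute)
  have 3: "a + (x + h) \<bullet> w = (a + x \<bullet> w) + t" "(smoothstep' (a + x \<bullet> w) *\<^sub>R w) \<bullet> h = smoothstep' (a + x \<bullet> w) * t"
    by (simp_all add: t_def inner_add_left inner_commute[of w h])
  show "\<bar>smoothstep (a + (x + h) \<bullet> w) - smoothstep (a + x \<bullet> w) - (smoothstep' (a + x \<bullet> w) *\<^sub>R w) \<bullet> h\<bar> \<le> (15 * (norm w)\<^sup>2) * (norm h)\<^sup>2"
    unfolding 3 by (rule order_trans[OF 1 2])
qed

text \<open>A product over the coordinates of \<open>smoothstep (2 + s) * smoothstep (2 - s)\<close>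
  with \<open>s\<close> the rescaled coordinate: the factor is 1 for \<open>|s| \<le> 1\<close> and
  0 for \<open>|s| \<ge> 2\<close>. The cube contains \<open>ball p r\<close>, and its diameter is
  what brings in the dimension.\<close>

lemma cube_bump:
  fixes p :: "'a::euclidean_space" and r :: real
  assumes r: "r > 0"
  obtains \<beta> where "\<beta> \<in> C11" "\<And>x. 0 \<le> \<beta> x \<and> \<beta> x \<le> 1" "\<And>x. x \<in> ball p r \<Longrightarrow> \<beta> x = 1"
    "\<And>x. \<beta> x \<noteq> 0 \<Longrightarrow> norm (x - p) \<le> 2 * DIM('a) * r"
proof -
  define \<theta> where "\<theta> b x = smoothstep ((2 - p \<bullet> b / r) + x \<bullet> ((1/r) *\<^sub>R b)) * smoothstep ((2 + p \<bullet> b / r) + x \<bullet> ((- 1/r) *\<^sub>R b))" for b x :: 'a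
  have \<theta>: "\<theta> b x = smoothstep (2 + (x - p) \<bullet> b / r) * smoothstep (2 - (x - p) \<bullet> b / r)" for b x
    by (simp add: \<theta>_def inner_diff_left diff_divide_distrib algebra_simps)
  let ?\<beta> = "\<lambda>x. \<Prod>b\<in>Basis. \<theta> b x"
  have 1: "?\<beta> \<in> C11" unfolding \<theta>_def by (intro C11_prod C11_mult C11_smoothstep)
  have \<theta>b: "0 \<le> \<theta> b x \<and> \<theta> b x \<le> 1" for b x
    unfolding \<theta> using smoothstep_bounds by (simp add: mult_le_one)
  then have 2: "0 \<le> ?\<beta> x \<and> ?\<beta> x \<le> 1" for x by (auto intro!: prod_nonneg prod_le_1)
  have 3: "?\<beta> x = 1" if "x \<in> ball p r" for x
  proof (rule prod.neutral, rule ballI)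
    fix b :: 'a assume "b \<in> Basis"
    then have "\<bar>(x - p) \<bullet> b\<bar> \<le> r"
      using that Basis_le_norm[of b "x - p"] by (simp add: dist_norm norm_minus_commute)
    then have "\<bar>(x - p) \<bullet> b / r\<bar> \<le> 1" using r by simp
    then have "1 \<le> 2 + (x - p) \<bullet> b / r" "1 \<le> 2 - (x - p) \<bullet> b / r" by linarith+
    then show "\<theta> b x = 1" unfolding \<theta> by (simp add: smoothstep_eq_1)
  qed
  have 4: "norm (x - p) \<le> 2 * DIM('a) * r" if nz: "?\<beta> x \<noteq> 0" for x
  proof -
    have "\<bar>(x - p) \<bullet> b\<bar> \<le> 2 * r" if b: "b \<in> Basis" for b
    proof (rule ccontr)
      assume "\<not> \<bar>(x - p) \<bullet> b\<bar> \<le> 2 * r"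
      then have "2 \<le> \<bar>(x - p) \<bullet> b / r\<bar>" using r by (simp add: field_simps)
      then have "\<theta> b x = 0" unfolding \<theta> using smoothstep_eq_0(1)[of "2 + (x - p) \<bullet> b / r"] smoothstep_eq_0(1)[of "2 - (x - p) \<bullet> b / r"]
        by (auto simp: abs_if split: if_splits)
      with b nz show False by (auto simp: prod_zero_iff)
    qed
    then have "(\<Sum>b\<in>Basis. \<bar>(x - p) \<bullet> b\<bar>) \<le> (\<Sum>b\<in>(Basis::'a set). 2 * r)" by (intro sum_mono)
    with norm_le_l1[of "x - p"] show ?thesis by (simp add: ac_simps)
  qed
  show thesis by (rule that[of ?\<beta>, OF 1 2 3 4])
qed

text \<open>Finitely many bumps \<open>\<beta> p\<close> are combined as one minus the product of
  their complements, which is 1 wherever some bump is 1, is 0 where all vanish, and stays between 0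
  and 1.\<close>

lemma compact_bump:
  fixes C :: "'a::euclidean_space set"
  assumes C: "compact C" and U: "open U" "C \<subseteq> U"
  obtains \<phi> where "\<phi> \<in> C11" "\<And>x. 0 \<le> \<phi> x \<and> \<phi> x \<le> 1" "\<And>x. x \<in> C \<Longrightarrow> \<phi> x = 1" "\<And>x. x \<notin> U \<Longrightarrow> \<phi> x = 0"
proof -
  define P where "P p \<beta> r \<longleftrightarrow> r > 0 \<and> \<beta> \<in> C11 \<and> (\<forall>x. 0 \<le> \<beta> x \<and> \<beta> x \<le> 1) \<and> (\<forall>x\<in>ball p r. \<beta> x = 1) \<and> (\<forall>x. x \<notin> U \<longrightarrow> \<beta> x = 0)"
    for p :: 'a and \<beta> :: "'a \<Rightarrow> real" and r
  have "\<exists>\<beta> r. P p \<beta> r"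
    if "p \<in> C" for p
  proof -
    have "p \<in> U" using that U(2) by blast
    then obtain d where d: "d > 0" "ball p d \<subseteq> U" using U(1) by (metis open_contains_ball)
    define r where "r = d / (3 * DIM('a))"
    have r: "r > 0" using d by (simp add: r_def)
    obtain \<beta> where \<beta>: "\<beta> \<in> C11" "\<And>x. 0 \<le> \<beta> x \<and> \<beta> x \<le> 1" "\<And>x. x \<in> ball p r \<Longrightarrow> \<beta> x = 1"
      "\<And>x. \<beta> x \<noteq> 0 \<Longrightarrow> norm (x - p) \<le> 2 * DIM('a) * r" by (rule cube_bump[OF r, of p]) (rule that)
    have "real (2 * DIM('a)) * r = 2 / 3 * d" by (simp add: r_def)
    then have "2 * DIM('a) * r < d" using d(1) by (simp only:)
    have "x \<in> U" if "\<beta> x \<noteq> 0" for x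
    proof -
      have "norm (x - p) < d" using \<beta>(4)[OF that] \<open>2 * DIM('a) * r < d\<close> by (rule le_less_trans)
      then have "x \<in> ball p d" by (simp add: dist_norm norm_minus_commute)
      with d(2) show ?thesis by blast
    qed
    then have "\<forall>x. x \<notin> U \<longrightarrow> \<beta> x = 0" by blast
    then show ?thesis using r \<beta>(1-3) by (intro exI[of _ \<beta>] exI[of _ r]) (simp add: P_def)
  qed
  then obtain \<beta> r where Pp: "\<And>p. p \<in> C \<Longrightarrow> P p (\<beta> p) (r p)" by metis
  have \<beta>: "\<And>p. p \<in> C \<Longrightarrow> r p > 0" "\<And>p. p \<in> C \<Longrightarrow> \<beta> p \<in> C11"
    "\<And>p x. p \<in> C \<Longrightarrow> 0 \<le> \<beta> p x \<and> \<beta> p x \<le> 1" "\<And>p x. p \<in> C \<Longrightarrow> x \<in> ball p (r p) \<Longrightarrow> \<beta> p x = 1"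
    "\<And>p x. p \<in> C \<Longrightarrow> x \<notin> U \<Longrightarrow> \<beta> p x = 0" using Pp by (simp_all add: P_def)
  obtain D where D: "D \<subseteq> C" "finite D" "C \<subseteq> (\<Union>p\<in>D. ball p (r p))"
  proof (rule compactE_image[OF C, of C "\<lambda>p. ball p (r p)"])
    show "C \<subseteq> (\<Union>p\<in>C. ball p (r p))" using \<beta>(1) by force
  qed auto
  have DC: "p \<in> C" if "p \<in> D" for p using D that by auto
  show ?thesis
  proof (rule that[of "\<lambda>x. 1 + (- 1) * (\<Prod>p\<in>D. 1 + (- 1) * \<beta> p x)"])
    show "(\<lambda>x. 1 + (- 1) * (\<Prod>p\<in>D. 1 + (- 1) * \<beta> p x)) \<in> C11"
      by (intro C11_add C11_const C11_cmult C11_prod \<beta> DC)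
    fix x
    have "0 \<le> (\<Prod>p\<in>D. 1 + (- 1) * \<beta> p x)" "(\<Prod>p\<in>D. 1 + (- 1) * \<beta> p x) \<le> 1"
      using \<beta>(3) DC by (auto intro!: prod_nonneg prod_le_1)
    then show "0 \<le> 1 + (- 1) * (\<Prod>p\<in>D. 1 + (- 1) * \<beta> p x) \<and> 1 + (- 1) * (\<Prod>p\<in>D. 1 + (- 1) * \<beta> p x) \<le> 1" by simp
    show "1 + (- 1) * (\<Prod>p\<in>D. 1 + (- 1) * \<beta> p x) = 1" if xC: "x \<in> C"
    proof -
      obtain p where "p \<in> D" "x \<in> ball p (r p)" using D(3) xC by blast
      then have "\<exists>p\<in>D. 1 + (- 1) * \<beta> p x = 0" using \<beta>(4)[OF DC] by (intro bexI[of _ p]) auto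
      then have "(\<Prod>p\<in>D. 1 + (- 1) * \<beta> p x) = 0" using D(2) by (intro prod_zero) auto
      then show ?thesis by simp
    qed
    show "1 + (- 1) * (\<Prod>p\<in>D. 1 + (- 1) * \<beta> p x) = 0" if "x \<notin> U"
      using \<beta>(5)[OF DC that] by simp
  qed
qed

lemma compact_inner_approx:
  fixes M :: "'a::euclidean_space measure"
  assumes M: "finite_measure M" "sets M = sets borel" and B: "B \<in> sets borel" and d: "d > 0"
  obtains C where "compact C" "C \<subseteq> B" "measure M B - d < measure M C"
proof -
  interpret finite_measure M by (rule M)
  show ?thesis
  proof (cases "measure M B = 0")
    case True
    then show ?thesis using d by (intro that[of "{}"]) auto
  next
    case False
    then have "measure M B > 0" by (simp add: less_le)
    then have "ennreal (measure M B - d) < emeasure M B"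
      unfolding emeasure_eq_measure using d by (intro ennreal_lessI) auto
    also have "emeasure M B = (SUP K \<in> {K. K \<subseteq> B \<and> compact K}. emeasure M K)"
      by (rule inner_regular[OF M(2) _ B]) simp
    finally obtain C where C: "C \<subseteq> B" "compact C" "ennreal (measure M B - d) < emeasure M C"
      unfolding less_SUP_iff by auto
    have "measure M B - d < measure M C"
    proof (rule ccontr)
      assume "\<not> measure M B - d < measure M C"
      then have "ennreal (measure M C) \<le> ennreal (measure M B - d)" by (intro ennreal_leI) simp
      with C(3) show False by (simp add: emeasure_eq_measure not_le[symmetric])
    qed
    with C(2,1) show ?thesis by (rule that)
  qed
qed

definition smooth_compact :: "('a::euclidean_space \<Rightarrow> real) set" where
  "smooth_compact = {\<phi> \<in> C11. \<exists>R. \<forall>x. R \<le> norm x \<longrightarrow> \<phi> x = 0}"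

lemma smooth_compact_bdd_int: "\<phi> \<in> smooth_compact \<Longrightarrow> \<phi> \<in> bdd_int"
proof -
  assume "\<phi> \<in> smooth_compact"
  then obtain R where R: "\<phi> \<in> C11" "\<And>x. R \<le> norm x \<Longrightarrow> \<phi> x = 0" by (auto simp: smooth_compact_def)
  obtain M where "\<And>x. \<bar>\<phi> x\<bar> \<le> M" using C11_obtain[OF R(1)] by metis
  then show ?thesis
    by (intro integral_bounded_support(3)[OF C11_measurable[OF R(1)], of M "max R 0" 0]) (use R in auto)
qed

lemma smooth_compact_add: "\<phi> \<in> smooth_compact \<Longrightarrow> \<psi> \<in> smooth_compact \<Longrightarrow> (\<lambda>x. \<phi> x + \<psi> x) \<in> smooth_compact"
proof -
  assume "\<phi> \<in> smooth_compact" "\<psi> \<in> smooth_compact"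
  then obtain R R' where "\<phi> \<in> C11" "\<psi> \<in> C11" "\<And>x. R \<le> norm x \<Longrightarrow> \<phi> x = 0" "\<And>x. R' \<le> norm x \<Longrightarrow> \<psi> x = 0"
    by (auto simp: smooth_compact_def)
  then show ?thesis by (auto simp: smooth_compact_def intro!: C11_add exI[of _ "max R R'"])
qed

lemma smooth_compact_cmult: "\<phi> \<in> smooth_compact \<Longrightarrow> (\<lambda>x. a * \<phi> x) \<in> smooth_compact"
  by (auto simp: smooth_compact_def intro!: C11_cmult)

lemma smooth_compact_dense_indicator:
  fixes A :: "'a::euclidean_space set"
  assumes A: "A \<in> sets borel" "emeasure lborel A < \<infinity>" and d: "d > 0"
  shows "\<exists>\<phi>\<in>smooth_compact. (\<integral>x. \<bar>indicator A x - \<phi> x\<bar> \<partial>lborel) < d"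
proof -
  \<comment> \<open>Lebesgue measure restricted to \<open>A\<close> is finite, so that
    \<open>compact_inner_approx\<close> applies.\<close>
  define N where "N = density lborel (indicator A :: 'a \<Rightarrow> ennreal)"
  have sN: "sets N = sets borel" by (simp add: N_def)
  have eN: "emeasure N B = emeasure lborel (A \<inter> B)" if "B \<in> sets borel" for B
  proof -
    have "emeasure N B = (\<integral>\<^sup>+x. indicator A x * indicator B x \<partial>lborel)"
      unfolding N_def using that A(1) by (intro emeasure_density) auto
    also have "\<dots> = (\<integral>\<^sup>+x. indicator (A \<inter> B) x \<partial>lborel)"
      by (intro nn_integral_cong) (auto split: split_indicator)
    also have "\<dots> = emeasure lborel (A \<inter> B)" using that A(1) by (intro nn_integral_indicator) auto
    finally show ?thesis .
  qed
  have fN: "finite_measure N"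
    using eN[of UNIV] A sets_eq_imp_space_eq[OF sN] by (intro finite_measureI) auto
  obtain C where C: "compact C" "C \<subseteq> A" "measure N A - d / 4 < measure N C"
    using compact_inner_approx[OF fN sN A(1), of "d / 4"] d by auto
  have Cm: "C \<in> sets borel" using C(1) by (simp add: borel_compact)
  have mN: "measure N A = measure lborel A" "measure N C = measure lborel C"
    using eN[OF A(1)] eN[OF Cm] C(2) by (auto simp: measure_def Int_absorb1)
  obtain U0 where U0: "open U0" "A \<subseteq> U0" "emeasure lborel (U0 - A) < ennreal (d / 4)"
    using outer_regular_lborel[OF A(1), of "d / 4"] d by auto
  obtain R where R: "C \<subseteq> ball 0 R" using compact_imp_bounded[OF C(1)] bounded_subset_ballD by blast
  obtain \<phi> where \<phi>: "\<phi> \<in> C11" "\<And>x. 0 \<le> \<phi> x \<and> \<phi> x \<le> 1" "\<And>x. x \<in> C \<Longrightarrow> \<phi> x = 1" "\<And>x. x \<notin> U0 \<inter> ball 0 R \<Longrightarrow> \<phi> x = 0"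
  proof (rule compact_bump[OF C(1), of "U0 \<inter> ball 0 R"])
    show "open (U0 \<inter> ball 0 R)" using U0(1) by auto
    show "C \<subseteq> U0 \<inter> ball 0 R" using C(2) U0(2) R by auto
  qed (rule that)
  have sc: "\<phi> \<in> smooth_compact" using \<phi> by (auto simp: smooth_compact_def intro!: exI[of _ R])
  have Ufin: "emeasure lborel (U0 - A) < \<infinity>" using U0(3) by (auto intro: less_trans)
  have iA: "integrable lborel (indicator A :: 'a \<Rightarrow> real)" "integrable lborel (indicator C :: 'a \<Rightarrow> real)"
    "integrable lborel (indicator (U0 - A) :: 'a \<Rightarrow> real)"
  proof -
    have "emeasure lborel C \<le> emeasure lborel A" using C(2) A(1) by (intro emeasure_mono) auto
    then have "emeasure lborel C < \<infinity>" using A(2) by (rule le_less_trans)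
    then show "integrable lborel (indicator C :: 'a \<Rightarrow> real)" using Cm by simp
    show "integrable lborel (indicator A :: 'a \<Rightarrow> real)" using A by simp
    show "integrable lborel (indicator (U0 - A) :: 'a \<Rightarrow> real)" using Ufin U0(1) A(1) by simp
  qed
  have "(\<integral>x. \<bar>indicator A x - \<phi> x\<bar> \<partial>lborel) \<le> (\<integral>x. (indicator A x - indicator C x) + indicator (U0 - A) x \<partial>lborel)"
  proof (rule integral_mono)
    show "integrable lborel (\<lambda>x. \<bar>indicator A x - \<phi> x\<bar>)"
      using iA(1) bdd_int_integrable[OF smooth_compact_bdd_int[OF sc]] by auto
    show "integrable lborel (\<lambda>x. (indicator A x - indicator C x) + indicator (U0 - A) x :: real)" using iA by auto
    show "\<bar>indicator A x - \<phi> x\<bar> \<le> (indicator A x - indicator C x) + indicator (U0 - A) x" for x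
      using \<phi>(2)[of x] \<phi>(3)[of x] \<phi>(4)[of x] C(2) U0(2) by (auto split: split_indicator)
  qed
  also have "\<dots> = (measure lborel A - measure lborel C) + measure lborel (U0 - A)"
    using iA A by simp
  also have "\<dots> < d"
  proof -
    have "ennreal (measure lborel (U0 - A)) < ennreal (d / 4)"
      using U0(3) Ufin by (simp add: emeasure_eq_ennreal_measure less_top)
    then have "measure lborel (U0 - A) < d / 4" using d by (simp add: ennreal_less_iff)
    then show ?thesis using C(3) d unfolding mN by linarith
  qed
  finally show ?thesis using sc by blast
qed

lemma smooth_compact_dense:
  fixes f :: "'a::euclidean_space \<Rightarrow> real"
  assumes "integrable lborel f" "d > 0"
  shows "\<exists>\<phi>\<in>smooth_compact. (\<integral>x. \<bar>f x - \<phi> x\<bar> \<partial>lborel) < d"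
  using assms
proof (induction f arbitrary: d rule: integrable_induct)
  case (base A a)
  show ?case
  proof (cases "a = 0")
    case True
    have "(\<lambda>x. 0) \<in> smooth_compact" using C11_const[of 0] by (auto simp: smooth_compact_def)
    with True base show ?thesis by (intro bexI[of _ "\<lambda>x. 0"]) auto
  next
    case False
    then obtain \<phi> where \<phi>: "\<phi> \<in> smooth_compact" "(\<integral>x. \<bar>indicator A x - \<phi> x\<bar> \<partial>lborel) < d / \<bar>a\<bar>"
      using smooth_compact_dense_indicator[of A "d / \<bar>a\<bar>"] base by auto
    have "(\<integral>x. \<bar>indicator A x *\<^sub>R a - a * \<phi> x\<bar> \<partial>lborel) = (\<integral>x. \<bar>a\<bar> * \<bar>indicator A x - \<phi> x\<bar> \<partial>lborel)"
      by (intro Bochner_Integration.integral_cong) (auto simp: abs_mult[symmetric] algebra_simps)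
    also have "\<dots> < d" using \<phi>(2) False by (simp add: field_simps)
    finally show ?thesis by (intro bexI[OF _ smooth_compact_cmult[OF \<phi>(1), of a]])
  qed
next
  case (add f g)
  obtain \<phi> \<psi> where \<phi>: "\<phi> \<in> smooth_compact" "(\<integral>x. \<bar>f x - \<phi> x\<bar> \<partial>lborel) < d / 2"
    and \<psi>: "\<psi> \<in> smooth_compact" "(\<integral>x. \<bar>g x - \<psi> x\<bar> \<partial>lborel) < d / 2"
    using add.IH(1)[of "d / 2"] add.IH(2)[of "d / 2"] add.prems by auto
  note i = add.hyps bdd_int_integrable[OF smooth_compact_bdd_int[OF \<phi>(1)]] bdd_int_integrable[OF smooth_compact_bdd_int[OF \<psi>(1)]]
  have "(\<integral>x. \<bar>f x + g x - (\<phi> x + \<psi> x)\<bar> \<partial>lborel) \<le> (\<integral>x. \<bar>f x - \<phi> x\<bar> + \<bar>g x - \<psi> x\<bar> \<partial>lborel)"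
    using i by (intro integral_mono) auto
  also have "\<dots> = (\<integral>x. \<bar>f x - \<phi> x\<bar> \<partial>lborel) + (\<integral>x. \<bar>g x - \<psi> x\<bar> \<partial>lborel)"
    using i by (intro Bochner_Integration.integral_add) auto
  also have "\<dots> < d" using \<phi>(2) \<psi>(2) by simp
  finally show ?case by (intro bexI[OF _ smooth_compact_add[OF \<phi>(1) \<psi>(1)]])
next
  case (lim f s)
  have "(\<lambda>i. \<integral>x. \<bar>f x - s i x\<bar> \<partial>lborel) \<longlonglongrightarrow> (\<integral>x. 0 \<partial>(lborel::'a measure))"
  proof (rule integral_dominated_convergence[where w = "\<lambda>x. 3 * \<bar>f x\<bar>"])
    show "(\<lambda>x. \<bar>f x - s i x\<bar>) \<in> borel_measurable lborel" for i
      using lim by (intro borel_measurable_integrable integrable_abs Bochner_Integration.integrable_diff) auto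
    show "integrable lborel (\<lambda>x. 3 * \<bar>f x\<bar>)" using lim by auto
    show "AE x in lborel. (\<lambda>i. \<bar>f x - s i x\<bar>) \<longlonglongrightarrow> 0"
    proof (rule AE_I2)
      fix x :: 'a
      have "(\<lambda>i. f x - s i x) \<longlonglongrightarrow> f x - f x" using lim.hyps(2)[of x] by (intro tendsto_intros) auto
      then show "(\<lambda>i. \<bar>f x - s i x\<bar>) \<longlonglongrightarrow> 0" by (simp add: tendsto_rabs_zero)
    qed
    show "AE x in lborel. norm \<bar>f x - s i x\<bar> \<le> 3 * \<bar>f x\<bar>" for i
    proof (rule AE_I2)
      fix x :: 'a
      have "norm (s i x) \<le> 2 * norm (f x)" by (rule lim) simp
      then show "norm \<bar>f x - s i x\<bar> \<le> 3 * \<bar>f x\<bar>" by simp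
    qed
  qed simp
  then have "eventually (\<lambda>i. (\<integral>x. \<bar>f x - s i x\<bar> \<partial>lborel) < d / 2) sequentially"
    using order_tendstoD(2)[of _ _ sequentially "d / 2"] lim.prems by auto
  then obtain i where i: "(\<integral>x. \<bar>f x - s i x\<bar> \<partial>lborel) < d / 2" by (auto simp: eventually_sequentially)
  obtain \<phi> where \<phi>: "\<phi> \<in> smooth_compact" "(\<integral>x. \<bar>s i x - \<phi> x\<bar> \<partial>lborel) < d / 2"
    using lim.IH[of "d / 2" i] lim.prems by auto
  note ii = lim.hyps(1)[of i] lim.hyps(4) bdd_int_integrable[OF smooth_compact_bdd_int[OF \<phi>(1)]]
  have "(\<integral>x. \<bar>f x - \<phi> x\<bar> \<partial>lborel) \<le> (\<integral>x. \<bar>f x - s i x\<bar> + \<bar>s i x - \<phi> x\<bar> \<partial>lborel)"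
    using ii by (intro integral_mono) auto
  also have "\<dots> = (\<integral>x. \<bar>f x - s i x\<bar> \<partial>lborel) + (\<integral>x. \<bar>s i x - \<phi> x\<bar> \<partial>lborel)"
    using ii by (intro Bochner_Integration.integral_add) auto
  also have "\<dots> < d" using i \<phi>(2) by simp
  finally show ?case by (intro bexI[OF _ \<phi>(1)])
qed

subsection \<open>Approximate differentiability of potentials\<close>

lemma finite_density:
  fixes N :: "'a::euclidean_space measure"
  assumes N: "sets N = sets borel" and h: "integrable N h" "\<And>x. 0 \<le> h x"
  shows "finite_measure (density N (\<lambda>x. ennreal (h x)))" "sets (density N (\<lambda>x. ennreal (h x))) = sets borel"
    "measure (density N (\<lambda>x. ennreal (h x))) UNIV = (\<integral>x. h x \<partial>N)"
proof -
  have sp: "space N = UNIV" using sets_eq_imp_space_eq[OF N] by simp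
  have "emeasure (density N (\<lambda>x. ennreal (h x))) UNIV = (\<integral>\<^sup>+x. ennreal (h x) * indicator UNIV x \<partial>N)"
    using h(1) N by (intro emeasure_density) auto
  also have "\<dots> = ennreal (\<integral>x. h x \<partial>N)" using h by (simp add: nn_integral_eq_integral)
  finally have e: "emeasure (density N (\<lambda>x. ennreal (h x))) UNIV = ennreal (\<integral>x. h x \<partial>N)" .
  show "finite_measure (density N (\<lambda>x. ennreal (h x)))" using e sp by (intro finite_measureI) simp
  show "sets (density N (\<lambda>x. ennreal (h x))) = sets borel" using N by simp
  show "measure (density N (\<lambda>x. ennreal (h x))) UNIV = (\<integral>x. h x \<partial>N)"
    unfolding measure_def e using h by simp
qed

lemma dense_cells_antimono: "s \<le> t \<Longrightarrow> dense_cells M t \<subseteq> dense_cells M (s :: real)"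
proof
  fix x assume st: "s \<le> t" and "x \<in> dense_cells M t"
  then obtain k where "measure M (cell k x) > t * (2 powi k) ^ DIM('a)" by (auto simp: dense_cells_def)
  moreover have "s * (2 powi k) ^ DIM('a) \<le> t * (2 powi k) ^ DIM('a)" using st by (intro mult_right_mono) auto
  ultimately show "x \<in> dense_cells M s" unfolding dense_cells_def by (intro CollectI exI[of _ k]) linarith
qed

lemma near_linear_mono:
  assumes "near_linear S v y L a" "a \<le> b" shows "near_linear S v y L b"
proof -
  obtain A r where A: "thin_at A y" "r > 0"
    "\<And>x. x \<in> ball y r - A \<Longrightarrow> x \<in> S \<and> \<bar>v x - v y - L (x - y)\<bar> \<le> a * norm (x - y)"
    using assms(1) unfolding near_linear_def by blast
  have "x \<in> S \<and> \<bar>v x - v y - L (x - y)\<bar> \<le> b * norm (x - y)" if "x \<in> ball y r - A" for x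
    using A(3)[OF that] mult_right_mono[OF assms(2) norm_ge_zero[of "x - y"]] by linarith
  with A(1,2) show ?thesis unfolding near_linear_def by blast
qed

section \<open>Potentials that are differentiable, and the splitting of a measure\<close>

context CZ_kernel
begin

lemma K_Taylor:
  assumes a: "a \<noteq> 0" and h: "norm h \<le> norm a / 2"
  shows "\<bar>K (a + h) - K a - G a \<bullet> h\<bar> \<le> c * 2 ^ (DIM('a) + 1) / norm a ^ (DIM('a) + 1) * (norm h)\<^sup>2"
proof -
  let ?f = "\<lambda>x. K x - G a \<bullet> x"
  let ?C = "c * 2 ^ (DIM('a) + 1) / norm a ^ (DIM('a) + 1) * norm h"
  have "norm (?f (a + h) - ?f a) \<le> ?C * norm ((a + h) - a)"
  proof (rule mean_value_norm_bound[of "cball a (norm h)"])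
    fix x assume "x \<in> cball a (norm h)"
    then have ax: "norm (a - x) \<le> norm h" by (simp add: dist_norm)
    then have "x \<in> cball a (norm a / 2)" using h by (simp add: dist_norm)
    from cball_half(2)[OF a this] have x: "x \<noteq> 0" .
    show "(?f has_derivative (\<lambda>h. (G x - G a) \<bullet> h)) (at x)"
      by (rule derivative_eq_intros K_deriv[OF x] refl)+ (simp add: inner_diff_left fun_eq_iff)
    fix k :: 'a
    have "norm (G a - G x) \<le> c * 2 ^ (DIM('a) + 1) / norm a ^ (DIM('a) + 1) * norm (a - x)"
      using ax h by (intro G_diff a) simp
    also have "\<dots> \<le> ?C" using ax c_nonneg by (intro mult_left_mono) auto
    finally have "norm (G x - G a) * norm k \<le> ?C * norm k"
      by (intro mult_right_mono) (simp_all add: norm_minus_commute)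
    then show "norm ((G x - G a) \<bullet> k) \<le> ?C * norm k"
      using order_trans[OF Cauchy_Schwarz_ineq2[of "G x - G a" k]] by simp
  qed (auto simp: dist_norm)
  then show ?thesis by (simp add: inner_add_right power2_eq_square algebra_simps)
qed

lemma G_measurable [measurable]: "G \<in> borel_measurable borel"
proof -
  have "continuous_on (- {0}) G"
    by (intro continuous_at_imp_continuous_on ballI has_derivative_continuous[OF G_deriv]) auto
  then have "(\<lambda>x. if x \<in> - {0} then G x else G 0) \<in> borel_measurable borel"
    by (intro borel_measurable_continuous_on_if) auto
  moreover have "(\<lambda>x. if x \<in> - {0} then G x else G 0) = G" by auto
  ultimately show ?thesis by simp
qed

text \<open>A point off \<open>Z\<close> has positive distance \<open>d\<close> from it, so the
  kernel is only evaluated away from its singularity and its Taylor remainder is uniform in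
  \<open>z\<close>.\<close>

lemma diffable_off_compact:
  assumes M: "finite_measure M" "sets M = sets borel" and Z: "compact Z" and y: "y \<notin> Z"
  shows "diffable (\<lambda>x. \<integral>z. indicator Z z * K (x - z) \<partial>M) y"
proof -
  interpret finite_measure M by (rule M)
  have [measurable_cong]: "sets M = sets borel" by fact
  have [measurable]: "Z \<in> sets borel" using Z by (rule borel_compact)
  obtain d where d: "d > 0" "ball y d \<subseteq> - Z"
    using open_contains_ball[of "- Z"] compact_imp_closed[OF Z] y by blast
  have far: "d \<le> norm (y - z)" if "z \<in> Z" for z
    using d(2) that by (auto simp: subset_iff dist_norm not_less[symmetric])
  let ?n = "DIM('a)"
  have iK: "integrable M (\<lambda>z. indicator Z z * K (x - z))" if x: "norm (x - y) < d / 2" for x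
  proof (rule integrable_const_bound[of _ "c / (d / 2) ^ (?n - 1)"])
    show "AE z in M. norm (indicator Z z * K (x - z)) \<le> c / (d / 2) ^ (?n - 1)"
    proof (rule AE_I2)
      fix z
      show "norm (indicator Z z * K (x - z)) \<le> c / (d / 2) ^ (?n - 1)"
      proof (cases "z \<in> Z")
        case True
        have "norm (y - z) \<le> norm (y - x) + norm (x - z)" using norm_triangle_ineq[of "y - x" "x - z"] by simp
        then have xz: "d / 2 \<le> norm (x - z)" using far[OF True] x norm_minus_commute[of y x] by linarith
        then have "x - z \<noteq> 0" using d by auto
        from K_bound[OF this] power_div_mono[OF _ xz, of "?n - 1"] d True show ?thesis by simp
      qed (use c_nonneg d in simp)
    qed
  qed measurable
  have iG: "integrable M (\<lambda>z. indicator Z z *\<^sub>R G (y - z))"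
  proof (rule integrable_const_bound[of _ "c / d ^ ?n"])
    show "AE z in M. norm (indicator Z z *\<^sub>R G (y - z)) \<le> c / d ^ ?n"
    proof (rule AE_I2)
      fix z
      show "norm (indicator Z z *\<^sub>R G (y - z)) \<le> c / d ^ ?n"
      proof (cases "z \<in> Z")
        case True
        then have "y - z \<noteq> 0" using far[OF True] d by auto
        from G_bound[OF this] power_div_mono[OF d(1) far[OF True], of ?n] True show ?thesis by simp
      qed (use c_nonneg d in simp)
    qed
  qed measurable
  define w where "w = (\<integral>z. indicator Z z *\<^sub>R G (y - z) \<partial>M)"
  define C where "C = c * 2 ^ (?n + 1) / d ^ (?n + 1)"
  have C: "C \<ge> 0" using c_nonneg d by (simp add: C_def)
  show ?thesis
  proof (rule diffable_of_quadratic_remainder[where d = "d / 2" and w = w and C = "C * measure M (space M)"])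
    fix h :: 'a assume h: "norm h < d / 2"
    have wh: "w \<bullet> h = (\<integral>z. indicator Z z * (G (y - z) \<bullet> h) \<partial>M)"
      unfolding w_def using integral_inner_left[OF iG, of h] by simp
    have iGh: "integrable M (\<lambda>z. indicator Z z * (G (y - z) \<bullet> h))"
      using integrable_inner_left[OF iG, of h] by simp
    note i1 = iK[of "y + h"] and i2 = iK[of y]
    let ?B = "\<lambda>z. indicator Z z * K (y + h - z) - indicator Z z * K (y - z) - indicator Z z * (G (y - z) \<bullet> h)"
    have iB: "integrable M ?B"
      using i1 i2 h d by (intro Bochner_Integration.integrable_diff iGh) auto
    have eq: "(\<integral>z. indicator Z z * K (y + h - z) \<partial>M) - (\<integral>z. indicator Z z * K (y - z) \<partial>M) - w \<bullet> h = (\<integral>z. ?B z \<partial>M)" (is "?l = _")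
      unfolding wh using i1 i2 iGh h d by simp
    have "(\<integral>z. \<bar>?B z\<bar> \<partial>M) \<le> (\<integral>z. C * (norm h)\<^sup>2 \<partial>M)"
    proof (rule integral_mono[OF integrable_abs[OF iB]])
      fix z
      show "\<bar>?B z\<bar> \<le> C * (norm h)\<^sup>2"
      proof (cases "z \<in> Z")
        case True
        note f = far[OF True]
        then have ne: "y - z \<noteq> 0" using d by auto
        have "\<bar>K ((y - z) + h) - K (y - z) - G (y - z) \<bullet> h\<bar> \<le> c * 2 ^ (?n + 1) / norm (y - z) ^ (?n + 1) * (norm h)\<^sup>2"
          by (rule K_Taylor[OF ne]) (use f h in linarith)
        also have "\<dots> \<le> C * (norm h)\<^sup>2"
          unfolding C_def using f d c_nonneg ne
          by (intro mult_right_mono divide_left_mono power_mono mult_pos_pos) auto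
        finally show ?thesis using True by (simp add: algebra_simps)
      qed (use C in simp)
    qed simp
    also have "(\<integral>z. C * (norm h)\<^sup>2 \<partial>M) = C * measure M (space M) * (norm h)\<^sup>2" by simp
    finally have le: "(\<integral>z. \<bar>?B z\<bar> \<partial>M) \<le> C * measure M (space M) * (norm h)\<^sup>2" .
    show "\<bar>?l\<bar> \<le> C * measure M (space M) * (norm h)\<^sup>2"
      unfolding eq by (rule order_trans[OF integral_abs_bound le])
  qed (use d C in auto)
qed

lemma pot_eq: "\<phi> \<in> bdd_int \<Longrightarrow> pot \<phi> x = (\<integral>z. K z * \<phi> (x - z) \<partial>lborel)"
  "\<phi> \<in> bdd_int \<Longrightarrow> integrable lborel (\<lambda>z. K z * \<phi> (x - z))"
proof -
  assume \<phi>: "\<phi> \<in> bdd_int"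
  note [measurable] = bdd_int_measurable[OF \<phi>]
  show "pot \<phi> x = (\<integral>z. K z * \<phi> (x - z) \<partial>lborel)"
    unfolding pot_def using integral_lborel_minus(2)[of "\<lambda>z. K z * \<phi> (x - z)" x] by simp
  show "integrable lborel (\<lambda>z. K z * \<phi> (x - z))"
    using integrable_lborel_minus(2)[OF pot_integrable[OF \<phi>, of x], of x] by simp
qed

text \<open>\<open>K\<close> is locally integrable but its gradient is not, so the derivative is put
  on \<open>\<phi>\<close>: after the change of variables only the argument of \<open>\<phi>\<close>
  moves.\<close>

lemma diffable_pot:
  assumes \<phi>: "\<phi> \<in> smooth_compact" shows "diffable (pot \<phi>) y"
proof -
  obtain R0 where R0: "\<phi> \<in> C11" "\<And>x. R0 \<le> norm x \<Longrightarrow> \<phi> x = 0" using \<phi> by (auto simp: smooth_compact_def)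
  define R where "R = max R0 0"
  have R: "R \<ge> 0" "\<And>x. R \<le> norm x \<Longrightarrow> \<phi> x = 0" using R0(2) by (auto simp: R_def)
  obtain g M where g: "continuous_on UNIV g" "M \<ge> 1" "\<And>x. norm (g x) \<le> M"
    "\<And>x h. \<bar>\<phi> (x + h) - \<phi> x - g x \<bullet> h\<bar> \<le> M * (norm h)\<^sup>2"
    using C11_obtain[OF R0(1)] by metis
  have [measurable]: "g \<in> borel_measurable borel" by (rule borel_measurable_continuous_onI[OF g(1)])
  \<comment> \<open>The gradient is known only through the Taylor remainder. With a short step
    \<open>s\<close> along \<open>g v\<close>, both values of \<open>\<phi>\<close> vanish and the
    remainder bound forces \<open>s * norm (g v) ^ 2\<close> to be at most half of itself.\<close>
  have g0: "g v = 0" if v: "norm v > R" for v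
  proof (rule ccontr)
    assume "g v \<noteq> 0"
    then have gv: "norm (g v) > 0" by simp
    define s where "s = min (1 / (2 * M)) ((norm v - R) / norm (g v))"
    have s: "s > 0" "M * s \<le> 1 / 2" "s * norm (g v) \<le> norm v - R"
      using gv v g(2) by (auto simp: s_def field_simps min_def)
    have "R \<le> norm (v + s *\<^sub>R g v)"
      using norm_triangle_ineq2[of v "- (s *\<^sub>R g v)"] s by simp
    then have "\<bar>g v \<bullet> (s *\<^sub>R g v)\<bar> \<le> M * (norm (s *\<^sub>R g v))\<^sup>2"
      using g(4)[of v "s *\<^sub>R g v"] R(2)[of v] R(2)[of "v + s *\<^sub>R g v"] v by simp
    then have "s * (norm (g v))\<^sup>2 \<le> (M * s) * (s * (norm (g v))\<^sup>2)"
      using s by (simp add: dot_square_norm power_mult_distrib power2_eq_square ac_simps)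
    also have "\<dots> \<le> (1 / 2) * (s * (norm (g v))\<^sup>2)" using s by (intro mult_right_mono) auto
    finally show False using s gv by simp
  qed
  define B where "B = ball y (R + 1)"
  have Bb: "(\<lambda>v. indicator B v :: real) \<in> bdd_int"
    unfolding B_def by (rule integral_bounded_support(3)[of _ 1 "R + 1" y])
      (use R in \<open>auto simp: dist_norm norm_minus_commute intro!: borel_measurable_indicator split: split_indicator\<close>)
  have KB: "integrable lborel (\<lambda>z. K z * indicator B z)"
    using pot_eq(2)[OF bdd_int_minus(3)[OF Bb], of 0] by simp
  have [measurable]: "B \<in> sets borel" by (simp add: B_def)
  define w where "w = (\<integral>z. K z *\<^sub>R g (y - z) \<partial>lborel)"
  have iw: "integrable lborel (\<lambda>z. K z *\<^sub>R g (y - z))"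
  proof (rule Bochner_Integration.integrable_bound[where f = "\<lambda>z. M * (K z * indicator B z)"])
    show "integrable lborel (\<lambda>z. M * (K z * indicator B z))" using KB by simp
    show "AE z in lborel. norm (K z *\<^sub>R g (y - z)) \<le> norm (M * (K z * indicator B z))"
    proof (rule AE_I2)
      fix z
      show "norm (K z *\<^sub>R g (y - z)) \<le> norm (M * (K z * indicator B z))"
      proof (cases "z \<in> B")
        case True
        have "\<bar>K z\<bar> * norm (g (y - z)) \<le> \<bar>K z\<bar> * M" by (intro mult_left_mono g) simp
        then show ?thesis using True g(2) by (simp add: abs_mult mult.commute)
      next
        case False
        then have "norm (y - z) > R" by (simp add: B_def dist_norm)
        then show ?thesis by (simp add: g0)
      qed
    qed
  qed measurable
  note \<phi>b = smooth_compact_bdd_int[OF \<phi>]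
  show ?thesis
  proof (rule diffable_of_quadratic_remainder[where d = 1 and w = w and C = "M * (\<integral>z. \<bar>K z * indicator B z\<bar> \<partial>lborel)"])
    fix h :: 'a assume h: "norm h < 1"
    have wh: "w \<bullet> h = (\<integral>z. K z * (g (y - z) \<bullet> h) \<partial>lborel)"
      unfolding w_def using integral_inner_left[OF iw, of h] by simp
    have iwh: "integrable lborel (\<lambda>z. K z * (g (y - z) \<bullet> h))"
      using integrable_inner_left[OF iw, of h] by simp
    let ?B = "\<lambda>z. K z * \<phi> (y + h - z) - K z * \<phi> (y - z) - K z * (g (y - z) \<bullet> h)"
    have iB: "integrable lborel ?B"
      by (intro Bochner_Integration.integrable_diff pot_eq(2) \<phi>b iwh)
    have eq: "pot \<phi> (y + h) - pot \<phi> y - w \<bullet> h = (\<integral>z. ?B z \<partial>lborel)"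
      unfolding wh pot_eq(1)[OF \<phi>b] using pot_eq(2)[OF \<phi>b] iwh by simp
    have le: "(\<integral>z. \<bar>?B z\<bar> \<partial>lborel) \<le> (\<integral>z. (M * (norm h)\<^sup>2) * \<bar>K z * indicator B z\<bar> \<partial>lborel)"
    proof (rule integral_mono[OF integrable_abs[OF iB] integrable_mult_right[OF integrable_abs[OF KB]]])
      fix z
      have eq: "?B z = K z * (\<phi> ((y - z) + h) - \<phi> (y - z) - g (y - z) \<bullet> h)" by (simp add: algebra_simps)
      show "\<bar>?B z\<bar> \<le> (M * (norm h)\<^sup>2) * \<bar>K z * indicator B z\<bar>"
      proof (cases "z \<in> B")
        case True
        have "\<bar>K z\<bar> * \<bar>\<phi> ((y - z) + h) - \<phi> (y - z) - g (y - z) \<bullet> h\<bar> \<le> \<bar>K z\<bar> * (M * (norm h)\<^sup>2)"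
          by (intro mult_left_mono g) simp
        then show ?thesis unfolding eq abs_mult using True by (simp add: ac_simps)
      next
        case False
        then have n: "norm (y - z) \<ge> R + 1" by (simp add: B_def dist_norm)
        then have "norm ((y - z) + h) \<ge> R" using h norm_triangle_ineq2[of "y - z" "- h"] by simp
        then show ?thesis unfolding eq using False n g0[of "y - z"] R(2)[of "y - z"] R(2)[of "(y - z) + h"] by simp
      qed
    qed
    have "(\<integral>z. (M * (norm h)\<^sup>2) * \<bar>K z * indicator B z\<bar> \<partial>lborel) = M * (\<integral>z. \<bar>K z * indicator B z\<bar> \<partial>lborel) * (norm h)\<^sup>2"
      by (subst integral_mult_right_zero) simp
    note le = le[unfolded this]
    show "\<bar>pot \<phi> (y + h) - pot \<phi> y - w \<bullet> h\<bar> \<le> M * (\<integral>z. \<bar>K z * indicator B z\<bar> \<partial>lborel) * (norm h)\<^sup>2"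
      unfolding eq by (rule order_trans[OF integral_abs_bound le])
  qed (use g(2) in auto)
qed

lemma udom_iff: "sets M = sets borel \<Longrightarrow> x \<in> udom M \<longleftrightarrow> integrable M (\<lambda>y. K (x - y))"
proof -
  assume s: "sets M = sets borel"
  then have [measurable_cong]: "sets M = sets borel" .
  have "(\<lambda>y. K (x - y)) \<in> borel_measurable M" by measurable
  then show ?thesis by (simp add: udom_def integrable_iff_bounded)
qed

lemma upot_density:
  fixes N :: "'a measure"
  assumes "sets N = sets borel" "h \<in> borel_measurable borel" "\<And>x. 0 \<le> h x"
  shows "upot (density N (\<lambda>x. ennreal (h x))) x = (\<integral>y. h y * K (x - y) \<partial>N)"
    "x \<in> udom (density N (\<lambda>x. ennreal (h x))) \<longleftrightarrow> integrable N (\<lambda>y. h y * K (x - y))"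
proof -
  have [measurable_cong]: "sets N = sets borel" by fact
  note [measurable] = assms(2)
  have m: "h \<in> borel_measurable N" "(\<lambda>y. K (x - y)) \<in> borel_measurable N" by measurable
  show "upot (density N (\<lambda>x. ennreal (h x))) x = (\<integral>y. h y * K (x - y) \<partial>N)"
    unfolding upot_def using m assms(3) by (intro integral_real_density) auto
  show "x \<in> udom (density N (\<lambda>x. ennreal (h x))) \<longleftrightarrow> integrable N (\<lambda>y. h y * K (x - y))"
    using m assms by (subst udom_iff) (auto simp: integrable_real_density)
qed

text \<open>The density of \<open>M\<close> off \<open>\<Omega> n\<close> is approximated in L^1 by
  \<open>\<phi>\<close>; \<open>P1\<close> and \<open>P2\<close> are the positive and negative parts
  of the error, and \<open>P3\<close> is the mass of \<open>\<Omega> n\<close> that the compact null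
  set misses. All three are positive measures, as the weak type estimate requires.\<close>

lemma upot_split:
  fixes M :: "'a measure"
  assumes M: "finite_measure M" "sets M = sets borel" and \<delta>: "\<delta> > 0"
  obtains v P1 P2 P3 where "AE y in lebesgue. diffable v y"
    "\<And>P. P \<in> {P1, P2, P3} \<Longrightarrow> finite_measure P \<and> sets P = sets borel \<and> measure P UNIV \<le> \<delta>"
    "\<And>x. x \<in> udom M \<Longrightarrow> x \<in> udom P1 \<and> x \<in> udom P2 \<and> x \<in> udom P3 \<and>
       upot M x = v x + upot P1 x - upot P2 x + upot P3 x"
proof -
  interpret finite_measure M by (rule M)
  have mc[measurable_cong]: "sets M = sets borel" by fact
  have spM: "space M = UNIV" using sets_eq_imp_space_eq[OF M(2)] by simp
  define \<Omega> where "\<Omega> n = dense_cells M (real (Suc n))" for n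
  have \<Omega>[measurable]: "\<Omega> n \<in> sets borel" for n unfolding \<Omega>_def by (rule dense_cells_borel[OF M]) simp
  have anti: "\<Omega> n \<subseteq> \<Omega> m" if "m \<le> n" for m n
    unfolding \<Omega>_def by (rule dense_cells_antimono) (use that in simp)
  \<comment> \<open>A null set that carries the singular part of \<open>M\<close>, since off each
    \<open>\<Omega> n\<close> the measure has a bounded density.\<close>
  define Z where "Z = (\<Inter>n. \<Omega> n)"
  have Zm[measurable]: "Z \<in> sets borel" unfolding Z_def by (intro sets.countable_INT) auto
  have Z0: "emeasure lborel Z = 0"
  proof (rule antisym)
    have "emeasure lborel Z \<le> ennreal (measure M UNIV / real (Suc n))" for n
    proof -
      have "emeasure lborel Z \<le> emeasure lborel (\<Omega> n)" by (rule emeasure_mono) (auto simp: Z_def)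
      also have "\<dots> \<le> ennreal (measure M UNIV / real (Suc n))"
        unfolding \<Omega>_def by (rule emeasure_dense_cells_le[OF M]) simp
      finally show ?thesis .
    qed
    moreover have "(\<lambda>n. ennreal (measure M UNIV / real (Suc n))) \<longlonglongrightarrow> ennreal 0"
      by (intro tendsto_ennrealI LIMSEQ_Suc[OF lim_const_over_n])
    ultimately show "emeasure lborel Z \<le> 0"
      by (intro tendsto_lowerbound[of "\<lambda>n. ennreal (measure M UNIV / real (Suc n))"]) auto
  qed simp
  have "(\<lambda>n. measure M (\<Omega> n - Z)) \<longlonglongrightarrow> measure M (\<Inter>n. \<Omega> n - Z)"
    by (rule finite_Lim_measure_decseq) (use anti M in \<open>auto simp: decseq_def\<close>)
  moreover have "(\<Inter>n. \<Omega> n - Z) = {}" by (auto simp: Z_def)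
  ultimately have "(\<lambda>n. measure M (\<Omega> n - Z)) \<longlonglongrightarrow> 0" by (simp only: measure_empty)
  then have "eventually (\<lambda>n. measure M (\<Omega> n - Z) < \<delta> / 2) sequentially"
    using order_tendstoD(2)[of _ 0 sequentially "\<delta> / 2"] \<delta> by simp
  then obtain n where n: "measure M (\<Omega> n - Z) < \<delta> / 2" by (auto simp: eventually_sequentially)
  \<comment> \<open>Compactness gives every point outside \<open>Z'\<close> a positive distance to
    it, which a null set alone would not.\<close>
  obtain Z' where Z': "compact Z'" "Z' \<subseteq> Z" "measure M Z - \<delta> / 2 < measure M Z'"
    by (rule compact_inner_approx[OF M Zm, of "\<delta> / 2"]) (use \<delta> in auto)
  have Zm'[measurable]: "Z' \<in> sets borel" using Z'(1) by (rule borel_compact)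
  have Z\<Omega>: "Z \<subseteq> \<Omega> n" by (auto simp: Z_def)
  define F where "F = - \<Omega> n"
  have Fm[measurable]: "F \<in> sets borel" by (simp add: F_def)
  define D where "D = \<Omega> n - Z'"
  have Dm[measurable]: "D \<in> sets borel" by (simp add: D_def)
  define P3 where "P3 = density M (\<lambda>x. ennreal (indicator D x))"
  note P3' = density_indicator[OF M Dm, folded P3_def]
  have P3: "finite_measure P3" "sets P3 = sets borel" "measure P3 UNIV \<le> \<delta>"
  proof -
    show "finite_measure P3" "sets P3 = sets borel" by (fact P3')+
    have "measure P3 UNIV = measure M D" using P3'(3)[of UNIV] by (simp add: measure_def)
    also have "D = (\<Omega> n - Z) \<union> (Z - Z')" using Z'(2) Z\<Omega> by (auto simp: D_def)
    also have "measure M \<dots> \<le> measure M (\<Omega> n - Z) + measure M (Z - Z')"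
      using M by (intro measure_Un_le) auto
    also have "measure M (Z - Z') = measure M Z - measure M Z'"
      using Z'(2) M by (intro finite_measure_Diff) auto
    finally show "measure P3 UNIV \<le> \<delta>" using n Z'(3) by linarith
  qed
  define MF where "MF = density M (\<lambda>x. ennreal (indicator F x))"
  note MF = density_indicator[OF M Fm, folded MF_def]
  obtain f where f: "f \<in> borel_measurable borel" "\<And>x. 0 \<le> f x" "\<And>x. f x \<le> real (Suc n)"
    "MF = density lborel (\<lambda>x. ennreal (f x))"
    unfolding MF_def F_def \<Omega>_def by (rule density_outside_dense_cells[OF M, where t = "real (Suc n)"]) (simp, rule that[unfolded MF_def F_def \<Omega>_def])
  note [measurable] = f(1)
  have fint: "integrable lborel f"
  proof (rule integrable_of_nn_integral_le(1)[of _ _ "measure MF UNIV"])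
    interpret MF: finite_measure MF by (rule MF(1))
    have "(\<integral>\<^sup>+x. ennreal \<bar>f x\<bar> \<partial>lborel) = (\<integral>\<^sup>+x. ennreal (f x) * indicator UNIV x \<partial>lborel)"
      using f(2) by (intro nn_integral_cong) simp
    also have "\<dots> = emeasure MF UNIV" unfolding f(4) by (rule emeasure_density[symmetric]) auto
    also have "\<dots> = ennreal (measure MF UNIV)" by (rule MF.emeasure_eq_measure)
    finally show "(\<integral>\<^sup>+x. ennreal \<bar>f x\<bar> \<partial>lborel) \<le> ennreal (measure MF UNIV)" by simp
  qed auto
  have fb: "f \<in> bdd_int" using fint f(2,3) by (auto simp: bdd_int_def intro!: exI[of _ "real (Suc n)"])
  obtain \<phi> where \<phi>: "\<phi> \<in> smooth_compact" "(\<integral>x. \<bar>f x - \<phi> x\<bar> \<partial>lborel) < \<delta>"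
    using smooth_compact_dense[OF fint \<delta>] by blast
  note \<phi>b = smooth_compact_bdd_int[OF \<phi>(1)]
  note [measurable] = bdd_int_measurable[OF \<phi>b]
  \<comment> \<open>\<open>f = \<phi> + p - q\<close> with nonnegative \<open>p\<close> and
    \<open>q\<close>.\<close>
  define p q where "p x = max 0 (f x - \<phi> x)" and "q x = max 0 (\<phi> x - f x)" for x
  have db: "(\<lambda>x. f x - \<phi> x) \<in> bdd_int"
    using bdd_int_add[OF fb bdd_int_cmult[OF \<phi>b, of "- 1"]] by simp
  have peq: "p = (\<lambda>x. 1/2 * (\<bar>f x - \<phi> x\<bar> + (f x - \<phi> x)))" "q = (\<lambda>x. 1/2 * (\<bar>f x - \<phi> x\<bar> + - 1 * (f x - \<phi> x)))"
    by (rule ext, simp add: p_def q_def max_def)+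
  have pq: "p \<in> bdd_int" "q \<in> bdd_int"
    unfolding peq by (intro bdd_int_cmult bdd_int_add bdd_int_abs db)+
  have pq0: "0 \<le> p x" "0 \<le> q x" for x by (auto simp: p_def q_def)
  have pqd: "(\<integral>x. p x \<partial>lborel) \<le> \<delta>" "(\<integral>x. q x \<partial>lborel) \<le> \<delta>"
  proof -
    have "(\<integral>x. p x \<partial>lborel) \<le> (\<integral>x. \<bar>f x - \<phi> x\<bar> \<partial>lborel)" "(\<integral>x. q x \<partial>lborel) \<le> (\<integral>x. \<bar>f x - \<phi> x\<bar> \<partial>lborel)"
      by (rule integral_mono[OF bdd_int_integrable[OF pq(1)] bdd_int_integrable[OF bdd_int_abs[OF db]]], simp add: p_def)
         (rule integral_mono[OF bdd_int_integrable[OF pq(2)] bdd_int_integrable[OF bdd_int_abs[OF db]]], simp add: q_def)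
    with \<phi>(2) show "(\<integral>x. p x \<partial>lborel) \<le> \<delta>" "(\<integral>x. q x \<partial>lborel) \<le> \<delta>" by auto
  qed
  define P1 where "P1 = density lborel (\<lambda>x. ennreal (p x))"
  define P2 where "P2 = density lborel (\<lambda>x. ennreal (q x))"
  note P1 = finite_density[OF sets_lborel bdd_int_integrable[OF pq(1)] pq0(1), folded P1_def]
  note P2 = finite_density[OF sets_lborel bdd_int_integrable[OF pq(2)] pq0(2), folded P2_def]
  note d1 = upot_density[OF sets_lborel bdd_int_measurable[OF pq(1)] pq0(1), folded P1_def]
  note d2 = upot_density[OF sets_lborel bdd_int_measurable[OF pq(2)] pq0(2), folded P2_def]
  note d3 = upot_density[OF M(2) borel_measurable_indicator[OF Dm], folded P3_def]
  define v where "v x = (\<integral>z. indicator Z' z * K (x - z) \<partial>M) + pot \<phi> x" for x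
  show thesis
  proof (rule that[of v P1 P2 P3])
    have "Z' \<in> null_sets lebesgue"
    proof -
      have "Z' \<in> null_sets lborel"
        using Z0 Z'(2) emeasure_mono[OF Z'(2), of lborel] by (auto simp: null_sets_def)
      then show ?thesis by (rule null_sets_completionI)
    qed
    from AE_not_in[OF this] show "AE y in lebesgue. diffable v y"
    proof eventually_elim
      fix y assume "y \<notin> Z'"
      then show "diffable v y"
        unfolding v_def[abs_def] by (intro diffable_add diffable_off_compact[OF M Z'(1)] diffable_pot \<phi>(1))
    qed
    show "finite_measure P \<and> sets P = sets borel \<and> measure P UNIV \<le> \<delta>" if "P \<in> {P1, P2, P3}" for P
      using that P1 P2 P3 pqd by auto
    fix x assume x: "x \<in> udom M"
    note KM = udom_integrable[OF M(2) x]
    have iA: "integrable M (\<lambda>z. indicator A z * K (x - z))" if "A \<in> sets borel" for A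
      using integrable_real_mult_indicator[OF _ KM, of A] that M by (simp add: mult.commute)
    have ip: "integrable lborel (\<lambda>y. g y * K (x - y))" if "g \<in> bdd_int" for g
      using pot_integrable[OF that, of x] by (simp add: mult.commute)
    have u1: "x \<in> udom P1" "upot P1 x = (\<integral>y. p y * K (x - y) \<partial>lborel)" using d1 ip[OF pq(1)] by auto
    have u2: "x \<in> udom P2" "upot P2 x = (\<integral>y. q y * K (x - y) \<partial>lborel)" using d2 ip[OF pq(2)] by auto
    have u3: "x \<in> udom P3" "upot P3 x = (\<integral>z. indicator D z * K (x - z) \<partial>M)" using d3 iA[OF Dm] by auto
    have split: "K (x - z) = indicator Z' z * K (x - z) + indicator F z * K (x - z) + indicator D z * K (x - z)" for z
      using Z'(2) Z\<Omega> by (auto simp: F_def D_def split: split_indicator)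
    have "upot M x = (\<integral>z. indicator Z' z * K (x - z) + indicator F z * K (x - z) + indicator D z * K (x - z) \<partial>M)"
      unfolding upot_def using split by simp
    also have "\<dots> = (\<integral>z. indicator Z' z * K (x - z) \<partial>M) + (\<integral>z. indicator F z * K (x - z) \<partial>M) + upot P3 x"
      unfolding u3 using iA[OF Zm'] iA[OF Fm] iA[OF Dm] by simp
    also have "(\<integral>z. indicator F z * K (x - z) \<partial>M) = upot MF x"
      unfolding MF_def by (rule upot_density(1)[symmetric]) (use M in auto)
    also have "\<dots> = (\<integral>y. f y * K (x - y) \<partial>lborel)" unfolding f(4) by (rule upot_density(1)) (use f in auto)
    also have "\<dots> = (\<integral>y. \<phi> y * K (x - y) + p y * K (x - y) - q y * K (x - y) \<partial>lborel)"
      by (rule Bochner_Integration.integral_cong) (auto simp: p_def q_def max_def algebra_simps)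
    also have "\<dots> = (\<integral>y. \<phi> y * K (x - y) \<partial>lborel) + upot P1 x - upot P2 x"
      unfolding u1 u2 using ip[OF \<phi>b] ip[OF pq(1)] ip[OF pq(2)] by simp
    also have "(\<integral>y. \<phi> y * K (x - y) \<partial>lborel) = pot \<phi> x" by (simp add: pot_def mult.commute)
    finally show "x \<in> udom P1 \<and> x \<in> udom P2 \<and> x \<in> udom P3 \<and> upot M x = v x + upot P1 x - upot P2 x + upot P3 x"
      using u1 u2 u3 by (simp add: v_def)
  qed
qed

lemma const_nonneg: "bad_const \<ge> 0" "lip_const \<ge> 0" "small_const \<ge> 0"
proof -
  show "bad_const \<ge> 0" using c_nonneg by (simp add: bad_const_def)
  then show "lip_const \<ge> 0" using c_nonneg by (simp add: lip_const_def good_const_def max_const_def piece_const_def)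
  show "small_const \<ge> 0"
    using c_nonneg by (simp add: small_const_def good_const_def max_const_def piece_const_def)
qed

text \<open>For fixed \<open>\<epsilon>\<close> a whole sequence of splittings is used, with
  exceptional sets of measure tending to 0. Almost every point escapes at least one of them and is
  then a point of density 0 of that set, where the slope of the differentiable part of that
  splitting can be taken.\<close>

lemma AE_near_linear_eps:
  fixes M :: "'a measure"
  assumes M: "finite_measure M" "sets M = sets borel" and \<epsilon>: "\<epsilon> > 0"
  shows "AE y in lebesgue. \<exists>L. near_linear (udom M) (upot M) y L \<epsilon>"
proof -
  \<comment> \<open>Each of the three error potentials gets a quarter of \<open>\<epsilon>\<close>
    as Lipschitz constant; the last quarter is left for the differentiable part. Adding 1 guards
    against a vanishing constant.\<close>
  define t where "t = \<epsilon> / (4 * (lip_const + 1))"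
  have t: "t > 0" "lip_const * t \<le> \<epsilon> / 4"
    using \<epsilon> const_nonneg(2) by (auto simp: t_def field_simps)
  \<comment> \<open>Chosen so that each of the three exceptional sets has measure at most a third of
    \<open>1 / Suc j\<close>.\<close>
  define \<delta> where "\<delta> j = t / (3 * (small_const + 1) * real (Suc j))" for j
  have \<delta>: "\<delta> j > 0" "small_const * \<delta> j / t \<le> 1 / (3 * real (Suc j))" for j
  proof -
    show "\<delta> j > 0" unfolding \<delta>_def using t const_nonneg(3) by (intro divide_pos_pos mult_pos_pos) auto
    have "small_const * \<delta> j / t = small_const / (small_const + 1) * (1 / (3 * real (Suc j)))"
      using t const_nonneg(3) by (simp add: \<delta>_def) (simp add: algebra_simps)
    also have "\<dots> \<le> 1 * (1 / (3 * real (Suc j)))"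
      using const_nonneg(3) by (intro mult_right_mono) auto
    finally show "small_const * \<delta> j / t \<le> 1 / (3 * real (Suc j))" by simp
  qed
  define good where "good v E j \<longleftrightarrow> E \<in> sets borel \<and> emeasure lborel E \<le> ennreal (1 / real (Suc j)) \<and>
      (AE y in lebesgue. diffable v y) \<and>
      (\<forall>x\<in>udom M - E. \<forall>y\<in>udom M - E. \<bar>(upot M x - v x) - (upot M y - v y)\<bar> \<le> 3 / 4 * \<epsilon> * norm (x - y))" for v E and j :: nat
  have "\<exists>v E. good v E j" for j
  proof -
    obtain v P1 P2 P3 where v: "AE y in lebesgue. diffable v y"
      "\<And>P. P \<in> {P1, P2, P3} \<Longrightarrow> finite_measure P \<and> sets P = sets borel \<and> measure P UNIV \<le> \<delta> j"
      "\<And>x. x \<in> udom M \<Longrightarrow> x \<in> udom P1 \<and> x \<in> udom P2 \<and> x \<in> udom P3 \<and>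
         upot M x = v x + upot P1 x - upot P2 x + upot P3 x"
      by (rule upot_split[OF M \<delta>(1)[of j]]) (rule that)
    have "\<exists>E. E \<in> sets borel \<and> emeasure lborel E \<le> ennreal (1 / (3 * real (Suc j))) \<and>
        (\<forall>x\<in>udom P - E. \<forall>y\<in>udom P - E. \<bar>upot P x - upot P y\<bar> \<le> \<epsilon> / 4 * norm (x - y))"
      if P: "P \<in> {P1, P2, P3}" for P
    proof -
      from v(2)[OF P] have fP: "finite_measure P" "sets P = sets borel" "measure P UNIV \<le> \<delta> j" by auto
      obtain E where E: "E \<in> sets borel" "emeasure lborel E \<le> ennreal (small_const * measure P UNIV / t)"
        "\<And>x y. x \<in> udom P - E \<Longrightarrow> y \<in> udom P - E \<Longrightarrow> \<bar>upot P x - upot P y\<bar> \<le> lip_const * t * norm (x - y)"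
        by (rule upot_Lipschitz_off_small_set[OF fP(1,2) t(1)]) (rule that)
      have "small_const * measure P UNIV / t \<le> small_const * \<delta> j / t"
        using fP(3) const_nonneg(3) t by (intro divide_right_mono mult_left_mono) auto
      then have "small_const * measure P UNIV / t \<le> 1 / (3 * real (Suc j))" using \<delta>(2)[of j] by linarith
      then have e: "emeasure lborel E \<le> ennreal (1 / (3 * real (Suc j)))"
        by (rule order_trans[OF E(2) ennreal_leI])
      have "\<bar>upot P x - upot P y\<bar> \<le> \<epsilon> / 4 * norm (x - y)" if "x \<in> udom P - E" "y \<in> udom P - E" for x y
        using E(3)[OF that] mult_right_mono[OF t(2) norm_ge_zero[of "x - y"]] by linarith
      with E(1) e show ?thesis by blast
    qed
    then obtain E where E: "\<And>P. P \<in> {P1, P2, P3} \<Longrightarrow> E P \<in> sets borel"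
      "\<And>P. P \<in> {P1, P2, P3} \<Longrightarrow> emeasure lborel (E P) \<le> ennreal (1 / (3 * real (Suc j)))"
      "\<And>P x y. P \<in> {P1, P2, P3} \<Longrightarrow> x \<in> udom P - E P \<Longrightarrow> y \<in> udom P - E P \<Longrightarrow> \<bar>upot P x - upot P y\<bar> \<le> \<epsilon> / 4 * norm (x - y)"
      by metis
    let ?E = "E P1 \<union> E P2 \<union> E P3"
    have "good v ?E j"
      unfolding good_def
    proof (intro conjI ballI v(1))
      show "?E \<in> sets borel" using E(1) by auto
      have "emeasure lborel ?E \<le> emeasure lborel (E P1 \<union> E P2) + emeasure lborel (E P3)"
        using E(1) by (intro emeasure_subadditive) auto
      also have "\<dots> \<le> (emeasure lborel (E P1) + emeasure lborel (E P2)) + emeasure lborel (E P3)"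
        using E(1) by (intro add_right_mono emeasure_subadditive) auto
      also have "\<dots> \<le> (ennreal (1 / (3 * real (Suc j))) + ennreal (1 / (3 * real (Suc j)))) + ennreal (1 / (3 * real (Suc j)))"
        by (intro add_mono E(2)) auto
      also have "\<dots> = ennreal (1 / real (Suc j))"
        by (simp add: ennreal_plus[symmetric] field_simps del: ennreal_plus)
      finally show "emeasure lborel ?E \<le> ennreal (1 / real (Suc j))" .
      fix x y assume xy: "x \<in> udom M - ?E" "y \<in> udom M - ?E"
      let ?d = "\<epsilon> / 4 * norm (x - y)"
      have "\<bar>upot P1 x - upot P1 y\<bar> \<le> ?d" "\<bar>upot P2 x - upot P2 y\<bar> \<le> ?d" "\<bar>upot P3 x - upot P3 y\<bar> \<le> ?d"
        using xy v(3)[of x] v(3)[of y] by (intro E(3); simp)+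
      moreover have "upot M x = v x + upot P1 x - upot P2 x + upot P3 x"
          "upot M y = v y + upot P1 y - upot P2 y + upot P3 y"
        using v(3)[of x] v(3)[of y] xy by auto
      moreover have "3 / 4 * \<epsilon> * norm (x - y) = ?d + ?d + ?d" by simp
      ultimately show "\<bar>(upot M x - v x) - (upot M y - v y)\<bar> \<le> 3 / 4 * \<epsilon> * norm (x - y)"
        by linarith
    qed
    then show ?thesis by blast
  qed
  then obtain v E where vE: "\<And>j. good (v j) (E j) j" by metis
  have Eb: "E j \<in> sets borel" for j using vE[of j] by (simp add: good_def)
  have Ee: "emeasure lborel (E j) \<le> ennreal (1 / real (Suc j))" for j using vE[of j] by (simp add: good_def)
  have null: "(\<Inter>j. E j) \<in> null_sets lebesgue"
  proof -
    have m: "(\<Inter>j. E j) \<in> sets borel" using Eb by (intro sets.countable_INT) auto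
    have "emeasure lborel (\<Inter>j. E j) \<le> 0"
    proof (rule tendsto_lowerbound[of "\<lambda>j. ennreal (1 / real (Suc j))" _ sequentially])
      show "(\<lambda>j. ennreal (1 / real (Suc j))) \<longlonglongrightarrow> 0"
        using tendsto_ennrealI[OF LIMSEQ_Suc[OF lim_const_over_n[of 1]]] by simp
      show "\<forall>\<^sub>F j in sequentially. emeasure lborel (\<Inter>j. E j) \<le> ennreal (1 / real (Suc j))"
        using Eb by (intro always_eventually allI order_trans[OF emeasure_mono Ee]) auto
    qed simp
    with m have "(\<Inter>j. E j) \<in> null_sets lborel" by (auto simp: null_sets_def)
    then show ?thesis by (rule null_sets_completionI)
  qed
  have dens: "AE y in lebesgue. \<forall>j. y \<notin> E j \<longrightarrow> thin_at (E j) y"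
    unfolding AE_all_countable using Lebesgue_density[OF Eb] by blast
  have dif: "AE y in lebesgue. \<forall>j. diffable (v j) y"
    unfolding AE_all_countable using vE by (simp add: good_def)
  have dom: "AE y in lebesgue. y \<in> udom M" by (rule AE_completion[OF AE_udom[OF M]])
  have ndom: "- udom M \<in> null_sets lebesgue"
    using dom udom_borel[OF M] by (subst AE_iff_null_sets) auto
  from AE_not_in[OF null] dens dif dom show ?thesis
  proof eventually_elim
    fix y assume y: "y \<notin> (\<Inter>j. E j)" "\<forall>j. y \<notin> E j \<longrightarrow> thin_at (E j) y" "\<forall>j. diffable (v j) y" "y \<in> udom M"
    then obtain j where j: "y \<notin> E j" by auto
    have "\<exists>L :: 'a \<Rightarrow>\<^sub>L real. \<forall>\<epsilon>>0. \<exists>r>0. \<forall>x\<in>ball y r. \<bar>v j x - v j y - L (x - y)\<bar> \<le> \<epsilon> * norm (x - y)"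
      using spec[OF y(3), of j] unfolding diffable_def .
    then obtain L :: "'a \<Rightarrow>\<^sub>L real"
      where L: "\<forall>\<epsilon>>0. \<exists>r>0. \<forall>x\<in>ball y r. \<bar>v j x - v j y - L (x - y)\<bar> \<le> \<epsilon> * norm (x - y)" ..
    have "\<exists>r>0. \<forall>x\<in>ball y r. \<bar>v j x - v j y - L (x - y)\<bar> \<le> \<epsilon> / 4 * norm (x - y)"
      by (rule L[rule_format]) (use \<epsilon> in simp)
    then obtain r where r: "r > 0" "\<And>x. x \<in> ball y r \<Longrightarrow> \<bar>v j x - v j y - L (x - y)\<bar> \<le> \<epsilon> / 4 * norm (x - y)"
      by auto
    let ?A = "E j \<union> - udom M"
    have A: "thin_at ?A y" using y(2) j by (intro thin_at_Un[OF _ thin_at_null[OF ndom]]) auto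
    have "x \<in> udom M \<and> \<bar>upot M x - upot M y - L (x - y)\<bar> \<le> \<epsilon> * norm (x - y)" if x: "x \<in> ball y r - ?A" for x
    proof -
      have "\<bar>(upot M x - v j x) - (upot M y - v j y)\<bar> \<le> 3 / 4 * \<epsilon> * norm (x - y)"
        using vE[of j] x y(4) j by (simp add: good_def)
      moreover have "\<bar>v j x - v j y - L (x - y)\<bar> \<le> \<epsilon> / 4 * norm (x - y)" using x by (intro r(2)) simp
      moreover have "\<epsilon> * norm (x - y) = 3 / 4 * \<epsilon> * norm (x - y) + \<epsilon> / 4 * norm (x - y)" by (simp add: algebra_simps)
      ultimately have "\<bar>upot M x - upot M y - L (x - y)\<bar> \<le> \<epsilon> * norm (x - y)" by linarith
      with x show ?thesis by simp
    qed
    then have "near_linear (udom M) (upot M) y L \<epsilon>"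
      unfolding near_linear_def using A r(1) by (intro exI[of _ ?A] exI[of _ r]) blast
    then show "\<exists>L. near_linear (udom M) (upot M) y L \<epsilon>" by blast
  qed
qed

lemma AE_near_linear:
  fixes M :: "'a measure"
  assumes M: "finite_measure M" "sets M = sets borel"
  shows "AE y in lebesgue. \<exists>L. \<forall>\<epsilon>>0. near_linear (udom M) (upot M) y L \<epsilon>"
proof -
  have "AE y in lebesgue. \<forall>n::nat. \<exists>L. near_linear (udom M) (upot M) y L (1 / real (Suc n))"
    unfolding AE_all_countable by (intro allI AE_near_linear_eps[OF M]) simp
  then show ?thesis
  proof eventually_elim
    fix y assume y: "\<forall>n::nat. \<exists>L. near_linear (udom M) (upot M) y L (1 / real (Suc n))"
    have "\<exists>L. near_linear (udom M) (upot M) y L \<epsilon>" if e: "\<epsilon> > 0" for \<epsilon>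
    proof -
      obtain n where "inverse (real (Suc n)) < \<epsilon>" using reals_Archimedean[OF e] by blast
      then have n: "1 / real (Suc n) \<le> \<epsilon>" by (simp add: inverse_eq_divide)
      from y obtain L where "near_linear (udom M) (upot M) y L (1 / real (Suc n))" by blast
      from near_linear_mono[OF this n] show ?thesis by blast
    qed
    from near_linear_limit[OF this] obtain L where "\<And>\<epsilon>. \<epsilon> > 0 \<Longrightarrow> near_linear (udom M) (upot M) y L \<epsilon>" by blast
    then show "\<exists>L. \<forall>\<epsilon>>0. near_linear (udom M) (upot M) y L \<epsilon>" by blast
  qed
qed

end

subsection \<open>The weak gradient\<close>

text \<open>Outside \<open>E k\<close> the function has Lipschitz constant \<open>2 powi k\<close>,
  so a point may be charged a multiple of the largest level whose exceptional set contains it. The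
  supremum may be infinite, where the inequality is trivial for distinct points; for the weak norm
  only the sum of the measures over the higher levels is needed.\<close>

lemma weak_gradient_of_level_sets:
  fixes E :: "int \<Rightarrow> 'a::euclidean_space set"
  assumes E: "\<And>k. E k \<in> sets borel" "\<And>k. emeasure lborel (E k) \<le> ennreal (C * 2 powi (- k))" and C: "C \<ge> 0"
    and u: "\<And>k x y. x \<in> D - E k \<Longrightarrow> y \<in> D - E k \<Longrightarrow> \<bar>u x - u y\<bar> \<le> 2 powi k * norm (x - y)"
  obtains I :: "'a \<Rightarrow> ennreal" where "I \<in> borel_measurable borel" "weak_L1_seminorm I \<le> ennreal (16 * C)"
    "\<And>x y. x \<in> D \<Longrightarrow> y \<in> D \<Longrightarrow> ennreal \<bar>u x - u y\<bar> \<le> (I x + I y) * ennreal (norm (x - y))"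
proof -
  \<comment> \<open>For any \<open>e > I x + I y\<close> there is a level with
    \<open>e / 2 \<le> 2 powi k \<le> e\<close>; the factor 4 then puts \<open>I x\<close> and
    \<open>I y\<close> below \<open>4 * 2 powi k\<close>, so neither point is in
    \<open>E k\<close>.\<close>
  define I where "I x = (SUP k. ennreal (4 * 2 powi k) * indicator (E k) x)" for x
  have notin: "x \<notin> E k" if "I x < ennreal (4 * 2 powi k)" for x k
  proof
    assume "x \<in> E k"
    then have "ennreal (4 * 2 powi k) \<le> I x" unfolding I_def by (intro SUP_upper2[of k]) auto
    with that show False by simp
  qed
  show thesis
  proof (rule that[of I])
    show m: "I \<in> borel_measurable borel"
      unfolding I_def[abs_def] using E(1) by measurable
    show "weak_L1_seminorm I \<le> ennreal (16 * C)"
      unfolding weak_L1_seminorm_def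
    proof (rule SUP_least)
      fix t :: real assume "t \<in> {0<..}"
      then have t: "t > 0" by simp
      \<comment> \<open>A point with \<open>I x > t\<close> lies in some \<open>E j\<close> with
        \<open>4 * 2 powi j > t\<close>, hence \<open>j > k\<close>. The geometric series over these
        levels gives a factor 2 and \<open>2 powi k \<ge> t / 8\<close> a factor 8, together
        16.\<close>
      obtain k :: int where k: "t / 8 \<le> 2 powi k" "2 powi k \<le> 2 * (t / 8)"
        using ex_dyadic_scale[of "t / 8"] t by auto
      have sub: "{x. I x > ennreal t} \<subseteq> (\<Union>n::nat. E (k + int n))"
      proof
        fix x assume "x \<in> {x. I x > ennreal t}"
        then obtain j where j: "ennreal t < ennreal (4 * 2 powi j) * indicator (E j) x"
          by (auto simp: I_def less_SUP_iff)
        then have x: "x \<in> E j" by (auto split: split_indicator_asm)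
        with j t have "t < 4 * 2 powi j" by (auto simp: ennreal_less_iff)
        with k have "(2::real) powi k < 2 powi j" by linarith
        then have "k < j" by (metis not_less power_int_increasing one_le_numeral)
        then have "j = k + int (nat (j - k))" by simp
        with x show "x \<in> (\<Union>n::nat. E (k + int n))" by (metis UN_I UNIV_I)
      qed
      have s: "(\<lambda>n. C * 2 powi (- (k + int n))) sums (C * 2 powi (- k) * 2)"
      proof -
        have "(\<lambda>n. (C * 2 powi (- k)) * (1 / 2) ^ n) sums ((C * 2 powi (- k)) * (1 / (1 - 1 / 2)))"
          by (intro sums_mult geometric_sums) simp
        moreover have "(\<lambda>n. C * 2 powi (- (k + int n))) = (\<lambda>n. (C * 2 powi (- k)) * (1 / 2) ^ n)"
          by (rule ext) (simp add: power_int_diff power_int_minus power_one_over field_simps)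
        ultimately show ?thesis by (simp only:) simp
      qed
      have "emeasure lebesgue {x. I x > ennreal t} = emeasure lborel {x. I x > ennreal t}"
      proof -
        have "{x. I x > ennreal t} \<in> sets lborel" using m by simp
        then show ?thesis by (simp add: emeasure_completion)
      qed
      also have "\<dots> \<le> emeasure lborel (\<Union>n::nat. E (k + int n))"
        using E(1) by (intro emeasure_mono sub sets.countable_UN) auto
      also have "\<dots> \<le> (\<Sum>n. emeasure lborel (E (k + int n)))"
        using E(1) by (intro emeasure_subadditive_countably) auto
      also have "\<dots> \<le> (\<Sum>n. ennreal (C * 2 powi (- (k + int n))))"
        by (intro suminf_le E(2)) auto
      also have "\<dots> = ennreal (C * 2 powi (- k) * 2)"
        using s C by (intro suminf_ennreal_eq) auto
      finally have "ennreal t * emeasure lebesgue {x. I x > ennreal t} \<le> ennreal t * ennreal (C * 2 powi (- k) * 2)"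
        by (intro mult_left_mono) auto
      also have "\<dots> = ennreal (C * (2 * t / 2 powi k))"
        using t C by (subst ennreal_mult[symmetric]) (auto simp: power_int_minus field_simps)
      also have "\<dots> \<le> ennreal (C * 16)"
        using k t C by (intro ennreal_leI mult_left_mono) (auto simp: field_simps)
      finally show "ennreal t * emeasure lebesgue {x. I x > ennreal t} \<le> ennreal (16 * C)" by (simp add: mult.commute)
    qed
    fix x y assume xy: "x \<in> D" "y \<in> D"
    show "ennreal \<bar>u x - u y\<bar> \<le> (I x + I y) * ennreal (norm (x - y))"
    proof (cases "x = y \<or> I x + I y = \<infinity>")
      case True
      then show ?thesis by (auto simp: ennreal_top_mult)
    next
      case False
      then have n: "norm (x - y) > 0" and "I x < \<infinity>" "I y < \<infinity>" by (auto simp: less_top)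
      then obtain a b where ab: "I x = ennreal a" "I y = ennreal b" "a \<ge> 0" "b \<ge> 0"
        by (metis ennreal_cases infinity_ennreal_def less_irrefl)
      \<comment> \<open>The strict inequality keeps \<open>e\<close> positive even if
        \<open>I\<close> vanishes at both points; it is removed by letting \<open>e\<close> tend to
        \<open>a + b\<close>.\<close>
      have *: "\<bar>u x - u y\<bar> \<le> e * norm (x - y)" if e: "e > a + b" for e
      proof -
        have "e / 2 > 0" using ab e by simp
        then obtain k :: int where k: "e / 2 \<le> 2 powi k" "2 powi k \<le> 2 * (e / 2)"
          by (rule ex_dyadic_scale)
        have "x \<notin> E k" "y \<notin> E k"
          by (intro notin; use ab e k in \<open>simp add: ennreal_less_iff\<close>)+
        then have "\<bar>u x - u y\<bar> \<le> 2 powi k * norm (x - y)" using xy by (intro u) auto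
        also have "\<dots> \<le> e * norm (x - y)" using k by (intro mult_right_mono) auto
        finally show ?thesis .
      qed
      have "\<bar>u x - u y\<bar> \<le> (a + b) * norm (x - y)"
      proof (rule field_le_epsilon)
        fix e :: real assume "e > 0"
        then show "\<bar>u x - u y\<bar> \<le> (a + b) * norm (x - y) + e"
          using *[of "a + b + e / norm (x - y)"] n by (simp add: distrib_right)
      qed
      then have "ennreal \<bar>u x - u y\<bar> \<le> ennreal ((a + b) * norm (x - y))" by (rule ennreal_leI)
      also have "\<dots> = (I x + I y) * ennreal (norm (x - y))" using ab by (simp add: ennreal_mult)
      finally show ?thesis .
    qed
  qed
qed

lemma near_linear_diff:
  assumes L1: "near_linear S v y L1 a" and L2: "near_linear T w y L2 b" and D: "- D \<in> null_sets lebesgue"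
  shows "near_linear D (\<lambda>x. v x - w x) y (L1 - L2) (a + b)"
proof -
  obtain A r where A: "thin_at A y" "r > 0"
    "\<And>x. x \<in> ball y r - A \<Longrightarrow> x \<in> S \<and> \<bar>v x - v y - L1 (x - y)\<bar> \<le> a * norm (x - y)"
    using L1 unfolding near_linear_def by blast
  obtain B s where B: "thin_at B y" "s > 0"
    "\<And>x. x \<in> ball y s - B \<Longrightarrow> x \<in> T \<and> \<bar>w x - w y - L2 (x - y)\<bar> \<le> b * norm (x - y)"
    using L2 unfolding near_linear_def by blast
  let ?A = "A \<union> B \<union> - D" and ?r = "min r s"
  have "thin_at ?A y" by (intro thin_at_Un A(1) B(1) thin_at_null[OF D])
  moreover have "?r > 0" using A(2) B(2) by simp
  moreover have "x \<in> D \<and> \<bar>(v x - w x) - (v y - w y) - (L1 - L2) (x - y)\<bar> \<le> (a + b) * norm (x - y)"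
    if x: "x \<in> ball y ?r - ?A" for x
  proof
    show "x \<in> D" using x by simp
    have "\<bar>v x - v y - L1 (x - y)\<bar> \<le> a * norm (x - y)" "\<bar>w x - w y - L2 (x - y)\<bar> \<le> b * norm (x - y)"
      using A(3)[of x] B(3)[of x] x by auto
    then show "\<bar>(v x - w x) - (v y - w y) - (L1 - L2) (x - y)\<bar> \<le> (a + b) * norm (x - y)"
      unfolding blinfun.diff_left distrib_right by linarith
  qed
  ultimately show ?thesis unfolding near_linear_def by blast
qed

text \<open>For a rational \<open>q > I y\<close> the set where \<open>I\<close> exceeds
  \<open>q\<close> does not contain \<open>y\<close> and, for almost every \<open>y\<close>, has
  density 0 there; off this set the increments from \<open>y\<close> are at most
  \<open>2 * q\<close> times the distance. Only countably many \<open>q\<close> occur, which keeps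
  the exceptional points a null set.\<close>

lemma AE_norm_le_weak_gradient:
  fixes u :: "'a::euclidean_space \<Rightarrow> real"
  assumes I: "I \<in> borel_measurable borel"
    and u: "\<And>x y. x \<in> D \<Longrightarrow> y \<in> D \<Longrightarrow> ennreal \<bar>u x - u y\<bar> \<le> (I x + I y) * ennreal (norm (x - y))"
  shows "AE y in lebesgue. \<forall>L. y \<in> D \<longrightarrow> (\<forall>\<epsilon>>0. near_linear D u y L \<epsilon>) \<longrightarrow> ennreal (norm L) \<le> 2 * I y"
proof -
  define B where "B q = {x. I x > ennreal q}" for q
  have "B q \<in> sets borel" for q unfolding B_def using I by measurable
  then have "AE y in lebesgue. \<forall>q\<in>\<rat>. y \<notin> B q \<longrightarrow> thin_at (B q) y"
    using Lebesgue_density by (subst AE_ball_countable[OF countable_rat]) blast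
  then show ?thesis
  proof (eventually_elim, intro allI impI)
    fix y and L :: "'a \<Rightarrow>\<^sub>L real"
    assume thin: "\<forall>q\<in>\<rat>. y \<notin> B q \<longrightarrow> thin_at (B q) y" and y: "y \<in> D" and L: "\<forall>\<epsilon>>0. near_linear D u y L \<epsilon>"
    show "ennreal (norm L) \<le> 2 * I y"
    proof (cases "I y")
      case (real a)
      have "norm L \<le> 2 * a"
      proof (rule ccontr)
        assume "\<not> norm L \<le> 2 * a"
        then have "a < norm L / 2" by simp
        then obtain q where q: "q \<in> \<rat>" "a < q" "q < norm L / 2" using Rats_dense_in_real by blast
        have "thin_at (B q) y" using thin q(1,2) real by (auto simp: B_def ennreal_less_iff)
        moreover have "\<bar>u x - u y\<bar> \<le> (2 * q) * norm (x - y)" if x: "x \<in> D - B q" for x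
        proof -
          have "I x \<le> ennreal q" using x by (simp add: B_def not_less)
          moreover have "I y \<le> ennreal q" using real q by (simp add: ennreal_leI)
          ultimately have "(I x + I y) * ennreal (norm (x - y)) \<le> (ennreal q + ennreal q) * ennreal (norm (x - y))"
            by (intro mult_right_mono add_mono) auto
          also have "\<dots> = ennreal ((2 * q) * norm (x - y))"
            using real q by (simp add: ennreal_plus[symmetric] ennreal_mult[symmetric] del: ennreal_plus)
          finally have "ennreal \<bar>u x - u y\<bar> \<le> ennreal ((2 * q) * norm (x - y))"
            using u[of x y] x y by (auto intro: order_trans)
          then show ?thesis using real q by (subst (asm) ennreal_le_iff) auto
        qed
        ultimately have "norm L \<le> 2 * q" using L real q by (intro near_linear_norm_le[where B = "B q"]) auto
        with q show False by simp
      qed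
      then have "ennreal (norm L) \<le> ennreal (2 * a)" by (rule ennreal_leI)
      then show ?thesis using real by (simp add: ennreal_mult)
    qed (simp add: ennreal_mult_top)
  qed
qed

section \<open>From the Jordan parts to the signed measure\<close>

lemma ap_derivative_eq: "has_ap_derivative S v y L \<Longrightarrow> ap_derivative S v y = L"
  unfolding ap_derivative_def by (blast intro: has_ap_derivative_unique)

lemma sets_pos_part_measure: "sets (pos_part_measure \<mu>) = sets borel"
  unfolding pos_part_measure_def by (metis sets.sets_measure_of_eq space_borel)

lemma sets_neg_part_measure: "sets (neg_part_measure \<mu>) = sets borel"
  unfolding neg_part_measure_eq by (rule sets_pos_part_measure)

text \<open>Domination of the part by the total variation follows from
  \<open>\<bar>\<mu> E\<bar> \<le> |\<mu>|(E)\<close>; it carries integrability of the kernel and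
  mass bounds over to the part.\<close>

lemma pos_part_measure_le:
  assumes \<mu>: "finite_signed_measure \<mu>"
  shows "pos_part_measure \<mu> \<le> variation_measure \<mu>"
proof -
  interpret finite_measure "variation_measure \<mu>" by (rule finite_measure_variation_measure[OF \<mu>])
  have "emeasure (pos_part_measure \<mu>) E \<le> emeasure (variation_measure \<mu>) E" for E
  proof (cases "E \<in> sets borel")
    case True
    then show ?thesis
      using abs_le_measure_variation[OF \<mu> True]
      by (auto simp: emeasure_pos_part_measure[OF \<mu>] emeasure_eq_measure intro!: ennreal_leI)
  qed (simp add: emeasure_notin_sets sets_pos_part_measure)
  then show ?thesis by (simp add: le_measure sets_pos_part_measure le_fun_def)
qed

lemma neg_part_measure_le:
  "finite_signed_measure \<mu> \<Longrightarrow> neg_part_measure \<mu> \<le> variation_measure \<mu>"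
  using pos_part_measure_le[OF finite_signed_measure_uminus]
  by (simp add: neg_part_measure_eq variation_measure_uminus)

context CZ_kernel
begin

text \<open>The domain of the convolution is defined through the total variation, so it is contained
  in the domains of the potentials of both parts, where their estimates apply.\<close>

lemma below_finite_measure:
  fixes P V :: "'a measure"
  assumes V: "finite_measure V" "sets V = sets borel" and P: "sets P = sets borel" "P \<le> V"
  shows "finite_measure P" "measure P UNIV \<le> measure V UNIV" "udom V \<subseteq> udom P"
proof -
  interpret V: finite_measure V by (rule V)
  have e: "emeasure P UNIV \<le> emeasure V UNIV" using le_measureD3[OF P(2)] P(1) V(2) by simp
  then have "emeasure P UNIV \<noteq> \<infinity>" by (auto simp: V.emeasure_eq_measure top_unique)
  then show "finite_measure P" using sets_eq_imp_space_eq[OF P(1)] by (intro finite_measureI) simp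
  then interpret P: finite_measure P .
  show "measure P UNIV \<le> measure V UNIV" using e by (simp add: V.emeasure_eq_measure P.emeasure_eq_measure)
  show "udom V \<subseteq> udom P"
  proof
    fix x assume "x \<in> udom V"
    then show "x \<in> udom P"
      unfolding udom_def using nn_integral_mono_measure[of P V "\<lambda>y. ennreal \<bar>K (x - y)\<bar>"] P V
      by (auto intro: le_less_trans)
  qed
qed

lemma upot_measurable:
  assumes "finite_measure M" "sets M = sets borel"
  shows "upot M \<in> borel_measurable borel"
proof -
  interpret finite_measure M by fact
  have [measurable_cong]: "sets M = sets borel" by fact
  show ?thesis unfolding upot_def[abs_def] by measurable
qed

lemma upot_level_set:
  fixes M :: "'a measure" and k :: int
  assumes M: "finite_measure M" "sets M = sets borel"
  obtains E where "E \<in> sets borel"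
    "emeasure lborel E \<le> ennreal (2 * small_const * (lip_const + 1) * measure M UNIV * 2 powi (- k))"
    "\<And>x y. x \<in> udom M - E \<Longrightarrow> y \<in> udom M - E \<Longrightarrow> \<bar>upot M x - upot M y\<bar> \<le> 2 powi k / 2 * norm (x - y)"
proof -
  \<comment> \<open>Only half of \<open>2 powi k\<close> is allotted, since the potentials of the
    two parts are subtracted later.\<close>
  define t :: real where "t = 2 powi k / (2 * (lip_const + 1))"
  have t: "t > 0" unfolding t_def using const_nonneg(2) by (intro divide_pos_pos) auto
  have lt: "lip_const * t \<le> 2 powi k / 2"
    using const_nonneg(2) by (simp add: t_def field_simps)
  have st: "small_const * measure M UNIV / t = 2 * small_const * (lip_const + 1) * measure M UNIV * 2 powi (- k)"
    by (simp add: t_def power_int_minus field_simps)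
  obtain E where E: "E \<in> sets borel" "emeasure lborel E \<le> ennreal (small_const * measure M UNIV / t)"
    "\<And>x y. x \<in> udom M - E \<Longrightarrow> y \<in> udom M - E \<Longrightarrow> \<bar>upot M x - upot M y\<bar> \<le> lip_const * t * norm (x - y)"
    by (rule upot_Lipschitz_off_small_set[OF M t]) (rule that)
  show thesis
  proof (rule that[OF E(1) E(2)[unfolded st]])
    fix x y assume "x \<in> udom M - E" "y \<in> udom M - E"
    then show "\<bar>upot M x - upot M y\<bar> \<le> 2 powi k / 2 * norm (x - y)"
      by (intro order_trans[OF E(3) mult_right_mono[OF lt norm_ge_zero]])
  qed
qed

text \<open>\<open>64 = 16 * 2 * 2\<close>: the factor of
  \<open>weak_gradient_of_level_sets\<close>, the union of the exceptional sets of the two parts,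
  and the halved Lipschitz constant in \<open>upot_level_set\<close>.\<close>

definition weak_const :: real where
  "weak_const = 64 * small_const * (lip_const + 1)"

text \<open>The level sets of the two parts are united before the weak gradient is formed, so that a
  single \<open>I\<close> serves for the difference. On the domain of \<open>V\<close>, which has
  null complement, the linear approximations of the two potentials can be subtracted.\<close>

lemma upot_diff_weak_gradient:
  fixes V P Q :: "'a measure"
  assumes V: "finite_measure V" "sets V = sets borel"
    and P: "sets P = sets borel" "P \<le> V" and Q: "sets Q = sets borel" "Q \<le> V"
  defines "D \<equiv> udom V" and "u \<equiv> \<lambda>x. upot P x - upot Q x"
  obtains I :: "'a \<Rightarrow> ennreal" where "I \<in> borel_measurable borel"
    "weak_L1_seminorm I \<le> ennreal (weak_const * measure V UNIV)"
    "\<And>x y. x \<in> D \<Longrightarrow> y \<in> D \<Longrightarrow> ennreal \<bar>u x - u y\<bar> \<le> (I x + I y) * ennreal (norm (x - y))"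
    "AE y in lebesgue. ap_differentiable D u y"
    "AE y in lebesgue. ennreal (norm (ap_derivative D u y)) \<le> 2 * I y"
proof -
  note fP = below_finite_measure[OF V P] and fQ = below_finite_measure[OF V Q]
  define C where "C = 2 * small_const * (lip_const + 1)"
  have C: "C \<ge> 0" using const_nonneg by (simp add: C_def)
  define lev where "lev M E k \<longleftrightarrow> E \<in> sets borel \<and> emeasure lborel E \<le> ennreal (C * measure M UNIV * 2 powi (- k)) \<and>
      (\<forall>x\<in>udom M - E. \<forall>y\<in>udom M - E. \<bar>upot M x - upot M y\<bar> \<le> 2 powi k / 2 * norm (x - y))" for M E k
  have ex: "\<exists>E. lev M E k" if "finite_measure M" "sets M = sets borel" for M k
    by (rule upot_level_set[OF that, of k], rule exI) (auto simp: lev_def C_def)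
  obtain EP where EP: "\<And>k. lev P (EP k) k" using ex[OF fP(1) P(1)] by metis
  obtain EQ where EQ: "\<And>k. lev Q (EQ k) k" using ex[OF fQ(1) Q(1)] by metis
  define m where "m = measure V UNIV"
  obtain I :: "'a \<Rightarrow> ennreal" where I: "I \<in> borel_measurable borel"
    "weak_L1_seminorm I \<le> ennreal (16 * (2 * C * m))"
    "\<And>x y. x \<in> D \<Longrightarrow> y \<in> D \<Longrightarrow> ennreal \<bar>u x - u y\<bar> \<le> (I x + I y) * ennreal (norm (x - y))"
  proof (rule weak_gradient_of_level_sets[of "\<lambda>k. EP k \<union> EQ k" "2 * C * m" D u])
    fix k
    show "EP k \<union> EQ k \<in> sets borel" using EP[of k] EQ[of k] by (auto simp: lev_def)
    have "emeasure lborel (EP k \<union> EQ k) \<le> emeasure lborel (EP k) + emeasure lborel (EQ k)"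
      using EP[of k] EQ[of k] by (intro emeasure_subadditive) (auto simp: lev_def)
    also have "\<dots> \<le> ennreal (C * m * 2 powi (- k)) + ennreal (C * m * 2 powi (- k))"
    proof (rule add_mono)
      show "emeasure lborel (EP k) \<le> ennreal (C * m * 2 powi (- k))"
        by (rule order_trans[of _ "ennreal (C * measure P UNIV * 2 powi (- k))"])
           (use EP[of k] fP(2) C in \<open>auto simp: lev_def m_def intro!: ennreal_leI mult_right_mono mult_left_mono\<close>)
      show "emeasure lborel (EQ k) \<le> ennreal (C * m * 2 powi (- k))"
        by (rule order_trans[of _ "ennreal (C * measure Q UNIV * 2 powi (- k))"])
           (use EQ[of k] fQ(2) C in \<open>auto simp: lev_def m_def intro!: ennreal_leI mult_right_mono mult_left_mono\<close>)
    qed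
    also have "\<dots> = ennreal (2 * C * m * 2 powi (- k))"
      using C by (subst ennreal_plus[symmetric]) (auto simp: m_def)
    finally show "emeasure lborel (EP k \<union> EQ k) \<le> ennreal (2 * C * m * 2 powi (- k))" .
  next
    fix k x y assume xy: "x \<in> D - (EP k \<union> EQ k)" "y \<in> D - (EP k \<union> EQ k)"
    have "\<bar>upot P x - upot P y\<bar> \<le> 2 powi k / 2 * norm (x - y)"
      using EP[of k] xy fP(3) by (auto simp: lev_def D_def)
    moreover have "\<bar>upot Q x - upot Q y\<bar> \<le> 2 powi k / 2 * norm (x - y)"
      using EQ[of k] xy fQ(3) by (auto simp: lev_def D_def)
    moreover have "2 powi k * norm (x - y) = 2 powi k / 2 * norm (x - y) + 2 powi k / 2 * norm (x - y)" by simp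
    ultimately show "\<bar>u x - u y\<bar> \<le> 2 powi k * norm (x - y)" unfolding u_def by linarith
  qed (use C that in \<open>auto simp: m_def\<close>)
  have dom: "AE y in lebesgue. y \<in> D" unfolding D_def by (rule AE_completion[OF AE_udom[OF V]])
  have Db: "D \<in> sets borel" unfolding D_def by (rule udom_borel[OF V])
  have nD: "- D \<in> null_sets lebesgue"
    using dom Db by (subst AE_iff_null_sets) auto
  have um: "u \<in> borel_measurable (lebesgue_on D)"
    unfolding u_def using upot_measurable[OF fP(1) P(1)] upot_measurable[OF fQ(1) Q(1)]
    by (intro measurable_restrict_space1 measurable_completion borel_measurable_diff) auto
  have nl: "AE y in lebesgue. \<exists>L. \<forall>\<epsilon>>0. near_linear D u y L \<epsilon>"
    using AE_near_linear[OF fP(1) P(1)] AE_near_linear[OF fQ(1) Q(1)]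
  proof eventually_elim
    fix y
    assume "\<exists>L. \<forall>\<epsilon>>0. near_linear (udom P) (upot P) y L \<epsilon>" and "\<exists>L. \<forall>\<epsilon>>0. near_linear (udom Q) (upot Q) y L \<epsilon>"
    then obtain L1 L2 where L: "\<And>\<epsilon>. \<epsilon> > 0 \<Longrightarrow> near_linear (udom P) (upot P) y L1 \<epsilon>"
      "\<And>\<epsilon>. \<epsilon> > 0 \<Longrightarrow> near_linear (udom Q) (upot Q) y L2 \<epsilon>" by auto
    have "near_linear D u y (L1 - L2) \<epsilon>" if "\<epsilon> > 0" for \<epsilon>
      using near_linear_diff[OF L(1)[of "\<epsilon> / 2"] L(2)[of "\<epsilon> / 2"] nD] that by (simp add: u_def)
    then show "\<exists>L. \<forall>\<epsilon>>0. near_linear D u y L \<epsilon>" by auto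
  qed
  have nle: "AE y in lebesgue. \<forall>L. y \<in> D \<longrightarrow> (\<forall>\<epsilon>>0. near_linear D u y L \<epsilon>) \<longrightarrow> ennreal (norm L) \<le> 2 * I y"
    by (rule AE_norm_le_weak_gradient[OF I(1)]) (rule I(3))
  have der: "AE y in lebesgue. \<exists>L. has_ap_derivative D u y L \<and> ennreal (norm L) \<le> 2 * I y"
    using nl dom nle
  proof eventually_elim
    fix y
    assume "\<exists>L. \<forall>\<epsilon>>0. near_linear D u y L \<epsilon>" and y: "y \<in> D"
      and le: "\<forall>L. y \<in> D \<longrightarrow> (\<forall>\<epsilon>>0. near_linear D u y L \<epsilon>) \<longrightarrow> ennreal (norm L) \<le> 2 * I y"
    then obtain L where L: "\<forall>\<epsilon>>0. near_linear D u y L \<epsilon>" by auto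
    then have "has_ap_derivative D u y L" by (intro has_ap_derivative_of_near_linear nD um y) auto
    with le y L show "\<exists>L. has_ap_derivative D u y L \<and> ennreal (norm L) \<le> 2 * I y" by auto
  qed
  show thesis
  proof (rule that[OF I(1) _ I(3)])
    show "weak_L1_seminorm I \<le> ennreal (weak_const * measure V UNIV)"
      using I(2) by (simp add: weak_const_def C_def m_def mult.assoc)
    show "AE y in lebesgue. ap_differentiable D u y"
      using der by (rule AE_mp) (auto simp: ap_differentiable_def)
    show "AE y in lebesgue. ennreal (norm (ap_derivative D u y)) \<le> 2 * I y"
      using der by (rule AE_mp) (auto simp: ap_derivative_eq)
  qed
qed

end

theorem theorem1p2:
  fixes A B :: real
  assumes "CARD('n::finite) \<ge> 2" and "A > 0" and "B > 0"
  shows "\<exists>C>0. \<forall>(K :: real ^ 'n \<Rightarrow> real) (\<mu> :: (real ^ 'n) set \<Rightarrow> real).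
    C2_on (- {0}) K \<longrightarrow>
    (\<forall>x. x \<noteq> 0 \<longrightarrow> \<bar>K x\<bar> \<le> A / norm x ^ (CARD('n) - 1)) \<longrightarrow>
    (\<forall>x. x \<noteq> 0 \<longrightarrow> norm (Df (Df K) x) \<le> B / norm x ^ (CARD('n) + 1)) \<longrightarrow>
    finite_signed_measure \<mu> \<longrightarrow>
    (\<exists>I :: real ^ 'n \<Rightarrow> ennreal.
       I \<in> weak_L1 \<and>
       (\<forall>x\<in>convolution_dom K \<mu>. \<forall>y\<in>convolution_dom K \<mu>.
          ennreal \<bar>convolution K \<mu> x - convolution K \<mu> y\<bar> \<le> (I x + I y) * ennreal (norm (x - y))) \<and>
       weak_L1_seminorm I \<le> ennreal C * tv_norm \<mu> \<and>
       (AE y in lebesgue. ap_differentiable (convolution_dom K \<mu>) (convolution K \<mu>) y) \<and>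
       (AE y in lebesgue. ennreal (norm (ap_derivative (convolution_dom K \<mu>) (convolution K \<mu>) y)) \<le> 2 * I y))"
proof -
  define c where "c = (A + B) * 2 ^ (CARD('n) + 1)"
  \<comment> \<open>Outside the locale \<open>weak_const\<close> depends only on the type and on
    \<open>c\<close>, hence on \<open>A\<close>, \<open>B\<close> and the dimension, and can be
    fixed before \<open>K\<close> and \<open>\<mu>\<close>. The maximum with 1 makes positivity
    immediate.\<close>
  define C where "C = max 1 (CZ_kernel.weak_const TYPE(real ^ 'n) c)"
  show ?thesis
  proof (intro exI[of _ C] conjI allI impI)
    show "C > 0" by (simp add: C_def)
    fix K :: "real ^ 'n \<Rightarrow> real" and \<mu> :: "(real ^ 'n) set \<Rightarrow> real"
    assume C2: "C2_on (- {0}) K"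
      and KA: "\<forall>x. x \<noteq> 0 \<longrightarrow> \<bar>K x\<bar> \<le> A / norm x ^ (CARD('n) - 1)"
      and KB: "\<forall>x. x \<noteq> 0 \<longrightarrow> norm (Df (Df K) x) \<le> B / norm x ^ (CARD('n) + 1)"
      and \<mu>: "finite_signed_measure \<mu>"
    interpret CZ_kernel K "gradient K" "hessian K" c
      using CZ_kernel_of_C2[OF C2, of A B] KA KB assms by (simp add: c_def)
    let ?V = "variation_measure \<mu>"
    interpret V: finite_measure ?V by (rule finite_measure_variation_measure[OF \<mu>])
    have dom: "convolution_dom K \<mu> = udom ?V" by (simp add: convolution_dom_def udom_def)
    have conv: "convolution K \<mu> = (\<lambda>x. upot (pos_part_measure \<mu>) x - upot (neg_part_measure \<mu>) x)"
      by (simp add: fun_eq_iff convolution_def signed_integral_def upot_def)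
    obtain I :: "real ^ 'n \<Rightarrow> ennreal" where I: "I \<in> borel_measurable borel"
      "weak_L1_seminorm I \<le> ennreal (weak_const * measure ?V UNIV)"
      "\<And>x y. x \<in> convolution_dom K \<mu> \<Longrightarrow> y \<in> convolution_dom K \<mu> \<Longrightarrow>
         ennreal \<bar>convolution K \<mu> x - convolution K \<mu> y\<bar> \<le> (I x + I y) * ennreal (norm (x - y))"
      "AE y in lebesgue. ap_differentiable (convolution_dom K \<mu>) (convolution K \<mu>) y"
      "AE y in lebesgue. ennreal (norm (ap_derivative (convolution_dom K \<mu>) (convolution K \<mu>) y)) \<le> 2 * I y"
      unfolding dom conv
      by (rule upot_diff_weak_gradient[OF V.finite_measure_axioms sets_variation_measure
          sets_pos_part_measure pos_part_measure_le[OF \<mu>] sets_neg_part_measure neg_part_measure_le[OF \<mu>]]) (rule that[unfolded dom conv])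
    have "ennreal (weak_const * measure ?V UNIV) \<le> ennreal (C * measure ?V UNIV)"
      by (intro ennreal_leI mult_right_mono) (auto simp: C_def)
    also have "\<dots> = ennreal C * tv_norm \<mu>"
      by (simp add: tv_norm_def V.emeasure_eq_measure ennreal_mult C_def)
    finally have wI: "weak_L1_seminorm I \<le> ennreal C * tv_norm \<mu>" by (rule order_trans[OF I(2)])
    have "I \<in> weak_L1"
      using I(1) le_less_trans[OF I(2)] by (auto simp: weak_L1_def intro: measurable_completion)
    with wI I(3-5) show "\<exists>I :: real ^ 'n \<Rightarrow> ennreal.
       I \<in> weak_L1 \<and>
       (\<forall>x\<in>convolution_dom K \<mu>. \<forall>y\<in>convolution_dom K \<mu>.
          ennreal \<bar>convolution K \<mu> x - convolution K \<mu> y\<bar> \<le> (I x + I y) * ennreal (norm (x - y))) \<and>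
       weak_L1_seminorm I \<le> ennreal C * tv_norm \<mu> \<and>
       (AE y in lebesgue. ap_differentiable (convolution_dom K \<mu>) (convolution K \<mu>) y) \<and>
       (AE y in lebesgue. ennreal (norm (ap_derivative (convolution_dom K \<mu>) (convolution K \<mu>) y)) \<le> 2 * I y)"
      by (intro exI[of _ I] conjI ballI)
  qed
qed

end
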